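(* Let $\mathfrak g$ be a complex simple Lie algebra which is neither of type $A$ nor of type $C$, and let $D\subset TZ_{\mathfrak g}$ be the contact distribution on the adjoint variety $Z_{\mathfrak g}$. Then there is no smooth conic in a general direction of $D$; that is, there is a nonempty Zariski open subset $U$ of the projectivized bundle $\mathbb P(D)$ (of $1$-dimensional subspaces of fibres of $D$) such that no smooth conic $C\subset Z_{\mathfrak g}$ and point $x\in C$ satisfy $[T_xC]\in U$.
   Context: $G$ is the simply connected complex Lie group with Lie algebra $\mathfrak g$. The adjoint variety $Z_{\mathfrak g}\subset\mathbb P(\mathfrak g)$ is the unique closed $G$-orbit for the action induced by the adjoint representation. Fix a maximal torus and Borel subgroup with root system $R$, highest root $\rho$, $o=[E_\rho]$ with $E_\rho\in\mathfrak g_\rho\setminus0$. The contact distribution $D\subset TZ_{\mathfrak g}$ is the $G$-invariant subbundle with fibre $D_o=\bigoplus_{\alpha\ne-\rho,\ \langle\alpha,\rho\rangle<0}\mathfrak g_\alpha$ in $T_oZ_{\mathfrak g}\simeq\bigoplus_{\langle\alpha,\rho\rangle<0}\mathfrak g_\alpha$. A conic in $Z_{\mathfrak g}$ is a closed subscheme with Hilbert polynomial $2m+1$ with respect to $\mathcal O_{\mathbb P(\mathfrak g)}(1)$. *)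

theory Defs
  imports
    "HOL-Analysis.Analysis"
    "HOL-Library.Poly_Mapping"
    "HOL-Computational_Algebra.Polynomial"
begin

section \<open>Complex simple Lie algebras and their types\<close>

text \<open>
  A complex Lie algebra of dimension \<open>CARD('n)\<close> is given, after the choice of a vector space
  basis, by a bracket on \<open>complex^'n\<close>.
\<close>

locale complex_lie_algebra =
  fixes br :: "complex^'n \<Rightarrow> complex^'n \<Rightarrow> complex^'n"
  assumes linear_left: "Vector_Spaces.linear (*s) (*s) (\<lambda>x. br x y)"
    and linear_right: "Vector_Spaces.linear (*s) (*s) (br x)"
    and alternating: "br x x = 0"
    and jacobi: "br x (br y z) + br y (br z x) + br z (br x y) = 0"

definition lie_ideal :: "(complex^'n \<Rightarrow> complex^'n \<Rightarrow> complex^'n) \<Rightarrow> (complex^'n) set \<Rightarrow> bool"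
  where "lie_ideal br J \<longleftrightarrow> vec.subspace J \<and> (\<forall>x. \<forall>y\<in>J. br x y \<in> J)"

locale simple_lie_algebra = complex_lie_algebra +
  assumes nonabelian: "\<exists>x y. br x y \<noteq> 0"
    and ideals_trivial: "lie_ideal br J \<Longrightarrow> J = {0} \<or> J = UNIV"

definition killing_form :: "(complex^'n \<Rightarrow> complex^'n \<Rightarrow> complex^'n) \<Rightarrow> complex^'n \<Rightarrow> complex^'n \<Rightarrow> complex"
  where "killing_form br x y = trace (matrix (\<lambda>z. br x (br y z)))"

definition ad_semisimple :: "(complex^'n \<Rightarrow> complex^'n \<Rightarrow> complex^'n) \<Rightarrow> complex^'n \<Rightarrow> bool"
  where "ad_semisimple br x \<longleftrightarrow> vec.span {v. \<exists>c. br x v = c *s v} = UNIV"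

definition toral_subalgebra :: "(complex^'n \<Rightarrow> complex^'n \<Rightarrow> complex^'n) \<Rightarrow> (complex^'n) set \<Rightarrow> bool"
  where "toral_subalgebra br h \<longleftrightarrow>
    vec.subspace h \<and> (\<forall>x\<in>h. \<forall>y\<in>h. br x y = 0) \<and> (\<forall>x\<in>h. ad_semisimple br x)"

text \<open>The Lie algebra of a maximal torus.\<close>

definition cartan_subalgebra :: "(complex^'n \<Rightarrow> complex^'n \<Rightarrow> complex^'n) \<Rightarrow> (complex^'n) set \<Rightarrow> bool"
  where "cartan_subalgebra br h \<longleftrightarrow>
    toral_subalgebra br h \<and> (\<forall>k. toral_subalgebra br k \<and> h \<subseteq> k \<longrightarrow> k = h)"

text \<open>
  An element of the dual space of \<open>h\<close> is a function that is \<open>undefined\<close> outside \<open>h\<close>, so that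
  equality of roots is equality on \<open>h\<close>.
\<close>

type_synonym 'n weight = "complex^'n \<Rightarrow> complex"

definition root_space ::
  "(complex^'n \<Rightarrow> complex^'n \<Rightarrow> complex^'n) \<Rightarrow> (complex^'n) set \<Rightarrow> 'n weight \<Rightarrow> (complex^'n) set"
  where "root_space br h \<alpha> = {x. \<forall>t\<in>h. br t x = \<alpha> t *s x}"

definition roots ::
  "(complex^'n \<Rightarrow> complex^'n \<Rightarrow> complex^'n) \<Rightarrow> (complex^'n) set \<Rightarrow> 'n weight set"
  where "roots br h =
    {\<alpha> \<in> extensional h. (\<exists>t\<in>h. \<alpha> t \<noteq> 0) \<and> root_space br h \<alpha> \<noteq> {0}}"

definition neg_weight :: "(complex^'n) set \<Rightarrow> 'n weight \<Rightarrow> 'n weight"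
  where "neg_weight h \<alpha> = restrict (\<lambda>t. - \<alpha> t) h"

text \<open>The form on the dual of \<open>h\<close> induced by the Killing form; it is real on roots.\<close>

definition dual_element ::
  "(complex^'n \<Rightarrow> complex^'n \<Rightarrow> complex^'n) \<Rightarrow> (complex^'n) set \<Rightarrow> 'n weight \<Rightarrow> complex^'n"
  where "dual_element br h \<alpha> = (THE t. t \<in> h \<and> (\<forall>s\<in>h. killing_form br t s = \<alpha> s))"

definition weight_form ::
  "(complex^'n \<Rightarrow> complex^'n \<Rightarrow> complex^'n) \<Rightarrow> (complex^'n) set \<Rightarrow> 'n weight \<Rightarrow> 'n weight \<Rightarrow> complex"
  where "weight_form br h \<alpha> \<beta> =
    killing_form br (dual_element br h \<alpha>) (dual_element br h \<beta>)"

text \<open>A Borel subalgebra containing \<open>h\<close> is encoded by its set \<open>\<Delta>\<close> of simple roots.\<close>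

definition simple_roots ::
  "(complex^'n \<Rightarrow> complex^'n \<Rightarrow> complex^'n) \<Rightarrow> (complex^'n) set \<Rightarrow> 'n weight set \<Rightarrow> bool"
  where "simple_roots br h \<Delta> \<longleftrightarrow>
    finite \<Delta> \<and> \<Delta> \<subseteq> roots br h \<and>
    (\<forall>c :: _ \<Rightarrow> complex. (\<forall>t\<in>h. (\<Sum>\<beta>\<in>\<Delta>. c \<beta> * \<beta> t) = 0) \<longrightarrow> (\<forall>\<beta>\<in>\<Delta>. c \<beta> = 0)) \<and>
    (\<forall>\<alpha>\<in>roots br h. \<exists>c :: _ \<Rightarrow> int. (\<forall>t\<in>h. \<alpha> t = (\<Sum>\<beta>\<in>\<Delta>. of_int (c \<beta>) * \<beta> t)) \<and>
        ((\<forall>\<beta>\<in>\<Delta>. c \<beta> \<ge> 0) \<or> (\<forall>\<beta>\<in>\<Delta>. c \<beta> \<le> 0)))"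

definition highest_root ::
  "(complex^'n \<Rightarrow> complex^'n \<Rightarrow> complex^'n) \<Rightarrow> (complex^'n) set \<Rightarrow> 'n weight set \<Rightarrow> 'n weight \<Rightarrow> bool"
  where "highest_root br h \<Delta> \<rho> \<longleftrightarrow>
    \<rho> \<in> roots br h \<and>
    (\<forall>\<alpha>\<in>roots br h. \<exists>c :: _ \<Rightarrow> nat. \<forall>t\<in>h. \<rho> t - \<alpha> t = (\<Sum>\<beta>\<in>\<Delta>. of_nat (c \<beta>) * \<beta> t))"

definition has_cartan_matrix ::
  "(complex^'n \<Rightarrow> complex^'n \<Rightarrow> complex^'n) \<Rightarrow> nat \<Rightarrow> (nat \<Rightarrow> nat \<Rightarrow> int) \<Rightarrow> bool"
  where "has_cartan_matrix br l M \<longleftrightarrow>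
    (\<exists>h \<Delta> a. cartan_subalgebra br h \<and> simple_roots br h \<Delta> \<and> bij_betw a {..<l} \<Delta> \<and>
      (\<forall>i<l. \<forall>j<l. 2 * weight_form br h (a i) (a j) / weight_form br h (a j) (a j)
          = of_int (M i j)))"

definition cartan_matrix_A :: "nat \<Rightarrow> nat \<Rightarrow> int"
  where "cartan_matrix_A i j =
    (if i = j then 2 else if i = Suc j \<or> j = Suc i then -1 else 0)"

text \<open>The last simple root (index \<open>l - 1\<close>) is the long one.\<close>

definition cartan_matrix_C :: "nat \<Rightarrow> nat \<Rightarrow> nat \<Rightarrow> int"
  where "cartan_matrix_C l i j =
    (if i = j then 2
     else if i = Suc j then (if Suc i = l then -2 else -1)
     else if j = Suc i then -1 else 0)"

text \<open>
  The low-rank coincidences \<open>A\<^sub>3 = D\<^sub>3\<close> and \<open>C\<^sub>2 = B\<^sub>2\<close> (and \<open>A\<^sub>1 = B\<^sub>1 = C\<^sub>1\<close>) count as types A and C.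
\<close>

definition lie_type_A :: "(complex^'n \<Rightarrow> complex^'n \<Rightarrow> complex^'n) \<Rightarrow> bool"
  where "lie_type_A br \<longleftrightarrow> (\<exists>l\<ge>1. has_cartan_matrix br l cartan_matrix_A)"

definition lie_type_C :: "(complex^'n \<Rightarrow> complex^'n \<Rightarrow> complex^'n) \<Rightarrow> bool"
  where "lie_type_C br \<longleftrightarrow> (\<exists>l\<ge>1. has_cartan_matrix br l (cartan_matrix_C l))"

section \<open>Subschemes of projective space\<close>

text \<open>
  Polynomials with variables indexed by \<open>'i\<close>; the product of the type \<open>\<Rightarrow>\<^sub>0\<close> is convolution.
\<close>

type_synonym 'i mpoly = "('i \<Rightarrow>\<^sub>0 nat) \<Rightarrow>\<^sub>0 complex"

definition mpoly_eval :: "('i \<Rightarrow> complex) \<Rightarrow> 'i mpoly \<Rightarrow> complex"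
  where "mpoly_eval x F =
    (\<Sum>m\<in>Poly_Mapping.keys F. Poly_Mapping.lookup F m *
       (\<Prod>i\<in>Poly_Mapping.keys m. x i ^ Poly_Mapping.lookup m i))"

definition partial_degree :: "'i set \<Rightarrow> ('i \<Rightarrow>\<^sub>0 nat) \<Rightarrow> nat"
  where "partial_degree A m = (\<Sum>i\<in>Poly_Mapping.keys m \<inter> A. Poly_Mapping.lookup m i)"

definition homogeneous :: "nat \<Rightarrow> 'i mpoly \<Rightarrow> bool"
  where "homogeneous d F \<longleftrightarrow> (\<forall>m\<in>Poly_Mapping.keys F. partial_degree UNIV m = d)"

definition poly_ideal :: "'i mpoly set \<Rightarrow> bool"
  where "poly_ideal I \<longleftrightarrow> module.subspace (*) I"

definition ideal_generated :: "'i mpoly set \<Rightarrow> 'i mpoly set"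
  where "ideal_generated B = module.span (*) B"

definition homogeneous_ideal :: "'i mpoly set \<Rightarrow> bool"
  where "homogeneous_ideal I \<longleftrightarrow>
    (\<exists>B. (\<forall>F\<in>B. \<exists>d. homogeneous d F) \<and> I = ideal_generated B)"

definition saturated :: "'i mpoly set \<Rightarrow> bool"
  where "saturated I \<longleftrightarrow>
    (\<forall>F. (\<exists>k. \<forall>H. homogeneous k H \<longrightarrow> H * F \<in> I) \<longrightarrow> F \<in> I)"

definition mpoly_dim :: "'i mpoly set \<Rightarrow> nat"
  where "mpoly_dim V =
    vector_space.dim (\<lambda>(c::complex) F. Poly_Mapping.single 0 c * F) V"

text \<open>For \<open>m\<close> large, \<open>P(m)\<close> is the dimension of the degree \<open>m\<close> part of the quotient by \<open>I\<close>.\<close>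

definition has_hilbert_polynomial :: "'i mpoly set \<Rightarrow> rat poly \<Rightarrow> bool"
  where "has_hilbert_polynomial I P \<longleftrightarrow>
    (\<forall>\<^sub>F m in sequentially.
       of_nat (mpoly_dim {F :: 'i mpoly. homogeneous m F}) - of_nat (mpoly_dim {F \<in> I. homogeneous m F})
         = poly P (of_nat m))"

text \<open>
  A point of the projective space of \<open>complex^'n\<close> is a one-dimensional linear subspace.
  Closed subschemes correspond bijectively to saturated homogeneous ideals.
\<close>

definition proj_space :: "(complex^'n) set set"
  where "proj_space = {vec.span {x} | x. x \<noteq> 0}"

definition proj_zeros :: "'n::finite mpoly set \<Rightarrow> (complex^'n) set set"
  where "proj_zeros I = {p \<in> proj_space. \<forall>F\<in>I. \<forall>x\<in>p. mpoly_eval (($) x) F = 0}"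

definition zariski_closed :: "(complex^'n) set set \<Rightarrow> bool"
  where "zariski_closed Z \<longleftrightarrow>
    (\<exists>S. (\<forall>F\<in>S. \<exists>d. homogeneous d F) \<and> Z = proj_zeros S)"

definition vanishing_ideal :: "(complex^'n) set set \<Rightarrow> 'n mpoly set"
  where "vanishing_ideal Z = {F. \<forall>p\<in>Z. \<forall>x\<in>p. mpoly_eval (($) x) F = 0}"

definition closed_subscheme :: "(complex^'n) set set \<Rightarrow> 'n mpoly set \<Rightarrow> bool"
  where "closed_subscheme Z I \<longleftrightarrow>
    homogeneous_ideal I \<and> saturated I \<and> vanishing_ideal Z \<subseteq> I"

definition mpoly_differential :: "'n mpoly \<Rightarrow> complex^'n \<Rightarrow> complex^'n \<Rightarrow> complex"
  where "mpoly_differential F x v = deriv (\<lambda>t. mpoly_eval (($) (x + t *s v)) F) 0"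

definition mpoly_gradient :: "'n mpoly \<Rightarrow> complex^'n \<Rightarrow> complex^'n"
  where "mpoly_gradient F x = (\<chi> i. mpoly_differential F x (axis i 1))"

text \<open>
  Jacobian criterion: near the point \<open>[x]\<close>, the scheme is cut out by finitely many equations
  whose differentials at \<open>x\<close> are linearly independent. The condition involving \<open>H\<close> says that
  these equations generate the ideal after localization at \<open>[x]\<close>.
\<close>

definition smooth_at :: "'n mpoly set \<Rightarrow> complex^'n \<Rightarrow> bool"
  where "smooth_at I x \<longleftrightarrow>
    (\<exists>B. finite B \<and> B \<subseteq> I \<and> (\<forall>F\<in>B. \<exists>d. homogeneous d F) \<and>
      vec.dim ((\<lambda>F. mpoly_gradient F x) ` B) = card B \<and>
      (\<forall>F\<in>I. \<exists>H d. homogeneous d H \<and> mpoly_eval (($) x) H \<noteq> 0 \<and> H * F \<in> ideal_generated B))"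

definition smooth_subscheme :: "'n::finite mpoly set \<Rightarrow> bool"
  where "smooth_subscheme I \<longleftrightarrow> (\<forall>p\<in>proj_zeros I. \<forall>x\<in>p - {0}. smooth_at I x)"

definition conic_in :: "(complex^'n) set set \<Rightarrow> 'n mpoly set \<Rightarrow> bool"
  where "conic_in Z I \<longleftrightarrow> closed_subscheme Z I \<and> has_hilbert_polynomial I [:1, 2:]"

text \<open>
  The tangent space of projective space at a line \<open>p\<close> of the vector space \<open>V\<close> is \<open>Hom(p, V/p)\<close>.
  We encode a linear subspace \<open>T\<close> of it by the subspace of \<open>V\<close> that contains \<open>p\<close> and is spanned
  by all lifts to \<open>V\<close> of images of elements of \<open>T\<close>. Its dimension is \<open>1 + dim T\<close>; in
  particular a tangent direction at \<open>p\<close> is a plane containing \<open>p\<close>. For the tangent space at \<open>p\<close>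
  of a closed subscheme this gives the tangent space of the affine cone.
\<close>

definition tangent_cone_space :: "'n mpoly set \<Rightarrow> (complex^'n) set \<Rightarrow> (complex^'n) set"
  where "tangent_cone_space I p =
    {v. \<forall>F\<in>I. \<forall>x\<in>p - {0}. mpoly_differential F x v = 0}"

section \<open>The adjoint variety and its contact distribution\<close>

definition exp_ad ::
  "(complex^'n \<Rightarrow> complex^'n \<Rightarrow> complex^'n) \<Rightarrow> complex^'n \<Rightarrow> complex^'n \<Rightarrow> complex^'n"
  where "exp_ad br x y = suminf (\<lambda>k. (1 / fact k) *s ((br x ^^ k) y))"

text \<open>
  The image of the adjoint representation of the simply connected (hence connected) group, which
  is generated by the exponentials of \<open>ad x\<close>. It is closed under inverses since the inverse of
  \<open>exp (ad x)\<close> is \<open>exp (ad (- x))\<close>.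
\<close>

inductive_set adjoint_group ::
  "(complex^'n \<Rightarrow> complex^'n \<Rightarrow> complex^'n) \<Rightarrow> (complex^'n \<Rightarrow> complex^'n) set"
  for br where
    id: "id \<in> adjoint_group br"
  | exp_ad: "g \<in> adjoint_group br \<Longrightarrow> exp_ad br x \<circ> g \<in> adjoint_group br"

definition adjoint_variety ::
  "(complex^'n \<Rightarrow> complex^'n \<Rightarrow> complex^'n) \<Rightarrow> (complex^'n) set set \<Rightarrow> bool"
  where "adjoint_variety br Z \<longleftrightarrow>
    (\<exists>p\<in>proj_space. Z = {g ` p | g. g \<in> adjoint_group br}) \<and> zariski_closed Z"

text \<open>
  \<open>T\<^sub>o Z\<close> is the quotient of the Lie algebra by the stabilizer of \<open>o = [E]\<close>, and the class of \<open>x\<close>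
  corresponds to the homomorphism sending \<open>E\<close> to \<open>[x, E]\<close> modulo \<open>E\<close>.
\<close>

definition contact_fibre ::
  "(complex^'n \<Rightarrow> complex^'n \<Rightarrow> complex^'n) \<Rightarrow> (complex^'n) set \<Rightarrow> 'n weight \<Rightarrow> complex^'n \<Rightarrow>
    (complex^'n) set"
  where "contact_fibre br h \<rho> E =
    vec.span (insert E ((\<lambda>x. br x E) ` vec.span
      (\<Union>\<alpha>\<in>{\<alpha> \<in> roots br h. \<alpha> \<noteq> neg_weight h \<rho> \<and> Re (weight_form br h \<alpha> \<rho>) < 0}.
         root_space br h \<alpha>)))"

text \<open>The pairs consisting of a point \<open>p\<close> of the adjoint variety and the encoding of the fibre at \<open>p\<close>.\<close>

definition contact_distribution ::
  "(complex^'n \<Rightarrow> complex^'n \<Rightarrow> complex^'n) \<Rightarrow> (complex^'n) set \<Rightarrow> 'n weight \<Rightarrow> complex^'n \<Rightarrow>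
    ((complex^'n) set \<times> (complex^'n) set) set"
  where "contact_distribution br h \<rho> E =
    {(g ` vec.span {E}, g ` contact_fibre br h \<rho> E) | g. g \<in> adjoint_group br}"

definition proj_bundle ::
  "((complex^'n) set \<times> (complex^'n) set) set \<Rightarrow> ((complex^'n) set \<times> (complex^'n) set) set"
  where "proj_bundle D =
    {(p, L) | p L W. (p, W) \<in> D \<and> vec.subspace L \<and> vec.dim L = 2 \<and> p \<subseteq> L \<and> L \<subseteq> W}"

text \<open>
  A point of the projectivized tangent bundle of projective space is a flag of a line \<open>[x]\<close> in a
  plane spanned by \<open>x\<close> and \<open>w\<close>. Flags embed in the product of the projective spaces of \<open>V\<close> and
  of the second exterior power of \<open>V\<close> by means of \<open>x\<close> and the coordinates of \<open>x \<and> w\<close>. Closed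
  sets in the product are the zero loci of bihomogeneous polynomials.
\<close>

definition flag_coordinates :: "complex^'n \<Rightarrow> complex^'n \<Rightarrow> 'n + 'n \<times> 'n \<Rightarrow> complex"
  where "flag_coordinates x w = case_sum (($) x) (\<lambda>(i, j). x $ i * w $ j - x $ j * w $ i)"

definition bihomogeneous :: "nat \<Rightarrow> nat \<Rightarrow> ('i + 'j) mpoly \<Rightarrow> bool"
  where "bihomogeneous d e F \<longleftrightarrow>
    (\<forall>m\<in>Poly_Mapping.keys F. partial_degree (range Inl) m = d \<and> partial_degree (range Inr) m = e)"

definition zariski_open_in ::
  "((complex^'n) set \<times> (complex^'n) set) set \<Rightarrow> ((complex^'n) set \<times> (complex^'n) set) set \<Rightarrow> bool"
  where "zariski_open_in P U \<longleftrightarrow>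
    (\<exists>S. (\<forall>F\<in>S. \<exists>d e. bihomogeneous d e F) \<and>
      U = {(p, L) \<in> P. \<exists>F\<in>S. \<exists>x w. p = vec.span {x} \<and> L = vec.span {x, w} \<and>
              mpoly_eval (flag_coordinates x w) F \<noteq> 0})"

end

theory Submission
  imports
    Defs
    "HOL-Computational_Algebra.Fundamental_Theorem_Algebra"
    "HOL-Computational_Algebra.Polynomial_FPS"
begin

text \<open>
  Every \<open>x\<close> on a line in \<open>Z\<close> satisfies the quadratic equations \<open>[x, [x, y]] = l K(x, y) x\<close>, where \<open>K\<close>
  is the Killing form. Let a smooth conic be tangent to \<open>b\<close> at \<open>[a]\<close>. Smoothness gives a formal arc with
  this tangent, and the Hilbert polynomial \<open>2m + 1\<close> bounds the number of vanishing orders of the forms of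
  degree \<open>m\<close> on the arc; hence the conic is parametrized by \<open>a + s b + s\<^sup>2 c\<close>. Comparing the coefficients
  of the powers of \<open>s\<close> in the quadratic equations, one finds \<open>(ad b)\<^sup>4 = 0\<close> whenever \<open>[a, b] = 0\<close>,
  which holds if \<open>b\<close> is a contact direction. The condition \<open>(ad b)\<^sup>4 \<noteq> 0\<close> is open, and it holds for some \<open>b\<close>
  in the fibre at the highest root \<open>\<theta>\<close> if \<open>\<theta> = x + y\<close> for roots \<open>x\<close>, \<open>y\<close> of the same length as \<open>\<theta>\<close>: then
  \<open>b = u\<^sub>x + u\<^sub>y\<close>, a sum of root vectors, belongs to an \<open>sl\<^sub>2\<close>-triple whose semisimple element acts on
  \<open>\<gg>\<^bsub>-\<theta>\<^esub>\<close> by \<open>-4\<close>. Without such roots the long roots are pairwise orthogonal up to sign,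
  which forces type C.
\<close>

section \<open>Linear algebra\<close>

text \<open>A tangent direction is known only as a plane, and the quartics single out a vector of
  that plane that cannot be prescribed. Hence nilpotency is proved for all combinations of
  \<open>a\<close> and \<open>b\<close>, and the generic vector has to tolerate added multiples of
  \<open>E\<close>. The direction does not determine the conic either: the quadratic equations
  contain an unknown second order vector \<open>c\<close>, and the point of the algebra is to
  eliminate it. Roots, their integrality and the positivity of the form have to be derived from the
  bracket. Nearly all of this rests on one device: the trace of \<open>[ad u, ad w]\<close> on an
  invariant subspace is zero, and in a weight basis this is a relation between weights.
  Nondegeneracy of the Killing form comes from the given base: at the element where all simple roots
  equal 1, the form is a sum of squares of integers. The orbit \<open>Z\<close> has an unspecified
  base point. It meets the orbit of \<open>[E]\<close> as soon as a conic in \<open>Z\<close> has a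
  tangent flag in the contact bundle, and automorphisms then carry the equations satisfied by
  \<open>E\<close> to all of \<open>Z\<close>.\<close>

abbreviation clinear :: "('a::field^'m \<Rightarrow> 'a^'n) \<Rightarrow> bool"
  where "clinear \<equiv> Vector_Spaces.linear (*s) (*s)"

lemma clinearI:
  assumes "\<And>x y. f (x + y) = f x + f y" and "\<And>c x. f (c *s x) = c *s f x"
  shows "clinear f"
  unfolding Vector_Spaces.linear_iff using assms by (simp add: vec.vector_space_axioms)

lemmas clinear_simps = vec.linear_0 vec.linear_add vec.linear_scale vec.linear_neg
  vec.linear_diff vec.linear_sum

lemma clinear_comp: "clinear f \<Longrightarrow> clinear g \<Longrightarrow> clinear (\<lambda>x. f (g x))"
  by (intro clinearI) (simp_all add: clinear_simps)

lemma clinear_compow: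
  fixes f :: "'a::field^'n \<Rightarrow> 'a^'n"
  assumes "clinear f"
  shows "clinear (f ^^ k)"
proof (rule clinearI)
  show "(f ^^ k) (x + y) = (f ^^ k) x + (f ^^ k) y" for x y
    by (induction k) (simp_all add: vec.linear_add[OF assms])
  show "(f ^^ k) (c *s x) = c *s (f ^^ k) x" for c x
    by (induction k) (simp_all add: vec.linear_scale[OF assms])
qed

lemma clinear_span_subset:
  assumes "clinear f" "\<And>x. x \<in> A \<Longrightarrow> f x \<in> vec.span B" "x \<in> vec.span A"
  shows "f x \<in> vec.span B"
proof -
  have "f ` vec.span A = vec.span (f ` A)"
    using assms(1) by (metis vec.linear_span_image)
  also have "\<dots> \<subseteq> vec.span B"
    using assms(2) by (intro vec.span_minimal) auto
  finally show ?thesis using assms(3) by blast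
qed

lemma independent_iff_scalars:
  fixes S :: "('a::field^'n) set"
  shows "vec.independent S \<longleftrightarrow> finite S \<and> (\<forall>c. (\<Sum>v\<in>S. c v *s v) = 0 \<longrightarrow> (\<forall>v\<in>S. c v = 0))"
proof safe
  assume S: "vec.independent S"
  show "finite S" using S by (rule vec.finiteI_independent)
  then show "c v = 0" if "(\<Sum>v\<in>S. c v *s v) = 0" "v \<in> S" for c v
    using vec.independentD[OF S _ order_refl] that by blast
next
  assume "finite S" "\<forall>c. (\<Sum>v\<in>S. c v *s v) = 0 \<longrightarrow> (\<forall>v\<in>S. c v = 0)"
    and dep: "vec.dependent S"
  then have "vec.independent S"
    using vec.independent_if_scalars_zero[of S] by blast
  with dep show False by contradiction
qed

lemma sum_representation:
  assumes "vec.independent S" "v \<in> vec.span S"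
  shows "(\<Sum>b\<in>S. vec.representation S v b *s b) = v"
  using assms vec.sum_representation_eq vec.finiteI_independent by blast

subsection \<open>Traces on invariant subspaces\<close>

text \<open>For a basis \<open>S\<close> of an invariant subspace this is the trace of the
  restriction. Working with bases instead of restricted maps lets weight vectors serve directly as
  eigenvectors.\<close>

definition trace_on :: "('a::field^'n) set \<Rightarrow> ('a^'n \<Rightarrow> 'a^'n) \<Rightarrow> 'a"
  where "trace_on S f = (\<Sum>b\<in>S. vec.representation S (f b) b)"

lemma trace_on_diagonal:
  assumes "vec.independent S" "\<And>b. b \<in> S \<Longrightarrow> f b = \<kappa> b *s b"
  shows "trace_on S f = (\<Sum>b\<in>S. \<kappa> b)"
  unfolding trace_on_def
proof (rule sum.cong)
  fix b assume b: "b \<in> S"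
  show "vec.representation S (f b) b = \<kappa> b"
    using assms b by (simp add: vec.representation_scale vec.span_base vec.representation_basis)
qed simp

lemma trace_on_diff:
  assumes "vec.independent S" "\<And>b. b \<in> S \<Longrightarrow> f b \<in> vec.span S" "\<And>b. b \<in> S \<Longrightarrow> g b \<in> vec.span S"
  shows "trace_on S (\<lambda>x. f x - g x) = trace_on S f - trace_on S g"
  unfolding trace_on_def using assms by (simp add: vec.representation_diff sum_subtractf)

lemma trace_on_commute:
  assumes S: "vec.independent S" and f: "clinear f" and g: "clinear g"
    and fS: "\<And>b. b \<in> S \<Longrightarrow> f b \<in> vec.span S" and gS: "\<And>b. b \<in> S \<Longrightarrow> g b \<in> vec.span S"
  shows "trace_on S (\<lambda>x. f (g x)) = trace_on S (\<lambda>x. g (f x))"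
proof -
  have *: "trace_on S (\<lambda>x. f (g x))
      = (\<Sum>b\<in>S. \<Sum>b'\<in>S. vec.representation S (g b) b' * vec.representation S (f b') b)"
    if f: "clinear f" and fS: "\<And>b. b \<in> S \<Longrightarrow> f b \<in> vec.span S"
      and gS: "\<And>b. b \<in> S \<Longrightarrow> g b \<in> vec.span S" for f g
    unfolding trace_on_def
  proof (rule sum.cong)
    fix b assume b: "b \<in> S"
    have "f (g b) = f (\<Sum>b'\<in>S. vec.representation S (g b) b' *s b')"
      using sum_representation[OF S gS[OF b]] by simp
    also have "\<dots> = (\<Sum>b'\<in>S. vec.representation S (g b) b' *s f b')"
      using f by (simp add: clinear_simps)
    finally show "vec.representation S (f (g b)) b
        = (\<Sum>b'\<in>S. vec.representation S (g b) b' * vec.representation S (f b') b)"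
      using S fS by (simp add: vec.representation_sum vec.span_scale vec.representation_scale)
  qed simp
  show ?thesis
    using *[OF f fS gS] *[OF g gS fS] by (subst (asm) sum.swap) (simp add: mult.commute)
qed

text \<open>Independence of the trace from the basis: the Killing form is defined by the standard
  matrix, while its values are computed in bases of weight vectors.\<close>

lemma trace_matrix_eq_trace_on:
  fixes f :: "'a::field^'n \<Rightarrow> 'a^'n"
  assumes S: "vec.independent S" "vec.span S = UNIV" and f: "clinear f"
  shows "trace (matrix f) = trace_on S f"
proof -
  have "vec.representation S (f b) b
      = (\<Sum>i\<in>UNIV. b $ i * vec.representation S (f (axis i 1)) b)" for b
  proof -
    have "f b = f (\<Sum>i\<in>UNIV. b $ i *s axis i 1)"
      by (simp add: basis_expansion)
    also have "\<dots> = (\<Sum>i\<in>UNIV. b $ i *s f (axis i 1))"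
      using f by (simp add: clinear_simps)
    finally show ?thesis
      using S by (simp add: vec.representation_sum vec.representation_scale)
  qed
  then have "trace_on S f = (\<Sum>i\<in>UNIV. \<Sum>b\<in>S. vec.representation S (f (axis i 1)) b * b $ i)"
    unfolding trace_on_def by (subst sum.swap) (simp add: mult.commute)
  also have "\<dots> = (\<Sum>i\<in>UNIV. (\<Sum>b\<in>S. vec.representation S (f (axis i 1)) b *s b) $ i)"
    by simp
  also have "\<dots> = (\<Sum>i\<in>UNIV. f (axis i 1) $ i)"
    using S by (simp add: sum_representation)
  finally show ?thesis by (simp add: trace_def matrix_def)
qed

lemma trace_matrix_commute:
  fixes f g :: "'a::field^'n \<Rightarrow> 'a^'n"
  assumes "clinear f" "clinear g"
  shows "trace (matrix (\<lambda>x. f (g x))) = trace (matrix (\<lambda>x. g (f x)))"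
proof -
  have "trace (matrix (f \<circ> g)) = trace (matrix (g \<circ> f))"
    unfolding matrix_compose_gen[OF assms(2,1)] matrix_compose_gen[OF assms]
    by (rule trace_mul_sym)
  then show ?thesis by (simp add: o_def)
qed

lemma trace_matrix_add:
  "trace (matrix (\<lambda>x. f x + g x)) = trace (matrix f) + trace (matrix (g :: 'a::field^'n \<Rightarrow> 'a^'n))"
  by (simp add: trace_def matrix_def sum.distrib)

lemma trace_matrix_diff:
  "trace (matrix (\<lambda>x. f x - g x)) = trace (matrix f) - trace (matrix (g :: 'a::field^'n \<Rightarrow> 'a^'n))"
  by (simp add: trace_def matrix_def sum_subtractf)

lemma trace_matrix_scale:
  "trace (matrix (\<lambda>x. c *s f x)) = c * trace (matrix (f :: 'a::field^'n \<Rightarrow> 'a^'n))"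
  by (simp add: trace_def matrix_def sum_distrib_left)

text \<open>A basis adapted to the flag of kernels of the powers of \<open>f\<close> makes \<open>f\<close> strictly triangular.\<close>

lemma trace_nilpotent:
  fixes f :: "'a::field^'n \<Rightarrow> 'a^'n"
  assumes f: "clinear f" and nil: "\<And>x. (f ^^ N) x = 0"
  shows "trace (matrix f) = 0"
proof -
  have "\<exists>B. vec.independent B \<and> vec.span B = {x. (f ^^ k) x = 0} \<and>
      (\<forall>b\<in>B. vec.representation B (f b) b = 0)" for k
  proof (induction k)
    case 0
    show ?case by (rule exI[of _ "{}"]) (auto simp: vec.independent_empty)
  next
    case (Suc k)
    then obtain B where B: "vec.independent B" "vec.span B = {x. (f ^^ k) x = 0}"
      "\<And>b. b \<in> B \<Longrightarrow> vec.representation B (f b) b = 0" by blast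
    let ?K = "{x. (f ^^ Suc k) x = 0}"
    have lin: "clinear (f ^^ Suc k)" using f by (rule clinear_compow)
    have K: "vec.subspace ?K"
      using vec.linear_subspace_kernel[OF lin] .
    have fk: "f x \<in> vec.span B" if "x \<in> ?K" for x
      using that B(2) by (simp add: funpow_Suc_right del: funpow.simps)
    have BK: "B \<subseteq> ?K"
    proof
      fix x assume "x \<in> B"
      then have "(f ^^ k) x = 0" using B(2) vec.span_base by blast
      then show "x \<in> ?K" using f by (simp add: clinear_simps)
    qed
    obtain C where C: "B \<subseteq> C" "C \<subseteq> ?K" "vec.independent C" "?K \<subseteq> vec.span C"
      using vec.maximal_independent_subset_extend[OF BK B(1)] by blast
    have spC: "vec.span C = ?K"
      using C K by (metis vec.span_subspace)
    have "vec.representation C (f b) b = 0" if b: "b \<in> C" for b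
    proof -
      \<comment> \<open>Since \<open>f b\<close> already lies in the kernel of
        \<open>f ^^ k\<close>, its coordinates in \<open>C\<close> are those in \<open>B\<close>:
        the one at \<open>b\<close> vanishes by induction if \<open>b \<in> B\<close>, and does not
        occur otherwise.\<close>
      have "vec.representation C (f b) = vec.representation B (f b)"
        using C b fk by (intro vec.representation_extend) auto
      then show ?thesis using B(3) vec.representation_ne_zero by metis
    qed
    then show ?case using C(3) spC by blast
  qed
  from this[of N] obtain B where B: "vec.independent B" "vec.span B = UNIV"
    and "\<And>b. b \<in> B \<Longrightarrow> vec.representation B (f b) b = 0"
    unfolding nil by auto
  then have "trace_on B f = 0" by (simp add: trace_on_def)
  then show ?thesis by (simp add: trace_matrix_eq_trace_on[OF B f])
qed

subsection \<open>Dual vectors\<close>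

text \<open>Gram-Schmidt for functionals, adding one functional at a time. They are linear on the
  whole space but independent on \<open>h\<close> only, as for roots on a Cartan subalgebra. The
  uses are the principal element, the Newton iteration and the choice of linear forms along an
  arc.\<close>

lemma dual_vectors:
  fixes \<phi> :: "'b \<Rightarrow> 'a::field^'n \<Rightarrow> 'a"
  assumes fin: "finite A" and h: "vec.subspace h"
    and add: "\<And>i x y. \<phi> i (x + y) = \<phi> i x + \<phi> i y"
    and scale: "\<And>i c x. \<phi> i (c *s x) = c * \<phi> i x"
    and "\<And>c i. \<forall>x\<in>h. (\<Sum>i\<in>A. c i * \<phi> i x) = 0 \<Longrightarrow> i \<in> A \<Longrightarrow> c i = 0"
  shows "\<exists>t. \<forall>i\<in>A. t i \<in> h \<and> (\<forall>j\<in>A. \<phi> j (t i) = (if i = j then 1 else 0))"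
  using assms(1,5)
proof (induction A rule: finite_induct)
  case empty
  show ?case by simp
next
  case (insert g A)
  note sub = vec.subspace_scale[OF h] vec.subspace_diff[OF h]
  have neg: "\<phi> k (x - y) = \<phi> k x - \<phi> k y" for k x y
    using add[of k "x - y" y] by simp
  have sums: "\<phi> k (\<Sum>i\<in>B. c i *s u i) = (\<Sum>i\<in>B. c i * \<phi> k (u i))" if "finite B" for k c B and u :: "'b \<Rightarrow> _"
    using that
  proof (induction B rule: finite_induct)
    case empty
    show ?case using scale[of k 0 0] by simp
  qed (simp add: add scale)
  have "\<exists>t. \<forall>i\<in>A. t i \<in> h \<and> (\<forall>j\<in>A. \<phi> j (t i) = (if i = j then 1 else 0))"
  proof (rule insert.IH)
    fix c i assume c: "\<forall>x\<in>h. (\<Sum>i\<in>A. c i * \<phi> i x) = 0" "i \<in> A"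
    have "(c(g := 0)) i = 0"
    proof (rule insert.prems[rule_format])
      fix x assume "x \<in> h"
      then have "(\<Sum>i\<in>A. c i * \<phi> i x) = 0" using c by blast
      moreover have "(\<Sum>i\<in>A. (c(g := 0)) i * \<phi> i x) = (\<Sum>i\<in>A. c i * \<phi> i x)"
        using insert.hyps by (intro sum.cong) auto
      ultimately show "(\<Sum>i\<in>insert g A. (c(g := 0)) i * \<phi> i x) = 0"
        using insert.hyps by simp
    qed (use c in auto)
    then show "c i = 0" using insert.hyps c by (auto split: if_splits)
  qed
  then obtain t where t: "\<And>i. i \<in> A \<Longrightarrow> t i \<in> h"
    "\<And>i j. i \<in> A \<Longrightarrow> j \<in> A \<Longrightarrow> \<phi> j (t i) = (if i = j then 1 else 0)" by blast
  have "\<exists>x\<in>h. \<phi> g x \<noteq> (\<Sum>i\<in>A. \<phi> g (t i) * \<phi> i x)"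
  proof (rule ccontr)
    assume *: "\<not> ?thesis"
    define c where "c i = (if i = g then 1 else - \<phi> g (t i))" for i
    have cA: "(\<Sum>i\<in>A. c i * \<phi> i x) = - (\<Sum>i\<in>A. \<phi> g (t i) * \<phi> i x)" for x
      unfolding sum_negf[symmetric] using insert.hyps by (intro sum.cong) (auto simp: c_def)
    have "c g = 0"
    proof (rule insert.prems[rule_format])
      fix x assume "x \<in> h"
      then show "(\<Sum>i\<in>insert g A. c i * \<phi> i x) = 0"
        using * insert.hyps cA by (simp add: c_def)
    qed simp
    then show False by (simp add: c_def)
  qed
  then obtain x where x: "x \<in> h" "\<phi> g x \<noteq> (\<Sum>i\<in>A. \<phi> g (t i) * \<phi> i x)" by blast
  \<comment> \<open>Removing from \<open>x\<close> its components along the old dual system leaves a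
    vector killed by all old functionals but not by the new one.\<close>
  define y where "y = x - (\<Sum>i\<in>A. \<phi> i x *s t i)"
  have yh: "y \<in> h"
    unfolding y_def by (intro vec.subspace_diff[OF h] vec.subspace_sum[OF h] vec.subspace_scale[OF h] x(1) t)
  have yg: "\<phi> g y \<noteq> 0"
    unfolding y_def using neg[of g] x sums[of A g] insert.hyps by (simp add: mult.commute)
  have yA: "\<phi> j y = 0" if "j \<in> A" for j
  proof -
    have "(\<Sum>i\<in>A. \<phi> i x * \<phi> j (t i)) = (\<Sum>i\<in>A. if i = j then \<phi> i x else 0)"
      using t that by (intro sum.cong) auto
    also have "\<dots> = \<phi> j x" using that insert.hyps by simp
    finally show ?thesis
      unfolding y_def using neg[of j] x sums[of A j] insert.hyps by simp
  qed
  define s where "s i = (if i = g then (1 / \<phi> g y) *s y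
      else t i - (\<phi> g (t i) / \<phi> g y) *s y)" for i
  have "s i \<in> h \<and> (\<forall>j\<in>insert g A. \<phi> j (s i) = (if i = j then 1 else 0))" if "i \<in> insert g A" for i
  proof (cases "i = g")
    case True
    then show ?thesis using yh yg yA sub scale insert.hyps by (auto simp: s_def)
  next
    case False
    then have i: "i \<in> A" using that by simp
    have "\<phi> j (s i) = (if i = j then 1 else 0)" if "j \<in> insert g A" for j
      using False i yg yA scale insert.hyps t neg that by (auto simp: s_def)
    then show ?thesis using False yh t i sub by (simp add: s_def)
  qed
  then show ?case by (intro exI[of _ s]) simp
qed

subsection \<open>Generalized eigenspaces\<close>

definition eig_shift :: "('a::field^'n \<Rightarrow> 'a^'n) \<Rightarrow> 'a \<Rightarrow> 'a^'n \<Rightarrow> 'a^'n"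
  where "eig_shift f c x = f x - c *s x"

definition gen_eigenspace :: "('a::field^'n \<Rightarrow> 'a^'n) \<Rightarrow> 'a \<Rightarrow> ('a^'n) set"
  where "gen_eigenspace f c = {v. \<exists>k. (eig_shift f c ^^ k) v = 0}"

lemma clinear_eig_shift:
  assumes "clinear f"
  shows "clinear (eig_shift f c)"
  by (rule clinearI) (simp_all add: eig_shift_def vec.linear_add[OF assms] vec.linear_scale[OF assms]
      algebra_simps)

lemma compow_zero_mono:
  fixes f :: "'a::field^'n \<Rightarrow> 'a^'n"
  assumes "clinear f" "(f ^^ k) v = 0" "k \<le> m"
  shows "(f ^^ m) v = 0"
proof -
  have "(f ^^ m) v = (f ^^ (m - k)) ((f ^^ k) v)"
    using assms(3) by (metis comp_apply funpow_add le_add_diff_inverse2)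
  then show ?thesis using assms(2) vec.linear_0[OF clinear_compow[OF assms(1)]] by simp
qed

lemma compow_commute:
  assumes "\<And>x. f (g x) = g (f x)"
  shows "f ((g ^^ k) x) = (g ^^ k) (f x)"
  by (induction k) (simp_all add: assms)

context
  fixes f :: "'a::field^'n \<Rightarrow> 'a^'n"
  assumes f: "clinear f"
begin

lemma subspace_gen_eigenspace: "vec.subspace (gen_eigenspace f c)"
proof (rule vec.subspaceI)
  note lin = clinear_compow[OF clinear_eig_shift[OF f]]
  show "0 \<in> gen_eigenspace f c"
    unfolding gen_eigenspace_def using vec.linear_0[OF lin] by blast
  show "x + y \<in> gen_eigenspace f c" if xy: "x \<in> gen_eigenspace f c" "y \<in> gen_eigenspace f c" for x y
  proof -
    obtain k l where "(eig_shift f c ^^ k) x = 0" "(eig_shift f c ^^ l) y = 0"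
      using xy by (auto simp: gen_eigenspace_def)
    then have "(eig_shift f c ^^ max k l) x = 0" "(eig_shift f c ^^ max k l) y = 0"
      by (auto intro: compow_zero_mono[OF clinear_eig_shift[OF f]])
    then have "(eig_shift f c ^^ max k l) (x + y) = 0"
      by (simp add: vec.linear_add[OF lin])
    then show ?thesis by (auto simp: gen_eigenspace_def)
  qed
  show "r *s x \<in> gen_eigenspace f c" if "x \<in> gen_eigenspace f c" for x r
    using that by (auto simp: gen_eigenspace_def vec.linear_scale[OF lin] intro: exI)
qed

lemma gen_eigenspace_invariant:
  assumes "clinear g" "\<And>x. g (f x) = f (g x)" "x \<in> gen_eigenspace f c"
  shows "g x \<in> gen_eigenspace f c"
proof -
  obtain k where "(eig_shift f c ^^ k) x = 0" using assms(3) by (auto simp: gen_eigenspace_def)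
  moreover have "g (eig_shift f c x) = eig_shift f c (g x)" for x
    by (simp add: eig_shift_def vec.linear_diff[OF assms(1)] vec.linear_scale[OF assms(1)] assms(2))
  ultimately have "(eig_shift f c ^^ k) (g x) = 0"
    using compow_commute[of g "eig_shift f c" k x] vec.linear_0[OF assms(1)] by simp
  then show ?thesis by (auto simp: gen_eigenspace_def)
qed

lemma eig_shift_gen_eigenspace:
  assumes "x \<in> gen_eigenspace f c"
  shows "eig_shift f a x \<in> gen_eigenspace f c"
proof (rule gen_eigenspace_invariant[OF clinear_eig_shift[OF f] _ assms])
  show "eig_shift f a (f x) = f (eig_shift f a x)" for x
    by (simp add: eig_shift_def vec.linear_diff[OF f] vec.linear_scale[OF f])
qed

lemma eig_shift_inj_on_gen_eigenspace:
  assumes "x \<in> gen_eigenspace f c" "eig_shift f a x = 0" "a \<noteq> c"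
  shows "x = 0"
proof -
  obtain k where k: "(eig_shift f c ^^ k) x = 0" using assms(1) by (auto simp: gen_eigenspace_def)
  have fx: "f x = a *s x" using assms(2) by (simp add: eig_shift_def)
  have "(eig_shift f c ^^ k) x = (a - c) ^ k *s x" for k
    by (induction k)
      (simp_all add: eig_shift_def vec.linear_scale[OF f] fx algebra_simps)
  with k assms(3) show ?thesis by simp
qed

lemma eig_shift_compow_inj_on_gen_eigenspace:
  assumes "x \<in> gen_eigenspace f c" "(eig_shift f a ^^ k) x = 0" "a \<noteq> c"
  shows "x = 0"
  using assms(1,2)
proof (induction k arbitrary: x)
  case (Suc k)
  then have "eig_shift f a x = 0"
    using Suc.IH[of "eig_shift f a x"] eig_shift_gen_eigenspace by (simp add: funpow_Suc_right del: funpow.simps)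
  then show ?case using Suc.prems assms(3) eig_shift_inj_on_gen_eigenspace by blast
qed simp

text \<open>On this space \<open>f - a\<close> is the nonzero scalar \<open>c - a\<close> plus a
  nilpotent operator. The Neumann series for its inverse is built by induction on the order of
  nilpotency.\<close>

lemma eig_shift_surj_on_gen_eigenspace:
  assumes "x \<in> gen_eigenspace f c" "a \<noteq> c"
  shows "\<exists>y\<in>gen_eigenspace f c. eig_shift f a y = x"
proof -
  obtain k where "(eig_shift f c ^^ k) x = 0" using assms(1) by (auto simp: gen_eigenspace_def)
  then show ?thesis using assms(1)
  proof (induction k arbitrary: x)
    case 0
    then show ?case
      using vec.subspace_0[OF subspace_gen_eigenspace] by (intro bexI[of _ 0]) (simp_all add: eig_shift_def vec.linear_0[OF f])
  next
    case (Suc k)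
    let ?x0 = "(1 / (c - a)) *s x" and ?r = "(- 1 / (c - a)) *s eig_shift f c x"
    have "?r \<in> gen_eigenspace f c"
      using Suc.prems eig_shift_gen_eigenspace vec.subspace_scale[OF subspace_gen_eigenspace] by blast
    moreover have "(eig_shift f c ^^ k) ?r = 0"
      using Suc.prems(1)
      unfolding vec.linear_scale[OF clinear_compow[OF clinear_eig_shift[OF f]]]
      by (simp add: funpow_Suc_right del: funpow.simps)
    ultimately obtain y where y: "y \<in> gen_eigenspace f c" "eig_shift f a y = ?r"
      using Suc.IH by blast
    have "eig_shift f a ?x0 = (1 / (c - a)) *s (eig_shift f c x + (c - a) *s x)"
      by (simp add: eig_shift_def vec.linear_scale[OF f] algebra_simps)
    also have "\<dots> = x - ?r"
      unfolding vec.scale_right_distrib vec.scale_scale using assms(2) by simp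
    finally have "eig_shift f a (?x0 + y) = x"
      using y vec.linear_add[OF clinear_eig_shift[OF f]] by simp
    moreover have "?x0 + y \<in> gen_eigenspace f c"
      using y Suc.prems vec.subspace_add[OF subspace_gen_eigenspace] vec.subspace_scale[OF subspace_gen_eigenspace] by blast
    ultimately show ?case by blast
  qed
qed

text \<open>A power of \<open>f - a\<close> that kills the component at \<open>a\<close> leaves a
  shorter relation, and this power is injective on the other generalized eigenspaces.\<close>

lemma gen_eigenspaces_independent:
  assumes "finite A" "\<And>c. c \<in> A \<Longrightarrow> v c \<in> gen_eigenspace f c" "(\<Sum>c\<in>A. v c) = 0" "c \<in> A"
  shows "v c = 0"
  using assms
proof (induction A arbitrary: v c rule: finite_induct)
  case (insert a A)
  obtain k where k: "(eig_shift f a ^^ k) (v a) = 0"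
    using insert.prems(1)[of a] by (auto simp: gen_eigenspace_def)
  note lin = clinear_compow[OF clinear_eig_shift[OF f], of k a]
  have stay: "(eig_shift f a ^^ k) x \<in> gen_eigenspace f c" if "x \<in> gen_eigenspace f c" for x c k
    using that by (induction k) (simp_all add: eig_shift_gen_eigenspace)
  have "(eig_shift f a ^^ k) (\<Sum>c\<in>insert a A. v c) = 0"
    using insert.prems(2) vec.linear_0[OF lin] by simp
  then have "(\<Sum>c\<in>A. (eig_shift f a ^^ k) (v c)) = 0"
    using insert.hyps k by (simp add: vec.linear_add[OF lin] vec.linear_sum[OF lin])
  then have 0: "(eig_shift f a ^^ k) (v c) = 0" if "c \<in> A" for c
    using insert.IH[of "\<lambda>c. (eig_shift f a ^^ k) (v c)" c] insert.prems(1) stay that by simp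
  have *: "v c = 0" if "c \<in> A" for c
    using eig_shift_compow_inj_on_gen_eigenspace[OF _ 0] insert.prems(1) insert.hyps that by blast
  then have "(\<Sum>c\<in>A. v c) = 0" by simp
  then have "v a = 0" using insert.prems(2) insert.hyps by simp
  with * insert.prems(3) show ?case by blast
qed simp

end

text \<open>Division of \<open>p\<close> by a linear factor \<open>X - c\<close> reduces to a vector \<open>w = f v - c v\<close> in the span; its
  components in the generalized eigenspaces lift back along \<open>f - c\<close>.\<close>

lemma in_span_gen_eigenspaces:
  fixes f :: "complex^'n \<Rightarrow> complex^'n"
  assumes f: "clinear f" and "p \<noteq> 0" "(\<Sum>k\<le>degree p. coeff p k *s (f ^^ k) v) = 0"
  shows "v \<in> vec.span (\<Union>c. gen_eigenspace f c)"
  using assms(2,3)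
proof (induction "degree p" arbitrary: p v)
  case 0
  then have "coeff p 0 *s v = 0" "coeff p 0 \<noteq> 0"
    by (auto simp: leading_coeff_0_iff[symmetric] simp del: leading_coeff_0_iff)
  then show ?case by (simp add: vec.span_zero)
next
  case (Suc d)
  have ev: "(\<Sum>k\<le>degree q. coeff q k *s (f ^^ k) v) = (\<Sum>k\<le>n. coeff q k *s (f ^^ k) v)"
    if "degree q \<le> n" for q :: "complex poly" and v n
    using that by (intro sum.mono_neutral_left) (auto simp: coeff_eq_0)
  obtain c where "poly p c = 0"
    using Suc.hyps(2) fundamental_theorem_of_algebra[of p] by (auto simp: constant_degree)
  then obtain q where q: "p = [:- c, 1:] * q" by (metis poly_eq_0_iff_dvd dvdE)
  have q0: "q \<noteq> 0" using Suc.prems q by auto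
  then have d: "degree q = d" using Suc.hyps(2) q by (simp add: degree_mult_eq del: mult_pCons_left)
  let ?w = "eig_shift f c v"
  note linp = clinear_compow[OF f]
  \<comment> \<open>As \<open>p = (X - c) q\<close>, the operator \<open>q(f)\<close> applied to
    \<open>?w = (f - c) v\<close> gives \<open>p(f) v = 0\<close>, so the induction hypothesis
    applies to \<open>?w\<close>.\<close>
  have "(\<Sum>k\<le>d. coeff q k *s (f ^^ k) ?w)
      = (\<Sum>k\<le>d. coeff q k *s (f ^^ Suc k) v) - (\<Sum>k\<le>d. (c * coeff q k) *s (f ^^ k) v)"
    by (simp add: eig_shift_def vec.linear_diff[OF linp] vec.linear_scale[OF linp] funpow_Suc_right
        vec.scale_right_diff_distrib sum_subtractf mult.commute del: funpow.simps)
  also have "\<dots> = (\<Sum>k\<le>Suc d. coeff (pCons 0 q) k *s (f ^^ k) v) - (\<Sum>k\<le>Suc d. (c * coeff q k) *s (f ^^ k) v)"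
  proof -
    have "(\<Sum>k\<le>Suc d. coeff (pCons 0 q) k *s (f ^^ k) v) = (\<Sum>k\<le>d. coeff q k *s (f ^^ Suc k) v)"
      by (subst sum.atMost_Suc_shift) simp
    moreover have "coeff q (Suc d) = 0" using d by (simp add: coeff_eq_0)
    ultimately show ?thesis by simp
  qed
  also have "\<dots> = (\<Sum>k\<le>Suc d. coeff p k *s (f ^^ k) v)"
    unfolding sum_subtractf[symmetric] vec.scale_left_diff_distrib[symmetric] q
    by (intro sum.cong) (auto simp: algebra_simps)
  also have "\<dots> = 0" using Suc.prems(2) Suc.hyps(2) by simp
  finally have "?w \<in> vec.span (\<Union>c. gen_eigenspace f c)"
    using Suc.hyps(1)[of q ?w] d q0 by simp
  then obtain t r where t: "finite t" "t \<subseteq> (\<Union>c. gen_eigenspace f c)" "?w = (\<Sum>b\<in>t. r b *s b)"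
    unfolding vec.span_explicit by blast
  \<comment> \<open>Components of \<open>?w\<close> with eigenvalue different from \<open>c\<close>
    are images under \<open>f - c\<close>; only the part \<open>u\<close> with eigenvalue
    \<open>c\<close> need not be one.\<close>
  have "\<exists>v'. \<exists>u\<in>gen_eigenspace f c. v' \<in> vec.span (\<Union>c. gen_eigenspace f c) \<and>
      (\<Sum>b\<in>t. r b *s b) = eig_shift f c v' + u"
    using t(1,2)
  proof (induction t rule: finite_induct)
    case empty
    show ?case
      using vec.subspace_0[OF subspace_gen_eigenspace[OF f, of c]] vec.linear_0[OF clinear_eig_shift[OF f]]
      by (intro exI[of _ 0] bexI[of _ 0]) (auto simp: vec.span_zero)
  next
    case (insert b t)
    then obtain v' u where vu: "u \<in> gen_eigenspace f c" "v' \<in> vec.span (\<Union>c. gen_eigenspace f c)"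
      "(\<Sum>b\<in>t. r b *s b) = eig_shift f c v' + u" by auto
    obtain e where e: "b \<in> gen_eigenspace f e" using insert.prems by auto
    have rb: "r b *s b \<in> gen_eigenspace f e" using e vec.subspace_scale[OF subspace_gen_eigenspace[OF f]] by blast
    show ?case
    proof (cases "e = c")
      case True
      then have "r b *s b + u \<in> gen_eigenspace f c"
        using rb vu vec.subspace_add[OF subspace_gen_eigenspace[OF f]] by blast
      moreover have "(\<Sum>b\<in>insert b t. r b *s b) = eig_shift f c v' + (r b *s b + u)"
        using insert.hyps vu by simp
      ultimately show ?thesis using vu(2) by blast
    next
      case False
      then obtain y where y: "y \<in> gen_eigenspace f e" "eig_shift f c y = r b *s b"
        using eig_shift_surj_on_gen_eigenspace[OF f rb, of c] by auto
      have "y + v' \<in> vec.span (\<Union>c. gen_eigenspace f c)"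
        using y(1) vu(2) by (intro vec.span_add) (auto intro: vec.span_base)
      moreover have "(\<Sum>b\<in>insert b t. r b *s b) = eig_shift f c (y + v') + u"
        using insert.hyps vu y vec.linear_add[OF clinear_eig_shift[OF f]] by simp
      ultimately show ?thesis using vu(1) by blast
    qed
  qed
  then obtain v' u where vu: "u \<in> gen_eigenspace f c" "v' \<in> vec.span (\<Union>c. gen_eigenspace f c)"
    "?w = eig_shift f c v' + u" using t(3) by auto
  have "eig_shift f c (v - v') = u"
    using vu(3) vec.linear_diff[OF clinear_eig_shift[OF f]] by simp
  moreover obtain k where "(eig_shift f c ^^ k) u = 0" using vu(1) by (auto simp: gen_eigenspace_def)
  ultimately have "(eig_shift f c ^^ Suc k) (v - v') = 0"
    by (simp add: funpow_Suc_right del: funpow.simps)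
  then have "v - v' \<in> gen_eigenspace f c" unfolding gen_eigenspace_def by blast
  then have "v - v' + v' \<in> vec.span (\<Union>c. gen_eigenspace f c)"
    using vu(2) by (intro vec.span_add) (auto intro: vec.span_base)
  then show ?case by simp
qed

lemma span_gen_eigenspaces:
  fixes f :: "complex^'n \<Rightarrow> complex^'n"
  assumes f: "clinear f"
  shows "vec.span (\<Union>c. gen_eigenspace f c) = UNIV"
proof -
  have "v \<in> vec.span (\<Union>c. gen_eigenspace f c)" for v
  proof -
    obtain a where a: "(\<Sum>k\<le>CARD('n). a k *s (f ^^ k) v) = 0" "\<exists>k\<le>CARD('n). a k \<noteq> 0"
    proof (cases "inj_on (\<lambda>k. (f ^^ k) v) {..CARD('n)}")
      case True
      let ?S = "(\<lambda>k. (f ^^ k) v) ` {..CARD('n)}"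
      have "card ?S > CARD('n)" using True by (simp add: card_image)
      then have "vec.dependent ?S"
        using dim_subset_UNIV_cart_gen[of ?S] by (intro vec.dependent_biggerset_general) simp
      then obtain u where u: "(\<Sum>w\<in>?S. u w *s w) = 0" "\<exists>w\<in>?S. u w \<noteq> 0"
        using independent_iff_scalars[of ?S] by auto
      show ?thesis
        using u by (intro that[of "\<lambda>k. u ((f ^^ k) v)"]) (auto simp: sum.reindex[OF True])
    next
      \<comment> \<open>If two iterates coincide, the set of iterates is too small for the dimension
        count, but their difference is itself the required relation.\<close>
      case False
      then obtain i j where ij: "i \<le> CARD('n)" "j \<le> CARD('n)" "i \<noteq> j" "(f ^^ i) v = (f ^^ j) v"
        by (auto simp: inj_on_def)
      define a where "a k = (if k = i then 1 else if k = j then -1 else (0::complex))" for k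
      have "(\<Sum>k\<le>CARD('n). a k *s (f ^^ k) v) = (\<Sum>k\<in>{i, j}. a k *s (f ^^ k) v)"
        using ij by (intro sum.mono_neutral_right) (auto simp: a_def)
      also have "\<dots> = 0" using ij by (simp add: a_def)
      finally show ?thesis using ij by (intro that[of a]) (auto simp: a_def)
    qed
    define p where "p = (\<Sum>k\<le>CARD('n). monom (a k) k)"
    have cp: "coeff p k = (if k \<le> CARD('n) then a k else 0)" for k
      unfolding p_def coeff_sum coeff_monom by (simp add: sum.delta')
    have "p \<noteq> 0" using a(2) cp by (metis coeff_0)
    moreover have "degree p \<le> CARD('n)" using cp by (intro degree_le) auto
    then have "(\<Sum>k\<le>degree p. coeff p k *s (f ^^ k) v) = (\<Sum>k\<le>CARD('n). coeff p k *s (f ^^ k) v)"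
      by (intro sum.mono_neutral_left) (auto simp: coeff_eq_0)
    then have "(\<Sum>k\<le>degree p. coeff p k *s (f ^^ k) v) = (\<Sum>k\<le>CARD('n). a k *s (f ^^ k) v)"
      using cp by simp
    ultimately show ?thesis using in_span_gen_eigenspaces[OF f, of p v] a(1) by simp
  qed
  then show ?thesis by blast
qed

text \<open>\<open>D\<close> is defined on a basis of generalized eigenvectors. That it acts as a
  scalar on the whole of each generalized eigenspace is what later makes it a derivation and makes
  it commute with everything that preserves these spaces.\<close>

lemma semisimple_part_exists:
  fixes f :: "complex^'n \<Rightarrow> complex^'n"
  assumes f: "clinear f"
  shows "\<exists>D. clinear D \<and> (\<forall>c. \<forall>v\<in>gen_eigenspace f c. D v = c *s v) \<and>
    vec.span {v. \<exists>c. D v = c *s v} = UNIV \<and> (\<exists>N. \<forall>x. ((\<lambda>x. f x - D x) ^^ N) x = 0)"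
proof -
  let ?G = "\<Union>c. gen_eigenspace f c"
  obtain B where B: "B \<subseteq> ?G" "vec.independent B" "?G \<subseteq> vec.span B"
    using vec.maximal_independent_subset by blast
  have spB: "vec.span B = UNIV"
    using B(3) span_gen_eigenspaces[OF f] by (metis vec.span_mono vec.span_span top.extremum_uniqueI)
  have finB: "finite B" using B(2) by (rule vec.finiteI_independent)
  obtain e where e: "\<And>b. b \<in> B \<Longrightarrow> b \<in> gen_eigenspace f (e b)" using B(1) by (metis UN_E subsetD)
  obtain D where D: "clinear D" "\<And>b. b \<in> B \<Longrightarrow> D b = e b *s b"
    using vec.linear_independent_extend[OF B(2), of "\<lambda>b. e b *s b"] by blast
  have Dv: "D v = c *s v" if v: "v \<in> gen_eigenspace f c" for c v
  proof -
    let ?r = "vec.representation B v"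
    define A where "A = insert c (e ` B)"
    \<comment> \<open>The component of \<open>v\<close> with eigenvalue \<open>d\<close>, minus
      \<open>v\<close> itself in the slot \<open>d = c\<close>. These vectors add up to zero, hence
      vanish, so only basis vectors with eigenvalue \<open>c\<close> occur in
      \<open>v\<close>.\<close>
    define w where "w d = (\<Sum>b\<in>{b\<in>B. e b = d}. ?r b *s b) - (if d = c then v else 0)" for d
    have wd: "w d \<in> gen_eigenspace f d" for d
    proof -
      have "(\<Sum>b\<in>{b\<in>B. e b = d}. ?r b *s b) \<in> gen_eigenspace f d"
        using e by (intro vec.subspace_sum vec.subspace_scale subspace_gen_eigenspace f) auto
      moreover have "(if d = c then v else 0) \<in> gen_eigenspace f d"
        using v vec.subspace_0[OF subspace_gen_eigenspace[OF f]] by auto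
      ultimately show ?thesis
        unfolding w_def by (intro vec.subspace_diff subspace_gen_eigenspace f)
    qed
    have A: "finite A" "e ` B \<subseteq> A" "c \<in> A" using finB by (auto simp: A_def)
    have "(\<Sum>d\<in>A. w d) = (\<Sum>d\<in>A. \<Sum>b\<in>{b\<in>B. e b = d}. ?r b *s b) - v"
      using A by (simp add: w_def sum_subtractf)
    also have "(\<Sum>d\<in>A. \<Sum>b\<in>{b\<in>B. e b = d}. ?r b *s b) = (\<Sum>b\<in>B. ?r b *s b)"
      using A finB by (intro sum.group) auto
    also have "\<dots> = v" using B(2) spB by (intro sum_representation) auto
    finally have "(\<Sum>d\<in>A. w d) = 0" by simp
    then have "w c = 0" using gen_eigenspaces_independent[OF f A(1), of w c] wd A by blast
    then have v: "v = (\<Sum>b\<in>{b\<in>B. e b = c}. ?r b *s b)" by (simp add: w_def)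
    have "D v = (\<Sum>b\<in>{b\<in>B. e b = c}. ?r b *s D b)"
      by (subst v) (simp add: vec.linear_sum[OF D(1)] vec.linear_scale[OF D(1)])
    also have "\<dots> = (\<Sum>b\<in>{b\<in>B. e b = c}. c *s (?r b *s b))"
      using D(2) by (intro sum.cong) (auto simp: mult.commute)
    also have "\<dots> = c *s (\<Sum>b\<in>{b\<in>B. e b = c}. ?r b *s b)" by (rule vec.scale_sum_right[symmetric])
    also have "\<dots> = c *s v" using v by (rule arg_cong[OF sym])
    finally show ?thesis .
  qed
  have "vec.span {v. \<exists>c. D v = c *s v} = UNIV"
    using D(2) spB by (metis (mono_tags, lifting) mem_Collect_eq subsetI top.extremum_uniqueI vec.span_mono)
  moreover have "\<exists>N. \<forall>x. ((\<lambda>x. f x - D x) ^^ N) x = 0"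
  proof -
    let ?n = "\<lambda>x. f x - D x"
    have lin: "clinear ?n"
      by (rule clinearI) (simp_all add: vec.linear_add[OF D(1)] vec.linear_scale[OF D(1)]
          vec.linear_add[OF f] vec.linear_scale[OF f] algebra_simps)
    have "\<exists>k. (?n ^^ k) b = 0" if b: "b \<in> B" for b
    proof -
      have "(?n ^^ k) b = (eig_shift f (e b) ^^ k) b \<and> (eig_shift f (e b) ^^ k) b \<in> gen_eigenspace f (e b)" for k
        using e[OF b] eig_shift_gen_eigenspace[OF f] Dv by (induction k) (auto simp: eig_shift_def)
      then show ?thesis using e[OF b] by (auto simp: gen_eigenspace_def)
    qed
    then obtain k where k: "\<And>b. b \<in> B \<Longrightarrow> (?n ^^ k b) b = 0" by metis
    define N where "N = Max (k ` B)"
    have N: "(?n ^^ N) b = 0" if "b \<in> B" for b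
      using compow_zero_mono[OF lin k[OF that]] finB that by (simp add: N_def)
    have "(?n ^^ N) x = 0" for x
      using vec.linear_eq_0_on_span[OF clinear_compow[OF lin] N] spB by blast
    then show ?thesis by blast
  qed
  ultimately show ?thesis using D(1) Dv by blast
qed

text \<open>Split a common eigenvector of \<open>F\<close> into eigenvectors of the new map
  \<open>f\<close>. If \<open>g\<close> has eigenvalue \<open>d\<close> on the sum, then
  \<open>g - d\<close> maps each part to its own eigenspace of \<open>f\<close> and the results
  cancel, so each part is an eigenvector of \<open>g\<close>.\<close>

lemma simultaneous_eigenvectors_span:
  fixes F :: "('a::field^'n \<Rightarrow> 'a^'n) set"
  assumes "finite F" "\<And>f. f \<in> F \<Longrightarrow> clinear f" "\<And>f g x. f \<in> F \<Longrightarrow> g \<in> F \<Longrightarrow> f (g x) = g (f x)"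
    and "\<And>f. f \<in> F \<Longrightarrow> vec.span {v. \<exists>c. f v = c *s v} = UNIV"
  shows "vec.span {v. \<forall>f\<in>F. \<exists>c. f v = c *s v} = UNIV"
  using assms
proof (induction F rule: finite_induct)
  case (insert f F)
  define J where "J F = {v. \<forall>f\<in>F. \<exists>c. f v = c *s v}" for F :: "('a^'n \<Rightarrow> 'a^'n) set"
  have f: "clinear f" and comm: "\<And>g x. g \<in> F \<Longrightarrow> f (g x) = g (f x)"
    and linF: "\<And>g. g \<in> F \<Longrightarrow> clinear g" using insert.prems by auto
  have "v \<in> vec.span (J (insert f F))" if v: "v \<in> J F" for v
  proof -
    have "v \<in> vec.span {v. \<exists>c. f v = c *s v}" using insert.prems(3)[of f] by simp
    then obtain A r where A: "finite A" "A \<subseteq> {v. \<exists>c. f v = c *s v}" "v = (\<Sum>b\<in>A. r b *s b)"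
      unfolding vec.span_explicit by blast
    have "\<forall>b\<in>A. \<exists>c. f b = c *s b" using A(2) by blast
    then obtain e where e: "\<And>b. b \<in> A \<Longrightarrow> f b = e b *s b" by metis
    define w where "w c = (\<Sum>b\<in>{b\<in>A. e b = c}. r b *s b)" for c
    have fw: "f (w c) = c *s w c" for c
      unfolding w_def vec.linear_sum[OF f] vec.linear_scale[OF f] vec.scale_sum_right
      using e by (intro sum.cong) (auto simp: mult.commute)
    have vw: "v = (\<Sum>c\<in>e ` A. w c)"
      unfolding w_def A(3) using A(1) by (intro sum.group[symmetric]) auto
    have "w c \<in> J (insert f F)" if c: "c \<in> e ` A" for c
    proof -
      have "\<exists>d. g (w c) = d *s w c" if g: "g \<in> F" for g
      proof -
        obtain d where d: "g v = d *s v" using v g by (auto simp: J_def)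
        note lin = vec.linear_scale[OF f] vec.linear_diff[OF f] vec.linear_scale[OF linF[OF g]]
          vec.linear_sum[OF linF[OF g]]
        have "g (w c) - d *s w c \<in> gen_eigenspace f c" for c
        proof -
          have "eig_shift f c (g (w c) - d *s w c) = 0"
            using comm[OF g] fw by (simp add: eig_shift_def lin algebra_simps)
          then show ?thesis
            unfolding gen_eigenspace_def by (auto intro: exI[of _ "Suc 0"])
        qed
        moreover have "(\<Sum>c\<in>e ` A. g (w c) - d *s w c) = g v - d *s v"
          unfolding vw by (simp add: sum_subtractf lin vec.scale_sum_right)
        ultimately have "g (w c) - d *s w c = 0"
          using gen_eigenspaces_independent[OF f, of "e ` A" "\<lambda>c. g (w c) - d *s w c" c] A(1) c d
          by simp
        then show ?thesis by auto
      qed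
      then show ?thesis using fw by (auto simp: J_def)
    qed
    then show ?thesis unfolding vw by (intro vec.span_sum vec.span_base)
  qed
  then have "vec.span (J F) \<subseteq> vec.span (J (insert f F))"
    by (intro vec.span_minimal) auto
  moreover have "vec.span (J F) = UNIV"
    unfolding J_def using insert.prems by (intro insert.IH) auto
  ultimately have "vec.span (J (insert f F)) = UNIV" by blast
  then show ?case by (simp only: J_def)
qed simp

section \<open>Root decomposition\<close>

subsection \<open>Brackets and the Killing form\<close>

context complex_lie_algebra
begin

lemma br_left_simps:
  "br (x + y) z = br x z + br y z" "br (c *s x) z = c *s br x z" "br 0 z = 0"
  "br (- x) z = - br x z" "br (x - y) z = br x z - br y z" "br (sum f A) z = (\<Sum>i\<in>A. br (f i) z)"
  using vec.linear_add[OF linear_left] vec.linear_scale[OF linear_left] vec.linear_0[OF linear_left]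
    vec.linear_neg[OF linear_left] vec.linear_diff[OF linear_left] vec.linear_sum[OF linear_left]
  by blast+

lemma br_right_simps:
  "br z (x + y) = br z x + br z y" "br z (c *s x) = c *s br z x" "br z 0 = 0"
  "br z (- x) = - br z x" "br z (x - y) = br z x - br z y" "br z (sum f A) = (\<Sum>i\<in>A. br z (f i))"
  using vec.linear_add[OF linear_right] vec.linear_scale[OF linear_right] vec.linear_0[OF linear_right]
    vec.linear_neg[OF linear_right] vec.linear_diff[OF linear_right] vec.linear_sum[OF linear_right]
  by blast+

lemmas br_simps = br_left_simps br_right_simps

lemma br_anti: "br x y = - br y x"
proof -
  have "br (x + y) (x + y) = 0" by (rule alternating)
  then have "br x y + br y x = 0"
    using alternating[of x] alternating[of y] by (simp add: br_simps add.commute)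
  then show ?thesis by (simp add: eq_neg_iff_add_eq_0)
qed

lemma br_derivation: "br x (br y z) = br (br x y) z + br y (br x z)"
proof -
  have "br y (br z x) = - br y (br x z)" "br z (br x y) = - br (br x y) z"
    using br_anti[of z x] br_anti[of z "br x y"] by (simp_all add: br_simps)
  with jacobi[of x y z] show ?thesis by (simp add: algebra_simps)
qed

lemma killing_form_simps:
  "killing_form br (x + y) z = killing_form br x z + killing_form br y z"
  "killing_form br (c *s x) z = c * killing_form br x z"
  "killing_form br z (x + y) = killing_form br z x + killing_form br z y"
  "killing_form br z (c *s x) = c * killing_form br z x"
  unfolding killing_form_def by (simp_all add: br_simps trace_matrix_add trace_matrix_scale)

lemma killing_form_simps':
  "killing_form br 0 z = 0" "killing_form br z 0 = 0"
  "killing_form br (- x) z = - killing_form br x z"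
  "killing_form br z (- x) = - killing_form br z x"
  "killing_form br (x - y) z = killing_form br x z - killing_form br y z"
  "killing_form br z (x - y) = killing_form br z x - killing_form br z y"
proof -
  show "killing_form br 0 z = 0" "killing_form br z 0 = 0"
    using killing_form_simps(2)[of 0 0 z] killing_form_simps(4)[of z 0 0] by simp_all
  show neg: "killing_form br (- x) z = - killing_form br x z"
    "killing_form br z (- x) = - killing_form br z x" for x z
    using killing_form_simps(2)[of "-1" x z] killing_form_simps(4)[of z "-1" x] by simp_all
  show "killing_form br (x - y) z = killing_form br x z - killing_form br y z"
    "killing_form br z (x - y) = killing_form br z x - killing_form br z y"
    using killing_form_simps(1)[of x "-y" z] killing_form_simps(3)[of z x "-y"] by (simp_all add: neg)
qed

lemma killing_form_sum:
  "killing_form br (sum f A) z = (\<Sum>i\<in>A. killing_form br (f i) z)"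
  "killing_form br z (sum f A) = (\<Sum>i\<in>A. killing_form br z (f i))"
  by (induction A rule: infinite_finite_induct) (simp_all add: killing_form_simps killing_form_simps')

lemma killing_form_sym: "killing_form br x y = killing_form br y x"
  unfolding killing_form_def by (rule trace_matrix_commute[OF linear_right linear_right])

lemma killing_form_invariant: "killing_form br (br x y) z = killing_form br x (br y z)"
proof -
  have l: "clinear (\<lambda>w. br a (br b w))" for a b
    by (rule clinear_comp[OF linear_right linear_right])
  have "killing_form br (br x y) z
      = trace (matrix (\<lambda>w. br x (br y (br z w)))) - trace (matrix (\<lambda>w. br y (br x (br z w))))"
    unfolding killing_form_def trace_matrix_diff[symmetric]
    using br_derivation[of x y] by (simp add: algebra_simps)
  also have "trace (matrix (\<lambda>w. br y (br x (br z w)))) = trace (matrix (\<lambda>w. br x (br z (br y w))))"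
    by (rule trace_matrix_commute[OF linear_right l])
  also have "trace (matrix (\<lambda>w. br x (br y (br z w)))) - \<dots> = killing_form br x (br y z)"
    unfolding killing_form_def trace_matrix_diff[symmetric]
    using br_derivation[of y z] by (simp add: br_simps algebra_simps)
  finally show ?thesis .
qed

lemma lie_ideal_radical: "lie_ideal br {x. \<forall>y. killing_form br x y = 0}"
proof -
  have "killing_form br (br x y) z = 0" if "\<forall>z. killing_form br y z = 0" for x y z
    using that killing_form_invariant[of y x z] br_anti[of x y] by (simp add: killing_form_simps')
  then show ?thesis
    unfolding lie_ideal_def
    by (auto intro!: vec.subspaceI simp: killing_form_simps killing_form_simps')
qed

lemma lie_ideal_center: "lie_ideal br {x. \<forall>y. br x y = 0}"
  unfolding lie_ideal_def
proof (intro conjI allI ballI)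
  show "vec.subspace {x. \<forall>y. br x y = 0}"
    by (rule vec.subspaceI) (auto simp: br_simps)
  show "br x y \<in> {x. \<forall>y. br x y = 0}" if "y \<in> {x. \<forall>y. br x y = 0}" for x y
    using that br_anti[of x y] by (auto simp: br_simps)
qed

end

lemma (in simple_lie_algebra) center_trivial:
  assumes "\<And>y. br x y = 0"
  shows "x = 0"
  using ideals_trivial[OF lie_ideal_center] nonabelian assms by auto

subsection \<open>Weight vectors of a toral subalgebra\<close>

locale toral_lie_algebra = complex_lie_algebra br
  for br :: "complex^'n \<Rightarrow> complex^'n \<Rightarrow> complex^'n" +
  fixes h :: "(complex^'n) set"
  assumes toral: "toral_subalgebra br h"
begin

abbreviation W :: "(complex^'n \<Rightarrow> complex) \<Rightarrow> (complex^'n) set"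
  where "W \<equiv> root_space br h"

lemma subspace_h: "vec.subspace h" and abelian_h: "x \<in> h \<Longrightarrow> y \<in> h \<Longrightarrow> br x y = 0"
  and semisimple_h: "x \<in> h \<Longrightarrow> vec.span {v. \<exists>c. br x v = c *s v} = UNIV"
  using toral unfolding toral_subalgebra_def ad_semisimple_def by auto

lemma WD: "v \<in> W \<mu> \<Longrightarrow> t \<in> h \<Longrightarrow> br t v = \<mu> t *s v"
  by (simp add: root_space_def)

lemma WI: "(\<And>t. t \<in> h \<Longrightarrow> br t v = \<mu> t *s v) \<Longrightarrow> v \<in> W \<mu>"
  by (simp add: root_space_def)

lemma W_cong: "(\<And>t. t \<in> h \<Longrightarrow> \<mu> t = \<nu> t) \<Longrightarrow> W \<mu> = W \<nu>"
  by (simp add: root_space_def)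

lemma subspace_W: "vec.subspace (W \<mu>)"
  by (rule vec.subspaceI) (auto simp: root_space_def br_simps algebra_simps)

lemma br_W:
  assumes "x \<in> W \<mu>" "y \<in> W \<nu>"
  shows "br x y \<in> W (\<lambda>t. \<mu> t + \<nu> t)"
proof (rule WI)
  fix t assume t: "t \<in> h"
  show "br t (br x y) = (\<mu> t + \<nu> t) *s br x y"
    using br_derivation[of t x y] WD[OF assms(1) t] WD[OF assms(2) t]
    by (simp add: br_simps algebra_simps)
qed

lemma br_h_commute: "s \<in> h \<Longrightarrow> t \<in> h \<Longrightarrow> br s (br t x) = br t (br s x)"
  using br_derivation[of s t x] abelian_h[of s t] by (simp add: br_simps)

lemma W_weight_eq: "v \<in> W \<mu> \<Longrightarrow> v \<in> W \<nu> \<Longrightarrow> v \<noteq> 0 \<Longrightarrow> t \<in> h \<Longrightarrow> \<mu> t = \<nu> t"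
  by (metis WD vec.scale_right_imp_eq)

text \<open>A finite basis of \<open>h\<close> can be diagonalized simultaneously. The elements of
  \<open>h\<close> having a given vector as eigenvector are then all of \<open>h\<close>, because
  they form a subspace.\<close>

lemma span_W: "vec.span (\<Union>\<mu>. W \<mu>) = UNIV"
proof -
  define J where "J T = {v. \<forall>t\<in>T. \<exists>c. br t v = c *s v}" for T
  have J: "vec.span (J T) = UNIV" if "finite T" "T \<subseteq> h" for T
  proof -
    have "vec.span {v. \<forall>f\<in>br ` T. \<exists>c. f v = c *s v} = UNIV"
    proof (rule simultaneous_eigenvectors_span)
      show "f (g x) = g (f x)" if "f \<in> br ` T" "g \<in> br ` T" for f g x
        using that br_h_commute \<open>T \<subseteq> h\<close> by blast
    qed (use that linear_right semisimple_h in auto)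
    then show ?thesis by (simp add: J_def)
  qed
  obtain T where T: "T \<subseteq> h" "vec.independent T" "h \<subseteq> vec.span T"
    using vec.maximal_independent_subset by blast
  have "J T \<subseteq> (\<Union>\<mu>. W \<mu>)"
  proof
    fix v assume v: "v \<in> J T"
    have "vec.subspace {t. \<exists>c. br t v = c *s v}"
    proof (rule vec.subspaceI)
      show "0 \<in> {t. \<exists>c. br t v = c *s v}" by (intro CollectI exI[of _ 0]) (simp add: br_simps)
      show "x + y \<in> {t. \<exists>c. br t v = c *s v}"
        if xy: "x \<in> {t. \<exists>c. br t v = c *s v}" "y \<in> {t. \<exists>c. br t v = c *s v}" for x y
      proof -
        obtain c d where "br x v = c *s v" "br y v = d *s v" using xy by blast
        then have "br (x + y) v = (c + d) *s v" by (simp add: br_simps vec.scale_left_distrib)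
        then show ?thesis by blast
      qed
      show "c *s x \<in> {t. \<exists>c. br t v = c *s v}" if "x \<in> {t. \<exists>c. br t v = c *s v}" for c x
        using that by (auto simp: br_simps)
    qed
    then have "h \<subseteq> {t. \<exists>c. br t v = c *s v}"
      using v T(3) vec.span_minimal[of T "{t. \<exists>c. br t v = c *s v}"] by (auto simp: J_def)
    then have "v \<in> W (\<lambda>t. SOME c. br t v = c *s v)"
      by (intro WI) (metis (mono_tags, lifting) mem_Collect_eq someI_ex subsetD)
    then show "v \<in> (\<Union>\<mu>. W \<mu>)" by blast
  qed
  then show ?thesis
    using J[of T] T vec.finiteI_independent[OF T(2)] by (metis vec.span_mono top.extremum_uniqueI)
qed

lemma weight_basis_extend:
  assumes "vec.independent S" "S \<subseteq> (\<Union>\<mu>. W \<mu>)"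
  obtains B where "S \<subseteq> B" "B \<subseteq> (\<Union>\<mu>. W \<mu>)" "vec.independent B" "vec.span B = UNIV"
proof -
  obtain B where B: "S \<subseteq> B" "B \<subseteq> (\<Union>\<mu>. W \<mu>)" "vec.independent B" "(\<Union>\<mu>. W \<mu>) \<subseteq> vec.span B"
    using vec.maximal_independent_subset_extend assms by blast
  moreover have "vec.span B = UNIV"
    using B(4) span_W by (metis vec.span_mono vec.span_span top.extremum_uniqueI)
  ultimately show ?thesis using that by blast
qed

text \<open>Applying \<open>ad t - \<mu> t\<close> to the expansion of \<open>v\<close> multiplies
  each coefficient by a difference of weights; by independence all these products are zero.\<close>

lemma in_span_weight_basis:
  assumes B: "B \<subseteq> (\<Union>\<mu>. W \<mu>)" "vec.independent B" "v \<in> vec.span B" and v: "v \<in> W \<mu>"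
  shows "v \<in> vec.span (B \<inter> W \<mu>)"
proof -
  let ?r = "vec.representation B v"
  have fin: "finite B" using B(2) by (rule vec.finiteI_independent)
  have vB: "(\<Sum>b\<in>B. ?r b *s b) = v" using B(2,3) by (rule sum_representation)
  obtain wt where wt: "\<And>b. b \<in> B \<Longrightarrow> b \<in> W (wt b)" using B(1) by (metis UN_E subsetD)
  have r: "?r b = 0 \<or> b \<in> W \<mu>" if b: "b \<in> B" for b
  proof (cases "?r b = 0")
    case False
    have "wt b t = \<mu> t" if t: "t \<in> h" for t
    proof -
      have "(\<Sum>b\<in>B. (?r b * (wt b t - \<mu> t)) *s b) = br t (\<Sum>b\<in>B. ?r b *s b) - \<mu> t *s (\<Sum>b\<in>B. ?r b *s b)"
        unfolding br_simps vec.scale_sum_right sum_subtractf[symmetric]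
        using WD[OF wt t] by (intro sum.cong) (auto simp: algebra_simps)
      also have "\<dots> = 0" using WD[OF v t] vB by simp
      finally have "?r b * (wt b t - \<mu> t) = 0"
        using vec.independentD[OF B(2) fin order_refl, of "\<lambda>b. ?r b * (wt b t - \<mu> t)"] b by blast
      then show ?thesis using False by simp
    qed
    then show ?thesis using wt[OF b] W_cong by metis
  qed simp
  have "(\<Sum>b\<in>B. ?r b *s b) = (\<Sum>b\<in>B \<inter> W \<mu>. ?r b *s b)"
    using fin r by (intro sum.mono_neutral_right) auto
  then show ?thesis
    using vB by (metis (no_types, lifting) vec.span_base vec.span_scale vec.span_sum)
qed

lemma independent_weight_vectors:
  assumes "finite A" "\<And>i. i \<in> A \<Longrightarrow> v i \<in> W (\<mu> i) \<and> v i \<noteq> 0"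
    and "\<And>i j. i \<in> A \<Longrightarrow> j \<in> A \<Longrightarrow> (\<And>t. t \<in> h \<Longrightarrow> \<mu> i t = \<mu> j t) \<Longrightarrow> i = j"
  shows "vec.independent (v ` A)" "inj_on v A"
proof -
  show inj: "inj_on v A"
  proof (rule inj_onI)
    fix i j assume "i \<in> A" "j \<in> A" "v i = v j"
    then show "i = j" using assms(2,3) W_weight_eq by metis
  qed
  have "vec.independent (v ` A')" if "A' \<subseteq> A" for A'
    using finite_subset[OF that assms(1)] that
  proof (induction A' rule: finite_induct)
    case empty
    show ?case by (simp add: vec.independent_empty)
  next
    case (insert i A')
    have "v i \<notin> vec.span (v ` A')"
    proof
      assume "v i \<in> vec.span (v ` A')"
      then have "v i \<in> vec.span (v ` A' \<inter> W (\<mu> i))"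
        using insert assms(2) by (intro in_span_weight_basis) auto
      moreover have "v ` A' \<inter> W (\<mu> i) = {}"
      proof (rule ccontr)
        assume "v ` A' \<inter> W (\<mu> i) \<noteq> {}"
        then obtain j where j: "j \<in> A'" "v j \<in> W (\<mu> i)" by blast
        then have "j = i"
          using insert.prems assms(2,3) W_weight_eq[of "v j" "\<mu> j" "\<mu> i"] by blast
        then show False using j insert.hyps by blast
      qed
      ultimately show False using insert.prems assms(2) by simp
    qed
    then show ?case using insert by (simp add: vec.independent_insertI)
  qed
  then show "vec.independent (v ` A)" by blast
qed

lemma killing_form_W:
  assumes "x \<in> W \<mu>" "y \<in> W \<nu>" "t \<in> h" "\<mu> t + \<nu> t \<noteq> 0"
  shows "killing_form br x y = 0"
proof -
  have "killing_form br (br x t) y = killing_form br x (br t y)" by (rule killing_form_invariant)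
  then have "- (\<mu> t * killing_form br x y) = \<nu> t * killing_form br x y"
    using WD[OF assms(1,3)] WD[OF assms(2,3)] br_anti[of x t]
    by (simp add: killing_form_simps killing_form_simps')
  then have "(\<mu> t + \<nu> t) * killing_form br x y = 0"
    by (simp add: distrib_right) (metis add.right_inverse)
  then show ?thesis using assms(4) by simp
qed

end

subsection \<open>The Killing form is nondegenerate\<close>

locale based_simple_lie_algebra = simple_lie_algebra br
  for br :: "complex^'n \<Rightarrow> complex^'n \<Rightarrow> complex^'n" +
  fixes h :: "(complex^'n) set" and \<Delta> :: "'n weight set" and \<rho> :: "'n weight"
  assumes cartan: "cartan_subalgebra br h" and base: "simple_roots br h \<Delta>"
    and highest: "highest_root br h \<Delta> \<rho>"
begin

sublocale toral_lie_algebra br h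
  using cartan by unfold_locales (simp add: cartan_subalgebra_def)

abbreviation K :: "complex^'n \<Rightarrow> complex^'n \<Rightarrow> complex"
  where "K \<equiv> killing_form br"

lemma root_vector_exists:
  assumes "\<alpha> \<in> roots br h"
  obtains v where "v \<in> W \<alpha>" "v \<noteq> 0"
  using assms vec.subspace_0[OF subspace_W] by (auto simp: roots_def)

lemma root_of_weight_vector:
  assumes "v \<in> W \<mu>" "v \<noteq> 0" "t \<in> h" "\<mu> t \<noteq> 0"
  shows "restrict \<mu> h \<in> roots br h"
proof -
  have "v \<in> W (restrict \<mu> h)" using assms(1) by (simp add: root_space_def)
  then show ?thesis using assms by (auto simp: roots_def)
qed

text \<open>This is the element at which every root takes its height. It reduces statements about
  roots to statements about integers, in particular the nondegeneracy of the Killing form.\<close>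

lemma principal_element_exists: "\<exists>t\<in>h. \<forall>\<beta>\<in>\<Delta>. \<beta> t = 1"
proof -
  have fin: "finite \<Delta>" and rt: "\<Delta> \<subseteq> roots br h"
    and indep: "\<And>c :: _ \<Rightarrow> complex. \<forall>t\<in>h. (\<Sum>\<beta>\<in>\<Delta>. c \<beta> * \<beta> t) = 0 \<Longrightarrow> \<forall>\<beta>\<in>\<Delta>. c \<beta> = 0"
    using base unfolding simple_roots_def by blast+
  have "\<forall>\<beta>\<in>\<Delta>. \<exists>v. v \<in> W \<beta> \<and> v \<noteq> 0" using rt root_vector_exists by (metis subsetD)
  then obtain v where v: "\<And>\<beta>. \<beta> \<in> \<Delta> \<Longrightarrow> v \<beta> \<in> W \<beta> \<and> v \<beta> \<noteq> 0" by metis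
  have "\<forall>\<beta>\<in>\<Delta>. \<exists>j. v \<beta> $ j \<noteq> 0" using v by (auto simp: vec_eq_iff)
  then obtain j where j: "\<And>\<beta>. \<beta> \<in> \<Delta> \<Longrightarrow> v \<beta> $ j \<beta> \<noteq> 0" by metis
  \<comment> \<open>A root is linear on \<open>h\<close> only. Reading off one coordinate of
    \<open>br t (v \<beta>)\<close> gives a functional that is linear everywhere and agrees with
    \<open>\<beta>\<close> on \<open>h\<close>.\<close>
  define \<phi> where "\<phi> \<beta> t = br t (v \<beta>) $ j \<beta> / v \<beta> $ j \<beta>" for \<beta> t
  have \<phi>: "\<phi> \<beta> t = \<beta> t" if "\<beta> \<in> \<Delta>" "t \<in> h" for \<beta> t
    using v[OF that(1)] WD[of "v \<beta>" \<beta> t] that j[OF that(1)] by (simp add: \<phi>_def)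
  have "\<exists>t. \<forall>i\<in>\<Delta>. t i \<in> h \<and> (\<forall>j\<in>\<Delta>. \<phi> j (t i) = (if i = j then 1 else 0))"
  proof (rule dual_vectors[OF fin subspace_h])
    show "\<phi> i (x + y) = \<phi> i x + \<phi> i y" "\<phi> i (c *s x) = c * \<phi> i x" for i x y c
      by (simp_all add: \<phi>_def br_simps add_divide_distrib)
    show "c i = 0" if c: "\<forall>x\<in>h. (\<Sum>i\<in>\<Delta>. c i * \<phi> i x) = 0" and i: "i \<in> \<Delta>" for c i
    proof -
      have "\<forall>x\<in>h. (\<Sum>i\<in>\<Delta>. c i * i x) = 0" using c \<phi> by simp
      then show ?thesis using indep i by blast
    qed
  qed
  then obtain t where t: "\<And>i. i \<in> \<Delta> \<Longrightarrow> t i \<in> h"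
    "\<And>i j. i \<in> \<Delta> \<Longrightarrow> j \<in> \<Delta> \<Longrightarrow> \<phi> j (t i) = (if i = j then 1 else 0)" by blast
  let ?t = "\<Sum>i\<in>\<Delta>. t i"
  have th: "?t \<in> h" using t by (intro vec.subspace_sum subspace_h)
  have "\<beta> ?t = 1" if \<beta>: "\<beta> \<in> \<Delta>" for \<beta>
  proof -
    have "\<phi> \<beta> ?t = (\<Sum>i\<in>\<Delta>. \<phi> \<beta> (t i))"
      by (simp add: \<phi>_def br_simps sum_divide_distrib)
    also have "\<dots> = 1" using t \<beta> fin by simp
    finally show ?thesis using \<phi>[OF \<beta> th] by simp
  qed
  with th show ?thesis by blast
qed

definition t\<^sub>0 :: "complex^'n"
  where "t\<^sub>0 = (SOME t. t \<in> h \<and> (\<forall>\<beta>\<in>\<Delta>. \<beta> t = 1))"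

lemma t\<^sub>0: "t\<^sub>0 \<in> h" "\<beta> \<in> \<Delta> \<Longrightarrow> \<beta> t\<^sub>0 = 1"
  using someI_ex[OF principal_element_exists[unfolded Bex_def]] unfolding t\<^sub>0_def by auto

lemma root_coefficients:
  assumes "\<alpha> \<in> roots br h"
  shows "\<exists>c :: _ \<Rightarrow> int. (\<forall>t\<in>h. \<alpha> t = (\<Sum>\<beta>\<in>\<Delta>. of_int (c \<beta>) * \<beta> t)) \<and>
    ((\<forall>\<beta>\<in>\<Delta>. c \<beta> \<ge> 0) \<or> (\<forall>\<beta>\<in>\<Delta>. c \<beta> \<le> 0))"
  using base assms by (simp add: simple_roots_def)

lemma root_height:
  assumes "\<alpha> \<in> roots br h"
  obtains n :: int where "\<alpha> t\<^sub>0 = of_int n" "n \<noteq> 0"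
proof -
  obtain c :: "_ \<Rightarrow> int" where c: "\<forall>t\<in>h. \<alpha> t = (\<Sum>\<beta>\<in>\<Delta>. of_int (c \<beta>) * \<beta> t)"
    and sgn: "(\<forall>\<beta>\<in>\<Delta>. c \<beta> \<ge> 0) \<or> (\<forall>\<beta>\<in>\<Delta>. c \<beta> \<le> 0)"
    using root_coefficients[OF assms] by (elim exE conjE)
  have fin: "finite \<Delta>" using base unfolding simple_roots_def by blast
  have "\<alpha> t\<^sub>0 = (\<Sum>\<beta>\<in>\<Delta>. of_int (c \<beta>) * \<beta> t\<^sub>0)" using c t\<^sub>0(1) by blast
  also have "\<dots> = (\<Sum>\<beta>\<in>\<Delta>. of_int (c \<beta>))" using t\<^sub>0(2) by (intro sum.cong) simp_all
  finally have "\<alpha> t\<^sub>0 = of_int (\<Sum>\<beta>\<in>\<Delta>. c \<beta>)" by simp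
  moreover have "(\<Sum>\<beta>\<in>\<Delta>. c \<beta>) \<noteq> 0"
  proof
    assume 0: "(\<Sum>\<beta>\<in>\<Delta>. c \<beta>) = 0"
    have "\<forall>\<beta>\<in>\<Delta>. c \<beta> = 0"
    proof (cases "\<forall>\<beta>\<in>\<Delta>. c \<beta> \<ge> 0")
      case True
      then show ?thesis using 0 fin sum_nonneg_eq_0_iff[of \<Delta> c] by simp
    next
      case False
      then have "\<forall>\<beta>\<in>\<Delta>. c \<beta> \<le> 0" using sgn by blast
      then show ?thesis using 0 fin sum_nonneg_eq_0_iff[of \<Delta> "\<lambda>\<beta>. - c \<beta>"] by (simp add: sum_negf)
    qed
    with c have "\<forall>t\<in>h. \<alpha> t = 0" by simp
    then show False using assms by (simp add: roots_def)
  qed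
  ultimately show ?thesis using that by blast
qed

lemma weight_height:
  assumes "v \<in> W \<mu>" "v \<noteq> 0"
  obtains n :: int where "\<mu> t\<^sub>0 = of_int n" "n = 0 \<Longrightarrow> \<forall>t\<in>h. \<mu> t = 0"
proof (cases "\<forall>t\<in>h. \<mu> t = 0")
  case True
  then show ?thesis using that[of 0] t\<^sub>0(1) by simp
next
  case False
  then have "restrict \<mu> h \<in> roots br h" using root_of_weight_vector[OF assms] by blast
  then show ?thesis using root_height t\<^sub>0(1) that by (metis restrict_apply')
qed

lemma \<rho>_root: "\<rho> \<in> roots br h"
  using highest by (simp add: highest_root_def)

lemma weight_basis_exists:
  obtains B wt where "vec.independent B" "vec.span B = UNIV" "\<And>b. b \<in> B \<Longrightarrow> b \<in> W (wt b)"
    "\<And>b. b \<in> B \<Longrightarrow> b \<noteq> 0"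
proof -
  obtain B where B: "B \<subseteq> (\<Union>\<mu>. W \<mu>)" "vec.independent B" "vec.span B = UNIV"
    using weight_basis_extend[of "{}"] vec.independent_empty by auto
  then have "\<forall>b\<in>B. \<exists>\<mu>. b \<in> W \<mu>" by blast
  then obtain wt where "\<And>b. b \<in> B \<Longrightarrow> b \<in> W (wt b)" by metis
  then show ?thesis using that B vec.dependent_zero by blast
qed

lemma killing_form_h:
  assumes B: "vec.independent B" "vec.span B = UNIV" "\<And>b. b \<in> B \<Longrightarrow> b \<in> W (wt b)"
    and st: "s \<in> h" "t \<in> h"
  shows "K s t = (\<Sum>b\<in>B. wt b s * wt b t)"
proof -
  have lin: "clinear (\<lambda>z. br s (br t z))" by (rule clinear_comp[OF linear_right linear_right])
  have "K s t = trace_on B (\<lambda>z. br s (br t z))"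
    unfolding killing_form_def by (rule trace_matrix_eq_trace_on[OF B(1,2) lin])
  also have "\<dots> = (\<Sum>b\<in>B. wt b s * wt b t)"
    using WD[OF B(3)] st by (intro trace_on_diagonal[OF B(1)]) (simp add: br_simps mult.commute)
  finally show ?thesis .
qed

text \<open>The value is a sum of squares of integer heights. If it were zero,
  \<open>t\<^sub>0\<close> would be central, although roots do not vanish at it. One vector outside
  the radical is enough, since the radical is an ideal.\<close>

lemma killing_form_t\<^sub>0: "K t\<^sub>0 t\<^sub>0 \<noteq> 0"
proof
  assume 0: "K t\<^sub>0 t\<^sub>0 = 0"
  obtain B wt where B: "vec.independent B" "vec.span B = UNIV" "\<And>b. b \<in> B \<Longrightarrow> b \<in> W (wt b)"
    "\<And>b. b \<in> B \<Longrightarrow> b \<noteq> 0" using weight_basis_exists by blast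
  have fin: "finite B" using B(1) by (rule vec.finiteI_independent)
  have "\<forall>b\<in>B. \<exists>n :: int. wt b t\<^sub>0 = of_int n" using B(3,4) weight_height by metis
  then obtain n :: "_ \<Rightarrow> int" where n: "\<And>b. b \<in> B \<Longrightarrow> wt b t\<^sub>0 = of_int (n b)" by metis
  have "of_int (\<Sum>b\<in>B. n b * n b) = (0 :: complex)"
    using 0 killing_form_h[OF B(1-3) t\<^sub>0(1) t\<^sub>0(1)] n by simp
  then have "(\<Sum>b\<in>B. n b * n b) = 0" by (simp only: of_int_eq_0_iff)
  then have "\<forall>b\<in>B. n b = 0" using fin by (simp add: sum_nonneg_eq_0_iff)
  then have "\<And>b. b \<in> B \<Longrightarrow> br t\<^sub>0 b = 0" using WD[OF B(3) t\<^sub>0(1)] n by simp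
  then have z: "br t\<^sub>0 v = 0" for v
    using vec.linear_eq_0_on_span[OF linear_right, of B t\<^sub>0 v] B(2) by simp
  obtain v where v: "v \<in> W \<rho>" "v \<noteq> 0" using root_vector_exists[OF \<rho>_root] .
  then have "\<rho> t\<^sub>0 *s v = 0" using z WD[OF v(1) t\<^sub>0(1)] by simp
  then have "\<rho> t\<^sub>0 = 0" using v(2) by simp
  then show False using root_height[OF \<rho>_root] by (metis of_int_eq_0_iff)
qed

lemma killing_form_nondegenerate:
  assumes "\<And>y. K x y = 0"
  shows "x = 0"
proof -
  have "{x. \<forall>y. K x y = 0} \<noteq> UNIV" using killing_form_t\<^sub>0 by blast
  then have "{x. \<forall>y. K x y = 0} = {0}" using ideals_trivial[OF lie_ideal_radical] by blast
  then show ?thesis using assms by blast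
qed

lemma in_W_span_cases:
  assumes "\<And>\<mu> y. y \<in> W \<mu> \<Longrightarrow> P y" "vec.subspace {y. P y}"
  shows "P y"
proof -
  have "vec.span (\<Union>\<mu>. W \<mu>) \<subseteq> {y. P y}" using assms by (intro vec.span_minimal) auto
  then show ?thesis using span_W by blast
qed

lemma killing_form_representation:
  assumes add: "\<And>x y. g (x + y) = g x + g y" and scale: "\<And>c x. g (c *s x) = c * g x"
  obtains d where "\<And>y. K d y = g y"
proof -
  have g: "g y = (\<Sum>i\<in>UNIV. y $ i * g (axis i 1))"
    if "\<And>x y. g (x + y) = g x + g y" "\<And>c x. g (c *s x) = c * g x" for g :: "complex^'n \<Rightarrow> complex" and y
  proof -
    have "g (\<Sum>i\<in>A. y $ i *s axis i 1) = (\<Sum>i\<in>A. y $ i * g (axis i 1))" if "finite A" for A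
      using that
    proof (induction A rule: finite_induct)
      case empty
      show ?case using \<open>\<And>c x. g (c *s x) = c * g x\<close>[of 0 0] by simp
    qed (simp add: \<open>\<And>x y. g (x + y) = g x + g y\<close> \<open>\<And>c x. g (c *s x) = c * g x\<close>)
    from this[of UNIV] show ?thesis by (simp add: basis_expansion)
  qed
  define \<Phi> where "\<Phi> x = (\<chi> i. K x (axis i 1))" for x
  have lin: "clinear \<Phi>" by (rule clinearI) (simp_all add: \<Phi>_def vec_eq_iff killing_form_simps)
  have "x = 0" if "\<Phi> x = 0" for x
  proof (rule killing_form_nondegenerate)
    show "K x y = 0" for y
      using that by (subst g[of "K x"]) (simp_all add: killing_form_simps \<Phi>_def vec_eq_iff)
  qed
  then have "inj \<Phi>" using vec.linear_inj_iff_eq_0[OF lin] by blast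
  then have "surj \<Phi>" using vec.linear_injective_imp_surjective[OF lin] by blast
  then obtain d where d: "\<Phi> d = (\<chi> i. g (axis i 1))" by (metis surjD)
  have "K d y = g y" for y
  proof -
    have "K d (axis i 1) = g (axis i 1)" for i using d by (simp add: \<Phi>_def vec_eq_iff)
    then show ?thesis
      using g[of "K d" y] g[of g y] add scale by (simp add: killing_form_simps)
  qed
  then show ?thesis using that by blast
qed

text \<open>Choose \<open>d\<close> to represent the functional \<open>tr(D ad y)\<close>. Then
  \<open>F = D - ad d\<close> is a derivation with \<open>tr(F ad y) = 0\<close> for all
  \<open>y\<close>, and cyclicity of the trace gives
  \<open>K (F x) y = tr(F ad [x, y]) = 0\<close>.\<close>

lemma derivation_inner:
  assumes D: "clinear D" and der: "\<And>x y. D (br x y) = br (D x) y + br x (D y)"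
  obtains d where "\<And>x. D x = br d x"
proof -
  define T where "T f = trace (matrix f)" for f :: "complex^'n \<Rightarrow> complex^'n"
  obtain d where d: "\<And>y. K d y = T (\<lambda>z. D (br y z))"
  proof (rule killing_form_representation)
    show "T (\<lambda>z. D (br (x + y) z)) = T (\<lambda>z. D (br x z)) + T (\<lambda>z. D (br y z))" for x y
      by (simp add: T_def br_simps vec.linear_add[OF D] trace_matrix_add)
    show "T (\<lambda>z. D (br (c *s x) z)) = c * T (\<lambda>z. D (br x z))" for c x
      by (simp add: T_def br_simps vec.linear_scale[OF D] trace_matrix_scale)
  qed blast
  define F where "F x = D x - br d x" for x
  have lin: "clinear F"
    by (rule clinearI) (simp_all add: F_def br_simps vec.linear_add[OF D] vec.linear_scale[OF D] algebra_simps)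
  have F: "F (br x y) = br (F x) y + br x (F y)" for x y
    using der[of x y] br_derivation[of d x y] by (simp add: F_def br_simps)
  have TF: "T (\<lambda>z. F (br y z)) = 0" for y
    using d[of y] by (simp add: T_def F_def trace_matrix_diff killing_form_def)
  have "F x = 0" for x
  proof (rule killing_form_nondegenerate)
    fix y
    have "br (F x) z = F (br x z) - br x (F z)" for z using F by simp
    then have "K (F x) y = T (\<lambda>z. F (br x (br y z))) - T (\<lambda>z. br x (F (br y z)))"
      by (simp add: killing_form_def T_def trace_matrix_diff)
    also have "T (\<lambda>z. br x (F (br y z))) = T (\<lambda>z. F (br y (br x z)))"
      unfolding T_def by (rule trace_matrix_commute[OF linear_right clinear_comp[OF lin linear_right]])
    also have "T (\<lambda>z. F (br x (br y z))) - T (\<lambda>z. F (br y (br x z))) = T (\<lambda>z. F (br (br x y) z))"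
      unfolding T_def trace_matrix_diff[symmetric] vec.linear_diff[OF lin, symmetric]
      using br_derivation[of x y] by (simp add: algebra_simps)
    finally show "K (F x) y = 0" by (simp add: TF)
  qed
  then show ?thesis using that[of d] by (simp add: F_def)
qed

subsection \<open>A maximal toral subalgebra is its own centralizer\<close>

text \<open>By the Leibniz rule \<open>ad x - (c + d)\<close> shifts one factor at a time, so the
  induction is on the sum of the two exponents of nilpotency.\<close>

lemma br_gen_eigenspaces:
  assumes "y \<in> gen_eigenspace (br x) c" "z \<in> gen_eigenspace (br x) d"
  shows "br y z \<in> gen_eigenspace (br x) (c + d)"
proof -
  have "br y z \<in> gen_eigenspace (br x) (c + d)"
    if "(eig_shift (br x) c ^^ k) y = 0" "(eig_shift (br x) d ^^ l) z = 0" "k + l = n" for k l n y z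
    using that
  proof (induction n arbitrary: k l y z)
    case 0
    then show ?case using vec.subspace_0[OF subspace_gen_eigenspace[OF linear_right]] by (simp add: br_simps)
  next
    case (Suc n)
    note sub = vec.subspace_0[OF subspace_gen_eigenspace[OF linear_right]]
      vec.subspace_add[OF subspace_gen_eigenspace[OF linear_right]]
    have 1: "br (eig_shift (br x) c y) z \<in> gen_eigenspace (br x) (c + d)"
    proof (cases k)
      case 0
      then show ?thesis using Suc.prems sub by (simp add: br_simps eig_shift_def)
    next
      case (Suc k')
      then show ?thesis
        using Suc.prems Suc.IH[of k' "eig_shift (br x) c y" l z]
        by (simp add: funpow_Suc_right del: funpow.simps)
    qed
    have 2: "br y (eig_shift (br x) d z) \<in> gen_eigenspace (br x) (c + d)"
    proof (cases l)
      case 0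
      then show ?thesis using Suc.prems sub by (simp add: br_simps eig_shift_def)
    next
      case (Suc l')
      then show ?thesis
        using Suc.prems Suc.IH[of k y l' "eig_shift (br x) d z"]
        by (simp add: funpow_Suc_right del: funpow.simps)
    qed
    have "eig_shift (br x) (c + d) (br y z) = br (eig_shift (br x) c y) z + br y (eig_shift (br x) d z)"
      using br_derivation[of x y z] by (simp add: eig_shift_def br_simps algebra_simps)
    then have "eig_shift (br x) (c + d) (br y z) \<in> gen_eigenspace (br x) (c + d)"
      using 1 2 sub by simp
    then obtain m where "(eig_shift (br x) (c + d) ^^ m) (eig_shift (br x) (c + d) (br y z)) = 0"
      by (auto simp: gen_eigenspace_def)
    then have "(eig_shift (br x) (c + d) ^^ Suc m) (br y z) = 0"
      by (simp add: funpow_Suc_right del: funpow.simps)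
    then show ?case unfolding gen_eigenspace_def by blast
  qed
  then show ?thesis using assms by (auto simp: gen_eigenspace_def)
qed

text \<open>The semisimple part of \<open>ad x\<close> is a derivation, hence equal to some
  \<open>ad s\<close>. Because \<open>s\<close> commutes with \<open>h\<close>, the span of
  \<open>h\<close> and \<open>s\<close> is still toral, and maximality of \<open>h\<close> puts
  \<open>s\<close> into \<open>h\<close>.\<close>

lemma jordan_decomposition_in_centralizer:
  assumes x: "\<And>t. t \<in> h \<Longrightarrow> br t x = 0"
  obtains s n N where "x = s + n" "s \<in> h" "\<And>z. (br n ^^ N) z = 0"
proof -
  obtain D N where D: "clinear D" "\<And>c v. v \<in> gen_eigenspace (br x) c \<Longrightarrow> D v = c *s v"
    "vec.span {v. \<exists>c. D v = c *s v} = UNIV" and N: "\<And>z. ((\<lambda>z. br x z - D z) ^^ N) z = 0"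
    using semisimple_part_exists[OF linear_right[of x]] by (elim exE conjE) blast
  let ?G = "\<Union>c. gen_eigenspace (br x) c"
  have all: "P z" if "\<And>c z. z \<in> gen_eigenspace (br x) c \<Longrightarrow> P z" "vec.subspace {z. P z}" for P z
  proof -
    have "vec.span ?G \<subseteq> {z. P z}" using that by (intro vec.span_minimal) auto
    then show ?thesis using span_gen_eigenspaces[OF linear_right] by blast
  qed
  have der: "D (br y z) = br (D y) z + br y (D z)" for y z
  proof (rule all[of "\<lambda>y. D (br y z) = br (D y) z + br y (D z)"])
    show "vec.subspace {y. D (br y z) = br (D y) z + br y (D z)}"
      by (rule vec.subspaceI) (auto simp: br_simps vec.linear_add[OF D(1)] vec.linear_scale[OF D(1)]
          vec.linear_0[OF D(1)] algebra_simps)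
    show "D (br y z) = br (D y) z + br y (D z)" if y: "y \<in> gen_eigenspace (br x) c" for c y
    proof (rule all[of "\<lambda>z. D (br y z) = br (D y) z + br y (D z)"])
      show "vec.subspace {z. D (br y z) = br (D y) z + br y (D z)}"
        by (rule vec.subspaceI) (auto simp: br_simps vec.linear_add[OF D(1)] vec.linear_scale[OF D(1)]
            vec.linear_0[OF D(1)] algebra_simps)
      show "D (br y z) = br (D y) z + br y (D z)" if z: "z \<in> gen_eigenspace (br x) d" for d z
        using D(2)[OF br_gen_eigenspaces[OF y z]] D(2)[OF y] D(2)[OF z]
        by (simp add: br_simps algebra_simps)
    qed
  qed
  obtain s where s: "\<And>z. D z = br s z" using derivation_inner[OF D(1) der] by blast
  have tx: "br t (br x z) = br x (br t z)" if "t \<in> h" for t z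
    using br_derivation[of t x z] x[OF that] by (simp add: br_simps)
  \<comment> \<open>\<open>ad t\<close> preserves the generalized eigenspaces of
    \<open>ad x\<close>, and \<open>ad s\<close> is a scalar on each of them.\<close>
  have comm: "br t (br s z) = br s (br t z)" if t: "t \<in> h" for t z
  proof (rule all[of "\<lambda>z. br t (br s z) = br s (br t z)"])
    show "vec.subspace {z. br t (br s z) = br s (br t z)}"
      by (rule vec.subspaceI) (auto simp: br_simps)
    show "br t (br s z) = br s (br t z)" if z: "z \<in> gen_eigenspace (br x) c" for c z
      using D(2)[OF z] D(2)[OF gen_eigenspace_invariant[OF linear_right linear_right tx[OF t] z]] s
      by (simp add: br_simps)
  qed
  have ts: "br t s = 0" if "t \<in> h" for t
  proof (rule center_trivial)
    show "br (br t s) y = 0" for y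
      using br_derivation[of t s y] comm[OF that, of y] by (metis add_cancel_left_left)
  qed
  then have st: "br s t = 0" if "t \<in> h" for t using br_anti[of s t] that by simp
  define k where "k = {t + c *s s | t c. t \<in> h}"
  have "toral_subalgebra br k"
    unfolding toral_subalgebra_def
  proof (intro conjI ballI)
    show "vec.subspace k"
    proof (rule vec.subspaceI)
      show "0 \<in> k" unfolding k_def using vec.subspace_0[OF subspace_h] by (intro CollectI exI[of _ 0]) simp
      show "a + b \<in> k" if ab: "a \<in> k" "b \<in> k" for a b
      proof -
        obtain t c t' c' where "a = t + c *s s" "b = t' + c' *s s" "t \<in> h" "t' \<in> h"
          using ab unfolding k_def by blast
        then have "a + b = (t + t') + (c + c') *s s" "t + t' \<in> h"
          using vec.subspace_add[OF subspace_h] by (auto simp: algebra_simps)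
        then show ?thesis unfolding k_def by blast
      qed
      show "r *s a \<in> k" if a: "a \<in> k" for r a
      proof -
        obtain t c where "a = t + c *s s" "t \<in> h" using a unfolding k_def by blast
        then have "r *s a = r *s t + (r * c) *s s" "r *s t \<in> h"
          using vec.subspace_scale[OF subspace_h] by (auto simp: algebra_simps)
        then show ?thesis unfolding k_def by blast
      qed
    qed
    show "br a b = 0" if "a \<in> k" "b \<in> k" for a b
      using that abelian_h ts st alternating[of s] unfolding k_def by (auto simp: br_simps)
    show "ad_semisimple br a" if a: "a \<in> k" for a
    proof -
      obtain t c where t: "a = t + c *s s" "t \<in> h" using a unfolding k_def by blast
      have "vec.span {v. \<forall>f\<in>{br t, br s}. \<exists>c. f v = c *s v} = UNIV"
      proof (rule simultaneous_eigenvectors_span)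
        show "f (g z) = g (f z)" if "f \<in> {br t, br s}" "g \<in> {br t, br s}" for f g z
          using that comm[OF t(2)] by auto
        show "vec.span {v. \<exists>c. f v = c *s v} = UNIV" if "f \<in> {br t, br s}" for f
          using that D(3) semisimple_h[OF t(2)] s by auto
      qed (use linear_right in auto)
      moreover have "vec.span {v. \<forall>f\<in>{br t, br s}. \<exists>c. f v = c *s v} \<subseteq> vec.span {v. \<exists>c. br a v = c *s v}"
      proof (intro vec.span_mono subsetI)
        fix v assume "v \<in> {v. \<forall>f\<in>{br t, br s}. \<exists>c. f v = c *s v}"
        then have *: "\<forall>f\<in>{br t, br s}. \<exists>c. f v = c *s v" by (rule CollectD)
        have "\<exists>d. br t v = d *s v" by (rule bspec[OF *]) simp
        moreover have "\<exists>e. br s v = e *s v" by (rule bspec[OF *]) simp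
        ultimately obtain d e where "br t v = d *s v" "br s v = e *s v" by blast
        then have "br a v = (d + c * e) *s v" by (simp add: t br_simps vec.scale_left_distrib)
        then show "v \<in> {v. \<exists>c. br a v = c *s v}" by blast
      qed
      ultimately show ?thesis
        unfolding ad_semisimple_def by (simp only: top.extremum_unique)
    qed
  qed
  moreover have "h \<subseteq> k"
  proof
    fix t assume "t \<in> h"
    moreover have "t = t + 0 *s s" by simp
    ultimately show "t \<in> k" unfolding k_def by blast
  qed
  ultimately have "k = h" using cartan unfolding cartan_subalgebra_def by blast
  moreover have "s \<in> k"
  proof -
    have "s = 0 + 1 *s s" by simp
    then show ?thesis unfolding k_def using vec.subspace_0[OF subspace_h] by blast
  qed
  ultimately have "s \<in> h" by simp
  moreover have "(br (x - s) ^^ N) z = 0" for z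
  proof -
    have "br (x - s) = (\<lambda>z. br x z - D z)" using s by (auto simp: br_simps)
    then show ?thesis using N by simp
  qed
  ultimately show ?thesis using that[of s "x - s" N] by simp
qed

lemma killing_form_nilpotent:
  assumes comm: "\<And>z. br y (br n z) = br n (br y z)" and nil: "\<And>z. (br n ^^ N) z = 0"
  shows "K y n = 0"
  unfolding killing_form_def
proof (rule trace_nilpotent[where N = N])
  show "clinear (\<lambda>z. br y (br n z))" by (rule clinear_comp[OF linear_right linear_right])
  have "((\<lambda>z. br y (br n z)) ^^ k) z = (br y ^^ k) ((br n ^^ k) z)" for k z
  proof (induction k)
    case (Suc k)
    have "br n ((br y ^^ k) w) = (br y ^^ k) (br n w)" for w
      using compow_commute[of "br n" "br y" k w] comm by simp
    then show ?case by (simp add: Suc)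
  qed simp
  then show "((\<lambda>z. br y (br n z)) ^^ N) z = 0" for z
    using nil vec.linear_0[OF clinear_compow[OF linear_right]] by simp
qed

text \<open>Write \<open>L\<close> for the centralizer of \<open>h\<close>. The nilpotent parts of elements of \<open>L\<close> lie in the
  orthogonal complement \<open>M\<close> of \<open>h\<close> in \<open>L\<close>, and conversely all elements of \<open>M\<close> are nilpotent. So the
  Killing form vanishes on \<open>M\<close>, hence \<open>M\<close> is orthogonal to \<open>L\<close> and \<open>M = 0\<close>.\<close>

lemma centralizer_h:
  assumes x: "\<And>t. t \<in> h \<Longrightarrow> br t x = 0"
  shows "x \<in> h"
proof -
  define L where "L = {x. \<forall>t\<in>h. br t x = 0}"
  define M where "M = {x\<in>L. \<forall>t\<in>h. K t x = 0}"
  have hL: "h \<subseteq> L" using abelian_h by (auto simp: L_def)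
  have Lsub: "vec.subspace L" by (rule vec.subspaceI) (auto simp: L_def br_simps)
  have commL: "br t (br y z) = br y (br t z)" if "t \<in> h" "y \<in> L" for t y z
    using br_derivation[of t y z] that by (simp add: L_def br_simps)
  have dec: "\<exists>s n. y = s + n \<and> s \<in> h \<and> n \<in> M \<and> (\<exists>N. \<forall>z. (br n ^^ N) z = 0)" if y: "y \<in> L" for y
  proof -
    obtain s n N where s: "y = s + n" "s \<in> h" "\<And>z. (br n ^^ N) z = 0"
      using jordan_decomposition_in_centralizer[of y] y by (auto simp: L_def)
    have n: "n \<in> L" using y s hL vec.subspace_diff[OF Lsub, of y s] by auto
    have "K t n = 0" if "t \<in> h" for t
      by (rule killing_form_nilpotent[OF commL[OF that n] s(3)])
    then show ?thesis using s n by (auto simp: M_def)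
  qed
  \<comment> \<open>\<open>L\<close> is the zero weight space, which is orthogonal to all other
    weight spaces, so nondegeneracy passes to \<open>L\<close>.\<close>
  have nondeg: "y = 0" if y: "y \<in> L" "\<And>z. z \<in> L \<Longrightarrow> K y z = 0" for y
  proof (rule killing_form_nondegenerate)
    show "K y z = 0" for z
    proof (rule in_W_span_cases)
      show "vec.subspace {z. K y z = 0}"
        by (rule vec.subspaceI) (auto simp: killing_form_simps killing_form_simps')
      show "K y z = 0" if z: "z \<in> W \<nu>" for \<nu> z
      proof (cases "\<forall>t\<in>h. \<nu> t = 0")
        case True
        then have "z \<in> L" using WD[OF z] by (simp add: L_def)
        then show ?thesis using y by blast
      next
        case False
        then obtain t where t: "t \<in> h" "\<nu> t \<noteq> 0" by blast
        have "y \<in> W (\<lambda>t. 0)" using y(1) by (simp add: root_space_def L_def)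
        then show ?thesis using killing_form_W[of y "\<lambda>t. 0" z \<nu> t] z t by simp
      qed
    qed
  qed
  have nondeg_h: "s = 0" if s: "s \<in> h" "\<And>t. t \<in> h \<Longrightarrow> K t s = 0" for s
  proof (rule nondeg)
    show "s \<in> L" using s hL by blast
    fix z assume "z \<in> L"
    then obtain t n where "z = t + n" "t \<in> h" "n \<in> M" using dec by blast
    then show "K s z = 0"
      using s killing_form_sym[of s t] by (simp add: killing_form_simps M_def)
  qed
  have M0: "K m m = 0" if m: "m \<in> M" for m
  proof -
    obtain s n N where s: "m = s + n" "s \<in> h" "n \<in> M" "\<And>z. (br n ^^ N) z = 0"
      using dec m by (metis (mono_tags, lifting) M_def mem_Collect_eq)
    have "K t s = 0" if "t \<in> h" for t
      using m s that by (simp add: M_def killing_form_simps)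
    then have "s = 0" using nondeg_h s by blast
    then show ?thesis using s by (intro killing_form_nilpotent[where N = N]) auto
  qed
  have Msub: "a + b \<in> M" if "a \<in> M" "b \<in> M" for a b
    using that vec.subspace_add[OF Lsub] by (auto simp: M_def killing_form_simps)
  have MM: "K a b = 0" if "a \<in> M" "b \<in> M" for a b
  proof -
    have "K (a + b) (a + b) = 0" using that Msub M0 by blast
    then have "2 * K a b = 0"
      using M0 that killing_form_sym[of b a] by (simp add: killing_form_simps)
    then show ?thesis by simp
  qed
  have M: "m = 0" if m: "m \<in> M" for m
  proof (rule nondeg)
    show "m \<in> L" using m by (simp add: M_def)
    fix z assume "z \<in> L"
    then obtain t n where z: "z = t + n" "t \<in> h" "n \<in> M" using dec by blast
    have "K t m = 0" using m z(2) by (simp add: M_def)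
    then show "K m z = 0"
      using MM[OF m z(3)] killing_form_sym[of m t] by (simp add: z(1) killing_form_simps)
  qed
  have "x \<in> L" using x by (simp add: L_def)
  then show ?thesis using dec M by fastforce
qed

end

subsection \<open>Roots as elements of the Cartan subalgebra\<close>

context based_simple_lie_algebra
begin

text \<open>Weights are replaced by their dual vectors in \<open>h\<close>: these can be added,
  scaled and compared as ordinary vectors.\<close>

definition R :: "complex^'n \<Rightarrow> (complex^'n) set"
  where "R x = W (K x)"

text \<open>The set of the vectors dual to the roots with respect to the Killing form.\<close>

definition \<Phi> :: "(complex^'n) set"
  where "\<Phi> = {x\<in>h. x \<noteq> 0 \<and> (\<exists>v\<in>R x. v \<noteq> 0)}"

lemma \<Phi>D: "x \<in> \<Phi> \<Longrightarrow> x \<in> h" "x \<in> \<Phi> \<Longrightarrow> x \<noteq> 0"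
  by (auto simp: \<Phi>_def)

lemma subspace_R: "vec.subspace (R x)"
  unfolding R_def by (rule subspace_W)

lemma RD: "v \<in> R x \<Longrightarrow> t \<in> h \<Longrightarrow> br t v = K x t *s v"
  unfolding R_def by (rule WD)

lemma R_zero: "R 0 = h"
proof
  show "R 0 \<subseteq> h"
  proof
    fix v assume v: "v \<in> R 0"
    show "v \<in> h"
      by (rule centralizer_h) (use RD[OF v] in \<open>simp add: killing_form_simps'\<close>)
  qed
  show "h \<subseteq> R 0"
    unfolding R_def by (intro subsetI WI) (simp add: abelian_h killing_form_simps')
qed

lemma br_R:
  assumes "u \<in> R x" "v \<in> R y"
  shows "br u v \<in> R (x + y)"
  using br_W[OF assms[unfolded R_def]] W_cong[of "\<lambda>t. K x t + K y t" "K (x + y)"]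
  by (simp add: R_def killing_form_simps)

lemma killing_form_h_nondegenerate:
  assumes s: "s \<in> h" "\<And>t. t \<in> h \<Longrightarrow> K s t = 0"
  shows "s = 0"
proof (rule killing_form_nondegenerate)
  show "K s z = 0" for z
  proof (rule in_W_span_cases)
    show "vec.subspace {z. K s z = 0}"
      by (rule vec.subspaceI) (auto simp: killing_form_simps killing_form_simps')
    show "K s z = 0" if z: "z \<in> W \<nu>" for \<nu> z
    proof (cases "\<forall>t\<in>h. \<nu> t = 0")
      case True
      then have "z \<in> h" using WD[OF z] by (intro centralizer_h) simp
      then show ?thesis using s by blast
    next
      case False
      then obtain t where t: "t \<in> h" "\<nu> t \<noteq> 0" by blast
      have "s \<in> W (\<lambda>t. 0)" using s(1) abelian_h by (simp add: root_space_def)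
      then show ?thesis using killing_form_W[of s "\<lambda>t. 0" z \<nu> t] z t by simp
    qed
  qed
qed

lemma h_eqI:
  assumes "x \<in> h" "y \<in> h" "\<And>t. t \<in> h \<Longrightarrow> K x t = K y t"
  shows "x = y"
proof -
  have "x - y = 0"
    using assms vec.subspace_diff[OF subspace_h]
    by (intro killing_form_h_nondegenerate) (auto simp: killing_form_simps')
  then show ?thesis by simp
qed

lemma R_unique:
  assumes "v \<in> R x" "v \<in> R y" "v \<noteq> 0" "x \<in> h" "y \<in> h"
  shows "x = y"
  using assms W_weight_eq[of v "K x" "K y"] by (intro h_eqI) (auto simp: R_def)

lemma killing_form_R:
  assumes "u \<in> R x" "v \<in> R y" "x \<in> h" "y \<in> h" "x + y \<noteq> 0"
  shows "K u v = 0"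
proof -
  have "x + y \<in> h" using assms vec.subspace_add[OF subspace_h] by blast
  then obtain t where "t \<in> h" "K (x + y) t \<noteq> 0"
    using killing_form_h_nondegenerate assms(5) by blast
  then show ?thesis
    using killing_form_W[of u "K x" v "K y" t] assms by (simp add: R_def killing_form_simps)
qed

lemma br_opposite_W:
  assumes u: "u \<in> W \<mu>" and v: "v \<in> W \<nu>" and 0: "\<And>t. t \<in> h \<Longrightarrow> \<mu> t + \<nu> t = 0"
  shows "br u v \<in> h" "t \<in> h \<Longrightarrow> K (br u v) t = \<mu> t * K u v"
proof -
  have "br u v \<in> W (\<lambda>t. 0)"
    using br_W[OF u v] W_cong[of "\<lambda>t. \<mu> t + \<nu> t" "\<lambda>t. 0"] 0 by simp
  then show "br u v \<in> h" using WD by (intro centralizer_h) simp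
  assume t: "t \<in> h"
  have "\<nu> t = - \<mu> t" using 0[OF t] by (simp add: add_eq_0_iff)
  then have "br v t = \<mu> t *s v" using WD[OF v t] br_anti[of v t] by simp
  then show "K (br u v) t = \<mu> t * K u v"
    by (simp add: killing_form_invariant killing_form_simps)
qed

lemma dual_weight_vector_exists:
  assumes v: "v \<in> W \<mu>" "v \<noteq> 0"
  shows "\<exists>\<nu> w. w \<in> W \<nu> \<and> (\<forall>t\<in>h. \<mu> t + \<nu> t = 0) \<and> K v w = 1"
proof -
  have "\<exists>\<nu> w. w \<in> W \<nu> \<and> K v w \<noteq> 0"
  proof (rule ccontr)
    assume *: "\<not> ?thesis"
    have "K v y = 0" for y
    proof (rule in_W_span_cases)
      show "vec.subspace {y. K v y = 0}"
        by (rule vec.subspaceI) (auto simp: killing_form_simps killing_form_simps')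
    qed (use * in blast)
    then show False using killing_form_nondegenerate v(2) by blast
  qed
  then obtain \<nu> w where w: "w \<in> W \<nu>" "K v w \<noteq> 0" by blast
  then have "\<forall>t\<in>h. \<mu> t + \<nu> t = 0" using killing_form_W[OF v(1) w(1)] by blast
  moreover have "(1 / K v w) *s w \<in> W \<nu>" using w(1) vec.subspace_scale[OF subspace_W] by blast
  moreover have "K v ((1 / K v w) *s w) = 1" using w(2) by (simp add: killing_form_simps)
  ultimately show ?thesis by blast
qed

text \<open>The dual element is explicit: \<open>br v w\<close>, with \<open>w\<close> of the
  opposite weight and \<open>K v w = 1\<close>, pairs with \<open>h\<close> exactly as
  \<open>\<mu>\<close> does, by invariance of the form.\<close>

lemma dual_element_exists:
  assumes v: "v \<in> W \<mu>" "v \<noteq> 0"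
  obtains x where "x \<in> h" "\<And>t. t \<in> h \<Longrightarrow> \<mu> t = K x t"
proof -
  obtain \<nu> w where w: "w \<in> W \<nu>" "\<forall>t\<in>h. \<mu> t + \<nu> t = 0" "K v w = 1"
    using dual_weight_vector_exists[OF v] by blast
  then show ?thesis
    using that[of "br v w"] br_opposite_W[OF v(1) w(1)] by simp
qed

lemma weight_vector_in_R:
  assumes v: "v \<in> W \<mu>" "v \<noteq> 0"
  obtains x where "x \<in> h" "v \<in> R x" "\<And>t. t \<in> h \<Longrightarrow> \<mu> t = K x t"
proof -
  obtain x where x: "x \<in> h" "\<And>t. t \<in> h \<Longrightarrow> \<mu> t = K x t" using dual_element_exists[OF v] by blast
  moreover have "v \<in> R x" using v x W_cong unfolding R_def by metis
  ultimately show ?thesis using that by blast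
qed

lemma opposite_root_vector_exists:
  assumes "u \<in> R x" "u \<noteq> 0"
  obtains w where "w \<in> R (- x)" "K u w = 1"
proof -
  obtain \<nu> w where w: "w \<in> W \<nu>" "\<forall>t\<in>h. K x t + \<nu> t = 0" "K u w = 1"
    using dual_weight_vector_exists[of u "K x"] assms by (auto simp: R_def)
  have "W \<nu> = W (K (- x))"
  proof (rule W_cong)
    fix t assume "t \<in> h"
    then have "K x t + \<nu> t = 0" using w(2) by blast
    then have "\<nu> t = - K x t" by (simp add: add_eq_0_iff)
    then show "\<nu> t = K (- x) t" by (simp add: killing_form_simps')
  qed
  then show ?thesis using that w by (simp add: R_def)
qed

lemma br_opposite:
  assumes "u \<in> R x" "w \<in> R (- x)" "x \<in> h"
  shows "br u w = K u w *s x"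
proof (rule h_eqI)
  have *: "K x t + K (- x) t = 0" for t by (simp add: killing_form_simps')
  show "br u w \<in> h" using br_opposite_W[of u "K x" w "K (- x)"] assms * by (simp add: R_def)
  show "K u w *s x \<in> h" using assms(3) vec.subspace_scale[OF subspace_h] by blast
  show "K (br u w) t = K (K u w *s x) t" if "t \<in> h" for t
    using br_opposite_W(2)[of u "K x" w "K (- x)" t] assms * that by (simp add: R_def killing_form_simps)
qed

lemma neg_\<Phi>: "x \<in> \<Phi> \<Longrightarrow> - x \<in> \<Phi>"
proof -
  assume x: "x \<in> \<Phi>"
  then obtain u where u: "u \<in> R x" "u \<noteq> 0" by (auto simp: \<Phi>_def)
  obtain w where "w \<in> R (- x)" "K u w = 1" using opposite_root_vector_exists[OF u] .
  moreover from this have "w \<noteq> 0" by (auto simp: killing_form_simps')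
  ultimately show ?thesis using x vec.subspace_neg[OF subspace_h] by (auto simp: \<Phi>_def)
qed

lemma root_basis_extend:
  assumes "vec.independent S" "\<And>s. s \<in> S \<Longrightarrow> \<exists>x\<in>h. s \<in> R x"
  obtains B wt where "S \<subseteq> B" "vec.independent B" "vec.span B = UNIV"
    "\<And>b. b \<in> B \<Longrightarrow> wt b \<in> h \<and> b \<in> R (wt b) \<and> b \<noteq> 0 \<and> (wt b = 0 \<or> wt b \<in> \<Phi>)"
proof -
  have "S \<subseteq> (\<Union>\<mu>. W \<mu>)" using assms(2) by (auto simp: R_def)
  then obtain B where B: "S \<subseteq> B" "B \<subseteq> (\<Union>\<mu>. W \<mu>)" "vec.independent B" "vec.span B = UNIV"
    using weight_basis_extend[OF assms(1)] by blast
  have "\<forall>b\<in>B. \<exists>x. x \<in> h \<and> b \<in> R x \<and> b \<noteq> 0"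
  proof
    fix b assume b: "b \<in> B"
    have "b \<noteq> 0" using b B(3) vec.dependent_zero by blast
    moreover obtain \<mu> where "b \<in> W \<mu>" using B(2) b by blast
    ultimately show "\<exists>x. x \<in> h \<and> b \<in> R x \<and> b \<noteq> 0" using weight_vector_in_R by metis
  qed
  then obtain wt where "\<And>b. b \<in> B \<Longrightarrow> wt b \<in> h \<and> b \<in> R (wt b) \<and> b \<noteq> 0" by metis
  then show ?thesis using that[of B wt] B by (auto simp: \<Phi>_def)
qed

lemma in_span_root_basis:
  assumes B: "vec.independent B" "vec.span B = UNIV" "\<And>b. b \<in> B \<Longrightarrow> b \<in> R (wt b)" and v: "v \<in> R x"
  shows "v \<in> vec.span (B \<inter> R x)"
  unfolding R_def
proof (rule in_span_weight_basis[OF _ B(1)])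
  show "B \<subseteq> (\<Union>\<mu>. W \<mu>)" using B(3) by (auto simp: R_def)
qed (use B(2) v in \<open>auto simp: R_def\<close>)

text \<open>The trace of \<open>ad x = [ad u, ad w]\<close> on an invariant subspace vanishes.\<close>

lemma invariant_trace_zero:
  assumes A: "finite A" "inj_on v A" "vec.independent (v ` A)" "\<And>i. i \<in> A \<Longrightarrow> v i \<in> R (wt i)"
    and u: "\<And>i. i \<in> A \<Longrightarrow> br u (v i) \<in> vec.span (v ` A)"
    and w: "\<And>i. i \<in> A \<Longrightarrow> br w (v i) \<in> vec.span (v ` A)"
    and x: "br u w = x" "x \<in> h"
  shows "(\<Sum>i\<in>A. K (wt i) x) = 0"
proof -
  let ?S = "v ` A"
  have inv: "br u z \<in> vec.span ?S" "br w z \<in> vec.span ?S" if "z \<in> vec.span ?S" for z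
    using clinear_span_subset[OF linear_right _ that, of u ?S]
      clinear_span_subset[OF linear_right _ that, of w ?S] u w by auto
  have "(\<Sum>i\<in>A. K (wt i) x) = (\<Sum>b\<in>?S. K (wt (inv_into A v b)) x)"
    using A(2) by (simp add: sum.reindex)
  also have "\<dots> = trace_on ?S (br x)"
  proof (rule trace_on_diagonal[symmetric, OF A(3)])
    show "br x b = K (wt (inv_into A v b)) x *s b" if "b \<in> ?S" for b
      using that A(2,4) x(2) RD by auto
  qed
  also have "\<dots> = trace_on ?S (\<lambda>z. br u (br w z) - br w (br u z))"
    using br_derivation[of u w] x(1) by (intro arg_cong[of _ _ "trace_on ?S"]) auto
  also have "\<dots> = trace_on ?S (\<lambda>z. br u (br w z)) - trace_on ?S (\<lambda>z. br w (br u z))"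
    using inv u w by (intro trace_on_diff A(3)) auto
  also have "\<dots> = 0"
    using trace_on_commute[OF A(3) linear_right linear_right, of u w] u w by auto
  finally show ?thesis .
qed

text \<open>If \<open>K x x = 0\<close>, all weights in a string \<open>wt c + k x\<close> take the
  same value on \<open>x\<close>. The trace of \<open>ad x\<close> on the string is zero, so this
  value is zero for every weight and \<open>x\<close> would be central.\<close>

lemma root_norm_nonzero:
  assumes x: "x \<in> \<Phi>"
  shows "K x x \<noteq> 0"
proof
  assume 0: "K x x = 0"
  obtain u where u: "u \<in> R x" "u \<noteq> 0" using x by (auto simp: \<Phi>_def)
  obtain w where w: "w \<in> R (- x)" "K u w = 1" using opposite_root_vector_exists[OF u] .
  have xh: "x \<in> h" and uw: "br u w = x" using x br_opposite[OF u(1) w(1)] w(2) by (auto simp: \<Phi>_def)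
  obtain B wt where B: "vec.independent B" "vec.span B = UNIV"
    "\<And>b. b \<in> B \<Longrightarrow> wt b \<in> h \<and> b \<in> R (wt b) \<and> b \<noteq> 0 \<and> (wt b = 0 \<or> wt b \<in> \<Phi>)"
    using root_basis_extend[of "{}"] vec.independent_empty by auto
  have fin: "finite B" using B(1) by (rule vec.finiteI_independent)
  have "K (wt c) x = 0" if c: "c \<in> B" for c
  proof -
    define S where "S = {b\<in>B. \<exists>k::int. wt b = wt c + of_int k *s x}"
    have S: "S \<subseteq> B" "finite S" "c \<in> S"
      using fin c by (auto simp: S_def intro!: exI[of _ 0])
    have move: "br z b \<in> vec.span S" if b: "b \<in> S" and z: "z \<in> R (of_int d *s x)" for z b d
    proof -
      obtain k :: int where k: "wt b = wt c + of_int k *s x" using b by (auto simp: S_def)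
      let ?y = "wt c + of_int (k + d) *s x"
      have yh: "?y \<in> h"
        using xh B(3) c vec.subspace_add[OF subspace_h] vec.subspace_scale[OF subspace_h] by blast
      have "b \<in> R (wt b)" using B(3) b S(1) by blast
      then have "br z b \<in> R (of_int d *s x + wt b)" by (rule br_R[OF z])
      moreover have "of_int d *s x + wt b = ?y" by (simp add: k vec.scale_left_distrib)
      ultimately have "br z b \<in> vec.span (B \<inter> R ?y)"
        using in_span_root_basis[OF B(1,2), of wt] B(3) by simp
      moreover have "B \<inter> R ?y \<subseteq> S"
      proof
        fix b' assume b': "b' \<in> B \<inter> R ?y"
        then have "wt b' = ?y" using R_unique[of b' "wt b'" ?y] B(3) yh by blast
        then show "b' \<in> S" using b' unfolding S_def by blast
      qed
      ultimately show ?thesis using vec.span_mono by blast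
    qed
    have "(\<Sum>b\<in>S. K (wt b) x) = 0"
    proof (rule invariant_trace_zero[where v = "\<lambda>b. b" and u = u and w = w])
      show "vec.independent ((\<lambda>b. b) ` S)" using S(1) B(1) vec.independent_mono by simp
      show "br u b \<in> vec.span ((\<lambda>b. b) ` S)" "br w b \<in> vec.span ((\<lambda>b. b) ` S)" if "b \<in> S" for b
        using move[OF that, of u 1] move[OF that, of w "-1"] u w by simp_all
    qed (use S B(3) uw xh in auto)
    moreover have "K (wt b) x = K (wt c) x" if "b \<in> S" for b
      using that 0 by (auto simp: S_def killing_form_simps)
    ultimately have "of_nat (card S) * K (wt c) x = 0" by simp
    then show ?thesis using S by auto
  qed
  then have z: "br x b = 0" if "b \<in> B" for b
    using RD[of b "wt b" x] B(3)[OF that] xh that by simp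
  have "br x y = 0" for y
    using vec.linear_eq_0_on_span[OF linear_right z, of B y] B(2) by blast
  then have "x = 0" by (rule center_trivial)
  then show False using x \<Phi>D(2) by blast
qed

text \<open>The trace argument is applied to the span of \<open>u\<close>, \<open>x\<close> and all
  spaces \<open>R (- k x)\<close> with \<open>k \<ge> 1\<close>, which \<open>u\<close> and
  \<open>w\<close> preserve. It says that the dimensions weighted by \<open>k\<close> add up to 1,
  so \<open>R (- x)\<close> is a line and the other spaces are zero.\<close>

lemma negative_root_space:
  assumes x: "x \<in> \<Phi>"
  shows "\<exists>e. R (- x) \<subseteq> vec.span {e}" "2 \<le> k \<Longrightarrow> R (of_nat k *s (- x)) = {0}"
proof -
  obtain u where u: "u \<in> R x" "u \<noteq> 0" using x by (auto simp: \<Phi>_def)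
  obtain w where w: "w \<in> R (- x)" "K u w = 1" using opposite_root_vector_exists[OF u] .
  have xh: "x \<in> h" and x0: "x \<noteq> 0" using x by (auto simp: \<Phi>_def)
  have uw: "br u w = x" using br_opposite[OF u(1) w(1) xh] w(2) by simp
  have kh: "c *s x \<in> h" for c using xh vec.subspace_scale[OF subspace_h] by blast
  have h0: "0 \<in> h" using vec.subspace_0[OF subspace_h] .
  have nux: "u \<notin> vec.span {x}"
  proof
    assume "u \<in> vec.span {x}"
    then have "u \<in> R 0" using kh by (auto simp: vec.span_singleton R_zero)
    then have "x = 0" using R_unique[of u x 0] u xh h0 by blast
    then show False using x0 by blast
  qed
  then have ind: "vec.independent {u, x}" using x0 by (simp add: vec.independent_insert)
  obtain B wt where B: "{u, x} \<subseteq> B" "vec.independent B" "vec.span B = UNIV"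
    "\<And>b. b \<in> B \<Longrightarrow> wt b \<in> h \<and> b \<in> R (wt b) \<and> b \<noteq> 0 \<and> (wt b = 0 \<or> wt b \<in> \<Phi>)"
  proof (rule root_basis_extend[OF ind])
    show "\<exists>y\<in>h. s \<in> R y" if "s \<in> {u, x}" for s
      using that u xh h0 R_zero by auto
  qed blast
  have fin: "finite B" using B(2) by (rule vec.finiteI_independent)
  have wtu: "wt b = y" if "b \<in> B" "b \<in> R y" "y \<in> h" for b y
    using R_unique[of b "wt b" y] B(4) that by blast
  define S' where "S' = {b\<in>B. \<exists>k\<ge>1. wt b = of_nat k *s (- x)}"
  have "\<forall>b\<in>S'. \<exists>k\<ge>1. wt b = of_nat k *s (- x)" by (simp add: S'_def)
  then obtain m :: "_ \<Rightarrow> nat" where m: "\<And>b. b \<in> S' \<Longrightarrow> m b \<ge> 1 \<and> wt b = of_nat (m b) *s (- x)" by metis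
  have inR: "R (of_nat k *s (- x)) \<subseteq> vec.span S'" if "k \<ge> 1" for k
  proof
    fix v assume "v \<in> R (of_nat k *s (- x))"
    then have "v \<in> vec.span (B \<inter> R (of_nat k *s (- x)))"
      using in_span_root_basis[OF B(2,3), of wt] B(4) by blast
    moreover have "B \<inter> R (of_nat k *s (- x)) \<subseteq> S'"
      using wtu[of _ "of_nat k *s (- x)"] kh[of "- of_nat k"] that by (auto simp: S'_def)
    ultimately show "v \<in> vec.span S'" using vec.span_mono by blast
  qed
  define S where "S = insert u (insert x S')"
  have S: "S \<subseteq> B" using B(1) by (auto simp: S_def S'_def)
  have wt_ux: "wt u = x" "wt x = 0"
    using wtu[of u x] wtu[of x 0] B(1) u(1) xh h0 R_zero by auto
  have ne: "u \<noteq> x" "u \<notin> S'" "x \<notin> S'"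
  proof -
    show "u \<noteq> x" using wt_ux x0 by auto
    have neg: "c *s x \<noteq> of_nat k *s (- x)" if "c \<noteq> - of_nat k" for c :: complex and k
    proof
      assume "c *s x = of_nat k *s (- x)"
      then have "c *s x = (- of_nat k) *s x" by simp
      then have "c = - of_nat k" using x0 vec.scale_right_imp_eq by blast
      then show False using that by contradiction
    qed
    have "1 \<noteq> - (of_nat k :: complex)" for k
    proof
      assume "1 = - (of_nat k :: complex)"
      then have "Re 1 = Re (- of_nat k)" by (simp only:)
      then show False by simp
    qed
    then show "u \<notin> S'" using neg[of 1] wt_ux by (auto simp: S'_def)
    show "x \<notin> S'" using neg[of 0] wt_ux x0 by (auto simp: S'_def)
  qed
  have S'S: "vec.span S' \<subseteq> vec.span S" unfolding S_def by (intro vec.span_mono) auto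
  have bases: "u \<in> vec.span S" "x \<in> vec.span S" by (auto simp: S_def intro: vec.span_base)
  have Rm: "b \<in> R (of_nat (m b) *s (- x))" if "b \<in> S'" for b
  proof -
    have "b \<in> R (wt b)" using B(4) that by (simp add: S'_def)
    then show ?thesis using m[OF that] by simp
  qed
  have "(\<Sum>b\<in>S. K (wt b) x) = 0"
  proof (rule invariant_trace_zero[where v = "\<lambda>b. b" and u = u and w = w])
    show "vec.independent ((\<lambda>b. b) ` S)" using S B(2) vec.independent_mono by simp
    show "br u b \<in> vec.span ((\<lambda>b. b) ` S)" if bS: "b \<in> S" for b
    proof -
      consider "b = u" | "b = x" | "b \<in> S'" using bS unfolding S_def by blast
      then show ?thesis
      proof cases
        case 1
        then show ?thesis by (simp add: alternating vec.span_zero)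
      next
        case 2
        have "br u x = (- K x x) *s u" using RD[OF u(1) xh] br_anti[of u x] by simp
        then show ?thesis using 2 vec.span_neg[OF vec.span_scale[OF bases(1)]] by simp
      next
        case 3
        show ?thesis
        proof (cases "m b = 1")
          case True
          then have "b \<in> R (- x)" using Rm[OF 3] by simp
          then have "br u b = K u b *s x" using br_opposite[OF u(1) _ xh] by simp
          then show ?thesis using bases vec.span_scale by simp
        next
          case False
          then have mb: "m b - 1 \<ge> 1" using m[OF 3] by linarith
          have "br u b \<in> R (x + of_nat (m b) *s (- x))" using br_R[OF u(1) Rm[OF 3]] .
          moreover have "x + of_nat (m b) *s (- x) = of_nat (m b - 1) *s (- x)"
            using m[OF 3] by (simp add: of_nat_diff vec.scale_left_diff_distrib)
          ultimately show ?thesis using inR[OF mb] S'S by auto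
        qed
      qed
    qed
    show "br w b \<in> vec.span ((\<lambda>b. b) ` S)" if bS: "b \<in> S" for b
    proof -
      consider "b = u" | "b = x" | "b \<in> S'" using bS unfolding S_def by blast
      then show ?thesis
      proof cases
        case 1
        then show ?thesis using uw br_anti[of w u] bases vec.span_neg by simp
      next
        case 2
        have "br w x \<in> R (- x + 0)" using br_R[OF w(1)] xh R_zero by blast
        then show ?thesis using 2 inR[of 1] S'S by auto
      next
        case 3
        have "br w b \<in> R (- x + of_nat (m b) *s (- x))" using br_R[OF w(1) Rm[OF 3]] .
        moreover have "- x + of_nat (m b) *s (- x) = of_nat (m b + 1) *s (- x)"
          by (simp add: vec.scale_left_distrib algebra_simps)
        ultimately show ?thesis using inR[of "m b + 1"] S'S by auto
      qed
    qed
  qed (use S B(4) uw xh finite_subset[OF S fin] in auto)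
  \<comment> \<open>The vector \<open>u\<close> contributes \<open>K x x\<close>, the vector
    \<open>x\<close> contributes 0, and each basis vector of weight \<open>- m x\<close> contributes
    \<open>- m K x x\<close>.\<close>
  moreover have "(\<Sum>b\<in>S. K (wt b) x) = K x x * (1 - of_nat (\<Sum>b\<in>S'. m b))"
  proof -
    have fS': "finite S'" using fin by (simp add: S'_def)
    have "(\<Sum>b\<in>S'. K (wt b) x) = (\<Sum>b\<in>S'. - (K x x * of_nat (m b)))"
      using m by (intro sum.cong) (auto simp: killing_form_simps killing_form_simps')
    also have "\<dots> = - (K x x * of_nat (\<Sum>b\<in>S'. m b))" by (simp add: sum_negf sum_distrib_left)
    finally show ?thesis
      unfolding S_def using fS' ne wt_ux by (simp add: killing_form_simps' algebra_simps)
  qed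
  ultimately have "1 - (of_nat (\<Sum>b\<in>S'. m b) :: complex) = 0"
    using root_norm_nonzero[OF x] by (metis mult_eq_0_iff)
  then have "of_nat (\<Sum>b\<in>S'. m b) = (of_nat 1 :: complex)" by simp
  then have sum1: "(\<Sum>b\<in>S'. m b) = 1" by (simp only: of_nat_eq_iff)
  have fS': "finite S'" using fin by (simp add: S'_def)
  have w0: "w \<noteq> 0" using w(2) by (auto simp: killing_form_simps')
  obtain e where e: "e \<in> B" "e \<in> R (- x)"
  proof -
    have "w \<in> vec.span (B \<inter> R (- x))"
      using in_span_root_basis[OF B(2,3), of wt w "- x"] B(4) w(1) by blast
    then have "B \<inter> R (- x) \<noteq> {}" using w0 by (metis vec.span_empty singletonD)
    then show ?thesis using that by blast
  qed
  have eS: "e \<in> S'" using wtu[OF e] kh[of "-1"] e(1) by (auto simp: S'_def intro!: exI[of _ 1])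
  have "(\<Sum>b\<in>S'. m b) = m e + (\<Sum>b\<in>S' - {e}. m b)" using fS' eS by (rule sum.remove)
  then have me: "m e = 1" "(\<Sum>b\<in>S' - {e}. m b) = 0" using sum1 m[OF eS] by auto
  then have "\<forall>b\<in>S' - {e}. m b = 0" using fS' by simp
  then have "b = e" if "b \<in> S'" for b using m[OF that] that by force
  then have S'e: "S' = {e}" using eS by blast
  show "\<exists>e. R (- x) \<subseteq> vec.span {e}" using inR[of 1] S'e by auto
  show "R (of_nat k *s (- x)) = {0}" if k: "2 \<le> k"
  proof -
    have "B \<inter> R (of_nat k *s (- x)) = {}"
    proof (rule ccontr)
      assume "B \<inter> R (of_nat k *s (- x)) \<noteq> {}"
      then obtain b where b: "b \<in> B" "b \<in> R (of_nat k *s (- x))" by blast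
      then have wb: "wt b = of_nat k *s (- x)" using wtu kh[of "- of_nat k"] by simp
      then have "b \<in> S'" using b(1) k by (auto simp: S'_def intro!: exI[of _ k])
      then have "b = e" using S'e by blast
      then have "of_nat k *s (- x) = of_nat (m e) *s (- x)" using wb m[OF eS] by metis
      then have "m e = k" using x0 by auto
      then show False using me k by simp
    qed
    then have "R (of_nat k *s (- x)) \<subseteq> {0}"
      using in_span_root_basis[OF B(2,3), of wt _ "of_nat k *s (- x)"] B(4) by fastforce
    then show ?thesis using vec.subspace_0[OF subspace_R] by blast
  qed
qed

lemma root_space_1dim:
  assumes "x \<in> \<Phi>" "u \<in> R x" "u \<noteq> 0" "v \<in> R x"
  obtains c where "v = c *s u"
proof -
  obtain e where e: "R x \<subseteq> vec.span {e}" using negative_root_space(1)[OF neg_\<Phi>[OF assms(1)]] by auto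
  have "u \<in> range (\<lambda>k. k *s e)" "v \<in> range (\<lambda>k. k *s e)"
    using e assms by (auto simp: vec.span_singleton)
  then obtain a b where "u = a *s e" "v = b *s e" by blast
  then have "v = (b / a) *s u" using assms(3) by auto
  then show ?thesis using that by blast
qed

lemma multiple_not_root:
  assumes "x \<in> \<Phi>" "2 \<le> k"
  shows "of_nat k *s x \<notin> \<Phi>"
  using negative_root_space(2)[OF neg_\<Phi>[OF assms(1)] assms(2)] by (auto simp: \<Phi>_def)

end

subsection \<open>Root strings\<close>

lemma sum_int_interval: "2 * (\<Sum>k\<in>{- int r..int q}. k) = (int q - int r) * (int q + int r + 1)"
proof (induction q)
  case 0
  show ?case
  proof (induction r)
    case (Suc r)
    have "{- int (Suc r)..int 0} = insert (- int (Suc r)) {- int r..int 0}" by auto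
    then show ?case using Suc by (simp add: algebra_simps)
  qed simp
next
  case (Suc q)
  have "{- int r..int (Suc q)} = insert (int (Suc q)) {- int r..int q}" by auto
  then show ?case using Suc by (simp add: algebra_simps)
qed

context based_simple_lie_algebra
begin

lemmas h_closed = vec.subspace_add[OF subspace_h] vec.subspace_scale[OF subspace_h]
  vec.subspace_neg[OF subspace_h] vec.subspace_diff[OF subspace_h] vec.subspace_0[OF subspace_h]

lemma R_trivial: "v \<in> R y \<Longrightarrow> y \<in> h \<Longrightarrow> y \<noteq> 0 \<Longrightarrow> y \<notin> \<Phi> \<Longrightarrow> v = 0"
  by (auto simp: \<Phi>_def)

lemma root_basis_exists:
  obtains B wt where "vec.independent B" "vec.span B = UNIV"
    "\<And>b. b \<in> B \<Longrightarrow> wt b \<in> h \<and> b \<in> R (wt b) \<and> b \<noteq> 0 \<and> (wt b = 0 \<or> wt b \<in> \<Phi>)"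
  using root_basis_extend[of "{}"] vec.independent_empty by auto

lemma finite_\<Phi>: "finite \<Phi>"
proof -
  obtain B wt where B: "vec.independent B" "vec.span B = UNIV"
    "\<And>b. b \<in> B \<Longrightarrow> wt b \<in> h \<and> b \<in> R (wt b) \<and> b \<noteq> 0 \<and> (wt b = 0 \<or> wt b \<in> \<Phi>)"
    using root_basis_exists by blast
  have "\<Phi> \<subseteq> wt ` B"
  proof
    fix x assume x: "x \<in> \<Phi>"
    then obtain v where v: "v \<in> R x" "v \<noteq> 0" by (auto simp: \<Phi>_def)
    have "v \<in> vec.span (B \<inter> R x)" using in_span_root_basis[OF B(1,2), of wt] B(3) v(1) by blast
    then have "B \<inter> R x \<noteq> {}" using v(2) by (metis vec.span_empty singletonD)
    then obtain b where b: "b \<in> B" "b \<in> R x" by blast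
    then have "wt b = x" using R_unique[of b "wt b" x] B(3)[OF b(1)] \<Phi>D(1)[OF x] by blast
    then show "x \<in> wt ` B" using b(1) by blast
  qed
  then show ?thesis using vec.finiteI_independent[OF B(1)] finite_surj by blast
qed

lemma string_end:
  assumes x: "x \<in> \<Phi>" and y: "y \<in> \<Phi>"
  obtains q :: nat where "\<And>k. k \<le> q \<Longrightarrow> y + of_nat k *s x \<in> \<Phi>" "y + of_nat (Suc q) *s x \<notin> \<Phi>"
proof -
  let ?f = "\<lambda>k::nat. y + of_nat k *s x"
  have "inj ?f" using \<Phi>D(2)[OF x] by (auto simp: inj_def)
  then have "\<exists>k. ?f k \<notin> \<Phi>"
    using finite_\<Phi> finite_subset[of "range ?f" \<Phi>] finite_imageD[of ?f UNIV] by auto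
  then have L: "?f (LEAST k. ?f k \<notin> \<Phi>) \<notin> \<Phi>" by (rule LeastI_ex)
  have "(LEAST k. ?f k \<notin> \<Phi>) \<noteq> 0"
  proof
    assume "(LEAST k. ?f k \<notin> \<Phi>) = 0"
    with L have "?f 0 \<notin> \<Phi>" by simp
    then show False using y by simp
  qed
  then obtain q where q: "(LEAST k. ?f k \<notin> \<Phi>) = Suc q" by (metis not0_implies_Suc)
  have "?f k \<in> \<Phi>" if "k \<le> q" for k
    using not_less_Least[of k "\<lambda>k. ?f k \<notin> \<Phi>"] q that by auto
  then show ?thesis using that[of q] L q by simp
qed

lemma int_multiple_not_root:
  assumes x: "x \<in> \<Phi>" and y: "y \<in> \<Phi>" "y \<noteq> x" "y \<noteq> - x"
  shows "y + of_int k *s x \<noteq> 0"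
proof
  assume "y + of_int k *s x = 0"
  then have yk: "y = of_int (- k) *s x" by (simp add: add_eq_0_iff2)
  have "y = 0" if "k = 0" using yk unfolding that by simp
  moreover have "y = - x" if "k = 1" using yk unfolding that by simp
  moreover have "y = x" if "k = -1" using yk unfolding that by simp
  ultimately have k: "k \<noteq> 0" "k \<noteq> 1" "k \<noteq> -1" using y(2,3) \<Phi>D(2)[OF y(1)] by blast+
  show False
  proof (cases "k < 0")
    case True
    then have "of_int (- k) = (of_nat (nat (- k)) :: complex)" by simp
    then have "y = of_nat (nat (- k)) *s x" using yk by metis
    moreover have "2 \<le> nat (- k)" using True k by simp
    ultimately show False using multiple_not_root[OF x] y by metis
  next
    case False
    then have "of_int k = (of_nat (nat k) :: complex)" by simp
    moreover have "y = of_int k *s (- x)" using yk by simp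
    ultimately have "y = of_nat (nat k) *s (- x)" by metis
    moreover have "2 \<le> nat k" using False k by simp
    ultimately show False using multiple_not_root[OF neg_\<Phi>[OF x]] y by metis
  qed
qed

text \<open>The root vectors of the string through \<open>y\<close> span a subspace preserved by
  \<open>u\<close> and \<open>w\<close>, with one dimension for each weight. The vanishing trace of
  \<open>ad x\<close> on it is an arithmetic series in \<open>k\<close>, which yields the relation
  between \<open>K y x\<close> and \<open>K x x\<close>. For \<open>y = x\<close> or
  \<open>y = - x\<close> the string would meet the weight 0.\<close>

lemma root_string:
  assumes x: "x \<in> \<Phi>" and y: "y \<in> \<Phi>" "y \<noteq> x" "y \<noteq> - x"
  obtains r q :: nat where "\<And>k. - int r \<le> k \<Longrightarrow> k \<le> int q \<Longrightarrow> y + of_int k *s x \<in> \<Phi>"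
    "2 * K y x = of_int (int r - int q) * K x x"
proof -
  obtain q where q: "\<And>k. k \<le> q \<Longrightarrow> y + of_nat k *s x \<in> \<Phi>" "y + of_nat (Suc q) *s x \<notin> \<Phi>"
    using string_end[OF x y(1)] by blast
  obtain r where r: "\<And>k. k \<le> r \<Longrightarrow> y + of_nat k *s (- x) \<in> \<Phi>" "y + of_nat (Suc r) *s (- x) \<notin> \<Phi>"
    using string_end[OF neg_\<Phi>[OF x] y(1)] by blast
  define A where "A = {- int r..int q}"
  let ?z = "\<lambda>k::int. y + of_int k *s x"
  have zh: "?z k \<in> h" for k using \<Phi>D(1)[OF x] \<Phi>D(1)[OF y(1)] h_closed by blast
  have z0: "?z k \<noteq> 0" for k using int_multiple_not_root[OF x y] .
  have zA: "?z k \<in> \<Phi>" if "k \<in> A" for k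
  proof (cases "k \<ge> 0")
    case True
    then have "of_int k = (of_nat (nat k) :: complex)" by simp
    then show ?thesis using q(1)[of "nat k"] that True by (simp add: A_def nat_le_iff)
  next
    case False
    then have "of_int k = - (of_nat (nat (- k)) :: complex)" by simp
    then show ?thesis using r(1)[of "nat (- k)"] that False by (simp add: A_def nat_le_iff)
  qed
  have ends: "?z (int q + 1) \<notin> \<Phi>" "?z (- int r - 1) \<notin> \<Phi>"
  proof -
    have "of_int (int q + 1) = (of_nat (Suc q) :: complex)" by simp
    then show "?z (int q + 1) \<notin> \<Phi>" using q(2) by metis
    have "of_int (- int r - 1) *s x = of_nat (Suc r) *s (- x)"
      by (simp add: vec.scale_left_distrib vec.scale_left_diff_distrib)
    then show "?z (- int r - 1) \<notin> \<Phi>" using r(2) by metis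
  qed
  have "\<forall>k\<in>A. \<exists>v. v \<in> R (?z k) \<and> v \<noteq> 0" using zA by (auto simp: \<Phi>_def)
  then obtain e where e: "\<And>k. k \<in> A \<Longrightarrow> e k \<in> R (?z k) \<and> e k \<noteq> 0" by metis
  obtain u where u: "u \<in> R x" "u \<noteq> 0" using x by (auto simp: \<Phi>_def)
  obtain w where w: "w \<in> R (- x)" "K u w = 1" using opposite_root_vector_exists[OF u] .
  have "vec.independent (e ` A)" "inj_on e A"
  proof -
    have *: "i = j" if "\<And>t. t \<in> h \<Longrightarrow> K (?z i) t = K (?z j) t" for i j
    proof -
      have "?z i = ?z j" using that by (intro h_eqI zh)
      then show ?thesis using \<Phi>D(2)[OF x] by simp
    qed
    show "vec.independent (e ` A)" "inj_on e A"
      by (rule independent_weight_vectors[where \<mu> = "\<lambda>k. K (?z k)"];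
          (use e * in \<open>auto simp: A_def R_def\<close>))+
  qed
  note ind = this
  have step: "br z v \<in> vec.span (e ` A)"
    if v: "k \<in> A" "v = e k" and z: "z \<in> R (of_int d *s x)" and d: "d = 1 \<or> d = -1" for k z v d
  proof -
    have eq: "of_int d *s x + ?z k = ?z (k + d)" by (simp add: vec.scale_left_distrib)
    have "br z v \<in> R (of_int d *s x + ?z k)" using br_R[OF z] e v by blast
    then have bz: "br z v \<in> R (?z (k + d))" unfolding eq .
    show ?thesis
    proof (cases "k + d \<in> A")
      case True
      then obtain c where "br z v = c *s e (k + d)"
        using root_space_1dim[OF zA[OF True] _ _ bz, of "e (k + d)"] e by metis
      then show ?thesis using True by (simp add: vec.span_scale vec.span_base)
    next
      case False
      then have "k + d = int q + 1 \<or> k + d = - int r - 1" using v(1) d by (auto simp: A_def)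
      then have "?z (k + d) \<notin> \<Phi>" using ends by metis
      then have "br z v = 0" using R_trivial[OF bz zh z0] by blast
      then show ?thesis by (simp add: vec.span_zero)
    qed
  qed
  have "(\<Sum>k\<in>A. K (?z k) x) = 0"
  proof (rule invariant_trace_zero[where v = e and u = u and w = w])
    show "br u (e k) \<in> vec.span (e ` A)" if "k \<in> A" for k
      using step[OF that refl, of u 1] u by simp
    show "br w (e k) \<in> vec.span (e ` A)" if "k \<in> A" for k
      using step[OF that refl, of w "-1"] w by simp
    show "br u w = x" using br_opposite[OF u(1) w(1) \<Phi>D(1)[OF x]] w(2) by simp
  qed (use ind e \<Phi>D(1)[OF x] in \<open>auto simp: A_def\<close>)
  moreover have "(\<Sum>k\<in>A. K (?z k) x) = of_nat (card A) * K y x + of_int (\<Sum>k\<in>A. k) * K x x"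
    by (simp add: killing_form_simps sum.distrib sum_distrib_right)
  ultimately have "2 * (of_nat (card A) * K y x + of_int (\<Sum>k\<in>A. k) * K x x) = 0" by simp
  moreover have "2 * (of_nat (card A) * K y x + of_int (\<Sum>k\<in>A. k) * K x x)
      = of_nat (card A) * (2 * K y x) + of_int (2 * (\<Sum>k\<in>A. k)) * K x x"
    unfolding of_int_mult by (simp only: of_int_numeral algebra_simps)
  moreover have "2 * (\<Sum>k\<in>A. k) = (int q - int r) * int (card A)"
    using sum_int_interval[of r q] by (simp add: A_def)
  ultimately have "of_nat (card A) * (2 * K y x) + of_int ((int q - int r) * int (card A)) * K x x = 0"
    by metis
  then have "of_nat (card A) * (2 * K y x + of_int (int q - int r) * K x x) = 0"
    unfolding of_int_mult of_int_of_nat_eq by (simp only: algebra_simps)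
  moreover have "card A \<noteq> 0" by (simp add: A_def)
  ultimately have "2 * K y x + of_int (int q - int r) * K x x = 0" by simp
  then have "2 * K y x = - (of_int (int q - int r) * K x x)" by (simp only: eq_neg_iff_add_eq_0)
  also have "\<dots> = of_int (int r - int q) * K x x" by (simp add: algebra_simps)
  finally show ?thesis using that[of r q] zA by (simp add: A_def)
qed

subsection \<open>Cartan integers\<close>

definition cn :: "complex^'n \<Rightarrow> complex^'n \<Rightarrow> int"
  where "cn y x = (THE c. 2 * K y x = of_int c * K x x)"

lemma cn_eqI:
  assumes "x \<in> \<Phi>" "2 * K y x = of_int c * K x x"
  shows "cn y x = c"
  unfolding cn_def
proof (rule the_equality)
  fix d assume "2 * K y x = of_int d * K x x"
  then have "of_int d * K x x = of_int c * K x x" using assms(2) by metis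
  then have "(of_int d :: complex) = of_int c" using root_norm_nonzero[OF assms(1)] mult_right_cancel by blast
  then show "d = c" by (simp only: of_int_eq_iff)
qed (use assms in simp)

text \<open>Reflection moves \<open>y\<close> by \<open>q - r\<close> steps along its string, and
  \<open>- r \<le> q - r \<le> q\<close> keeps it inside; the cases \<open>y = x\<close> and
  \<open>y = - x\<close> are immediate.\<close>

lemma cn_and_reflection:
  assumes "x \<in> \<Phi>" "y \<in> \<Phi>"
  shows "2 * K y x = of_int (cn y x) * K x x \<and> y - of_int (cn y x) *s x \<in> \<Phi>"
proof -
  have "\<exists>c::int. 2 * K y x = of_int c * K x x \<and> y - of_int c *s x \<in> \<Phi>"
  proof -
    consider "y = x" | "y = - x" | "y \<noteq> x" "y \<noteq> - x" by blast
    then show ?thesis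
    proof cases
      case 1
      have "x - of_int 2 *s x = - x" by (simp add: vec_eq_iff)
      then have "y - of_int 2 *s x \<in> \<Phi>" using 1 neg_\<Phi>[OF assms(1)] by metis
      moreover have "2 * K y x = of_int 2 * K x x" using 1 by simp
      ultimately show ?thesis by blast
    next
      case 2
      have "- x - of_int (- 2) *s x = x" by (simp add: vec_eq_iff)
      then have "y - of_int (- 2) *s x \<in> \<Phi>" using 2 assms(1) by metis
      moreover have "2 * K y x = of_int (- 2) * K x x" using 2 by (simp add: killing_form_simps')
      ultimately show ?thesis by blast
    next
      case 3
      obtain r q :: nat where rq: "\<And>k. - int r \<le> k \<Longrightarrow> k \<le> int q \<Longrightarrow> y + of_int k *s x \<in> \<Phi>"
        "2 * K y x = of_int (int r - int q) * K x x"
        using root_string[OF assms 3] by blast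
      have "y - of_int (int r - int q) *s x = y + of_int (int q - int r) *s x"
        by (simp add: vec.scale_left_diff_distrib)
      moreover have "y + of_int (int q - int r) *s x \<in> \<Phi>" by (rule rq(1)) auto
      ultimately show ?thesis using rq(2) by metis
    qed
  qed
  then show ?thesis using cn_eqI[OF assms(1)] by metis
qed

lemmas cn = cn_and_reflection[THEN conjunct1] and reflection = cn_and_reflection[THEN conjunct2]

text \<open>Expand \<open>K x x\<close> as the sum of the squares of \<open>K (wt b) x\<close> and
  substitute Cartan integers: \<open>4 K x x\<close> is \<open>(K x x)^2\<close> times a sum
  \<open>s\<close> of integer squares, hence \<open>K x x = 4 / s\<close>.\<close>

lemma root_norm_positive:
  assumes x: "x \<in> \<Phi>"
  shows "K x x \<in> \<real>" "Re (K x x) > 0"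
proof -
  obtain B wt where B: "vec.independent B" "vec.span B = UNIV"
    "\<And>b. b \<in> B \<Longrightarrow> wt b \<in> h \<and> b \<in> R (wt b) \<and> b \<noteq> 0 \<and> (wt b = 0 \<or> wt b \<in> \<Phi>)"
    using root_basis_exists by blast
  have xh: "x \<in> h" using \<Phi>D(1)[OF x] .
  have "\<exists>c::int. 2 * K (wt b) x = of_int c * K x x" if b: "b \<in> B" for b
  proof (cases "wt b = 0")
    case True
    then show ?thesis by (intro exI[of _ 0]) (simp add: killing_form_simps')
  next
    case False
    then have "wt b \<in> \<Phi>" using B(3)[OF b] by blast
    then show ?thesis using cn[OF x] by blast
  qed
  then obtain c :: "_ \<Rightarrow> int" where c: "\<And>b. b \<in> B \<Longrightarrow> 2 * K (wt b) x = of_int (c b) * K x x" by metis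
  have "4 * K x x = 4 * (\<Sum>b\<in>B. K (wt b) x * K (wt b) x)"
    using killing_form_h[OF B(1,2), of "\<lambda>b. K (wt b)" x x] B(3) xh by (simp add: R_def)
  also have "\<dots> = (\<Sum>b\<in>B. (2 * K (wt b) x) * (2 * K (wt b) x))"
    by (simp add: sum_distrib_left algebra_simps)
  also have "\<dots> = (\<Sum>b\<in>B. of_int (c b * c b) * (K x x * K x x))"
    using c by (intro sum.cong) (auto simp: algebra_simps)
  also have "\<dots> = of_int (\<Sum>b\<in>B. c b * c b) * (K x x * K x x)"
    by (simp add: sum_distrib_right)
  finally have "4 = of_int (\<Sum>b\<in>B. c b * c b) * K x x"
    using root_norm_nonzero[OF x] by simp
  moreover define s where "s = (\<Sum>b\<in>B. c b * c b)"
  ultimately have s: "4 = of_int s * K x x" by simp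
  have "s \<ge> 0" unfolding s_def by (intro sum_nonneg) simp
  moreover have "s \<noteq> 0" using s by auto
  ultimately have s0: "s > 0" by simp
  have "K x x = complex_of_real (4 / of_int s)" using s s0 by (simp add: field_simps)
  then show "K x x \<in> \<real>" "Re (K x x) > 0" using s0 by (auto simp del: of_real_divide)
qed

lemma killing_form_roots_real:
  assumes "x \<in> \<Phi>" "y \<in> \<Phi>"
  shows "K y x \<in> \<real>"
proof -
  have "K y x = of_int (cn y x) * K x x / 2"
    using cn[OF assms] by (simp add: eq_divide_eq mult.commute)
  moreover have "of_int (cn y x) * K x x / 2 \<in> \<real>"
    using root_norm_positive(1)[OF assms(1)] by (intro Reals_divide Reals_mult) simp_all
  ultimately show ?thesis by (simp only:)
qed

text \<open>The complex space \<open>h\<close> may contain isotropic vectors. For a vector on which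
  all roots are real, \<open>K v v\<close> is a sum of squares of real numbers.\<close>

lemma killing_form_definite:
  assumes v: "v \<in> h" "\<And>y. y \<in> \<Phi> \<Longrightarrow> K y v \<in> \<real>" "K v v = 0"
  shows "v = 0"
proof -
  obtain B wt where B: "vec.independent B" "vec.span B = UNIV"
    "\<And>b. b \<in> B \<Longrightarrow> wt b \<in> h \<and> b \<in> R (wt b) \<and> b \<noteq> 0 \<and> (wt b = 0 \<or> wt b \<in> \<Phi>)"
    using root_basis_exists by blast
  have fin: "finite B" using B(1) by (rule vec.finiteI_independent)
  have real: "K (wt b) v \<in> \<real>" if "b \<in> B" for b
    using B(3)[OF that] v(2) by (auto simp: killing_form_simps')
  have "0 = Re (\<Sum>b\<in>B. K (wt b) v * K (wt b) v)"
    using killing_form_h[OF B(1,2), of "\<lambda>b. K (wt b)" v v] B(3) v(1,3) by (simp add: R_def)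
  also have "\<dots> = (\<Sum>b\<in>B. (Re (K (wt b) v))\<^sup>2)"
    unfolding Re_sum using real by (intro sum.cong) (auto simp: power2_eq_square complex_is_Real_iff)
  finally have "(\<Sum>b\<in>B. (Re (K (wt b) v))\<^sup>2) = 0" by simp
  then have "\<forall>b\<in>B. (Re (K (wt b) v))\<^sup>2 = 0" using fin by (simp add: sum_nonneg_eq_0_iff)
  then have K0: "K (wt b) v = 0" if "b \<in> B" for b
    using real[OF that] that by (auto simp: complex_eq_iff complex_is_Real_iff)
  have z: "br v b = 0" if "b \<in> B" for b
    using RD[of b "wt b" v] B(3)[OF that] v(1) K0[OF that] by simp
  have "br v y = 0" for y
    using vec.linear_eq_0_on_span[OF linear_right z, of B y] B(2) by blast
  then show ?thesis by (rule center_trivial)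
qed

subsection \<open>The highest root\<close>

lemma dual_element_eq:
  assumes "x \<in> h" "\<And>t. t \<in> h \<Longrightarrow> \<alpha> t = K x t"
  shows "dual_element br h \<alpha> = x"
  unfolding dual_element_def
proof (rule the_equality)
  show "t = x" if "t \<in> h \<and> (\<forall>s\<in>h. K t s = \<alpha> s)" for t
    using that assms by (intro h_eqI) auto
qed (use assms in simp)

lemma root_dual_element:
  assumes "\<alpha> \<in> roots br h"
  shows "dual_element br h \<alpha> \<in> \<Phi>" "t \<in> h \<Longrightarrow> \<alpha> t = K (dual_element br h \<alpha>) t"
    "W \<alpha> = R (dual_element br h \<alpha>)"
proof -
  obtain v where v: "v \<in> W \<alpha>" "v \<noteq> 0" using root_vector_exists[OF assms] .
  obtain x where x: "x \<in> h" "v \<in> R x" "\<And>t. t \<in> h \<Longrightarrow> \<alpha> t = K x t"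
    using weight_vector_in_R[OF v] by blast
  have d: "dual_element br h \<alpha> = x" using dual_element_eq x by blast
  show "t \<in> h \<Longrightarrow> \<alpha> t = K (dual_element br h \<alpha>) t" using d x by simp
  show "W \<alpha> = R (dual_element br h \<alpha>)" unfolding R_def d using x(3) by (rule W_cong)
  have "x \<noteq> 0" using assms x(3) by (auto simp: roots_def killing_form_simps')
  then show "dual_element br h \<alpha> \<in> \<Phi>" using d x v by (auto simp: \<Phi>_def)
qed

lemma restrict_root:
  assumes "x \<in> \<Phi>"
  shows "restrict (K x) h \<in> roots br h" "dual_element br h (restrict (K x) h) = x"
proof -
  obtain v where v: "v \<in> R x" "v \<noteq> 0" using assms by (auto simp: \<Phi>_def)
  obtain t where "t \<in> h" "K x t \<noteq> 0"
    using killing_form_h_nondegenerate \<Phi>D[OF assms] by blast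
  then show "restrict (K x) h \<in> roots br h" using root_of_weight_vector v by (simp add: R_def)
  show "dual_element br h (restrict (K x) h) = x"
    using \<Phi>D(1)[OF assms] by (intro dual_element_eq) auto
qed

definition \<theta> :: "complex^'n"
  where "\<theta> = dual_element br h \<rho>"

lemma \<theta>: "\<theta> \<in> \<Phi>" "t \<in> h \<Longrightarrow> \<rho> t = K \<theta> t" "W \<rho> = R \<theta>"
  using root_dual_element[OF \<rho>_root] by (simp_all add: \<theta>_def)

text \<open>For a root the value at \<open>t\<^sub>0\<close> is already an integer; rounding only
  changes its type.\<close>

definition ht :: "complex^'n \<Rightarrow> int"
  where "ht x = \<lfloor>Re (K x t\<^sub>0)\<rfloor>"

lemma ht: "x \<in> \<Phi> \<Longrightarrow> K x t\<^sub>0 = of_int (ht x)" "x \<in> \<Phi> \<Longrightarrow> ht x \<noteq> 0"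
proof -
  assume x: "x \<in> \<Phi>"
  obtain n where n: "restrict (K x) h t\<^sub>0 = of_int n" "n \<noteq> 0"
    using root_height[OF restrict_root(1)[OF x]] .
  then show "K x t\<^sub>0 = of_int (ht x)" "ht x \<noteq> 0" using t\<^sub>0(1) by (simp_all add: ht_def)
qed

lemma ht_linear:
  assumes "x \<in> \<Phi>" "y \<in> \<Phi>" "z \<in> \<Phi>" "z = of_int k *s x + of_int l *s y"
  shows "ht z = k * ht x + l * ht y"
proof -
  have "(of_int (ht z) :: complex) = of_int (k * ht x + l * ht y)"
    using ht(1)[OF assms(1)] ht(1)[OF assms(2)] ht(1)[OF assms(3)] assms(4)
    by (simp add: killing_form_simps)
  then show ?thesis by (simp only: of_int_eq_iff)
qed

lemma ht_neg:
  assumes x: "x \<in> \<Phi>"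
  shows "ht (- x) = - ht x"
proof -
  have "- x = of_int (- 1) *s x + of_int 0 *s x" by simp
  then have "ht (- x) = (- 1) * ht x + 0 * ht x" by (rule ht_linear[OF x x neg_\<Phi>[OF x]])
  then show ?thesis by simp
qed

lemma \<theta>_highest:
  assumes x: "x \<in> \<Phi>"
  shows "ht x \<le> ht \<theta>" "ht x = ht \<theta> \<Longrightarrow> x = \<theta>"
proof -
  have "\<exists>c :: _ \<Rightarrow> nat. \<forall>t\<in>h. \<rho> t - restrict (K x) h t = (\<Sum>\<beta>\<in>\<Delta>. of_nat (c \<beta>) * \<beta> t)"
    by (rule bspec[OF conjunct2[OF highest[unfolded highest_root_def]] restrict_root(1)[OF x]])
  then obtain c :: "_ \<Rightarrow> nat" where c: "\<forall>t\<in>h. \<rho> t - restrict (K x) h t = (\<Sum>\<beta>\<in>\<Delta>. of_nat (c \<beta>) * \<beta> t)"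
    by (elim exE)
  have fin: "finite \<Delta>" using base unfolding simple_roots_def by blast
  have "K \<theta> t\<^sub>0 - K x t\<^sub>0 = (\<Sum>\<beta>\<in>\<Delta>. of_nat (c \<beta>) * \<beta> t\<^sub>0)" using c t\<^sub>0(1) \<theta>(2) by simp
  also have "\<dots> = (\<Sum>\<beta>\<in>\<Delta>. of_nat (c \<beta>))" using t\<^sub>0(2) by (intro sum.cong) simp_all
  finally have "(of_int (ht \<theta> - ht x) :: complex) = of_int (int (\<Sum>\<beta>\<in>\<Delta>. c \<beta>))"
    using ht(1)[OF x] ht(1)[OF \<theta>(1)] by simp
  then have d: "ht \<theta> - ht x = int (\<Sum>\<beta>\<in>\<Delta>. c \<beta>)" by (simp only: of_int_eq_iff)
  then show "ht x \<le> ht \<theta>" by linarith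
  assume "ht x = ht \<theta>"
  then have "(\<Sum>\<beta>\<in>\<Delta>. c \<beta>) = 0" using d by linarith
  then have c0: "\<forall>\<beta>\<in>\<Delta>. c \<beta> = 0" using fin by simp
  show "x = \<theta>"
  proof (rule h_eqI)
    show "K x t = K \<theta> t" if t: "t \<in> h" for t
    proof -
      have "\<rho> t - restrict (K x) h t = (\<Sum>\<beta>\<in>\<Delta>. of_nat (c \<beta>) * \<beta> t)" using c t by blast
      also have "\<dots> = 0" using c0 by (intro sum.neutral) simp
      finally show ?thesis using \<theta>(2) t by simp
    qed
  qed (use \<Phi>D(1) x \<theta>(1) in auto)
qed

lemma ht_\<theta>_pos: "ht \<theta> > 0"
  using \<theta>_highest(1)[OF neg_\<Phi>[OF \<theta>(1)]] ht_neg[OF \<theta>(1)] ht(2)[OF \<theta>(1)] by simp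

lemma cn_neg: "x \<in> \<Phi> \<Longrightarrow> y \<in> \<Phi> \<Longrightarrow> cn (- y) x = - cn y x"
  using cn[of x y] by (intro cn_eqI) (simp_all add: killing_form_simps')

text \<open>The negative of the reflected root \<open>x - c \<theta>\<close> is again no higher than
  \<open>\<theta>\<close>. This reads
  \<open>c ht \<theta> \<le> ht \<theta> + ht x \<le> 2 ht \<theta>\<close>, and equality forces
  \<open>ht x = ht \<theta>\<close>.\<close>

lemma cn_\<theta>_le:
  assumes x: "x \<in> \<Phi>"
  shows "cn x \<theta> \<le> 2" "cn x \<theta> = 2 \<Longrightarrow> x = \<theta>"
proof -
  let ?c = "cn x \<theta>"
  have s: "x - of_int ?c *s \<theta> \<in> \<Phi>" using reflection[OF \<theta>(1) x] .
  have "x - of_int ?c *s \<theta> = of_int 1 *s x + of_int (- ?c) *s \<theta>" by simp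
  then have "ht (x - of_int ?c *s \<theta>) = 1 * ht x + (- ?c) * ht \<theta>"
    by (rule ht_linear[OF x \<theta>(1) s])
  moreover have "- ht (x - of_int ?c *s \<theta>) \<le> ht \<theta>"
    using \<theta>_highest(1)[OF neg_\<Phi>[OF s]] ht_neg[OF s] by simp
  ultimately have *: "?c * ht \<theta> \<le> ht \<theta> + ht x" by simp
  have le: "ht x \<le> ht \<theta>" using \<theta>_highest(1)[OF x] .
  have "?c * ht \<theta> \<le> 2 * ht \<theta>" using * le by linarith
  then show "?c \<le> 2" using ht_\<theta>_pos by simp
  assume "?c = 2"
  then have "ht x = ht \<theta>" using * le by simp
  then show "x = \<theta>" using \<theta>_highest(2)[OF x] by blast
qed

lemma cn_\<theta>_ge:
  assumes x: "x \<in> \<Phi>"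
  shows "- 2 \<le> cn x \<theta>" "cn x \<theta> = - 2 \<Longrightarrow> x = - \<theta>"
proof -
  show "- 2 \<le> cn x \<theta>" using cn_\<theta>_le(1)[OF neg_\<Phi>[OF x]] cn_neg[OF \<theta>(1) x] by simp
  show "x = - \<theta>" if "cn x \<theta> = - 2"
    using cn_\<theta>_le(2)[OF neg_\<Phi>[OF x]] cn_neg[OF \<theta>(1) x] that by (metis minus_minus)
qed

lemma add_\<theta>_not_root:
  assumes "x \<in> \<Phi>" "ht x > 0"
  shows "\<theta> + x \<notin> \<Phi>"
proof
  assume s: "\<theta> + x \<in> \<Phi>"
  have "\<theta> + x = of_int 1 *s \<theta> + of_int 1 *s x" by simp
  then have "ht (\<theta> + x) = 1 * ht \<theta> + 1 * ht x" by (rule ht_linear[OF \<theta>(1) assms(1) s])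
  then show False using \<theta>_highest(1)[OF s] assms(2) by simp
qed

end

section \<open>Conics of extremal elements\<close>

lemma quartic_coefficients_zero:
  fixes v :: "nat \<Rightarrow> complex^'n"
  assumes "\<And>s. v 0 + s *s v 1 + s^2 *s v 2 + s^3 *s v 3 + s^4 *s v 4 = 0"
  shows "v 0 = 0" "v 1 = 0" "v 2 = 0" "v 3 = 0" "v 4 = 0"
proof -
  have *: "[:v 0 $ i, v 1 $ i, v 2 $ i, v 3 $ i, v 4 $ i:] = 0" for i
  proof -
    have "poly [:v 0 $ i, v 1 $ i, v 2 $ i, v 3 $ i, v 4 $ i:] s
        = (v 0 + s *s v 1 + s^2 *s v 2 + s^3 *s v 3 + s^4 *s v 4) $ i" for s
      by (simp add: algebra_simps power2_eq_square power3_eq_cube power4_eq_xxxx)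
    then have "poly [:v 0 $ i, v 1 $ i, v 2 $ i, v 3 $ i, v 4 $ i:] s = 0" for s
      by (simp only: assms zero_index)
    then show ?thesis using poly_all_0_iff_0 by blast
  qed
  show "v 0 = 0" "v 1 = 0" "v 2 = 0" "v 3 = 0" "v 4 = 0"
    using * by (simp_all add: vec_eq_iff)
qed

context complex_lie_algebra
begin

text \<open>Comparing the coefficients of the powers of \<open>s\<close> and evaluating at \<open>a\<close>, \<open>b\<close> and \<open>c\<close> shows that
  \<open>\<phi>\<close> vanishes on the span of \<open>a\<close>, \<open>b\<close>, \<open>c\<close>. Modulo terms that vanish for this reason, the
  coefficient of \<open>s\<^sup>2\<close> writes \<open>(ad b)\<^sup>2\<close> as \<open>- ad a ad c - ad c ad a\<close>, and \<open>(ad b)\<^sup>2 ad a = 0\<close> since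
  \<open>ad a\<close> and \<open>ad b\<close> commute.\<close>

lemma conic_tangent_ad_nilpotent:
  fixes a b c :: "complex^'n" and l :: complex
  defines "\<phi> \<equiv> \<lambda>x y. l * killing_form br x y"
  assumes conic: "\<And>s y. br (a + s *s b + s^2 *s c) (br (a + s *s b + s^2 *s c) y)
      = \<phi> (a + s *s b + s^2 *s c) y *s (a + s *s b + s^2 *s c)"
    and indep: "\<And>r t. r *s a + t *s b = 0 \<Longrightarrow> r = 0 \<and> t = 0"
    and ab: "br a b = 0"
  shows "br (r *s a + t *s b) (br (r *s a + t *s b) (br (r *s a + t *s b) (br (r *s a + t *s b) y))) = 0"
proof -
  have \<phi>: "\<phi> (x + x') y = \<phi> x y + \<phi> x' y" "\<phi> (k *s x) y = k * \<phi> x y"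
    "\<phi> y (x + x') = \<phi> y x + \<phi> y x'" "\<phi> y (k *s x) = k * \<phi> y x" "\<phi> 0 y = 0" "\<phi> y 0 = 0"
    "\<phi> y (x - x') = \<phi> y x - \<phi> y x'" "\<phi> y (- x) = - \<phi> y x" for x x' y k
    by (simp_all add: \<phi>_def killing_form_simps killing_form_simps' algebra_simps)
  have sym: "\<phi> x y = \<phi> y x" for x y by (simp add: \<phi>_def killing_form_sym[of x y])
  have inv: "\<phi> x (br y z) = \<phi> (br x y) z" for x y z by (simp add: \<phi>_def killing_form_invariant)
  have ba: "br b a = 0" using ab br_anti[of b a] by simp
  have a0: "a \<noteq> 0" using indep[of 1 0] by auto
  have b0: "b \<noteq> 0" using indep[of 0 1] by auto
  \<comment> \<open>The coefficient of \<open>s^k\<close> in the difference of the two sides of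
    \<open>conic\<close>.\<close>
  define e where "e y = (\<lambda>k::nat. if k = 0 then br a (br a y) - \<phi> a y *s a
    else if k = 1 then br a (br b y) + br b (br a y) - (\<phi> a y *s b + \<phi> b y *s a)
    else if k = 2 then br b (br b y) + br a (br c y) + br c (br a y) - (\<phi> a y *s c + \<phi> b y *s b + \<phi> c y *s a)
    else if k = 3 then br b (br c y) + br c (br b y) - (\<phi> b y *s c + \<phi> c y *s b)
    else br c (br c y) - \<phi> c y *s c)" for y
  have "e y 0 + s *s e y 1 + s^2 *s e y 2 + s^3 *s e y 3 + s^4 *s e y 4 = 0" for s y
  proof -
    have "e y 0 + s *s e y 1 + s^2 *s e y 2 + s^3 *s e y 3 + s^4 *s e y 4
      = br (a + s *s b + s^2 *s c) (br (a + s *s b + s^2 *s c) y)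
        - \<phi> (a + s *s b + s^2 *s c) y *s (a + s *s b + s^2 *s c)"
      by (simp add: e_def br_simps \<phi> vec_eq_iff algebra_simps power2_eq_square power3_eq_cube power4_eq_xxxx)
    then show ?thesis using conic[of s y] by simp
  qed
  note zero = quartic_coefficients_zero[of "e _", OF this]
  have e0: "br a (br a y) = \<phi> a y *s a" for y
    using zero(1)[of y] by (simp add: e_def)
  have e1: "br a (br b y) + br b (br a y) = \<phi> a y *s b + \<phi> b y *s a" for y
    using zero(2)[of y] by (simp add: e_def)
  have e2: "br b (br b y) + br a (br c y) + br c (br a y) = \<phi> a y *s c + \<phi> b y *s b + \<phi> c y *s a" for y
    using zero(3)[of y] by (simp add: e_def)
  have e3: "br b (br c y) + br c (br b y) = \<phi> b y *s c + \<phi> c y *s b" for y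
    using zero(4)[of y] by (simp add: e_def)
  have e4: "br c (br c y) = \<phi> c y *s c" for y
    using zero(5)[of y] by (simp add: e_def)
  have paa: "\<phi> a a = 0" using e0[of a] a0 by (simp add: alternating br_simps)
  have pba: "\<phi> b a = 0" "\<phi> a b = 0"
    using e1[of a] a0 sym[of a b] by (simp_all add: alternating br_simps ba paa)
  have pac: "\<phi> a c = 0" "\<phi> c a = 0"
  proof -
    have "br a (br c a) = - (\<phi> a c *s a)" using e0[of c] br_anti[of c a] by (simp add: br_simps)
    then have "- (\<phi> a c *s a) = \<phi> c a *s a"
      using e2[of a] by (simp add: alternating br_simps ba paa pba)
    then have "(\<phi> a c + \<phi> c a) *s a = 0" unfolding vec.scale_left_distrib by (metis add.right_inverse)
    then have "\<phi> a c + \<phi> c a = 0" using a0 vec.scale_eq_0_iff by blast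
    then show "\<phi> a c = 0" "\<phi> c a = 0" using sym[of a c] by simp_all
  qed
  have comm: "br a (br b y) = br b (br a y)" for y
    using br_derivation[of a b y] ab by (simp add: br_simps)
  have AB: "br b (br a y) = (1/2) *s (\<phi> a y *s b + \<phi> b y *s a)" for y
    using e1[of y] comm[of y] by (metis (no_types, lifting) vec.scale_scale vec.scale_one
        mult_2 nonzero_eq_divide_eq one_add_one vec.scale_left_distrib zero_neq_numeral)
  have pb: "\<phi> b b = 0" "\<phi> b c = 0" "\<phi> c b = 0"
  proof -
    have "br a (br c b) = - br b (br a c)"
      using br_derivation[of a c b] ab br_anti[of "br a c" b] by (simp add: br_simps)
    also have "br b (br a c) = (1/2) *s (\<phi> b c *s a)" using AB[of c] pac by simp
    finally have "- ((1/2) *s (\<phi> b c *s a)) = \<phi> b b *s b + \<phi> c b *s a"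
      using e2[of b] by (simp add: alternating br_simps ab pba)
    then have "(1/2) *s (\<phi> b c *s a) = - (\<phi> b b *s b + \<phi> c b *s a)"
      by (metis minus_minus)
    then have "2 *s ((1/2) *s (\<phi> b c *s a)) = 2 *s (- (\<phi> b b *s b + \<phi> c b *s a))" by (rule arg_cong)
    then have "\<phi> b c *s a + 2 *s (\<phi> b b *s b + \<phi> c b *s a) = 0" by simp
    moreover have "\<phi> b c *s a + 2 *s (\<phi> b b *s b + \<phi> c b *s a)
        = (\<phi> b c + 2 * \<phi> c b) *s a + (2 * \<phi> b b) *s b"
      by (simp add: vec_eq_iff algebra_simps)
    ultimately have "(\<phi> b c + 2 * \<phi> c b) *s a + (2 * \<phi> b b) *s b = 0" by (simp only:)
    then have "\<phi> b c + 2 * \<phi> c b = 0 \<and> 2 * \<phi> b b = 0" by (rule indep)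
    then show "\<phi> b b = 0" "\<phi> b c = 0" "\<phi> c b = 0" using sym[of c b] by simp_all
  qed
  have pcc: "\<phi> c c = 0" using e4[of c] by (cases "c = 0") (simp_all add: alternating br_simps \<phi>)
  \<comment> \<open>In the coefficient of \<open>s^2\<close> at \<open>c\<close> all values of
    \<open>\<phi>\<close> vanish by now, and \<open>[c, [a, c]] = - (ad c)^2 a\<close> is a multiple
    of \<open>\<phi> c a = 0\<close>.\<close>
  have bbc: "br b (br b c) = 0"
  proof -
    have "br c (br a c) = 0" using e4[of a] br_anti[of a c] pac by (simp add: br_simps)
    then show ?thesis using e2[of c] by (simp add: alternating br_simps pac pb pcc)
  qed
  have B2A: "br b (br b (br a y)) = 0" for y
    by (simp add: AB br_simps alternating ba)
  \<comment> \<open>By \<open>e3\<close> the operators \<open>ad b\<close> and \<open>ad c\<close>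
    anticommute up to values in the span of \<open>b\<close> and \<open>c\<close>, so
    \<open>ad c\<close> passes \<open>(ad b)^2\<close> with only these correction terms.\<close>
  have B2C: "br b (br b (br c y)) = \<phi> b y *s br b c - \<phi> c (br b y) *s b + br c (br b (br b y))" for y
  proof -
    have 1: "br b (br c y) = \<phi> b y *s c + \<phi> c y *s b - br c (br b y)" for y
      using e3[of y] by (simp add: eq_diff_eq)
    have "\<phi> b (br b y) = 0" using inv[of b b y] by (simp add: alternating \<phi>)
    then have "br b (br c (br b y)) = \<phi> c (br b y) *s b - br c (br b (br b y))"
      using 1[of "br b y"] by simp
    then show ?thesis by (simp add: 1[of y] br_simps alternating algebra_simps)
  qed
  have B4: "br b (br b (br b (br b y))) = 0" for y
  proof -
    have "br b (br b (br c (br a y))) = 0"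
      using B2C[of "br a y"] inv[of b a y]
      by (simp add: B2A br_simps ba \<phi> AB pb pac alternating)
    moreover have "br b (br b y) = \<phi> a y *s c + \<phi> b y *s b + \<phi> c y *s a - br a (br c y) - br c (br a y)"
      using e2[of y] by (simp add: algebra_simps)
    ultimately show ?thesis by (simp add: br_simps bbc B2A alternating ba)
  qed
  \<comment> \<open>In \<open>(ad w)^2\<close> everything except \<open>t^2 (ad b)^2\<close> takes
    values in the span of \<open>a\<close> and \<open>b\<close>, which \<open>ad w\<close> kills.
    Thus the general member of the pencil inherits nilpotency from \<open>b\<close>.\<close>
  define w where "w = r *s a + t *s b"
  have ww: "br w (br w y) = (r * r * \<phi> a y + r * t * \<phi> b y) *s a + (r * t * \<phi> a y) *s b
      + (t * t) *s br b (br b y)" for y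
  proof -
    have "br w (br w y) = (r * r) *s br a (br a y) + (2 * r * t) *s br b (br a y) + (t * t) *s br b (br b y)"
      by (simp add: w_def br_simps comm vec_eq_iff algebra_simps)
    then show ?thesis by (simp add: e0 AB vec_eq_iff algebra_simps)
  qed
  have "br w a = 0" "br w b = 0" by (simp_all add: w_def br_simps alternating ab ba)
  moreover have "\<phi> a (br b (br b y)) = 0" "\<phi> b (br b (br b y)) = 0"
    using inv[of a b "br b y"] inv[of b b "br b y"] by (simp_all add: ab alternating \<phi>)
  ultimately have "br w (br w (br w (br w y))) = 0"
    by (subst (2) ww) (simp add: br_simps ww B4)
  then show ?thesis by (simp add: w_def)
qed

end

section \<open>The contact fibre\<close>

context based_simple_lie_algebra
begin

text \<open>\<open>(ad E)^2\<close> raises weights by \<open>2 \<theta>\<close>. By heights the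
  result can be nonzero only on the weight \<open>- \<theta>\<close>, where it is computed from
  \<open>[E, F] = \<theta>\<close>; the factor is \<open>l = - K \<theta> \<theta>\<close>.\<close>

lemma ad_highest_root_vector:
  assumes E: "E \<in> R \<theta>" "E \<noteq> 0"
  obtains l where "\<And>y. br E (br E y) = (l * K E y) *s E"
proof -
  obtain F where F: "F \<in> R (- \<theta>)" "K E F = 1" using opposite_root_vector_exists[OF E] .
  have \<theta>h: "\<theta> \<in> h" using \<theta>(1) \<Phi>D by blast
  have EF: "br E F = \<theta>" using br_opposite[OF E(1) F(1) \<theta>h] F(2) by simp
  have E\<theta>: "br E \<theta> = (- K \<theta> \<theta>) *s E" using RD[OF E(1) \<theta>h] br_anti[of E \<theta>] by simp
  have F0: "F \<noteq> 0" using F(2) by (auto simp: killing_form_simps')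
  have "br E (br E y) = (- K \<theta> \<theta> * K E y) *s E" for y
  proof (rule in_W_span_cases[of "\<lambda>y. br E (br E y) = (- K \<theta> \<theta> * K E y) *s E"])
    show "vec.subspace {y. br E (br E y) = (- K \<theta> \<theta> * K E y) *s E}"
      by (rule vec.subspaceI) (auto simp: br_simps killing_form_simps killing_form_simps' algebra_simps)
    fix \<mu> y assume y: "y \<in> W \<mu>"
    show "br E (br E y) = (- K \<theta> \<theta> * K E y) *s E"
    proof (cases "y = 0")
      case False
      obtain x where x: "x \<in> h" "y \<in> R x" using weight_vector_in_R[OF y False] by blast
      show ?thesis
      proof (cases "x = - \<theta>")
        case True
        obtain d where "y = d *s F"
          using root_space_1dim[OF neg_\<Phi>[OF \<theta>(1)] F(1) F0, of y] x(2) True by blast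
        then show ?thesis by (simp add: br_simps EF E\<theta> killing_form_simps F(2) mult.commute)
      next
        case x\<theta>: False
        then have KE: "K E y = 0"
          using killing_form_R[OF E(1) x(2) \<theta>h x(1)] by (metis add_eq_0_iff)
        have in_R: "br E (br E y) \<in> R (\<theta> + (\<theta> + x))" using br_R[OF E(1) br_R[OF E(1) x(2)]] .
        have zh: "\<theta> + (\<theta> + x) \<in> h" by (intro h_closed(1) \<theta>h x(1))
        have x\<Phi>: "x = 0 \<or> x \<in> \<Phi>" using x y False by (auto simp: \<Phi>_def)
        have 2: "2 *s \<theta> \<notin> \<Phi>" "2 *s (- \<theta>) \<notin> \<Phi>"
          using multiple_not_root[OF \<theta>(1), of 2] multiple_not_root[OF neg_\<Phi>[OF \<theta>(1)], of 2] by simp_all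
        have \<theta>\<theta>: "\<theta> + \<theta> = 2 *s \<theta>" by (simp add: vec_eq_iff)
        have "\<theta> + (\<theta> + x) \<noteq> 0"
        proof
          assume "\<theta> + (\<theta> + x) = 0"
          then have "2 *s \<theta> + x = 0" by (metis \<theta>\<theta> add.assoc)
          then have x2: "x = - (2 *s \<theta>)" by (rule minus_unique[symmetric])
          then have "x \<noteq> 0" using \<Phi>D(2)[OF \<theta>(1)] by simp
          moreover have "x = 2 *s (- \<theta>)" using x2 by simp
          ultimately show False using x\<Phi> 2(2) by metis
        qed
        moreover have "\<theta> + (\<theta> + x) \<notin> \<Phi>"
        \<comment> \<open>If \<open>2 \<theta> + x\<close> is no higher than
          \<open>\<theta>\<close>, then \<open>- x\<close> is at least as high as
          \<open>\<theta>\<close> and hence equals it.\<close>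
        proof
          assume s: "\<theta> + (\<theta> + x) \<in> \<Phi>"
          have x: "x \<in> \<Phi>"
          proof (rule ccontr)
            assume "x \<notin> \<Phi>"
            then have "\<theta> + (\<theta> + x) = 2 *s \<theta>" using x\<Phi> \<theta>\<theta> by simp
            then show False using s 2 by metis
          qed
          have "\<theta> + (\<theta> + x) = of_int 2 *s \<theta> + of_int 1 *s x" by (simp add: vec_eq_iff)
          then have "ht (\<theta> + (\<theta> + x)) = 2 * ht \<theta> + 1 * ht x" by (rule ht_linear[OF \<theta>(1) x s])
          then have "ht (- x) \<ge> ht \<theta>" using \<theta>_highest(1)[OF s] ht_neg[OF x] by simp
          then have "- x = \<theta>" using \<theta>_highest[OF neg_\<Phi>[OF x]] by simp
          then show False using x\<theta> by (metis minus_minus)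
        qed
        ultimately have "br E (br E y) = 0" using R_trivial[OF in_R zh] by blast
        then show ?thesis using KE by simp
      qed
    qed (simp add: br_simps killing_form_simps')
  qed
  then show ?thesis using that by blast
qed

text \<open>The double bracket of \<open>E\<close> with \<open>x\<close> is a multiple of
  \<open>K E x\<close>, which is zero on root spaces other than that of \<open>- \<theta>\<close>.
  Leaving this root out of the fibre is what makes contact directions commute with
  \<open>E\<close>.\<close>

lemma br_contact_fibre:
  assumes E: "E \<in> R \<theta>" "E \<noteq> 0" and b: "b \<in> contact_fibre br h \<rho> E"
  shows "br E b = 0"
proof -
  let ?N = "\<Union>\<alpha>\<in>{\<alpha> \<in> roots br h. \<alpha> \<noteq> neg_weight h \<rho> \<and> Re (weight_form br h \<alpha> \<rho>) < 0}. W \<alpha>"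
  obtain l where l: "\<And>y. br E (br E y) = (l * K E y) *s E" using ad_highest_root_vector[OF E] by blast
  have "K E x = 0" if x: "x \<in> ?N" for x
  proof -
    obtain \<alpha> where \<alpha>: "\<alpha> \<in> roots br h" "\<alpha> \<noteq> neg_weight h \<rho>" "x \<in> W \<alpha>" using x by blast
    let ?y = "dual_element br h \<alpha>"
    have y: "?y \<in> \<Phi>" "x \<in> R ?y" using root_dual_element[OF \<alpha>(1)] \<alpha>(3) by auto
    have "\<theta> + ?y \<noteq> 0"
    proof
      assume "\<theta> + ?y = 0"
      then have "?y = - \<theta>" by (simp add: add_eq_0_iff)
      then have "\<alpha> t = - \<rho> t" if "t \<in> h" for t
        using root_dual_element(2)[OF \<alpha>(1) that] \<theta>(2)[OF that] by (simp add: killing_form_simps')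
      moreover have "\<alpha> \<in> extensional h" using \<alpha>(1) by (simp add: roots_def)
      ultimately have "\<alpha> = neg_weight h \<rho>"
        by (auto simp: neg_weight_def extensional_def restrict_def fun_eq_iff)
      then show False using \<alpha>(2) by blast
    qed
    then show "K E x = 0" using killing_form_R[OF E(1) y(2)] \<theta>(1) y(1) \<Phi>D(1) by blast
  qed
  moreover have "vec.subspace {x. K E x = 0}"
    by (rule vec.subspaceI) (auto simp: killing_form_simps killing_form_simps')
  ultimately have KN: "K E x = 0" if "x \<in> vec.span ?N" for x
    using that vec.span_minimal[of ?N "{x. K E x = 0}"] by blast
  have "vec.subspace {b. br E b = 0}"
    by (rule vec.subspaceI) (auto simp: br_simps)
  moreover have "insert E ((\<lambda>x. br x E) ` vec.span ?N) \<subseteq> {b. br E b = 0}"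
  proof -
    have "br E (br x E) = 0" if "x \<in> vec.span ?N" for x
      using l[of x] KN[OF that] br_anti[of x E] by (simp add: br_simps)
    then show ?thesis using alternating[of E] by auto
  qed
  ultimately have "contact_fibre br h \<rho> E \<subseteq> {b. br E b = 0}"
    unfolding contact_fibre_def by (intro vec.span_minimal)
  then show ?thesis using b by blast
qed

text \<open>If \<open>x\<close> and \<open>y = \<theta> - x\<close> are roots as long as \<open>\<theta>\<close>, then \<open>b = u\<^sub>x + u\<^sub>y\<close> is a principal nilpotent
  element of a subalgebra of type \<open>A\<^sub>2\<close>, and \<open>F\<close> is a vector of lowest weight \<open>- 4\<close> for the
  corresponding three-dimensional simple subalgebra.\<close>

lemma generic_contact_vector:
  assumes E: "E \<in> R \<theta>" "E \<noteq> 0" and x: "x \<in> \<Phi>" "cn x \<theta> = 1" "cn \<theta> x = 1"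
  obtains b F where "b \<in> contact_fibre br h \<rho> E" "b \<notin> vec.span {E}"
    "\<And>r t w. w = t *s b + r *s E \<Longrightarrow> t \<noteq> 0 \<Longrightarrow> br w (br w (br w (br w F))) \<noteq> 0"
proof -
  define N where "N = K \<theta> \<theta>"
  have N0: "N \<noteq> 0" using root_norm_nonzero[OF \<theta>(1)] by (simp add: N_def)
  have Npos: "Re N > 0" using root_norm_positive(2)[OF \<theta>(1)] by (simp add: N_def)
  define y where "y = \<theta> - x"
  have Kx\<theta>: "2 * K x \<theta> = N" using cn[OF \<theta>(1) x(1)] x(2) by (simp add: N_def)
  have "2 * K \<theta> x = K x x" using cn[OF x(1) \<theta>(1)] x(3) by simp
  then have Kxx: "K x x = N" using Kx\<theta> killing_form_sym[of \<theta> x] by simp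
  have K\<theta>x: "2 * K \<theta> x = N" using Kx\<theta> killing_form_sym[of \<theta> x] by simp
  have y\<Phi>: "y \<in> \<Phi>" using reflection[OF x(1) \<theta>(1)] x(3) by (simp add: y_def)
  have Ky\<theta>: "2 * K y \<theta> = N" "2 * K \<theta> y = N"
    using Kx\<theta> K\<theta>x by (simp_all add: y_def killing_form_simps' algebra_simps N_def)
  have Kxy: "2 * K x y = - N"
    using Kx\<theta> Kxx by (simp add: y_def killing_form_simps' algebra_simps)
  have xy: "x + y = \<theta>" "y + x = \<theta>" by (simp_all add: y_def)
  have hs: "x \<in> h" "y \<in> h" "\<theta> \<in> h" using x(1) y\<Phi> \<theta>(1) \<Phi>D(1) by blast+
  have x_ne: "x \<noteq> \<theta>" "y \<noteq> \<theta>"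
  proof -
    show "x \<noteq> \<theta>"
    proof
      assume "x = \<theta>"
      then have "2 * N = N" using Kx\<theta> by (simp add: N_def)
      then show False using N0 by simp
    qed
    show "y \<noteq> \<theta>" using \<Phi>D(2)[OF x(1)] by (simp add: y_def)
  qed
  have hx: "ht x > 0" and hy: "ht y > 0"
  proof -
    have "\<theta> = of_int 1 *s x + of_int 1 *s y" using xy by simp
    then have s: "ht \<theta> = 1 * ht x + 1 * ht y" by (rule ht_linear[OF x(1) y\<Phi> \<theta>(1)])
    show "ht x > 0" using s \<theta>_highest(1)[OF y\<Phi>] ht(2)[OF x(1)] by simp
    show "ht y > 0" using s \<theta>_highest(1)[OF x(1)] ht(2)[OF y\<Phi>] by simp
  qed
  have \<theta>x: "\<theta> + x \<notin> \<Phi>" "\<theta> + y \<notin> \<Phi>"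
    using add_\<theta>_not_root[OF x(1) hx] add_\<theta>_not_root[OF y\<Phi> hy] .
  have n\<theta>x: "- \<theta> + - x \<notin> \<Phi>" "- \<theta> + - y \<notin> \<Phi>"
    using neg_\<Phi>[of "- \<theta> + - x"] neg_\<Phi>[of "- \<theta> + - y"] \<theta>x by (auto simp: add.commute)
  have sum0: "\<theta> + z \<noteq> 0" "- \<theta> + - z \<noteq> 0" if z: "z \<in> \<Phi>" "ht z > 0" for z
  proof -
    have "z \<noteq> - \<theta>" using ht_neg[OF \<theta>(1)] ht_\<theta>_pos z by auto
    then show "\<theta> + z \<noteq> 0" "- \<theta> + - z \<noteq> 0" by (auto simp: add_eq_0_iff)
  qed
  have diff: "x - y \<noteq> 0" "x - y \<notin> \<Phi>"
  proof -
    show "x - y \<noteq> 0"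
    proof
      assume "x - y = 0"
      then have "2 * N = - N" using Kxx Kxy by simp
      then show False using N0 by (simp add: eq_neg_iff_add_eq_0)
    qed
    show "x - y \<notin> \<Phi>"
    proof
      assume z: "x - y \<in> \<Phi>"
      \<comment> \<open>If \<open>x - y\<close> were a root, its Cartan integer would be 3 and its
        reflection would be \<open>- \<theta> - x\<close>, which is excluded by height.\<close>
      have "2 * K (x - y) x = of_int 3 * K x x"
        using Kxx Kxy killing_form_sym[of x y] by (simp add: killing_form_simps' algebra_simps)
      then have "cn (x - y) x = 3" by (rule cn_eqI[OF x(1)])
      then have "x - y - of_int 3 *s x \<in> \<Phi>" using reflection[OF x(1) z] by simp
      moreover have "x - y - of_int 3 *s x = - \<theta> + - x" unfolding xy(1)[symmetric] by (simp add: vec_eq_iff)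
      ultimately show False using n\<theta>x(1) by metis
    qed
  qed
  have diff': "y - x \<noteq> 0" "y - x \<notin> \<Phi>" using diff neg_\<Phi>[of "y - x"] by auto
  obtain F where F: "F \<in> R (- \<theta>)" "K E F = 1" using opposite_root_vector_exists[OF E] .
  have EF: "br E F = \<theta>" using br_opposite[OF E(1) F(1) hs(3)] F(2) by simp
  have F0: "F \<noteq> 0" using F(2) by (auto simp: killing_form_simps')
  obtain ux where ux: "ux \<in> R x" "ux \<noteq> 0" using x(1) by (auto simp: \<Phi>_def)
  obtain uy where uy: "uy \<in> R y" "uy \<noteq> 0" using y\<Phi> by (auto simp: \<Phi>_def)
  obtain wx where wx: "wx \<in> R (- x)" "K ux wx = 1" using opposite_root_vector_exists[OF ux] .
  obtain wy where wy: "wy \<in> R (- y)" "K uy wy = 1" using opposite_root_vector_exists[OF uy] .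
  define b where "b = ux + uy"
  \<comment> \<open>The factor \<open>2 / N\<close> gives \<open>[b, n] = H\<close> with
    \<open>[H, b] = b\<close>. The semisimple element of the usual triple is \<open>2 H\<close>, so
    the eigenvalue \<open>- 2\<close> of \<open>H\<close> on \<open>F\<close> is the weight
    \<open>- 4\<close>.\<close>
  define n where "n = (2 / N) *s (wx + wy)"
  define H where "H = (2 / N) *s \<theta>"
  have "br ux wy = 0" "br uy wx = 0"
    using R_trivial[OF br_R[OF ux(1) wy(1)]] R_trivial[OF br_R[OF uy(1) wx(1)]] diff diff' hs h_closed by auto
  moreover have "br ux wx = x" "br uy wy = y"
    using br_opposite[OF ux(1) wx(1)] br_opposite[OF uy(1) wy(1)] wx(2) wy(2) hs by simp_all
  ultimately have bn: "br b n = H" 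
    by (simp add: b_def n_def H_def br_simps xy(1)[symmetric])
  have "br \<theta> ux = (N / 2) *s ux" "br \<theta> uy = (N / 2) *s uy"
    using RD[OF ux(1) hs(3)] RD[OF uy(1) hs(3)] Kx\<theta> Ky\<theta>(1) by (simp_all add: eq_divide_eq mult.commute)
  then have \<theta>b: "br \<theta> b = (N / 2) *s b" by (simp add: b_def br_simps vec.scale_right_distrib)
  then have Hb: "br H b = b" using N0 by (simp add: H_def br_simps)
  have HF: "br H F = (- 2) *s F"
    using RD[OF F(1) hs(3)] N0 by (simp add: H_def br_simps killing_form_simps' N_def)
  have "br wx F = 0" "br wy F = 0"
    using R_trivial[OF br_R[OF wx(1) F(1)]] R_trivial[OF br_R[OF wy(1) F(1)]] n\<theta>x sum0(2)[OF x(1) hx]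
      sum0(2)[OF y\<Phi> hy] hs h_closed by (simp_all add: add.commute)
  then have nF: "br n F = 0" by (simp add: n_def br_simps)
  have brH: "br H (br b v) = br b v + br b (br H v)" for v
    using br_derivation[of H b v] Hb by simp
  have brn: "br n (br b v) = br b (br n v) - br H v" for v
    using br_derivation[of n b v] bn br_anti[of n b] by (simp add: br_simps)
  \<comment> \<open>Raising the lowest weight vector \<open>F\<close> four times; applying
    \<open>n\<close> goes back down with the factors 2, 3, 3, 2, so no vector on the way up is
    zero.\<close>
  define v1 where "v1 = br b F"
  define v2 where "v2 = br b v1"
  define v3 where "v3 = br b v2"
  define v4 where "v4 = br b v3"
  have H1: "br H v1 = - v1" unfolding v1_def brH HF br_simps by (simp add: vec_eq_iff)
  have H2: "br H v2 = 0" unfolding v2_def brH H1 br_simps by simp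
  have H3: "br H v3 = v3" unfolding v3_def brH H2 br_simps by simp
  have n1: "br n v1 = 2 *s F" unfolding v1_def brn nF HF br_simps by (simp add: vec_eq_iff)
  have n2: "br n v2 = 3 *s v1"
    unfolding v2_def brn n1 H1 br_simps v1_def[symmetric] by (simp add: vec_eq_iff)
  have n3: "br n v3 = 3 *s v2"
    unfolding v3_def brn n2 H2 br_simps v2_def[symmetric] by simp
  have n4: "br n v4 = 2 *s v3"
    unfolding v4_def brn n3 H3 br_simps v3_def[symmetric] by (simp add: vec_eq_iff)
  have "v1 \<noteq> 0" using n1 F0 by (auto simp: br_simps)
  then have "v2 \<noteq> 0" using n2 by (auto simp: br_simps)
  then have "v3 \<noteq> 0" using n3 by (auto simp: br_simps)
  then have v4: "v4 \<noteq> 0" using n4 by (auto simp: br_simps)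
  have "br E ux = 0" "br E uy = 0"
    using R_trivial[OF br_R[OF E(1) ux(1)]] R_trivial[OF br_R[OF E(1) uy(1)]] \<theta>x sum0(1)[OF x(1) hx]
      sum0(1)[OF y\<Phi> hy] hs h_closed by simp_all
  then have Eb: "br E b = 0" by (simp add: b_def br_simps)
  have \<theta>E: "br \<theta> E = N *s E" using RD[OF E(1) hs(3)] by (simp add: N_def)
  have b\<theta>: "br b \<theta> = (- (N / 2)) *s b" using \<theta>b br_anti[of b \<theta>] by (simp add: vec_eq_iff)
  \<comment> \<open>\<open>E\<close> commutes with \<open>b\<close>, sends \<open>v1\<close> to a
    multiple of \<open>b\<close> and kills \<open>v2\<close> and \<open>v3\<close>. Consequently the
    terms with \<open>r\<close> drop out and \<open>(ad w)^4 F = t^4 v4\<close>.\<close>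
  have E1: "br E v1 = (- (N / 2)) *s b"
    using br_derivation[of E b F] Eb EF b\<theta> by (simp add: v1_def br_simps)
  have E2: "br E v2 = 0"
    using br_derivation[of E b v1] Eb E1 alternating[of b] by (simp add: v2_def br_simps)
  have E3: "br E v3 = 0"
    using br_derivation[of E b v2] Eb E2 by (simp add: v3_def br_simps)
  have b4: "br w (br w (br w (br w F))) \<noteq> 0" if w: "w = t *s b + r *s E" and t: "t \<noteq> 0" for r t w
  proof -
    have wb: "br w b = 0" and wE: "br w E = 0"
      using Eb br_anti[of b E] alternating[of b] alternating[of E] by (simp_all add: w br_simps)
    have w\<theta>: "br w \<theta> = (- (t * N / 2)) *s b + (- (r * N)) *s E"
      using b\<theta> \<theta>E br_anti[of E \<theta>] by (simp add: w br_simps vec_eq_iff)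
    have "br w F = t *s v1 + r *s \<theta>" by (simp add: w br_simps EF v1_def)
    moreover have "br w v1 = t *s v2 + (- (r * N / 2)) *s b" by (simp add: w br_simps E1 v2_def vec_eq_iff)
    ultimately have "br w (br w (br w F)) = (t * t) *s br w v2"
      by (simp add: br_simps w\<theta> wb wE)
    moreover have "br w v2 = t *s v3" by (simp add: w br_simps E2 v3_def)
    moreover have "br w v3 = t *s v4" by (simp add: w br_simps E3 v4_def)
    ultimately have "br w (br w (br w (br w F))) = (t * t * (t * t)) *s v4" by (simp add: br_simps mult.assoc)
    then show ?thesis using t v4 by simp
  qed
  \<comment> \<open>The fibre consists of brackets of negative root vectors with \<open>E\<close>;
    the bracket \<open>[b, F]\<close> has components of weights \<open>- x\<close> and
    \<open>- y\<close> and recovers \<open>b\<close> up to scale.\<close>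
  have bE: "b = br ((2 / N) *s br b F) E"
  proof -
    have "br E (br b F) = br b \<theta>" using br_derivation[of E b F] Eb EF by (simp add: br_simps)
    also have "\<dots> = - ((N / 2) *s b)" using \<theta>b br_anti[of b \<theta>] by simp
    finally have "br (br b F) E = (N / 2) *s b" using br_anti[of "br b F" E] by simp
    then show ?thesis using N0 by (simp add: br_simps)
  qed
  let ?N = "\<Union>\<alpha>\<in>{\<alpha> \<in> roots br h. \<alpha> \<noteq> neg_weight h \<rho> \<and> Re (weight_form br h \<alpha> \<rho>) < 0}. W \<alpha>"
  have neg: "R (- z) \<subseteq> ?N" if z: "z \<in> \<Phi>" "z \<noteq> \<theta>" "2 * K z \<theta> = N" for z
  proof -
    let ?\<alpha> = "restrict (K (- z)) h"
    have zh: "z \<in> h" using \<Phi>D(1) z(1) .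
    have "?\<alpha> \<in> roots br h" using restrict_root(1)[OF neg_\<Phi>[OF z(1)]] .
    moreover have "?\<alpha> \<noteq> neg_weight h \<rho>"
    proof
      assume eq: "?\<alpha> = neg_weight h \<rho>"
      have "K z t = K \<theta> t" if t: "t \<in> h" for t
        using fun_cong[OF eq, of t] t \<theta>(2)[OF t] by (simp add: neg_weight_def killing_form_simps')
      then have "z = \<theta>" using h_eqI zh hs(3) by blast
      then show False using z(2) by blast
    qed
    moreover have "weight_form br h ?\<alpha> \<rho> = K (- z) \<theta>"
      unfolding weight_form_def using restrict_root(2)[OF neg_\<Phi>[OF z(1)]] by (simp add: \<theta>_def)
    moreover have "Re (K (- z) \<theta>) < 0"
    proof -
      have "Re (2 * K z \<theta>) = Re N" using z(3) by (rule arg_cong)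
      then show ?thesis using Npos by (simp add: killing_form_simps')
    qed
    ultimately have "?\<alpha> \<in> {\<alpha> \<in> roots br h. \<alpha> \<noteq> neg_weight h \<rho> \<and> Re (weight_form br h \<alpha> \<rho>) < 0}"
      by (intro CollectI conjI) (simp_all only: not_False_eq_True)
    then have "W ?\<alpha> \<subseteq> ?N" by (rule UN_upper)
    moreover have "W ?\<alpha> = R (- z)" unfolding R_def by (rule W_cong) simp
    ultimately show ?thesis by (simp only:)
  qed
  have "br ux F \<in> R (- y)" "br uy F \<in> R (- x)"
    using br_R[OF ux(1) F(1)] br_R[OF uy(1) F(1)] by (simp_all add: y_def)
  then have "br ux F \<in> vec.span ?N" "br uy F \<in> vec.span ?N"
    using subsetD[OF neg[OF x(1) x_ne(1) Kx\<theta>]] subsetD[OF neg[OF y\<Phi> x_ne(2) Ky\<theta>(1)]]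
    by (simp_all only: vec.span_base)
  then have bFN: "(2 / N) *s br b F \<in> vec.span ?N"
    by (simp add: b_def br_simps vec.span_add vec.span_scale)
  have bcf: "b \<in> contact_fibre br h \<rho> E"
    unfolding contact_fibre_def by (rule vec.span_base, rule insertI2, rule image_eqI[OF _ bFN], rule bE)
  have "b \<notin> vec.span {E}"
  proof
    assume "b \<in> vec.span {E}"
    then obtain k where k: "b = k *s E" by (auto simp: vec.span_singleton)
    then have "N *s b = (N / 2) *s b" using \<theta>b \<theta>E by (simp add: br_simps mult.commute)
    then have "b = 0" using N0 by simp
    then show False using v4 by (simp add: v4_def br_simps)
  qed
  then show ?thesis using that bcf b4 by blast
qed

end

section \<open>Recognizing type C\<close>

context based_simple_lie_algebra
begin

section \<open>Reflections and the Weyl orbit of the highest root\<close>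

definition rf :: "complex^'n \<Rightarrow> complex^'n \<Rightarrow> complex^'n"
  where "rf x y = y - of_int (cn y x) *s x"

lemma rf_root: "x \<in> \<Phi> \<Longrightarrow> y \<in> \<Phi> \<Longrightarrow> rf x y \<in> \<Phi>"
  unfolding rf_def by (rule reflection)

lemma rf_alt:
  assumes x: "x \<in> \<Phi>" and y: "y \<in> \<Phi>"
  shows "rf x y = y - (2 * K y x / K x x) *s x"
proof -
  have "of_int (cn y x) = 2 * K y x / K x x"
    using cn[OF x y] root_norm_nonzero[OF x] by (simp add: eq_divide_eq)
  then show ?thesis by (simp only: rf_def)
qed

lemma killing_form_rf:
  assumes x: "x \<in> \<Phi>" and y: "y \<in> \<Phi>" and z: "z \<in> \<Phi>"
  shows "K (rf x y) (rf x z) = K y z"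
proof -
  have "K (rf x y) (rf x z) = K y z - (2 * K z x / K x x) * K y x
      - (2 * K y x / K x x) * K x z + (2 * K y x / K x x) * ((2 * K z x / K x x) * K x x)"
    unfolding rf_alt[OF x y] rf_alt[OF x z]
    by (simp add: killing_form_simps killing_form_simps' algebra_simps)
  also have "\<dots> = K y z"
    using root_norm_nonzero[OF x] killing_form_sym[of x z] by (simp add: field_simps)
  finally show ?thesis .
qed

lemma cn_rf:
  assumes x: "x \<in> \<Phi>" and y: "y \<in> \<Phi>" and z: "z \<in> \<Phi>"
  shows "cn (rf x y) (rf x z) = cn y z"
  using cn[OF z y] killing_form_rf[OF x y z] killing_form_rf[OF x z z]
  by (intro cn_eqI rf_root x z) simp

lemma rf_rf:
  assumes x: "x \<in> \<Phi>" and y: "y \<in> \<Phi>"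
  shows "rf x (rf x y) = y"
proof -
  have "2 * K (rf x y) x = of_int (- cn y x) * K x x"
    using cn[OF x y] by (simp add: rf_def killing_form_simps killing_form_simps' algebra_simps)
  then have "cn (rf x y) x = - cn y x" by (rule cn_eqI[OF x])
  then show ?thesis unfolding rf_def[of x "rf x y"] by (simp add: rf_def)
qed

text \<open>The Weyl orbit of \<open>\<theta>\<close> rather than all roots of its length: facts
  about \<open>\<theta>\<close> obtained from heights spread over the orbit by induction, because
  reflections preserve Cartan integers.\<close>

inductive_set long :: "(complex^'n) set"
  where theta: "\<theta> \<in> long"
  | reflect: "\<delta> \<in> long \<Longrightarrow> x \<in> \<Phi> \<Longrightarrow> rf x \<delta> \<in> long"

lemma long_root: "\<delta> \<in> long \<Longrightarrow> \<delta> \<in> \<Phi>"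
  by (induction rule: long.induct) (simp_all add: \<theta>(1) rf_root)

lemma long_norm: "\<delta> \<in> long \<Longrightarrow> K \<delta> \<delta> = K \<theta> \<theta>"
  by (induction rule: long.induct) (simp_all add: killing_form_rf long_root)

lemma rf_self: "x \<in> \<Phi> \<Longrightarrow> rf x x = - x"
proof -
  assume x: "x \<in> \<Phi>"
  have "cn x x = 2" by (rule cn_eqI[OF x]) simp
  then show ?thesis by (simp add: rf_def vec_eq_iff)
qed

lemma neg_long: "\<delta> \<in> long \<Longrightarrow> - \<delta> \<in> long"
  using long.reflect[of \<delta> \<delta>] long_root[of \<delta>] rf_self[of \<delta>] by simp

lemma long_cn:
  assumes "\<delta> \<in> long" "x \<in> \<Phi>"
  shows "cn x \<delta> \<le> 2" "- 2 \<le> cn x \<delta>" "cn x \<delta> = 2 \<Longrightarrow> x = \<delta>" "cn x \<delta> = - 2 \<Longrightarrow> x = - \<delta>"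
proof -
  have "\<forall>x\<in>\<Phi>. cn x \<delta> \<le> 2 \<and> - 2 \<le> cn x \<delta> \<and> (cn x \<delta> = 2 \<longrightarrow> x = \<delta>) \<and> (cn x \<delta> = - 2 \<longrightarrow> x = - \<delta>)"
    using assms(1)
  proof (induction rule: long.induct)
    case theta
    show ?case using cn_\<theta>_le cn_\<theta>_ge by blast
  next
    case (reflect \<delta> z)
    note \<delta> = long_root[OF reflect.hyps(1)] and z = reflect.hyps(2)
    show ?case
    proof
      fix x assume x: "x \<in> \<Phi>"
      have c: "cn x (rf z \<delta>) = cn (rf z x) \<delta>"
        using cn_rf[OF z rf_root[OF z x] \<delta>] rf_rf[OF z x] by simp
      have "rf z x = \<delta> \<Longrightarrow> x = rf z \<delta>" using rf_rf[OF z x] by simp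
      moreover have "x = - rf z \<delta>" if e: "rf z x = - \<delta>"
      proof -
        have "x = rf z (- \<delta>)" using rf_rf[OF z x] e by simp
        also have "\<dots> = - rf z \<delta>" using cn_neg[OF z \<delta>] by (simp add: rf_def)
        finally show ?thesis .
      qed
      ultimately show "cn x (rf z \<delta>) \<le> 2 \<and> - 2 \<le> cn x (rf z \<delta>) \<and> (cn x (rf z \<delta>) = 2 \<longrightarrow> x = rf z \<delta>) \<and>
          (cn x (rf z \<delta>) = - 2 \<longrightarrow> x = - rf z \<delta>)"
        using bspec[OF reflect.IH rf_root[OF z x]] c by metis
    qed
  qed
  from bspec[OF this assms(2)]
  show "cn x \<delta> \<le> 2" "- 2 \<le> cn x \<delta>" "cn x \<delta> = 2 \<Longrightarrow> x = \<delta>" "cn x \<delta> = - 2 \<Longrightarrow> x = - \<delta>" by blast+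
qed

lemma long_cn_one:
  assumes short: "\<And>x. x \<in> \<Phi> \<Longrightarrow> cn x \<theta> = 1 \<Longrightarrow> cn \<theta> x \<noteq> 1"
    and "\<delta> \<in> long" "x \<in> \<Phi>" "cn x \<delta> = 1"
  shows "cn \<delta> x \<noteq> 1"
proof -
  have "\<forall>x\<in>\<Phi>. cn x \<delta> = 1 \<longrightarrow> cn \<delta> x \<noteq> 1"
    using assms(2)
  proof (induction rule: long.induct)
    case theta
    show ?case using short by blast
  next
    case (reflect \<delta> z)
    note \<delta> = long_root[OF reflect.hyps(1)] and z = reflect.hyps(2)
    show ?case
    proof
      fix x assume x: "x \<in> \<Phi>"
      have "cn x (rf z \<delta>) = cn (rf z x) \<delta>" "cn (rf z \<delta>) x = cn \<delta> (rf z x)"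
        using cn_rf[OF z rf_root[OF z x] \<delta>] cn_rf[OF z \<delta> rf_root[OF z x]] rf_rf[OF z x] by simp_all
      then show "cn x (rf z \<delta>) = 1 \<longrightarrow> cn (rf z \<delta>) x \<noteq> 1"
        using bspec[OF reflect.IH rf_root[OF z x]] by metis
    qed
  qed
  then show ?thesis using assms by blast
qed

section \<open>The long roots span all roots\<close>

lemma simple_dual_element: "\<beta> \<in> \<Delta> \<Longrightarrow> dual_element br h \<beta> \<in> \<Phi>"
  using base root_dual_element(1) by (auto simp: simple_roots_def)

text \<open>\<open>\<delta>\<close> and its reflection in \<open>x\<close> are both long and differ
  by a nonzero multiple of \<open>x\<close>.\<close>

lemma root_not_orthogonal_in_span:
  assumes x: "x \<in> \<Phi>" and \<delta>: "\<delta> \<in> long" "K \<delta> x \<noteq> 0"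
  shows "x \<in> vec.span long"
proof -
  have "cn \<delta> x \<noteq> 0" using cn[OF x long_root[OF \<delta>(1)]] \<delta>(2) by auto
  then have "x = (1 / of_int (cn \<delta> x)) *s (\<delta> - rf x \<delta>)" by (simp add: rf_def)
  then show ?thesis
    using \<delta>(1) long.reflect[OF \<delta>(1) x] by (metis vec.span_base vec.span_diff vec.span_scale)
qed

lemma orthogonal_span_long:
  assumes "\<And>\<delta>. \<delta> \<in> long \<Longrightarrow> K \<delta> x = 0" "v \<in> vec.span long"
  shows "K v x = 0"
proof -
  have "vec.subspace {v. K v x = 0}"
    by (rule vec.subspaceI) (auto simp: killing_form_simps killing_form_simps')
  then have "vec.span long \<subseteq> {v. K v x = 0}" using assms(1) by (intro vec.span_minimal) auto
  then show ?thesis using assms(2) by blast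
qed

text \<open>Decompose \<open>\<theta>\<close> along the simple roots in the span of the long roots and the simple roots
  orthogonal to it; the second component is isotropic, hence zero, but it contains every simple root
  of the second kind with positive coefficient.\<close>

lemma roots_in_span_long:
  assumes x: "x \<in> \<Phi>"
  shows "x \<in> vec.span long"
proof (rule ccontr)
  assume nx: "x \<notin> vec.span long"
  let ?d = "dual_element br h"
  define \<Delta>\<^sub>2 where "\<Delta>\<^sub>2 = {\<beta>\<in>\<Delta>. \<forall>\<delta>\<in>long. K \<delta> (?d \<beta>) = 0}"
  note b = base[unfolded simple_roots_def]
  have fin: "finite \<Delta>" by (rule conjunct1[OF b])
  have rt: "\<Delta> \<subseteq> roots br h" by (rule conjunct1[OF conjunct2[OF b]])
  have d1: "?d \<beta> \<in> vec.span long" if \<beta>: "\<beta> \<in> \<Delta> - \<Delta>\<^sub>2" for \<beta>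
  proof -
    obtain \<delta> where "\<delta> \<in> long" "K \<delta> (?d \<beta>) \<noteq> 0" using \<beta> unfolding \<Delta>\<^sub>2_def by blast
    moreover have "?d \<beta> \<in> \<Phi>" using \<beta> simple_dual_element by blast
    ultimately show ?thesis using root_not_orthogonal_in_span by blast
  qed
  have \<beta>K: "\<beta> t = K (?d \<beta>) t" if "\<beta> \<in> \<Delta>" "t \<in> h" for \<beta> t
    using root_dual_element(2)[OF _ that(2)] rt that(1) by blast
  have dh: "?d \<beta> \<in> h" if "\<beta> \<in> \<Delta>" for \<beta> using simple_dual_element[OF that] by (rule \<Phi>D)
  have expand: "\<exists>c :: _ \<Rightarrow> int. y = (\<Sum>\<beta>\<in>\<Delta>. of_int (c \<beta>) *s ?d \<beta>) \<and>
      (\<forall>t\<in>h. restrict (K y) h t = (\<Sum>\<beta>\<in>\<Delta>. of_int (c \<beta>) * \<beta> t))" if y: "y \<in> \<Phi>" for y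
  proof -
    obtain c :: "_ \<Rightarrow> int" where c: "\<forall>t\<in>h. restrict (K y) h t = (\<Sum>\<beta>\<in>\<Delta>. of_int (c \<beta>) * \<beta> t)"
      using root_coefficients[OF restrict_root(1)[OF y]] by (elim exE conjE)
    have "y = (\<Sum>\<beta>\<in>\<Delta>. of_int (c \<beta>) *s ?d \<beta>)"
    proof (rule h_eqI)
      show "(\<Sum>\<beta>\<in>\<Delta>. of_int (c \<beta>) *s ?d \<beta>) \<in> h"
        using dh by (intro vec.subspace_sum[OF subspace_h] h_closed(2))
      show "K y t = K (\<Sum>\<beta>\<in>\<Delta>. of_int (c \<beta>) *s ?d \<beta>) t" if t: "t \<in> h" for t
      proof -
        have "K y t = restrict (K y) h t" using t by simp
        also have "\<dots> = (\<Sum>\<beta>\<in>\<Delta>. of_int (c \<beta>) * \<beta> t)" using c t by blast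
        also have "\<dots> = (\<Sum>\<beta>\<in>\<Delta>. of_int (c \<beta>) * K (?d \<beta>) t)"
          by (intro sum.cong refl arg_cong[of _ _ "\<lambda>z. _ * z"] \<beta>K t)
        also have "\<dots> = K (\<Sum>\<beta>\<in>\<Delta>. of_int (c \<beta>) *s ?d \<beta>) t"
          by (simp add: killing_form_sum killing_form_simps)
        finally show ?thesis .
      qed
    qed (use \<Phi>D(1)[OF y] in simp)
    then show ?thesis using c by (intro exI[of _ c] conjI)
  qed
  show False
  proof (cases "\<Delta>\<^sub>2 = {}")
    case True
    obtain c :: "_ \<Rightarrow> int" where c: "x = (\<Sum>\<beta>\<in>\<Delta>. of_int (c \<beta>) *s ?d \<beta>)" using expand[OF x] by (elim exE conjE)
    have "x \<in> vec.span long"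
      unfolding c using d1 True by (intro vec.span_sum vec.span_scale) simp
    then show False using nx by blast
  next
    case False
    then obtain \<gamma> where \<gamma>: "\<gamma> \<in> \<Delta>\<^sub>2" by blast
    then have \<gamma>\<Delta>: "\<gamma> \<in> \<Delta>" by (simp add: \<Delta>\<^sub>2_def)
    obtain c :: "_ \<Rightarrow> int" where c: "\<theta> = (\<Sum>\<beta>\<in>\<Delta>. of_int (c \<beta>) *s ?d \<beta>)"
      and c\<theta>: "\<forall>t\<in>h. restrict (K \<theta>) h t = (\<Sum>\<beta>\<in>\<Delta>. of_int (c \<beta>) * \<beta> t)"
      using expand[OF \<theta>(1)] by (elim exE conjE)
    have "\<exists>k :: _ \<Rightarrow> nat. \<forall>t\<in>h. \<rho> t - \<gamma> t = (\<Sum>\<beta>\<in>\<Delta>. of_nat (k \<beta>) * \<beta> t)"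
      by (rule bspec[OF conjunct2[OF highest[unfolded highest_root_def]]]) (use rt \<gamma>\<Delta> in blast)
    then obtain k :: "_ \<Rightarrow> nat" where k: "\<forall>t\<in>h. \<rho> t - \<gamma> t = (\<Sum>\<beta>\<in>\<Delta>. of_nat (k \<beta>) * \<beta> t)" by (elim exE)
    have indep: "\<forall>\<beta>\<in>\<Delta>. f \<beta> = 0" if "\<forall>t\<in>h. (\<Sum>\<beta>\<in>\<Delta>. f \<beta> * \<beta> t) = 0" for f :: "_ \<Rightarrow> complex"
      using conjunct1[OF conjunct2[OF conjunct2[OF b]]] that by blast
    \<comment> \<open>\<open>\<rho> - \<gamma>\<close> has nonnegative coefficients \<open>k\<close>
      because \<open>\<rho>\<close> is highest. By independence of the simple roots the coefficient
      of \<open>\<gamma>\<close> in \<open>\<theta>\<close> is therefore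
      \<open>k \<gamma> + 1\<close>, which is positive.\<close>
    define f where "f \<beta> = of_int (c \<beta>) - of_nat (k \<beta>) - (if \<beta> = \<gamma> then 1 else (0::complex))" for \<beta>
    have "(\<Sum>\<beta>\<in>\<Delta>. f \<beta> * \<beta> t) = 0" if t: "t \<in> h" for t
    proof -
      have "(\<Sum>\<beta>\<in>\<Delta>. f \<beta> * \<beta> t) = (\<Sum>\<beta>\<in>\<Delta>. of_int (c \<beta>) * \<beta> t) - (\<Sum>\<beta>\<in>\<Delta>. of_nat (k \<beta>) * \<beta> t)
          - (\<Sum>\<beta>\<in>\<Delta>. (if \<beta> = \<gamma> then 1 else 0) * \<beta> t)"
        by (simp add: f_def left_diff_distrib sum_subtractf)
      also have "(\<Sum>\<beta>\<in>\<Delta>. of_int (c \<beta>) * \<beta> t) = \<rho> t" using c\<theta> t \<theta>(2)[OF t] by simp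
      also have "(\<Sum>\<beta>\<in>\<Delta>. of_nat (k \<beta>) * \<beta> t) = \<rho> t - \<gamma> t" using k t by simp
      also have "(\<Sum>\<beta>\<in>\<Delta>. (if \<beta> = \<gamma> then 1 else 0) * \<beta> t) = (\<Sum>\<beta>\<in>\<Delta>. if \<beta> = \<gamma> then \<gamma> t else 0)"
        by (intro sum.cong) auto
      also have "\<dots> = \<gamma> t" using fin \<gamma>\<Delta> by simp
      finally show ?thesis by simp
    qed
    then have "f \<gamma> = 0" using indep \<gamma>\<Delta> by blast
    then have "of_int (c \<gamma>) = (of_int (int (k \<gamma>) + 1) :: complex)" by (simp add: f_def algebra_simps)
    then have c\<gamma>: "c \<gamma> = int (k \<gamma>) + 1" by (simp only: of_int_eq_iff)
    define \<theta>\<^sub>1 where "\<theta>\<^sub>1 = (\<Sum>\<beta>\<in>\<Delta> - \<Delta>\<^sub>2. of_int (c \<beta>) *s ?d \<beta>)"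
    define \<theta>\<^sub>2 where "\<theta>\<^sub>2 = (\<Sum>\<beta>\<in>\<Delta>\<^sub>2. of_int (c \<beta>) *s ?d \<beta>)"
    have \<Delta>\<^sub>2: "\<Delta>\<^sub>2 \<subseteq> \<Delta>" "finite \<Delta>\<^sub>2" using fin by (auto simp: \<Delta>\<^sub>2_def)
    have sum: "\<theta> = \<theta>\<^sub>1 + \<theta>\<^sub>2" unfolding \<theta>\<^sub>1_def \<theta>\<^sub>2_def c by (rule sum.subset_diff[OF \<Delta>\<^sub>2(1) fin])
    have "\<theta>\<^sub>1 \<in> vec.span long" unfolding \<theta>\<^sub>1_def using d1 by (intro vec.span_sum vec.span_scale)
    \<comment> \<open>The second component is a difference of two vectors in the span of the long
      roots, while its own summands are orthogonal to that span.\<close>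
    then have 2: "\<theta>\<^sub>2 \<in> vec.span long" using sum long.theta by (metis add_diff_cancel_left' vec.span_base vec.span_diff)
    have "K \<theta>\<^sub>2 (?d \<beta>) = 0" if "\<beta> \<in> \<Delta>\<^sub>2" for \<beta>
      using orthogonal_span_long[OF _ 2, of "?d \<beta>"] that by (simp add: \<Delta>\<^sub>2_def)
    then have "K \<theta>\<^sub>2 \<theta>\<^sub>2 = 0"
      by (subst (2) \<theta>\<^sub>2_def) (simp add: killing_form_sum killing_form_simps)
    moreover have "\<theta>\<^sub>2 \<in> h"
      unfolding \<theta>\<^sub>2_def using dh \<Delta>\<^sub>2 by (intro vec.subspace_sum[OF subspace_h] h_closed(2)) blast
    moreover have "K y \<theta>\<^sub>2 \<in> \<real>" if "y \<in> \<Phi>" for y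
      unfolding \<theta>\<^sub>2_def killing_form_sum killing_form_simps
      using killing_form_roots_real[OF simple_dual_element that] \<Delta>\<^sub>2(1)
      by (intro sum_in_Reals Reals_mult) auto
    ultimately have 0: "\<theta>\<^sub>2 = 0" using killing_form_definite by blast
    define g where "g \<beta> = (if \<beta> \<in> \<Delta>\<^sub>2 then of_int (c \<beta>) else (0::complex))" for \<beta>
    have "(\<Sum>\<beta>\<in>\<Delta>. g \<beta> * \<beta> t) = 0" if t: "t \<in> h" for t
    proof -
      have "(\<Sum>\<beta>\<in>\<Delta>. g \<beta> * \<beta> t) = (\<Sum>\<beta>\<in>\<Delta>\<^sub>2. of_int (c \<beta>) * K (?d \<beta>) t)"
        using \<Delta>\<^sub>2 fin \<beta>K t by (intro sum.mono_neutral_cong_right) (auto simp: g_def)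
      also have "\<dots> = K \<theta>\<^sub>2 t" by (simp add: \<theta>\<^sub>2_def killing_form_sum killing_form_simps)
      also have "\<dots> = 0" using 0 by (simp add: killing_form_simps')
      finally show ?thesis .
    qed
    then have "g \<gamma> = 0" using indep \<gamma>\<Delta> by blast
    then have "c \<gamma> = 0" using \<gamma> by (simp add: g_def)
    then show False using c\<gamma> by simp
  qed
qed

end

text \<open>If no root with \<open>cn x \<theta> = 1\<close> is as long as \<open>\<theta>\<close>, then the long roots are, up to sign, pairwise
  orthogonal vectors \<open>\<delta>\<^sub>i\<close>, and the other roots are the vectors \<open>(\<plusminus>\<delta>\<^sub>i \<plusminus> \<delta>\<^sub>j) / 2\<close>.\<close>

locale no_adjacent_long_root = based_simple_lie_algebra br h \<Delta> \<rho>
  for br :: "complex^'n \<Rightarrow> complex^'n \<Rightarrow> complex^'n" and h \<Delta> \<rho> +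
  assumes short: "\<And>x. x \<in> \<Phi> \<Longrightarrow> cn x \<theta> = 1 \<Longrightarrow> cn \<theta> x \<noteq> 1"
begin

section \<open>Orthogonality of the long roots and decomposition of the other roots\<close>

definition N :: complex
  where "N = K \<theta> \<theta>"

lemma N_nonzero: "N \<noteq> 0"
  unfolding N_def by (rule root_norm_nonzero[OF \<theta>(1)])

lemma long_norm_N: "\<delta> \<in> long \<Longrightarrow> K \<delta> \<delta> = N"
  unfolding N_def by (rule long_norm)

text \<open>Roots of equal length have equal Cartan integers in both orders. The values 1 and -1 are
  excluded by \<open>short\<close>, while 2 and -2 occur only for equal or opposite roots.\<close>

lemma long_orthogonal:
  assumes "\<delta> \<in> long" "\<epsilon> \<in> long" "\<epsilon> \<noteq> \<delta>" "\<epsilon> \<noteq> - \<delta>"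
  shows "K \<epsilon> \<delta> = 0"
proof -
  have *: "cn \<epsilon> \<delta> \<noteq> 1" if "\<epsilon> \<in> long" for \<epsilon>
  proof
    assume 1: "cn \<epsilon> \<delta> = 1"
    have "2 * K \<epsilon> \<delta> = N"
      using cn[OF long_root[OF assms(1)] long_root[OF that]] 1 long_norm_N[OF assms(1)] by simp
    then have "2 * K \<delta> \<epsilon> = of_int 1 * K \<epsilon> \<epsilon>"
      using killing_form_sym[of \<delta> \<epsilon>] long_norm_N[OF that] by simp
    then have "cn \<delta> \<epsilon> = 1" by (rule cn_eqI[OF long_root[OF that]])
    then show False using long_cn_one[OF short assms(1) long_root[OF that] 1] by blast
  qed
  have "cn (- \<epsilon>) \<delta> = - cn \<epsilon> \<delta>" using cn_neg[OF long_root[OF assms(1)] long_root[OF assms(2)]] .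
  then have "cn \<epsilon> \<delta> \<noteq> 1" "cn \<epsilon> \<delta> \<noteq> -1" using *[OF assms(2)] *[OF neg_long[OF assms(2)]] by simp_all
  moreover have "cn \<epsilon> \<delta> \<noteq> 2" "cn \<epsilon> \<delta> \<noteq> - 2" "cn \<epsilon> \<delta> \<le> 2" "- 2 \<le> cn \<epsilon> \<delta>"
    using long_cn[OF assms(1) long_root[OF assms(2)]] assms(3,4) by blast+
  ultimately have "cn \<epsilon> \<delta> = 0" by linarith
  then show ?thesis using cn[OF long_root[OF assms(1)] long_root[OF assms(2)]] by simp
qed

text \<open>One root from each pair of opposite long roots, so that \<open>D\<close> is an
  orthogonal basis of their span.\<close>

definition D :: "(complex^'n) set"
  where "D = {\<delta>\<in>long. ht \<delta> > 0}"

lemma D_long: "\<delta> \<in> D \<Longrightarrow> \<delta> \<in> long"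
  by (simp add: D_def)

lemma long_cases:
  assumes "\<epsilon> \<in> long"
  obtains \<delta> where "\<delta> \<in> D" "\<epsilon> = \<delta> \<or> \<epsilon> = - \<delta>"
proof (cases "ht \<epsilon> > 0")
  case True
  then show ?thesis using that assms by (simp add: D_def)
next
  case False
  then have "ht (- \<epsilon>) > 0" using ht_neg[OF long_root[OF assms]] ht(2)[OF long_root[OF assms]] by simp
  then show ?thesis using that[of "- \<epsilon>"] neg_long[OF assms] by (simp add: D_def)
qed

lemma D_orthogonal: "\<delta> \<in> D \<Longrightarrow> \<epsilon> \<in> D \<Longrightarrow> K \<delta> \<epsilon> = (if \<delta> = \<epsilon> then N else 0)"
proof (cases "\<delta> = \<epsilon>")
  case False
  assume D: "\<delta> \<in> D" "\<epsilon> \<in> D"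
  have "\<delta> \<noteq> - \<epsilon>" using D ht_neg[OF long_root[OF D_long]] by (auto simp: D_def)
  then show ?thesis using long_orthogonal[OF D_long D_long, of \<epsilon> \<delta>] D False by simp
qed (simp add: long_norm_N D_long)

lemma finite_D: "finite D"
  using finite_\<Phi> finite_subset[of D \<Phi>] D_long long_root by blast

lemma root_expansion:
  assumes x: "x \<in> \<Phi>"
  shows "2 *s x = (\<Sum>\<delta>\<in>D. of_int (cn x \<delta>) *s \<delta>)"
proof -
  have "vec.span long \<subseteq> vec.span D"
  proof (rule vec.span_minimal)
    show "long \<subseteq> vec.span D"
      using long_cases vec.span_base vec.span_neg by (metis subsetI)
  qed (rule vec.subspace_span)
  then have "x \<in> vec.span D" using roots_in_span_long[OF x] by blast
  then obtain a where a: "x = (\<Sum>\<delta>\<in>D. a \<delta> *s \<delta>)"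
    using vec.span_finite[OF finite_D] by auto
  have "2 * a \<delta> = of_int (cn x \<delta>)" if \<delta>: "\<delta> \<in> D" for \<delta>
  proof -
    have "K x \<delta> = (\<Sum>\<epsilon>\<in>D. if \<epsilon> = \<delta> then a \<delta> * N else 0)"
      unfolding a killing_form_sum killing_form_simps using D_orthogonal \<delta> by (intro sum.cong) auto
    also have "\<dots> = a \<delta> * N" using finite_D \<delta> by simp
    finally have "2 * a \<delta> * N = of_int (cn x \<delta>) * N"
      using cn[OF long_root[OF D_long[OF \<delta>]] x] long_norm_N[OF D_long[OF \<delta>]] by simp
    then show ?thesis using N_nonzero by simp
  qed
  then show ?thesis
    by (subst a) (simp add: vec.scale_sum_right)
qed

text \<open>If \<open>n\<close> long roots occur in the expansion of \<open>x\<close>, then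
  \<open>4 K x x = n N\<close>, and integrality of \<open>cn \<delta> x\<close> forces
  \<open>n\<close> to divide 4. For \<open>n = 4\<close> the root \<open>x\<close> would be as long
  as \<open>\<theta>\<close>, contradicting \<open>short\<close>; for \<open>n = 1\<close> the
  vector \<open>2 x\<close> would be a root. So \<open>n = 2\<close>.\<close>

lemma short_root_decomposition:
  assumes x: "x \<in> \<Phi>" "x \<notin> long"
  obtains \<delta> \<epsilon> where "\<delta> \<in> long" "\<epsilon> \<in> long" "\<epsilon> \<noteq> \<delta>" "\<epsilon> \<noteq> - \<delta>" "2 *s x = \<delta> + \<epsilon>"
proof -
  define T where "T = {\<delta>\<in>D. cn x \<delta> \<noteq> 0}"
  have T: "finite T" "T \<subseteq> D" using finite_D by (auto simp: T_def)
  have c1: "cn x \<delta> = 1 \<or> cn x \<delta> = - 1" if "\<delta> \<in> T" for \<delta>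
  proof -
    have \<delta>: "\<delta> \<in> long" "cn x \<delta> \<noteq> 0" using that D_long by (auto simp: T_def)
    have "cn x \<delta> \<noteq> 2" "cn x \<delta> \<noteq> - 2" "cn x \<delta> \<le> 2" "- 2 \<le> cn x \<delta>"
      using long_cn[OF \<delta>(1) x(1)] x(2) neg_long[OF \<delta>(1)] \<delta>(1) by metis+
    then show ?thesis using \<delta>(2) by linarith
  qed
  have exp: "2 *s x = (\<Sum>\<delta>\<in>T. of_int (cn x \<delta>) *s \<delta>)"
    unfolding root_expansion[OF x(1)] using finite_D by (intro sum.mono_neutral_right) (auto simp: T_def)
  have sq: "of_int (cn x \<delta>) * of_int (cn x \<delta>) = (1::complex)" if "\<delta> \<in> T" for \<delta>
    using c1[OF that] by auto
  have KxT: "2 * K x \<delta> = of_int (cn x \<delta>) * N" if "\<delta> \<in> T" for \<delta>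
    using cn[OF long_root[OF D_long] x(1), of \<delta>] long_norm_N[OF D_long, of \<delta>] that T by auto
  have "4 * K x x = 2 * K x (2 *s x)" by (simp add: killing_form_simps)
  also have "\<dots> = (\<Sum>\<delta>\<in>T. of_int (cn x \<delta>) * (2 * K x \<delta>))"
    unfolding exp killing_form_sum killing_form_simps by (simp add: sum_distrib_left algebra_simps)
  also have "\<dots> = (\<Sum>\<delta>\<in>T. N)"
    using KxT sq by (intro sum.cong refl) (simp add: mult.assoc[symmetric])
  finally have Kxx: "4 * K x x = of_nat (card T) * N" by simp
  have "card T \<noteq> 0"
  proof
    assume "card T = 0"
    then have "4 * K x x = 0" using Kxx by simp
    then show False using root_norm_nonzero[OF x(1)] by simp
  qed
  then obtain \<delta> where \<delta>: "\<delta> \<in> T" by fastforce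
  have \<delta>l: "\<delta> \<in> long" using \<delta> T D_long by blast
  have "of_int (cn \<delta> x * int (card T)) * N = of_int (cn \<delta> x) * (4 * K x x)" using Kxx by simp
  also have "\<dots> = 4 * (2 * K \<delta> x)" using cn[OF x(1) long_root[OF \<delta>l]] by simp
  also have "\<dots> = of_int (4 * cn x \<delta>) * N" using KxT[OF \<delta>] killing_form_sym[of \<delta> x] by simp
  finally have "(of_int (cn \<delta> x * int (card T)) :: complex) = of_int (4 * cn x \<delta>)"
    using N_nonzero mult_right_cancel by blast
  \<comment> \<open>Since \<open>cn x \<delta>\<close> is 1 or -1, this both gives the divisibility
    and shows that \<open>card T = 4\<close> makes the two Cartan integers equal.\<close>
  then have ck: "cn \<delta> x * int (card T) = 4 * cn x \<delta>" by (simp only: of_int_eq_iff)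
  have "\<bar>cn \<delta> x\<bar> * int (card T) = 4"
  proof -
    have "\<bar>cn \<delta> x * int (card T)\<bar> = \<bar>4 * cn x \<delta>\<bar>" using ck by simp
    then show ?thesis using c1[OF \<delta>] by (auto simp: abs_mult)
  qed
  moreover have "cn \<delta> x = cn x \<delta> \<Longrightarrow> False"
  proof -
    assume eq: "cn \<delta> x = cn x \<delta>"
    show False
    proof (cases "cn x \<delta> = 1")
      case True
      then show False using long_cn_one[OF short \<delta>l x(1)] eq by simp
    next
      case False
      then have m: "cn x \<delta> = - 1" using c1[OF \<delta>] by simp
      have "cn (- x) \<delta> = 1" using cn_neg[OF long_root[OF \<delta>l] x(1)] m by simp
      moreover have "cn \<delta> (- x) = 1"
        using cn[OF x(1) long_root[OF \<delta>l]] eq m neg_\<Phi>[OF x(1)]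
        by (intro cn_eqI) (simp_all add: killing_form_simps')
      ultimately show False using long_cn_one[OF short \<delta>l neg_\<Phi>[OF x(1)]] by simp
    qed
  qed
  then have "card T \<noteq> 4" using ck by auto
  moreover have "card T \<noteq> 1"
  proof
    assume "card T = 1"
    then have "T = {\<delta>}" using \<delta> by (auto simp: card_1_singleton_iff)
    then have "2 *s x = of_int (cn x \<delta>) *s \<delta>" using exp by simp
    then have "2 *s x = \<delta> \<or> 2 *s x = - \<delta>" using c1[OF \<delta>] by auto
    then have "of_nat 2 *s x \<in> \<Phi>" using long_root[OF \<delta>l] neg_\<Phi>[OF long_root[OF \<delta>l]] by auto
    then show False using multiple_not_root[OF x(1), of 2] by simp
  qed
  ultimately have "card T = 2"
  proof -
    assume 4: "\<bar>cn \<delta> x\<bar> * int (card T) = 4" and n: "card T \<noteq> 4" "card T \<noteq> 1"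
    have "card T dvd 4"
    proof -
      have "int (card T) dvd int 4" using 4 by (metis dvd_triv_right of_nat_numeral)
      then show ?thesis by (simp only: of_nat_dvd_iff)
    qed
    then have "card T \<le> 4" by (rule dvd_imp_le) simp
    moreover have "card T \<noteq> 3" using \<open>card T dvd 4\<close> by auto
    moreover have "card T \<noteq> 0" by fact
    ultimately show ?thesis using n by linarith
  qed
  then obtain \<delta>1 \<delta>2 where T2: "T = {\<delta>1, \<delta>2}" "\<delta>1 \<noteq> \<delta>2" by (auto simp: card_2_iff)
  define e1 where "e1 = of_int (cn x \<delta>1) *s \<delta>1"
  define e2 where "e2 = of_int (cn x \<delta>2) *s \<delta>2"
  have D12: "\<delta>1 \<in> D" "\<delta>2 \<in> D" using T2 T by auto
  have e: "e1 = \<delta>1 \<or> e1 = - \<delta>1" "e2 = \<delta>2 \<or> e2 = - \<delta>2"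
    using c1[of \<delta>1] c1[of \<delta>2] T2 by (auto simp: e1_def e2_def)
  have el: "e1 \<in> long" "e2 \<in> long" using e neg_long D_long D12 by metis+
  have K0: "K \<delta>1 \<delta>2 = 0" using D_orthogonal[OF D12] T2 by simp
  have "K e1 e2 = 0" using e K0 by (auto simp: killing_form_simps')
  then have "e2 \<noteq> e1" "e2 \<noteq> - e1"
    using long_norm_N[OF el(1)] N_nonzero by (auto simp: killing_form_simps')
  moreover have "2 *s x = e1 + e2" using exp T2 by (simp add: e1_def e2_def)
  ultimately show ?thesis using that el by blast
qed

lemma long_not_orthogonal_cases:
  assumes "\<delta> \<in> long" "\<epsilon> \<in> long" "2 *s x = \<delta> + \<epsilon>" "\<eta> \<in> long" "K \<eta> x \<noteq> 0"
  shows "\<eta> = \<delta> \<or> \<eta> = - \<delta> \<or> \<eta> = \<epsilon> \<or> \<eta> = - \<epsilon>"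
proof (rule ccontr)
  assume "\<not> ?thesis"
  then have "K \<eta> \<delta> = 0" "K \<eta> \<epsilon> = 0" using long_orthogonal assms by blast+
  then have "2 * K \<eta> x = 0"
    using arg_cong[OF assms(3), of "K \<eta>"] by (simp add: killing_form_simps)
  then show False using assms(5) by simp
qed

text \<open>Reflection in \<open>\<epsilon>\<close> changes the sign of \<open>\<epsilon>\<close>
  and fixes the orthogonal vector \<open>\<delta>\<close>.\<close>

lemma half_difference_flip:
  assumes "\<delta> \<in> long" "\<epsilon> \<in> long" "\<epsilon> \<noteq> \<delta>" "\<epsilon> \<noteq> - \<delta>" "(1/2) *s (\<delta> - \<epsilon>) \<in> \<Phi>"
  shows "(1/2) *s (\<delta> + \<epsilon>) \<in> \<Phi>"
proof -
  let ?y = "(1/2) *s (\<delta> - \<epsilon>)"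
  have K0: "K \<delta> \<epsilon> = 0" using long_orthogonal[OF assms(1,2,3,4)] killing_form_sym[of \<delta> \<epsilon>] by simp
  have "2 * K ?y \<epsilon> = of_int (- 1) * K \<epsilon> \<epsilon>" by (simp add: killing_form_simps killing_form_simps' K0)
  then have "cn ?y \<epsilon> = - 1" by (rule cn_eqI[OF long_root[OF assms(2)]])
  then have "?y - of_int (- 1) *s \<epsilon> \<in> \<Phi>" using reflection[OF long_root[OF assms(2)] assms(5)] by simp
  moreover have "?y - of_int (- 1) *s \<epsilon> = (1/2) *s (\<delta> + \<epsilon>)" by (simp add: vec_eq_iff field_simps)
  ultimately show ?thesis by (simp only:)
qed

text \<open>Induction along the reflections that lead from \<open>\<theta>\<close> to
  \<open>\<delta>\<close>: a reflection moving a long root to a different line must be in a half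
  sum, and these half sums connect every long root to \<open>\<theta>\<close>. Both signs are
  carried along so that the claim is stable under
  \<open>\<delta> \<mapsto> - \<delta>\<close>.\<close>

lemma half_difference_highest:
  assumes "\<delta> \<in> long"
  shows "\<delta> = \<theta> \<or> \<delta> = - \<theta> \<or> ((1/2) *s (\<theta> - \<delta>) \<in> \<Phi> \<and> (1/2) *s (\<theta> + \<delta>) \<in> \<Phi>)"
  using assms
proof (induction rule: long.induct)
  case theta
  show ?case by simp
next
  case (reflect \<delta> x)
  note \<delta> = reflect.hyps(1) and x = reflect.hyps(2)
  let ?Q = "\<lambda>\<delta>. \<delta> = \<theta> \<or> \<delta> = - \<theta> \<or> ((1/2) *s (\<theta> - \<delta>) \<in> \<Phi> \<and> (1/2) *s (\<theta> + \<delta>) \<in> \<Phi>)"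
  define \<eta> where "\<eta> = rf x \<delta>"
  have \<eta>: "\<eta> \<in> long" unfolding \<eta>_def by (rule long.reflect[OF \<delta> x])
  have neg: "?Q (- \<delta>)" using reflect.IH by auto
  have QI: "?Q \<eta>" if "(1/2) *s (\<theta> - \<eta>) \<in> \<Phi>"
    using half_difference_flip[OF long.theta \<eta> _ _ that] that by blast
  have QI': "?Q \<eta>" if "(1/2) *s (\<theta> + \<eta>) \<in> \<Phi>"
    using half_difference_flip[OF long.theta neg_long[OF \<eta>]] that by (metis diff_minus_eq_add minus_minus add_uminus_conv_diff)
  have orth: "\<eta> = \<delta>" if "K \<delta> x = 0"
    using that rf_alt[OF x long_root[OF \<delta>]] by (simp add: \<eta>_def)
  have "?Q \<eta>"
  proof (cases "x \<in> long")
    case True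
    show ?thesis
    proof (cases "x = \<delta> \<or> x = - \<delta>")
      case True
      then have "\<eta> = - \<delta>"
      proof
        assume "x = \<delta>"
        then show ?thesis unfolding \<eta>_def using rf_self[OF x] by simp
      next
        assume e: "x = - \<delta>"
        have "2 * K \<delta> x = of_int (- 2) * K x x" by (simp add: e killing_form_simps')
        then have "cn \<delta> x = - 2" by (rule cn_eqI[OF x])
        then show ?thesis unfolding \<eta>_def rf_def by (simp add: e vec_eq_iff)
      qed
      then show ?thesis using neg by (simp only:)
    next
      case False
      then have "K \<delta> x = 0"
        using long_orthogonal[OF \<delta> True] killing_form_sym[of x \<delta>] by simp
      then show ?thesis using orth reflect.IH by (simp only:)
    qed
  next
    case False
    obtain \<delta>1 \<delta>2 where d: "\<delta>1 \<in> long" "\<delta>2 \<in> long" "\<delta>2 \<noteq> \<delta>1" "\<delta>2 \<noteq> - \<delta>1" "2 *s x = \<delta>1 + \<delta>2"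
      using short_root_decomposition[OF x False] .
    show ?thesis
    proof (cases "K \<theta> x = 0")
      case True
      \<comment> \<open>A reflection fixing \<open>\<theta>\<close> carries the half difference of
        \<open>\<theta>\<close> and \<open>\<delta>\<close> to that of \<open>\<theta>\<close> and
        \<open>\<eta>\<close>.\<close>
      have rf\<theta>: "rf x \<theta> = \<theta>" using True rf_alt[OF x \<theta>(1)] by simp
      show ?thesis
      proof (cases "\<delta> = \<theta> \<or> \<delta> = - \<theta>")
        case True
        then have "K \<delta> x = 0" using \<open>K \<theta> x = 0\<close> by (auto simp: killing_form_simps')
        then show ?thesis using orth reflect.IH by (simp only:)
      next
        case False
        then have y: "(1/2) *s (\<theta> - \<delta>) \<in> \<Phi>" using reflect.IH by blast
        have "rf x ((1/2) *s (\<theta> - \<delta>)) = (1/2) *s (rf x \<theta> - rf x \<delta>)"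
          unfolding rf_alt[OF x y] rf_alt[OF x \<theta>(1)] rf_alt[OF x long_root[OF \<delta>]]
          using root_norm_nonzero[OF x]
          by (simp add: killing_form_simps killing_form_simps' vec_eq_iff field_simps)
        then have "(1/2) *s (\<theta> - \<eta>) \<in> \<Phi>" using rf_root[OF x y] rf\<theta> by (simp add: \<eta>_def)
        then show ?thesis by (rule QI)
      qed
    next
      case \<theta>x: False
      \<comment> \<open>One of the two long roots composing \<open>x\<close> is
        \<open>\<theta>\<close> up to sign; call it \<open>\<sigma>\<close>. If
        \<open>\<eta>\<close> is not orthogonal to \<open>x\<close>, it is \<open>\<sigma>\<close>
        or \<open>\<epsilon>\<close> up to sign, and in the second case \<open>x\<close> or
        \<open>- x\<close> is itself a required half sum.\<close>
      have key: "?Q \<eta>" if e: "2 *s x = \<sigma> + \<epsilon>" "\<sigma> = \<theta> \<or> \<sigma> = - \<theta>" "\<epsilon> \<in> long" for \<sigma> \<epsilon>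
      proof (cases "K \<eta> x = 0")
        case True
        have "rf x \<eta> = \<delta>" unfolding \<eta>_def by (rule rf_rf[OF x long_root[OF \<delta>]])
        moreover have "rf x \<eta> = \<eta>" using True rf_alt[OF x long_root[OF \<eta>]] by simp
        ultimately show ?thesis using reflect.IH by (simp only:)
      next
        case False
        have \<sigma>: "\<sigma> \<in> long" using e(2) long.theta neg_long by blast
        have "\<eta> = \<sigma> \<or> \<eta> = - \<sigma> \<or> \<eta> = \<epsilon> \<or> \<eta> = - \<epsilon>"
          by (rule long_not_orthogonal_cases[OF \<sigma> e(3,1) \<eta> False])
        moreover have "?Q \<eta>" if "\<eta> = \<sigma> \<or> \<eta> = - \<sigma>" using that e(2) by auto
        moreover have "?Q \<eta>" if h: "\<eta> = \<epsilon> \<or> \<eta> = - \<epsilon>"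
        proof -
          have xx: "x = (1/2) *s (\<sigma> + \<epsilon>)" using e(1)[symmetric] by simp
          have nx: "- x \<in> \<Phi>" using neg_\<Phi>[OF x] .
          from e(2) h show ?thesis
          proof (elim disjE)
            assume "\<sigma> = \<theta>" "\<eta> = \<epsilon>"
            then show ?thesis using QI' x xx by simp
          next
            assume "\<sigma> = \<theta>" "\<eta> = - \<epsilon>"
            then show ?thesis using QI x xx by simp
          next
            assume a: "\<sigma> = - \<theta>" "\<eta> = \<epsilon>"
            have "- x = (1/2) *s (\<theta> - \<eta>)" unfolding xx a by (simp add: vec_eq_iff field_simps)
            then show ?thesis using QI nx by simp
          next
            assume a: "\<sigma> = - \<theta>" "\<eta> = - \<epsilon>"
            have "- x = (1/2) *s (\<theta> + \<eta>)" unfolding xx a by (simp add: vec_eq_iff field_simps)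
            then show ?thesis using QI' nx by simp
          qed
        qed
        ultimately show ?thesis by blast
      qed
      have "\<theta> = \<delta>1 \<or> \<theta> = - \<delta>1 \<or> \<theta> = \<delta>2 \<or> \<theta> = - \<delta>2"
        by (rule long_not_orthogonal_cases[OF d(1,2,5) long.theta \<theta>x])
      then have "\<delta>1 = \<theta> \<or> \<delta>1 = - \<theta> \<or> \<delta>2 = \<theta> \<or> \<delta>2 = - \<theta>" by auto
      then show ?thesis
        using key[of \<delta>1 \<delta>2] key[of \<delta>2 \<delta>1] d by (metis add.commute)
    qed
  qed
  then show ?case by (simp only: \<eta>_def)
qed

text \<open>The highest root serves as an intermediary: reflecting the half difference of
  \<open>\<theta>\<close> and \<open>\<epsilon>\<close> in that of \<open>\<theta>\<close> and
  \<open>\<delta>\<close> subtracts one from the other.\<close>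

lemma half_difference:
  assumes D: "\<delta> \<in> D" "\<epsilon> \<in> D" "\<delta> \<noteq> \<epsilon>"
  shows "(1/2) *s (\<delta> - \<epsilon>) \<in> \<Phi>"
proof -
  have \<theta>D: "\<theta> \<in> D" using long.theta ht_\<theta>_pos by (simp add: D_def)
  have hd: "(1/2) *s (\<theta> - \<epsilon>) \<in> \<Phi>" if "\<epsilon> \<in> D" "\<epsilon> \<noteq> \<theta>" for \<epsilon>
  proof -
    have "\<epsilon> \<noteq> - \<theta>" using that(1) ht_neg[OF \<theta>(1)] ht_\<theta>_pos by (auto simp: D_def)
    then show ?thesis using half_difference_highest[OF D_long[OF that(1)]] that(2) by blast
  qed
  consider "\<delta> = \<theta>" | "\<epsilon> = \<theta>" "\<delta> \<noteq> \<theta>" | "\<delta> \<noteq> \<theta>" "\<epsilon> \<noteq> \<theta>" by blast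
  then show ?thesis
  proof cases
    case 1
    then show ?thesis using hd[OF D(2)] D(3) by simp
  next
    case 2
    have "- ((1/2) *s (\<theta> - \<delta>)) \<in> \<Phi>" using hd[OF D(1) 2(2)] by (rule neg_\<Phi>)
    moreover have "- ((1/2) *s (\<theta> - \<delta>)) = (1/2) *s (\<delta> - \<epsilon>)" using 2 by (simp add: vec_eq_iff field_simps)
    ultimately show ?thesis by (simp only:)
  next
    case 3
    let ?y = "(1/2) *s (\<theta> - \<delta>)" and ?z = "(1/2) *s (\<theta> - \<epsilon>)"
    have yz: "?y \<in> \<Phi>" "?z \<in> \<Phi>" using hd D 3 by blast+
    note orth = D_orthogonal[OF \<theta>D \<theta>D] D_orthogonal[OF D(1,1)] D_orthogonal[OF D(1) \<theta>D]
      D_orthogonal[OF \<theta>D D(1)] D_orthogonal[OF D(2) \<theta>D] D_orthogonal[OF D(2,1)]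
    have "2 * K ?z ?y = of_int 1 * K ?y ?y"
      using orth 3 D(3) by (simp add: killing_form_simps killing_form_simps' field_simps)
    then have "cn ?z ?y = 1" by (rule cn_eqI[OF yz(1)])
    then have "?z - of_int 1 *s ?y \<in> \<Phi>" using reflection[OF yz] by simp
    moreover have "?z - of_int 1 *s ?y = (1/2) *s (\<delta> - \<epsilon>)" by (simp add: vec_eq_iff field_simps)
    ultimately show ?thesis by (simp only:)
  qed
qed

lemma root_cases:
  assumes x: "x \<in> \<Phi>"
  obtains \<delta> where "\<delta> \<in> D" "x = \<delta> \<or> x = - \<delta>"
  | \<delta> \<epsilon> where "\<delta> \<in> D" "\<epsilon> \<in> D" "\<delta> \<noteq> \<epsilon>"
    "x = (1/2) *s (\<delta> - \<epsilon>) \<or> x = (1/2) *s (\<delta> + \<epsilon>) \<or> - x = (1/2) *s (\<delta> + \<epsilon>)"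
proof (cases "x \<in> long")
  case True
  then show ?thesis using that(1) long_cases by metis
next
  case False
  obtain d1 d2 where d: "d1 \<in> long" "d2 \<in> long" "d2 \<noteq> d1" "d2 \<noteq> - d1" "2 *s x = d1 + d2"
    using short_root_decomposition[OF x False] .
  have xx: "x = (1/2) *s (d1 + d2)" using d(5)[symmetric] by simp
  obtain \<delta> where \<delta>: "\<delta> \<in> D" "d1 = \<delta> \<or> d1 = - \<delta>" using long_cases[OF d(1)] .
  obtain \<epsilon> where \<epsilon>: "\<epsilon> \<in> D" "d2 = \<epsilon> \<or> d2 = - \<epsilon>" using long_cases[OF d(2)] .
  have ne: "\<delta> \<noteq> \<epsilon>" using d(3,4) \<delta>(2) \<epsilon>(2) by auto
  from \<delta>(2) \<epsilon>(2) show ?thesis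
  proof (elim disjE)
    assume "d1 = \<delta>" "d2 = \<epsilon>"
    then show ?thesis using that(2)[OF \<delta>(1) \<epsilon>(1) ne] xx by simp
  next
    assume "d1 = \<delta>" "d2 = - \<epsilon>"
    then show ?thesis using that(2)[OF \<delta>(1) \<epsilon>(1) ne] xx by simp
  next
    assume "d1 = - \<delta>" "d2 = \<epsilon>"
    then show ?thesis using that(2)[OF \<epsilon>(1) \<delta>(1) ne[symmetric]] xx by simp
  next
    assume a: "d1 = - \<delta>" "d2 = - \<epsilon>"
    have "- x = (1/2) *s (\<delta> + \<epsilon>)" unfolding xx a by (simp add: vec_eq_iff field_simps)
    then show ?thesis using that(2)[OF \<delta>(1) \<epsilon>(1) ne] by simp
  qed
qed


text \<open>A Cartan matrix may be exhibited in any base, so one is built from an arbitrary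
  enumeration of \<open>D\<close>. With \<open>f i\<close> in the role of \<open>2 e_i\<close> it is
  the standard base \<open>e_i - e_(i+1)\<close>, closed by the long root
  \<open>2 e_l\<close>.\<close>

lemma type_C: "lie_type_C br"
proof -
  define l where "l = card D"
  have \<theta>D: "\<theta> \<in> D" using long.theta ht_\<theta>_pos by (simp add: D_def)
  have l: "l \<ge> 1" using \<theta>D finite_D by (auto simp: l_def Suc_le_eq card_gt_0_iff)
  obtain f where "bij_betw f {0..<card D} D" using ex_bij_betw_nat_finite[OF finite_D] by blast
  then have f: "bij_betw f {..<l} D" by (simp add: l_def atLeast0LessThan)
  have fD: "f i \<in> D" if "i < l" for i using f that by (auto simp: bij_betw_def)
  have finj: "f i = f j \<longleftrightarrow> i = j" if "i < l" "j < l" for i j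
    using f that by (auto simp: bij_betw_def inj_on_def)
  have Kf: "K (f i) (f j) = (if i = j then N else 0)" if "i < l" "j < l" for i j
    using D_orthogonal[OF fD fD] finj that by simp
  define \<alpha> where "\<alpha> i = (if Suc i = l then f i else (1/2) *s (f i - f (Suc i)))" for i
  have \<alpha>\<Phi>: "\<alpha> i \<in> \<Phi>" if "i < l" for i
  proof (cases "Suc i = l")
    case True
    then show ?thesis using long_root[OF D_long[OF fD[OF that]]] by (simp add: \<alpha>_def)
  next
    case False
    then have "Suc i < l" using that by simp
    then show ?thesis using half_difference[OF fD fD] finj that by (simp add: \<alpha>_def)
  qed
  have K\<alpha>f: "K (\<alpha> i) (f j) = (if Suc i = l then (if i = j then N else 0)
      else if i = j then N / 2 else if Suc i = j then - (N / 2) else 0)" if "i < l" "j < l" for i j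
    using that by (auto simp: \<alpha>_def Kf killing_form_simps killing_form_simps')
  have K\<alpha>\<alpha>: "K (\<alpha> i) (\<alpha> j) = (if Suc j = l then K (\<alpha> i) (f j) else (K (\<alpha> i) (f j) - K (\<alpha> i) (f (Suc j))) / 2)" for i j
    by (simp add: \<alpha>_def[of j] killing_form_simps killing_form_simps')
  define a where "a i = restrict (K (\<alpha> i)) h" for i
  have a_dual: "dual_element br h (a i) = \<alpha> i" if "i < l" for i
    unfolding a_def by (rule restrict_root(2)[OF \<alpha>\<Phi>[OF that]])
  have \<alpha>_indep: "\<forall>i<l. C i = 0" if C: "\<forall>t\<in>h. (\<Sum>i<l. C i * K (\<alpha> i) t) = 0" for C :: "nat \<Rightarrow> complex"
  proof -
    \<comment> \<open>The system is triangular: among the \<open>\<alpha> k\<close> with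
      \<open>k \<ge> i\<close> only \<open>\<alpha> i\<close> pairs nontrivially with
      \<open>f i\<close>.\<close>
    have "i < l \<longrightarrow> C i = 0" for i
    proof (induction i rule: less_induct)
      case (less i)
      show ?case
      proof
        assume i: "i < l"
        have "f i \<in> h" using \<Phi>D(1)[OF long_root[OF D_long[OF fD[OF i]]]] .
        then have "0 = (\<Sum>k<l. C k * K (\<alpha> k) (f i))" using C by simp
        also have "\<dots> = (\<Sum>k<l. if k = i then C i * K (\<alpha> i) (f i) else 0)"
        proof (rule sum.cong)
          fix k assume k: "k \<in> {..<l}"
          show "C k * K (\<alpha> k) (f i) = (if k = i then C i * K (\<alpha> i) (f i) else 0)"
          proof (cases "k < i")
            case True
            then show ?thesis using less.IH[of k] k by simp
          next
            case False
            then show ?thesis using K\<alpha>f[of k i] k i by auto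
          qed
        qed simp
        also have "\<dots> = C i * K (\<alpha> i) (f i)" using i by simp
        finally show "C i = 0" using K\<alpha>f[OF i i] N_nonzero by (auto split: if_splits)
      qed
    qed
    then show ?thesis by blast
  qed
  have a_inj: "inj_on a {..<l}"
  proof (rule inj_onI)
    fix i j assume ij: "i \<in> {..<l}" "j \<in> {..<l}" "a i = a j"
    then have "\<alpha> i = \<alpha> j" using a_dual by (metis lessThan_iff)
    define C where "C k = (if k = i then 1 else 0) - (if k = j then 1 else (0::complex))" for k
    have "(\<Sum>k<l. C k * K (\<alpha> k) t) = 0" for t
    proof -
      have "(\<Sum>k<l. C k * K (\<alpha> k) t)
          = (\<Sum>k<l. if k = i then K (\<alpha> k) t else 0) - (\<Sum>k<l. if k = j then K (\<alpha> k) t else 0)"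
        unfolding sum_subtractf[symmetric] by (intro sum.cong) (auto simp: C_def)
      also have "\<dots> = K (\<alpha> i) t - K (\<alpha> j) t" using ij by simp
      finally show ?thesis using \<open>\<alpha> i = \<alpha> j\<close> by simp
    qed
    then have "C i = 0" using \<alpha>_indep ij by blast
    then show "i = j" by (simp add: C_def split: if_splits)
  qed
  define P where "P = {x. \<exists>n::nat \<Rightarrow> nat. x = (\<Sum>k<l. of_nat (n k) *s \<alpha> k)}"
  have P_add: "x + y \<in> P" if xy: "x \<in> P" "y \<in> P" for x y
  proof -
    obtain n m :: "nat \<Rightarrow> nat" where "x = (\<Sum>k<l. of_nat (n k) *s \<alpha> k)" "y = (\<Sum>k<l. of_nat (m k) *s \<alpha> k)"
      using xy unfolding P_def by blast
    then have "x + y = (\<Sum>k<l. of_nat (n k + m k) *s \<alpha> k)"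
      by (simp add: sum.distrib[symmetric] vec.scale_left_distrib)
    then show ?thesis unfolding P_def by (intro CollectI exI)
  qed
  have P_\<alpha>: "\<alpha> i \<in> P" if "i < l" for i
  proof -
    have "(\<Sum>k<l. of_nat (if k = i then 1 else 0) *s \<alpha> k) = (\<Sum>k<l. if k = i then \<alpha> k else 0)"
      by (intro sum.cong) auto
    also have "\<dots> = \<alpha> i" using that by simp
    finally show ?thesis unfolding P_def by (intro CollectI exI[of _ "\<lambda>k. if k = i then 1 else 0"]) simp
  qed
  have P0: "0 \<in> P" unfolding P_def by (intro CollectI exI[of _ "\<lambda>k. 0"]) simp
  have P_diff: "(1/2) *s (f i - f (i + d)) \<in> P" if "i + d < l" for i d
    using that
  proof (induction d)
    case 0
    show ?case using P0 by simp
  next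
    case (Suc d)
    have "(1/2) *s (f i - f (i + Suc d)) = (1/2) *s (f i - f (i + d)) + \<alpha> (i + d)"
      using Suc.prems by (simp add: \<alpha>_def vec_eq_iff field_simps)
    moreover have "(1/2) *s (f i - f (i + d)) \<in> P" using Suc by simp
    moreover have "\<alpha> (i + d) \<in> P" using P_\<alpha> Suc.prems by simp
    ultimately show ?case using P_add by (simp only:)
  qed
  have P_f: "f i \<in> P" if i: "i < l" for i
  proof -
    let ?y = "(1/2) *s (f i - f (i + (l - 1 - i)))"
    have last: "i + (l - 1 - i) = l - 1" using i by simp
    \<comment> \<open>Telescoping: twice the half difference of \<open>f i\<close> and
      \<open>f (l - 1)\<close>, and the last simple root is \<open>f (l - 1)\<close> itself.\<close>
    have "f i = (?y + ?y) + \<alpha> (l - 1)"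
      using l unfolding last by (simp add: \<alpha>_def vec_eq_iff field_simps)
    moreover have "?y \<in> P" using i by (intro P_diff) simp
    moreover have "\<alpha> (l - 1) \<in> P" using l by (intro P_\<alpha>) simp
    ultimately show ?thesis using P_add by metis
  qed
  have half: "(1/2) *s (f i - f j) \<in> P \<and> (1/2) *s (f i + f j) \<in> P" if "i < j" "j < l" for i j
  proof -
    have d: "(1/2) *s (f i - f j) \<in> P" using P_diff[of i "j - i"] that by simp
    have "(1/2) *s (f i + f j) = (1/2) *s (f i - f j) + f j" by (simp add: vec_eq_iff field_simps)
    then show ?thesis using P_add[OF d P_f[OF that(2)]] d by (simp only: simp_thms)
  qed
  have roots_P: "x \<in> P \<or> - x \<in> P" if x: "x \<in> \<Phi>" for x
    using x
  proof (cases rule: root_cases)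
    case (1 \<delta>)
    then obtain i where "i < l" "\<delta> = f i" using f by (auto simp: bij_betw_def)
    then show ?thesis using 1(2) P_f by auto
  next
    case (2 \<delta> \<epsilon>)
    have "f ` {..<l} = D" using f by (simp add: bij_betw_def)
    then obtain i j where ij: "i < l" "\<delta> = f i" "j < l" "\<epsilon> = f j"
      using 2(1,2) by (metis imageE lessThan_iff)
    have "i \<noteq> j" using ij 2(3) by auto
    show ?thesis
    proof (cases "i < j")
      case True
      then show ?thesis using half[OF True ij(3)] 2(4) ij by auto
    next
      case False
      then have ji: "j < i" using \<open>i \<noteq> j\<close> by simp
      have "- ((1/2) *s (f i - f j)) = (1/2) *s (f j - f i)" "(1/2) *s (f i + f j) = (1/2) *s (f j + f i)"
        by (simp_all add: vec_eq_iff field_simps)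
      then show ?thesis using half[OF ji ij(1)] 2(4) ij by metis
    qed
  qed
  have simple: "simple_roots br h (a ` {..<l})"
    unfolding simple_roots_def
  proof (intro conjI allI impI ballI)
    show "finite (a ` {..<l})" by simp
    show "a ` {..<l} \<subseteq> roots br h"
      unfolding a_def using restrict_root(1)[OF \<alpha>\<Phi>] by auto
    have reindex: "(\<Sum>\<beta>\<in>a ` {..<l}. c \<beta> * \<beta> t) = (\<Sum>i<l. c (a i) * K (\<alpha> i) t)"
      if "t \<in> h" for c :: "_ \<Rightarrow> complex" and t
      unfolding sum.reindex[OF a_inj] using that by (simp add: a_def)
    show "c \<beta> = 0" if c: "\<forall>t\<in>h. (\<Sum>\<beta>\<in>a ` {..<l}. c \<beta> * \<beta> t) = 0" and \<beta>: "\<beta> \<in> a ` {..<l}" for c \<beta>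
    proof -
      have "\<forall>t\<in>h. (\<Sum>i<l. c (a i) * K (\<alpha> i) t) = 0"
      proof
        fix t assume t: "t \<in> h"
        have "(\<Sum>\<beta>\<in>a ` {..<l}. c \<beta> * \<beta> t) = 0" using c t by (rule bspec)
        then show "(\<Sum>i<l. c (a i) * K (\<alpha> i) t) = 0" unfolding reindex[OF t] .
      qed
      then have "\<forall>i<l. c (a i) = 0" by (rule \<alpha>_indep)
      then show ?thesis using \<beta> by auto
    qed
    fix \<beta> assume \<beta>: "\<beta> \<in> roots br h"
    let ?x = "dual_element br h \<beta>"
    have x: "?x \<in> \<Phi>" using root_dual_element(1)[OF \<beta>] .
    have "\<exists>n :: nat \<Rightarrow> int. ?x = (\<Sum>k<l. of_int (n k) *s \<alpha> k) \<and> ((\<forall>k. n k \<ge> 0) \<or> (\<forall>k. n k \<le> 0))"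
    proof (cases "?x \<in> P")
      case True
      then obtain n :: "nat \<Rightarrow> nat" where "?x = (\<Sum>k<l. of_nat (n k) *s \<alpha> k)" unfolding P_def by blast
      then show ?thesis by (intro exI[of _ "\<lambda>k. int (n k)"]) simp
    next
      case False
      then have "- ?x \<in> P" using roots_P[OF x] by blast
      then obtain n :: "nat \<Rightarrow> nat" where "- ?x = (\<Sum>k<l. of_nat (n k) *s \<alpha> k)" unfolding P_def by blast
      then have "?x = - (\<Sum>k<l. of_nat (n k) *s \<alpha> k)" by (metis minus_minus)
      then show ?thesis by (intro exI[of _ "\<lambda>k. - int (n k)"]) (simp add: sum_negf)
    qed
    then obtain n :: "nat \<Rightarrow> int" where n: "?x = (\<Sum>k<l. of_int (n k) *s \<alpha> k)"
      "(\<forall>k. n k \<ge> 0) \<or> (\<forall>k. n k \<le> 0)" by (elim exE conjE)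
    define c where "c \<gamma> = n (inv_into {..<l} a \<gamma>)" for \<gamma>
    have ca: "c (a k) = n k" if "k < l" for k using a_inj that by (simp add: c_def)
    have "\<beta> t = (\<Sum>\<gamma>\<in>a ` {..<l}. of_int (c \<gamma>) * \<gamma> t)" if t: "t \<in> h" for t
    proof -
      have "\<beta> t = K ?x t" using root_dual_element(2)[OF \<beta> t] .
      also have "\<dots> = (\<Sum>k<l. of_int (n k) * K (\<alpha> k) t)"
        by (subst n(1)) (simp add: killing_form_sum killing_form_simps)
      also have "\<dots> = (\<Sum>k<l. of_int (c (a k)) * K (\<alpha> k) t)" using ca by simp
      also have "\<dots> = (\<Sum>\<gamma>\<in>a ` {..<l}. of_int (c \<gamma>) * \<gamma> t)"
        using reindex[OF t, of "\<lambda>\<gamma>. of_int (c \<gamma>)"] by simp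
      finally show ?thesis .
    qed
    moreover have "(\<forall>\<gamma>\<in>a ` {..<l}. c \<gamma> \<ge> 0) \<or> (\<forall>\<gamma>\<in>a ` {..<l}. c \<gamma> \<le> 0)"
      using n(2) by (auto simp: c_def)
    ultimately show "\<exists>c :: _ \<Rightarrow> int. (\<forall>t\<in>h. \<beta> t = (\<Sum>\<gamma>\<in>a ` {..<l}. of_int (c \<gamma>) * \<gamma> t)) \<and>
        ((\<forall>\<gamma>\<in>a ` {..<l}. c \<gamma> \<ge> 0) \<or> (\<forall>\<gamma>\<in>a ` {..<l}. c \<gamma> \<le> 0))" by (intro exI[of _ c] conjI ballI)
  qed
  have bij: "bij_betw a {..<l} (a ` {..<l})" using a_inj by (rule inj_on_imp_bij_betw)
  have entries: "2 * weight_form br h (a i) (a j) / weight_form br h (a j) (a j) = of_int (cartan_matrix_C l i j)"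
    if ij: "i < l" "j < l" for i j
  proof -
    have w: "weight_form br h (a i) (a j) = K (\<alpha> i) (\<alpha> j)" "weight_form br h (a j) (a j) = K (\<alpha> j) (\<alpha> j)"
      unfolding weight_form_def using a_dual ij by simp_all
    have jj: "K (\<alpha> j) (\<alpha> j) = (if Suc j = l then N else N / 2)"
      using K\<alpha>\<alpha>[of j j] K\<alpha>f[of j j] K\<alpha>f[of j "Suc j"] ij by auto
    have "K (\<alpha> i) (\<alpha> j) = of_int (cartan_matrix_C l i j) * K (\<alpha> j) (\<alpha> j) / 2"
    proof (cases "Suc j = l")
      case True
      then show ?thesis
        using ij unfolding jj K\<alpha>\<alpha>[of i j] by (auto simp: K\<alpha>f cartan_matrix_C_def)
    next
      case False
      then have j: "Suc j < l" using ij by simp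
      consider "i = j" | "i = Suc j" "Suc i = l" | "i = Suc j" "Suc i \<noteq> l" | "Suc i = j"
        | "i \<noteq> j" "i \<noteq> Suc j" "Suc i \<noteq> j" by blast
      then show ?thesis
        unfolding jj K\<alpha>\<alpha>[of i j] K\<alpha>f[OF ij] K\<alpha>f[OF ij(1) j]
        by cases (use False j in \<open>simp_all add: cartan_matrix_C_def\<close>)
    qed
    moreover have "K (\<alpha> j) (\<alpha> j) \<noteq> 0" using root_norm_nonzero[OF \<alpha>\<Phi>[OF ij(2)]] .
    ultimately show ?thesis unfolding w by (simp add: divide_eq_eq mult.commute)
  qed
  have "has_cartan_matrix br l (cartan_matrix_C l)"
    unfolding has_cartan_matrix_def
    by (intro exI[of _ h] exI[of _ "a ` {..<l}"] exI[of _ a] conjI allI impI cartan simple bij entries)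
  then show ?thesis unfolding lie_type_C_def using l by blast
qed

end

lemma (in based_simple_lie_algebra) adjacent_long_root_exists:
  assumes "\<not> lie_type_C br"
  obtains x where "x \<in> \<Phi>" "cn x \<theta> = 1" "cn \<theta> x = 1"
proof -
  have "\<exists>x\<in>\<Phi>. cn x \<theta> = 1 \<and> cn \<theta> x = 1"
  proof (rule ccontr)
    assume "\<not> ?thesis"
    then interpret no_adjacent_long_root br h \<Delta> \<rho> by unfold_locales blast
    show False using type_C assms by blast
  qed
  then show ?thesis using that by blast
qed

section \<open>The adjoint group acts by automorphisms\<close>

definition lie_automorphism :: "(complex^'n \<Rightarrow> complex^'n \<Rightarrow> complex^'n) \<Rightarrow> (complex^'n \<Rightarrow> complex^'n) \<Rightarrow> bool"
  where "lie_automorphism br g \<longleftrightarrow> clinear g \<and> bij g \<and> (\<forall>x y. g (br x y) = br (g x) (g y))"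

context complex_lie_algebra
begin

definition exp_term :: "complex^'n \<Rightarrow> nat \<Rightarrow> complex^'n \<Rightarrow> complex^'n"
  where "exp_term x k y = (1 / fact k) *s ((br x ^^ k) y)"

lemma exp_term_0: "exp_term x 0 y = y"
  by (simp add: exp_term_def)

lemma br_exp_term: "br x (exp_term x k y) = of_nat (Suc k) *s exp_term x (Suc k) y"
proof -
  have "(1 / fact k :: complex) = of_nat (Suc k) * (1 / fact (Suc k))"
    by (simp add: fact_Suc field_simps del: of_nat_Suc)
  then show ?thesis by (simp add: exp_term_def br_simps del: of_nat_Suc)
qed

lemma exp_term_linear:
  "exp_term x k (y + z) = exp_term x k y + exp_term x k z"
  "exp_term x k (c *s y) = c *s exp_term x k y"
  by (simp_all add: exp_term_def vec.linear_add[OF clinear_compow[OF linear_right]]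
      vec.linear_scale[OF clinear_compow[OF linear_right]] vec.scale_right_distrib mult.commute)

text \<open>Divided powers satisfy the Leibniz rule without binomial coefficients. In the induction
  step the factor \<open>n + 1\<close> is distributed as \<open>m\<close> plus
  \<open>n + 1 - m\<close> over the two arguments.\<close>

lemma exp_term_br:
  "(\<Sum>m\<le>n. br (exp_term x m y) (exp_term x (n - m) z)) = exp_term x n (br y z)"
proof (induction n)
  case 0
  show ?case by (simp add: exp_term_0)
next
  case (Suc n)
  let ?e = "\<lambda>m. br (exp_term x m y) (exp_term x (Suc n - m) z)"
  have "of_nat (Suc n) *s exp_term x (Suc n) (br y z) = br x (exp_term x n (br y z))"
    by (rule br_exp_term[symmetric])
  also have "\<dots> = (\<Sum>m\<le>n. br x (br (exp_term x m y) (exp_term x (n - m) z)))"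
    unfolding Suc.IH[symmetric] by (rule br_right_simps)
  also have "\<dots> = (\<Sum>m\<le>n. of_nat (Suc m) *s ?e (Suc m) + of_nat (Suc n - m) *s ?e m)"
  proof (rule sum.cong)
    fix m assume "m \<in> {..n}"
    then have m: "Suc (n - m) = Suc n - m" by auto
    have "br x (br (exp_term x m y) (exp_term x (n - m) z))
        = br (br x (exp_term x m y)) (exp_term x (n - m) z) + br (exp_term x m y) (br x (exp_term x (n - m) z))"
      by (rule br_derivation)
    also have "br x (exp_term x (n - m) z) = of_nat (Suc n - m) *s exp_term x (Suc n - m) z"
      unfolding br_exp_term m ..
    also have "br x (exp_term x m y) = of_nat (Suc m) *s exp_term x (Suc m) y" by (rule br_exp_term)
    finally show "br x (br (exp_term x m y) (exp_term x (n - m) z))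
        = of_nat (Suc m) *s ?e (Suc m) + of_nat (Suc n - m) *s ?e m"
      by (simp only: br_simps diff_Suc_Suc)
  qed simp
  also have "\<dots> = (\<Sum>m\<le>n. of_nat (Suc m) *s ?e (Suc m)) + (\<Sum>m\<le>n. of_nat (Suc n - m) *s ?e m)"
    by (rule sum.distrib)
  also have "(\<Sum>m\<le>n. of_nat (Suc m) *s ?e (Suc m)) = (\<Sum>m\<le>Suc n. of_nat m *s ?e m)"
    by (subst sum.atMost_Suc_shift) simp
  also have "(\<Sum>m\<le>n. of_nat (Suc n - m) *s ?e m) = (\<Sum>m\<le>Suc n. of_nat (Suc n - m) *s ?e m)"
    by simp
  also have "(\<Sum>m\<le>Suc n. of_nat m *s ?e m) + (\<Sum>m\<le>Suc n. of_nat (Suc n - m) *s ?e m)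
      = (\<Sum>m\<le>Suc n. of_nat (Suc n) *s ?e m)"
    unfolding sum.distrib[symmetric]
  proof (rule sum.cong)
    fix m assume "m \<in> {..Suc n}"
    then have "of_nat m + of_nat (Suc n - m) = (of_nat (Suc n) :: complex)"
      by (metis atMost_iff le_add_diff_inverse of_nat_add)
    then show "of_nat m *s ?e m + of_nat (Suc n - m) *s ?e m = of_nat (Suc n) *s ?e m"
      by (simp only: vec.scale_left_distrib[symmetric])
  qed simp
  also have "\<dots> = of_nat (Suc n) *s (\<Sum>m\<le>Suc n. ?e m)" by (rule vec.scale_sum_right[symmetric])
  finally have *: "of_nat (Suc n) *s exp_term x (Suc n) (br y z) = of_nat (Suc n) *s (\<Sum>m\<le>Suc n. ?e m)" .
  show ?case by (rule vec.scale_left_imp_eq[OF _ *, symmetric]) (rule of_nat_neq_0)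
qed

lemma exp_term_bound:
  obtains C where "\<And>k y. norm (exp_term x k y) \<le> C ^ k / fact k * norm y" "C \<ge> 0"
proof -
  have scaleR: "r *\<^sub>R v = complex_of_real r *s v" for r and v :: "complex^'k"
    unfolding vec_eq_iff vector_scaleR_component by (simp add: scaleR_conv_of_real)
  have "linear (br x)"
    by (rule linearI) (simp_all only: br_right_simps scaleR)
  then have "bounded_linear (br x)" by (simp add: linear_conv_bounded_linear)
  then obtain C where C: "C \<ge> 0" "\<And>y. norm (br x y) \<le> norm y * C"
    using bounded_linear.nonneg_bounded by blast
  have *: "norm ((br x ^^ k) y) \<le> C ^ k * norm y" for k y
  proof (induction k)
    case (Suc k)
    have "norm ((br x ^^ Suc k) y) \<le> norm ((br x ^^ k) y) * C" using C(2) by simp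
    also have "\<dots> \<le> C ^ k * norm y * C" using Suc C(1) by (intro mult_right_mono)
    finally show ?case by (simp add: algebra_simps)
  qed simp
  have "norm (exp_term x k y) \<le> C ^ k / fact k * norm y" for k y
  proof -
    have "exp_term x k y = (1 / fact k) *\<^sub>R ((br x ^^ k) y)"
      by (simp add: exp_term_def scaleR)
    then have "norm (exp_term x k y) = (1 / fact k) * norm ((br x ^^ k) y)" by simp
    also have "\<dots> \<le> (1 / fact k) * (C ^ k * norm y)" by (intro mult_left_mono *) simp
    finally show ?thesis by simp
  qed
  then show ?thesis using that C(1) by blast
qed

lemma summable_exp_term: "summable (\<lambda>k. norm (exp_term x k y))"
proof -
  obtain C where C: "\<And>k y. norm (exp_term x k y) \<le> C ^ k / fact k * norm y" "C \<ge> 0"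
    using exp_term_bound by blast
  have "summable (\<lambda>k. C ^ k /\<^sub>R fact k)" by (rule summable_exp_generic)
  then have "summable (\<lambda>k. C ^ k / fact k * norm y)"
    by (intro summable_mult2) (simp add: field_simps)
  then show ?thesis
  proof (rule summable_comparison_test'[where N = 0])
    show "norm (norm (exp_term x k y)) \<le> C ^ k / fact k * norm y" for k
      using C(1)[of k y] by (simp only: real_norm_def abs_norm_cancel)
  qed
qed

lemma summable_exp_term_component: "summable (\<lambda>k. norm (exp_term x k y $ i))"
  by (rule summable_comparison_test'[OF summable_exp_term[of x y], where N = 0])
    (simp add: Finite_Cartesian_Product.norm_nth_le)

lemma exp_ad_component: "(\<lambda>k. exp_term x k y $ i) sums (exp_ad br x y $ i)"
proof -
  have "(\<lambda>k. exp_term x k y) sums exp_ad br x y"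
    unfolding exp_ad_def exp_term_def[symmetric]
    using summable_norm_cancel[OF summable_exp_term] by (rule summable_sums)
  then show ?thesis by (rule bounded_linear.sums[OF bounded_linear_vec_nth])
qed

lemma clinear_exp_ad: "clinear (exp_ad br x)"
proof (rule clinearI)
  fix y z
  show "exp_ad br x (y + z) = exp_ad br x y + exp_ad br x z"
  proof (rule vec_eq_iff[THEN iffD2], rule allI)
    fix i
    have "(\<lambda>k. exp_term x k y $ i + exp_term x k z $ i) sums (exp_ad br x y $ i + exp_ad br x z $ i)"
      by (intro sums_add exp_ad_component)
    then show "exp_ad br x (y + z) $ i = (exp_ad br x y + exp_ad br x z) $ i"
      using exp_ad_component[of x "y + z" i] sums_unique2 by (fastforce simp: exp_term_linear)
  qed
next
  fix c y
  show "exp_ad br x (c *s y) = c *s exp_ad br x y"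
  proof (rule vec_eq_iff[THEN iffD2], rule allI)
    fix i
    have "(\<lambda>k. c * exp_term x k y $ i) sums (c * exp_ad br x y $ i)"
      by (intro sums_mult exp_ad_component)
    then show "exp_ad br x (c *s y) $ i = (c *s exp_ad br x y) $ i"
      using exp_ad_component[of x "c *s y" i] sums_unique2 by (fastforce simp: exp_term_linear)
  qed
qed

lemma br_component:
  "br y z $ i = (\<Sum>p\<in>UNIV. \<Sum>q\<in>UNIV. (br (axis p 1) (axis q 1) $ i) * (y $ p * z $ q))"
proof -
  have "br y z = br (\<Sum>p\<in>UNIV. y $ p *s axis p 1) (\<Sum>q\<in>UNIV. z $ q *s axis q 1)"
    by (simp add: basis_expansion)
  also have "\<dots> = (\<Sum>p\<in>UNIV. \<Sum>q\<in>UNIV. (y $ p * z $ q) *s br (axis p 1) (axis q 1))"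
    unfolding br_simps vec.scale_sum_right vec.scale_scale
    by (subst sum.swap) (simp only: mult.commute)
  finally show ?thesis by (simp add: mult.commute)
qed

text \<open>Structure constants reduce the claim to Cauchy products of scalar series, whose terms
  recombine by the Leibniz rule \<open>exp_term_br\<close>.\<close>

lemma exp_ad_br: "exp_ad br x (br y z) = br (exp_ad br x y) (exp_ad br x z)"
proof (rule vec_eq_iff[THEN iffD2], rule allI)
  fix i
  let ?c = "\<lambda>p q. br (axis p 1) (axis q 1) $ i"
  have "(\<lambda>n. \<Sum>m\<le>n. exp_term x m y $ p * exp_term x (n - m) z $ q) sums
      (exp_ad br x y $ p * exp_ad br x z $ q)" for p q
    using Cauchy_product_sums[OF summable_exp_term_component summable_exp_term_component, of x y p x z q]
    by (simp add: sums_unique[OF exp_ad_component, symmetric])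
  then have "(\<lambda>n. \<Sum>p\<in>UNIV. \<Sum>q\<in>UNIV. ?c p q * (\<Sum>m\<le>n. exp_term x m y $ p * exp_term x (n - m) z $ q)) sums
      (\<Sum>p\<in>UNIV. \<Sum>q\<in>UNIV. ?c p q * (exp_ad br x y $ p * exp_ad br x z $ q))"
    by (intro sums_sum sums_mult)
  moreover have "(\<Sum>p\<in>UNIV. \<Sum>q\<in>UNIV. ?c p q * (\<Sum>m\<le>n. exp_term x m y $ p * exp_term x (n - m) z $ q))
      = exp_term x n (br y z) $ i" for n
  proof -
    have "exp_term x n (br y z) $ i = (\<Sum>m\<le>n. br (exp_term x m y) (exp_term x (n - m) z) $ i)"
      unfolding exp_term_br[symmetric] by simp
    also have "\<dots> = (\<Sum>p\<in>UNIV. \<Sum>m\<le>n. \<Sum>q\<in>UNIV. ?c p q * (exp_term x m y $ p * exp_term x (n - m) z $ q))"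
      unfolding br_component[of "exp_term x _ y"] by (rule sum.swap)
    also have "\<dots> = (\<Sum>p\<in>UNIV. \<Sum>q\<in>UNIV. \<Sum>m\<le>n. ?c p q * (exp_term x m y $ p * exp_term x (n - m) z $ q))"
      by (intro sum.cong refl sum.swap)
    finally show ?thesis by (simp add: sum_distrib_left)
  qed
  ultimately have "(\<lambda>n. exp_term x n (br y z) $ i) sums (br (exp_ad br x y) (exp_ad br x z) $ i)"
    unfolding br_component[of "exp_ad br x y"] by simp
  then show "exp_ad br x (br y z) $ i = br (exp_ad br x y) (exp_ad br x z) $ i"
    using exp_ad_component sums_unique2 by blast
qed

lemma exp_ad_self: "exp_ad br x x = x"
proof (rule vec_eq_iff[THEN iffD2], rule allI)
  fix i
  have "exp_term x k x $ i = 0" if k: "k \<notin> {0}" for k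
  proof -
    obtain j where "k = Suc j" using k by (cases k) auto
    then have "(br x ^^ k) x = (br x ^^ j) (br x x)" by (simp add: funpow_Suc_right del: funpow.simps)
    then show ?thesis
      using vec.linear_0[OF clinear_compow[OF linear_right]] by (simp add: exp_term_def alternating)
  qed
  then have "(\<lambda>k. exp_term x k x $ i) sums (\<Sum>k\<in>{0}. exp_term x k x $ i)"
    by (intro sums_finite) auto
  then have "(\<lambda>k. exp_term x k x $ i) sums (x $ i)" by (simp add: exp_term_0)
  then show "exp_ad br x x $ i = x $ i"
    using exp_ad_component sums_unique2 by blast
qed

lemma killing_form_automorphism:
  assumes g: "lie_automorphism br g"
  shows "killing_form br (g x) (g y) = killing_form br x y"
proof -
  have lin: "clinear g" and bij: "bij g" and hom: "\<And>x y. g (br x y) = br (g x) (g y)"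
    using g by (auto simp: lie_automorphism_def)
  define k where "k = inv g"
  have gk: "g (k z) = z" and kg: "k (g z) = z" for z
    using bij by (simp_all add: k_def bij_is_surj surj_f_inv_f bij_is_inj)
  have link: "clinear k"
    by (rule clinearI) (metis gk kg vec.linear_add[OF lin], metis gk kg vec.linear_scale[OF lin])
  have "br (g x) (br (g y) z) = g (br x (br y (k z)))" for z
    using hom gk by metis
  then have "killing_form br (g x) (g y) = trace (matrix (\<lambda>z. g (br x (br y (k z)))))"
    by (simp add: killing_form_def)
  also have "\<dots> = trace (matrix (\<lambda>z. br x (br y (k (g z)))))"
    by (rule trace_matrix_commute[OF lin clinear_comp[OF linear_right clinear_comp[OF linear_right link]]])
  finally show ?thesis by (simp add: kg killing_form_def)
qed

end

context simple_lie_algebra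
begin

text \<open>Bijectivity comes from simplicity: the kernel is an ideal. It is not everything, for
  then \<open>x = exp (ad x) x\<close> would be zero, and the exponential of zero is the
  identity.\<close>

lemma exp_ad_automorphism: "lie_automorphism br (exp_ad br x)"
proof -
  let ?J = "{y. exp_ad br x y = 0}"
  have "lie_ideal br ?J"
    unfolding lie_ideal_def
    using vec.linear_subspace_kernel[OF clinear_exp_ad] by (auto simp: exp_ad_br br_simps)
  then have J: "?J = {0} \<or> ?J = UNIV" by (rule ideals_trivial)
  have "?J \<noteq> UNIV"
  proof
    assume U: "?J = UNIV"
    then have "exp_ad br x x = 0" by blast
    then have x: "x = 0" by (simp add: exp_ad_self)
    have e: "exp_ad br x y $ i = y $ i" for y i
    proof -
      have "exp_term x k y $ i = 0" if k: "k \<notin> {0}" for k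
      proof -
        obtain j where "k = Suc j" using k by (cases k) auto
        then show ?thesis by (simp add: exp_term_def x br_simps)
      qed
      then have "(\<lambda>k. exp_term x k y $ i) sums (\<Sum>k\<in>{0}. exp_term x k y $ i)"
        by (intro sums_finite) auto
      then have "(\<lambda>k. exp_term x k y $ i) sums (y $ i)" by (simp add: exp_term_0)
      then show ?thesis using exp_ad_component sums_unique2 by blast
    qed
    obtain u v where uv: "br u v \<noteq> 0" using nonabelian by blast
    have "exp_ad br x (br u v) = 0" using U by blast
    moreover have "exp_ad br x (br u v) = br u v" using e by (simp add: vec_eq_iff)
    ultimately show False using uv by simp
  qed
  then have "inj (exp_ad br x)"
    using J vec.linear_inj_iff_eq_0[OF clinear_exp_ad] by blast
  then have "bij (exp_ad br x)"
    using vec.linear_injective_imp_surjective[OF clinear_exp_ad] by (simp add: bij_def)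
  then show ?thesis by (simp add: lie_automorphism_def clinear_exp_ad exp_ad_br)
qed

lemma adjoint_group_automorphism:
  assumes "g \<in> adjoint_group br"
  shows "lie_automorphism br g"
  using assms
proof (induction rule: adjoint_group.induct)
  case id
  show ?case
    unfolding lie_automorphism_def by (intro conjI clinearI bij_id) simp_all
next
  case (exp_ad g x)
  have g: "clinear g" "bij g" "\<And>y z. g (br y z) = br (g y) (g z)"
    using exp_ad.IH by (auto simp: lie_automorphism_def)
  have e: "clinear (exp_ad br x)" "bij (exp_ad br x)"
    using exp_ad_automorphism[of x] by (auto simp: lie_automorphism_def)
  have "clinear (exp_ad br x \<circ> g)"
    unfolding comp_def by (rule clinear_comp[OF e(1) g(1)])
  moreover have "bij (exp_ad br x \<circ> g)" using g(2) e(2) by (rule bij_comp)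
  moreover have "(exp_ad br x \<circ> g) (br y z) = br ((exp_ad br x \<circ> g) y) ((exp_ad br x \<circ> g) z)" for y z
    by (simp add: g(3) exp_ad_br)
  ultimately show ?case unfolding lie_automorphism_def by (intro conjI allI)
qed

end

section \<open>Evaluation of polynomials\<close>

abbreviation fcoeff :: "complex fps \<Rightarrow> nat \<Rightarrow> complex"  (infixl "$$" 75)
  where "f $$ k \<equiv> fps_nth f k"

text \<open>Polynomials are evaluated at points, along polynomial curves and along formal arcs; the
  three evaluations share one theory with values in an arbitrary commutative ring.\<close>

locale coefficient_hom =
  fixes \<phi> :: "complex \<Rightarrow> 'a::comm_ring_1"
  assumes hom_add: "\<phi> (x + y) = \<phi> x + \<phi> y" and hom_mult: "\<phi> (x * y) = \<phi> x * \<phi> y"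
    and hom_1: "\<phi> 1 = 1"
begin

lemma hom_0: "\<phi> 0 = 0"
  using hom_add[of 0 0] by simp

definition ev :: "('i \<Rightarrow> 'a) \<Rightarrow> 'i mpoly \<Rightarrow> 'a"
  where "ev X F = (\<Sum>m\<in>Poly_Mapping.keys F. \<phi> (Poly_Mapping.lookup F m) *
    (\<Prod>i\<in>Poly_Mapping.keys m. X i ^ Poly_Mapping.lookup m i))"

end

abbreviation mvar :: "'i \<Rightarrow> 'i mpoly"
  where "mvar i \<equiv> Poly_Mapping.single (Poly_Mapping.single i (Suc 0)) 1"

abbreviation mconst :: "complex \<Rightarrow> 'i mpoly"
  where "mconst c \<equiv> Poly_Mapping.single 0 c"

lemma sum_singles: "(\<Sum>m\<in>Poly_Mapping.keys F. Poly_Mapping.single m (Poly_Mapping.lookup F m)) = F"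
proof (rule poly_mapping_eqI)
  fix k
  have "Poly_Mapping.lookup (\<Sum>m\<in>Poly_Mapping.keys F. Poly_Mapping.single m (Poly_Mapping.lookup F m)) k
      = (\<Sum>m\<in>Poly_Mapping.keys F. if m = k then Poly_Mapping.lookup F k else 0)"
    by (auto simp: lookup_sum lookup_single when_def intro!: sum.cong)
  also have "\<dots> = Poly_Mapping.lookup F k"
    by (simp add: in_keys_iff)
  finally show "Poly_Mapping.lookup (\<Sum>m\<in>Poly_Mapping.keys F. Poly_Mapping.single m (Poly_Mapping.lookup F m)) k
      = Poly_Mapping.lookup F k" .
qed

lemma mpoly_induct [case_names const var add mult]:
  fixes F :: "'i mpoly"
  assumes const: "\<And>c. P (mconst c)" and var: "\<And>i. P (mvar i)"
    and add: "\<And>F G. P F \<Longrightarrow> P G \<Longrightarrow> P (F + G)" and mult: "\<And>F G. P F \<Longrightarrow> P G \<Longrightarrow> P (F * G)"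
  shows "P F"
proof -
  have pow: "P (Poly_Mapping.single (Poly_Mapping.single i n) 1)" for i n
  proof (induction n)
    case 0
    show ?case using const[of 1] by simp
  next
    case (Suc n)
    have "Poly_Mapping.single (Poly_Mapping.single i (Suc n)) (1::complex)
        = mvar i * Poly_Mapping.single (Poly_Mapping.single i n) 1"
      by (simp add: mult_single single_add[symmetric])
    then show ?case using mult[OF var Suc] by simp
  qed
  have mon: "P (Poly_Mapping.single (\<Sum>i\<in>A. Poly_Mapping.single i (m i)) 1)" if "finite A" for A m
    using that
  proof (induction A rule: finite_induct)
    case empty
    show ?case using const[of 1] by simp
  next
    case (insert i A)
    have "Poly_Mapping.single (\<Sum>i\<in>insert i A. Poly_Mapping.single i (m i)) (1::complex)
        = Poly_Mapping.single (Poly_Mapping.single i (m i)) 1 * Poly_Mapping.single (\<Sum>i\<in>A. Poly_Mapping.single i (m i)) 1"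
      using insert.hyps by (simp add: mult_single)
    then show ?case using mult[OF pow insert.IH] by simp
  qed
  have sing: "P (Poly_Mapping.single m c)" for m c
  proof -
    have "(\<Sum>i\<in>Poly_Mapping.keys m. Poly_Mapping.single i (Poly_Mapping.lookup m i)) = m"
    proof (rule poly_mapping_eqI)
      fix k
      have "Poly_Mapping.lookup (\<Sum>i\<in>Poly_Mapping.keys m. Poly_Mapping.single i (Poly_Mapping.lookup m i)) k
          = (\<Sum>i\<in>Poly_Mapping.keys m. if i = k then Poly_Mapping.lookup m k else 0)"
        by (auto simp: lookup_sum lookup_single when_def intro!: sum.cong)
      also have "\<dots> = Poly_Mapping.lookup m k" by (simp add: in_keys_iff)
      finally show "Poly_Mapping.lookup (\<Sum>i\<in>Poly_Mapping.keys m. Poly_Mapping.single i (Poly_Mapping.lookup m i)) k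
          = Poly_Mapping.lookup m k" .
    qed
    then have "P (Poly_Mapping.single m 1)"
      using mon[of "Poly_Mapping.keys m" "Poly_Mapping.lookup m"] by simp
    then have "P (mconst c * Poly_Mapping.single m 1)" using mult const by blast
    then show ?thesis by (simp add: mult_single)
  qed
  have "P (\<Sum>m\<in>A. Poly_Mapping.single m (Poly_Mapping.lookup F m))" if "finite A" for A
    using that
  proof (induction A rule: finite_induct)
    case empty
    show ?case using const[of 0] by simp
  qed (simp add: add sing)
  from this[of "Poly_Mapping.keys F"] show ?thesis by (simp add: sum_singles)
qed

context coefficient_hom
begin

lemma ev_superset:
  assumes "finite A" "Poly_Mapping.keys F \<subseteq> A"
  shows "ev X F = (\<Sum>m\<in>A. \<phi> (Poly_Mapping.lookup F m) *
    (\<Prod>i\<in>Poly_Mapping.keys m. X i ^ Poly_Mapping.lookup m i))"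
  unfolding ev_def using assms by (intro sum.mono_neutral_left) (auto simp: in_keys_iff hom_0)

lemma ev_add: "ev X (F + G) = ev X F + ev X G"
proof -
  let ?A = "Poly_Mapping.keys F \<union> Poly_Mapping.keys G"
  have "finite ?A" by simp
  then show ?thesis
    using ev_superset[of ?A F X] ev_superset[of ?A G X] ev_superset[of ?A "F + G" X] keys_add[of F G]
    by (simp add: lookup_add hom_add distrib_right sum.distrib)
qed

lemma ev_0: "ev X 0 = 0"
  by (simp add: ev_def)

lemma ev_sum: "ev X (sum f A) = (\<Sum>i\<in>A. ev X (f i))"
  by (induction A rule: infinite_finite_induct) (simp_all add: ev_0 ev_add)

lemma ev_single: "ev X (Poly_Mapping.single m c)
    = \<phi> c * (\<Prod>i\<in>Poly_Mapping.keys m. X i ^ Poly_Mapping.lookup m i)"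
  by (simp add: ev_def hom_0)

lemma ev_const: "ev X (mconst c) = \<phi> c"
  by (simp add: ev_single)

lemma ev_var: "ev X (mvar i) = X i"
  by (simp add: ev_single hom_1)

lemma monomial_add:
  "(\<Prod>i\<in>Poly_Mapping.keys (m + n). X i ^ Poly_Mapping.lookup (m + n) i)
    = (\<Prod>i\<in>Poly_Mapping.keys m. X i ^ Poly_Mapping.lookup m i) *
      (\<Prod>i\<in>Poly_Mapping.keys n. X i ^ Poly_Mapping.lookup n i)" for X :: "'i \<Rightarrow> 'a"
proof -
  let ?A = "Poly_Mapping.keys m \<union> Poly_Mapping.keys n"
  have *: "(\<Prod>i\<in>Poly_Mapping.keys k. X i ^ Poly_Mapping.lookup k i) = (\<Prod>i\<in>?A. X i ^ Poly_Mapping.lookup k i)"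
    if "Poly_Mapping.keys k \<subseteq> ?A" for k :: "'i \<Rightarrow>\<^sub>0 nat"
    using that by (intro prod.mono_neutral_left) (auto simp: in_keys_iff)
  show ?thesis
    using *[of m] *[of n] *[OF keys_add]
    by (simp add: lookup_add power_add prod.distrib)
qed

lemma ev_mult: "ev X (F * G) = ev X F * ev X G"
proof -
  let ?s = "\<lambda>F m. Poly_Mapping.single m (Poly_Mapping.lookup F m)"
  have "F * G = (\<Sum>m\<in>Poly_Mapping.keys F. ?s F m) * (\<Sum>n\<in>Poly_Mapping.keys G. ?s G n)"
    by (simp only: sum_singles)
  also have "\<dots> = (\<Sum>m\<in>Poly_Mapping.keys F. \<Sum>n\<in>Poly_Mapping.keys G. ?s F m * ?s G n)"
    by (rule sum_product)
  finally have "ev X (F * G) = (\<Sum>m\<in>Poly_Mapping.keys F. \<Sum>n\<in>Poly_Mapping.keys G. ev X (?s F m * ?s G n))"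
    by (simp only: ev_sum)
  also have "\<dots> = (\<Sum>m\<in>Poly_Mapping.keys F. \<Sum>n\<in>Poly_Mapping.keys G. ev X (?s F m) * ev X (?s G n))"
    by (simp add: mult_single ev_single hom_mult monomial_add mult_ac)
  also have "\<dots> = ev X F * ev X G"
    unfolding sum_product[symmetric] ev_sum[symmetric] by (simp only: sum_singles)
  finally show ?thesis .
qed

lemmas ev_simps = ev_add ev_mult ev_const ev_var ev_sum ev_0

end

section \<open>The three evaluations and the differential\<close>

global_interpretation ce: coefficient_hom "\<lambda>c. c"
  by unfold_locales simp_all

global_interpretation pe: coefficient_hom "\<lambda>c. [:c:]"
  by unfold_locales (simp_all add: one_pCons)

global_interpretation fe: coefficient_hom "fps_const :: complex \<Rightarrow> complex fps"
  by unfold_locales simp_all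

lemma mpoly_eval_eq: "mpoly_eval = ce.ev"
  by (simp add: fun_eq_iff mpoly_eval_def ce.ev_def)

lemma poly_pe_ev: "poly (pe.ev X F) t = ce.ev (\<lambda>i. poly (X i) t) F"
  by (induction F rule: mpoly_induct) (simp_all add: pe.ev_simps ce.ev_simps)

lemma fps_nth_0_fe_ev: "fe.ev X F $$ 0 = ce.ev (\<lambda>i. X i $$ 0) F"
  by (induction F rule: mpoly_induct) (simp_all add: fe.ev_simps ce.ev_simps)

lemma coeff_0_pe_ev: "coeff (pe.ev X F) 0 = ce.ev (\<lambda>i. coeff (X i) 0) F"
  by (induction F rule: mpoly_induct) (simp_all add: pe.ev_simps ce.ev_simps coeff_mult)

text \<open>Replaces the analytic derivative by the linear coefficient of the restriction to a line,
  so that the product rule becomes algebra.\<close>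

lemma mpoly_differential_eq: "mpoly_differential F x v = coeff (pe.ev (\<lambda>i. [:x $ i, v $ i:]) F) 1"
proof -
  let ?p = "pe.ev (\<lambda>i. [:x $ i, v $ i:]) F"
  have eq: "(\<lambda>t. mpoly_eval (($) (x + t *s v)) F) = poly ?p"
  proof
    fix t
    have "(($) (x + t *s v)) = (\<lambda>i. poly [:x $ i, v $ i:] t)"
      by (rule ext) simp
    then show "mpoly_eval (($) (x + t *s v)) F = poly ?p t"
      by (simp only: mpoly_eval_eq poly_pe_ev)
  qed
  have "mpoly_differential F x v = deriv (poly ?p) 0"
    by (simp only: mpoly_differential_def eq)
  also have "\<dots> = poly (pderiv ?p) 0"
    by (rule DERIV_imp_deriv[OF poly_DERIV])
  also have "\<dots> = coeff ?p 1" by (simp add: poly_0_coeff_0 coeff_pderiv)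
  finally show ?thesis .
qed

lemma mpoly_differential_simps:
  "mpoly_differential (mconst c) x v = 0" "mpoly_differential (mvar i) x v = v $ i"
  "mpoly_differential (F + G) x v = mpoly_differential F x v + mpoly_differential G x v"
  "mpoly_differential (F * G) x v = ce.ev (($) x) F * mpoly_differential G x v
    + mpoly_differential F x v * ce.ev (($) x) G"
  by (simp_all add: mpoly_differential_eq pe.ev_simps coeff_mult coeff_0_pe_ev)

lemma mpoly_differential_gradient:
  fixes x v :: "complex^'n"
  shows "mpoly_differential F x v = (\<Sum>i\<in>UNIV. mpoly_gradient F x $ i * v $ i)"
proof -
  have "mpoly_differential F x v = (\<Sum>i\<in>UNIV. mpoly_differential F x (axis i 1) * v $ i)"
  proof (induction F rule: mpoly_induct)
    case (var j)
    have "(\<Sum>i\<in>UNIV. axis i 1 $ j * v $ i) = (\<Sum>i\<in>UNIV. if i = j then v $ i else 0)"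
      by (intro sum.cong) (auto simp: axis_def)
    then show ?case by (simp add: mpoly_differential_simps)
  next
    case (add F G)
    then show ?case by (simp add: mpoly_differential_simps distrib_right sum.distrib)
  next
    case (mult F G)
    show ?case
      unfolding mpoly_differential_simps mult.IH
      by (simp add: sum_distrib_left sum_distrib_right sum.distrib algebra_simps)
  qed (simp add: mpoly_differential_simps)
  then show ?thesis by (simp add: mpoly_gradient_def)
qed

interpretation mpoly_module: module "(*) :: 'i mpoly \<Rightarrow> 'i mpoly \<Rightarrow> 'i mpoly"
  by unfold_locales (simp_all add: algebra_simps)

lemma (in coefficient_hom) ev_ideal_generated:
  assumes "F \<in> ideal_generated B" "\<And>G. G \<in> B \<Longrightarrow> ev X G = 0"
  shows "ev X F = 0"
proof -
  have "mpoly_module.subspace {F. ev X F = 0}"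
    by (rule mpoly_module.subspaceI) (simp_all add: ev_simps)
  then have "mpoly_module.span B \<subseteq> {F. ev X F = 0}"
    using assms(2) by (intro mpoly_module.span_minimal) auto
  then show ?thesis using assms(1) by (auto simp: ideal_generated_def)
qed

subsection \<open>Gradings\<close>

text \<open>The common generalization of homogeneity and of both halves of bihomogeneity.\<close>

definition graded :: "'i set \<Rightarrow> nat \<Rightarrow> 'i mpoly \<Rightarrow> bool"
  where "graded A d F \<longleftrightarrow> (\<forall>m\<in>Poly_Mapping.keys F. partial_degree A m = d)"

lemma homogeneous_eq: "homogeneous = graded UNIV"
  by (simp add: fun_eq_iff homogeneous_def graded_def)

lemma bihomogeneous_eq: "bihomogeneous d e F \<longleftrightarrow> graded (range Inl) d F \<and> graded (range Inr) e F"
  by (auto simp: bihomogeneous_def graded_def)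

lemma partial_degree_add: "partial_degree A (m + n) = partial_degree A m + partial_degree A n"
proof -
  let ?K = "(Poly_Mapping.keys m \<union> Poly_Mapping.keys n) \<inter> A"
  have *: "partial_degree A k = (\<Sum>i\<in>?K. Poly_Mapping.lookup k i)"
    if "Poly_Mapping.keys k \<subseteq> Poly_Mapping.keys m \<union> Poly_Mapping.keys n" for k
    unfolding partial_degree_def using that by (intro sum.mono_neutral_left) (auto simp: in_keys_iff)
  show ?thesis
    using *[of m] *[of n] *[OF keys_add] by (simp add: lookup_add sum.distrib)
qed

lemma graded_mult:
  assumes "graded A d F" "graded A e G"
  shows "graded A (d + e) (F * G)"
  unfolding graded_def
proof
  fix m assume "m \<in> Poly_Mapping.keys (F * G)"
  then obtain a b where "m = a + b" "a \<in> Poly_Mapping.keys F" "b \<in> Poly_Mapping.keys G"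
    using keys_mult[of F G] by blast
  then show "partial_degree A m = d + e"
    using assms by (simp add: graded_def partial_degree_add)
qed

lemma graded_add: "graded A d F \<Longrightarrow> graded A d G \<Longrightarrow> graded A d (F + G)"
  using keys_add[of F G] unfolding graded_def by blast

lemma graded_0: "graded A d 0"
  by (simp add: graded_def)

lemma graded_sum: "(\<And>i. i \<in> S \<Longrightarrow> graded A d (f i)) \<Longrightarrow> graded A d (sum f S)"
  by (induction S rule: infinite_finite_induct) (simp_all add: graded_0 graded_add)

lemma graded_const: "graded A 0 (mconst c)"
  by (simp add: graded_def partial_degree_def)

lemma graded_const_mult: "graded A d F \<Longrightarrow> graded A d (mconst c * F)"
  using graded_mult[OF graded_const, of A d F c] by simp

lemma graded_var: "graded A (if i \<in> A then 1 else 0) (mvar i)"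
  by (simp add: graded_def partial_degree_def)

lemma (in coefficient_hom) ev_scale:
  assumes "homogeneous d F"
  shows "ev (\<lambda>i. c * X i) F = c ^ d * ev X F"
proof -
  have "(\<Prod>i\<in>Poly_Mapping.keys m. (c * X i) ^ Poly_Mapping.lookup m i)
      = c ^ d * (\<Prod>i\<in>Poly_Mapping.keys m. X i ^ Poly_Mapping.lookup m i)"
    if "m \<in> Poly_Mapping.keys F" for m
  proof -
    have "(\<Sum>i\<in>Poly_Mapping.keys m. Poly_Mapping.lookup m i) = d"
      using assms that by (simp add: homogeneous_def partial_degree_def)
    then show ?thesis by (simp add: power_mult_distrib prod.distrib power_sum[symmetric])
  qed
  then show ?thesis by (simp add: ev_def sum_distrib_left mult_ac)
qed

section \<open>Formal arcs\<close>

lemma fe_ev_cong: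
  assumes "\<And>i k. k \<le> N \<Longrightarrow> X i $$ k = Y i $$ k" "k \<le> N"
  shows "fe.ev X F $$ k = fe.ev Y F $$ k"
  using assms(2)
proof (induction F arbitrary: k rule: mpoly_induct)
  case (mult F G)
  then show ?case by (auto simp: fe.ev_simps fps_mult_nth intro!: sum.cong)
qed (use assms(1) in \<open>simp_all add: fe.ev_simps\<close>)

text \<open>A perturbation of order \<open>M + 1\<close> changes the value, to leading order, by the
  differential at the initial point of the arc. This controls one step of the Newton
  iteration.\<close>

lemma fe_ev_taylor:
  fixes w :: "complex^'n"
  shows "\<exists>G. fe.ev (\<lambda>i. X i + fps_X ^ Suc M * fps_const (w $ i)) F
    = fe.ev X F + fps_X ^ Suc M * (fps_const (mpoly_differential F (\<chi> i. X i $$ 0) w) + fps_X * G)"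
proof (induction F rule: mpoly_induct)
  case (const c)
  show ?case by (intro exI[of _ 0]) (simp add: fe.ev_simps mpoly_differential_simps)
next
  case (var i)
  show ?case by (intro exI[of _ 0]) (simp add: fe.ev_simps mpoly_differential_simps)
next
  case (add F G)
  then obtain P Q where
    "fe.ev (\<lambda>i. X i + fps_X ^ Suc M * fps_const (w $ i)) F
      = fe.ev X F + fps_X ^ Suc M * (fps_const (mpoly_differential F (\<chi> i. X i $$ 0) w) + fps_X * P)"
    "fe.ev (\<lambda>i. X i + fps_X ^ Suc M * fps_const (w $ i)) G
      = fe.ev X G + fps_X ^ Suc M * (fps_const (mpoly_differential G (\<chi> i. X i $$ 0) w) + fps_X * Q)"
    by blast
  then show ?case
    by (intro exI[of _ "P + Q"])
      (simp add: fe.ev_simps mpoly_differential_simps fps_const_add[symmetric] algebra_simps del: fps_const_add)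
next
  case (mult F G)
  let ?x = "\<chi> i. X i $$ 0"
  define a where "a = mpoly_differential F ?x w"
  define b where "b = mpoly_differential G ?x w"
  define A where "A = fe.ev X F"
  define B where "B = fe.ev X G"
  define T where "T = (fps_X :: complex fps) ^ M"
  obtain P Q where
    P: "fe.ev (\<lambda>i. X i + fps_X ^ Suc M * fps_const (w $ i)) F = A + fps_X * T * (fps_const a + fps_X * P)" and
    Q: "fe.ev (\<lambda>i. X i + fps_X ^ Suc M * fps_const (w $ i)) G = B + fps_X * T * (fps_const b + fps_X * Q)"
    using mult.IH unfolding a_def b_def A_def B_def T_def power_Suc by blast
  have dec: "C = fps_const (C $$ 0) + fps_X * fps_shift 1 C" for C :: "complex fps"
    by (simp add: fps_eq_iff fps_X_mult_nth)
  define A1 where "A1 = fps_shift 1 A"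
  define B1 where "B1 = fps_shift 1 B"
  have "(($) ?x) = (\<lambda>i. X i $$ 0)" by (rule ext) simp
  then have A0: "A $$ 0 = ce.ev (($) ?x) F" and B0: "B $$ 0 = ce.ev (($) ?x) G"
    by (simp_all only: A_def B_def fps_nth_0_fe_ev)
  have Ad: "A = fps_const (A $$ 0) + fps_X * A1" and Bd: "B = fps_const (B $$ 0) + fps_X * B1"
    unfolding A1_def B1_def by (rule dec)+
  define R where "R = fps_const a * B1 + A1 * fps_const b + P * B + A * Q
    + T * (fps_const a + fps_X * P) * (fps_const b + fps_X * Q)"
  have "(A + fps_X * T * (fps_const a + fps_X * P)) * (B + fps_X * T * (fps_const b + fps_X * Q))
      = A * B + fps_X * T * (fps_const a * B + A * fps_const b + fps_X * (P * B + A * Q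
        + T * (fps_const a + fps_X * P) * (fps_const b + fps_X * Q)))"
    by (simp add: algebra_simps)
  also have "fps_const a * B = fps_const (a * B $$ 0) + fps_X * (fps_const a * B1)"
    by (subst Bd) (simp add: algebra_simps)
  also have "A * fps_const b = fps_const (A $$ 0 * b) + fps_X * (A1 * fps_const b)"
    by (subst Ad) (simp add: algebra_simps)
  finally have "(A + fps_X * T * (fps_const a + fps_X * P)) * (B + fps_X * T * (fps_const b + fps_X * Q))
      = A * B + fps_X * T * (fps_const (A $$ 0 * b + a * B $$ 0) + fps_X * R)"
    by (simp add: R_def fps_const_add[symmetric] algebra_simps del: fps_const_add)
  then show ?case
    unfolding fe.ev_mult mpoly_differential_simps P Q
    unfolding A0[symmetric] B0[symmetric] a_def[symmetric] b_def[symmetric] A_def[symmetric]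
      B_def[symmetric] power_Suc T_def[symmetric]
    by (rule exI)
qed

text \<open>Newton iteration: as the differentials of the equations in \<open>B\<close> are linearly independent, a solution
  modulo \<open>t\<^sup>N\<^sup>+\<^sup>2\<close> can be corrected to a solution modulo \<open>t\<^sup>N\<^sup>+\<^sup>3\<close>.\<close>

lemma formal_arc_complete_intersection:
  fixes x b :: "complex^'n"
  assumes B: "finite B" "vec.dim ((\<lambda>F. mpoly_gradient F x) ` B) = card B"
    and x: "\<And>F. F \<in> B \<Longrightarrow> ce.ev (($) x) F = 0"
    and b: "\<And>F. F \<in> B \<Longrightarrow> mpoly_differential F x b = 0"
  obtains X where "\<And>i. X i $$ 0 = x $ i" "\<And>i. X i $$ 1 = b $ i" "\<And>F. F \<in> B \<Longrightarrow> fe.ev X F = 0"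
proof -
  define g where "g F = mpoly_gradient F x" for F
  have "card (g ` B) \<le> card B" using B(1) by (rule card_image_le)
  moreover have "vec.dim (g ` B) \<le> card (g ` B)" by (rule vec.dim_le_card[OF vec.span_superset]) (simp add: B(1))
  ultimately have card: "card (g ` B) = card B" "vec.dim (g ` B) = card (g ` B)" using B(2) by (simp_all add: g_def)
  then have inj: "inj_on g B" using B(1) by (intro eq_card_imp_inj_on) simp_all
  have ind: "vec.independent (g ` B)"
    by (rule vec.card_le_dim_spanning[of _ "g ` B"]) (simp_all add: B(1) card vec.span_superset)
  have "\<exists>v. \<forall>F\<in>B. v F \<in> UNIV \<and> (\<forall>G\<in>B. mpoly_differential G x (v F) = (if F = G then 1 else 0))"
  proof (rule dual_vectors[OF B(1) vec.subspace_UNIV])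
    show "mpoly_differential G x (v + w) = mpoly_differential G x v + mpoly_differential G x w"
      "mpoly_differential G x (c *s v) = c * mpoly_differential G x v" for G v w c
      by (simp_all add: mpoly_differential_gradient algebra_simps sum.distrib sum_distrib_left)
    fix c F assume c: "\<forall>v\<in>UNIV. (\<Sum>F\<in>B. c F * mpoly_differential F x v) = 0" and F: "F \<in> B"
    have "(\<Sum>F\<in>B. c F *s g F) = 0"
    proof (rule vec_eq_iff[THEN iffD2], rule allI)
      fix i
      have "mpoly_differential F x (axis i 1) = g F $ i" for F
        by (simp add: g_def mpoly_gradient_def)
      then show "(\<Sum>F\<in>B. c F *s g F) $ i = 0 $ i" using bspec[OF c, of "axis i 1"] by simp
    qed
    moreover have "(\<Sum>F\<in>B. c F *s g F) = (\<Sum>v\<in>g ` B. c (inv_into B g v) *s v)"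
      using inj by (simp add: sum.reindex)
    ultimately have "(\<Sum>v\<in>g ` B. c (inv_into B g v) *s v) = 0" by simp
    then have "\<forall>v\<in>g ` B. c (inv_into B g v) = 0"
      using ind[unfolded independent_iff_scalars, THEN conjunct2, rule_format, of "\<lambda>v. c (inv_into B g v)"]
      by simp
    then show "c F = 0" using F inj by simp
  qed
  then obtain v where v: "\<And>F G. F \<in> B \<Longrightarrow> G \<in> B \<Longrightarrow> mpoly_differential G x (v F) = (if F = G then 1 else 0)" by blast
  have lin_sum: "mpoly_differential G x (\<Sum>F\<in>B. e F *s v F) = (\<Sum>F\<in>B. e F * mpoly_differential G x (v F))" for G e
    by (simp add: mpoly_differential_gradient sum_distrib_left sum_distrib_right mult_ac)
      (rule sum.swap)
  \<comment> \<open>Stage \<open>N\<close> solves the equations modulo \<open>t^(N+2)\<close>,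
    starting from the line \<open>x + t b\<close>. The vectors \<open>v F\<close> are dual to the
    differentials, so this correction at order \<open>N + 2\<close> cancels the first unsolved
    coefficient of every equation at once.\<close>
  define w where "w N Y = (\<Sum>F\<in>B. (- (fe.ev Y F $$ (N + 2))) *s v F)" for N and Y :: "'n \<Rightarrow> complex fps"
  define Xs where "Xs = rec_nat (\<lambda>i. fps_const (x $ i) + fps_X ^ Suc 0 * fps_const (b $ i))
    (\<lambda>N Y i. Y i + fps_X ^ Suc (N + 1) * fps_const (w N Y $ i))"
  have Xs_0: "Xs 0 = (\<lambda>i. fps_const (x $ i) + fps_X ^ Suc 0 * fps_const (b $ i))"
    and Xs_Suc: "Xs (Suc N) = (\<lambda>i. Xs N i + fps_X ^ Suc (N + 1) * fps_const (w N (Xs N) $ i))" for N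
    by (simp_all add: Xs_def)
  have nth: "(fps_X ^ Suc M * fps_const c) $$ k = (if k = Suc M then c else 0)" for M k and c :: complex
    by (simp add: fps_X_power_mult_nth del: power_Suc)
  have stable: "Xs (N + d) i $$ k = Xs N i $$ k" if "k \<le> N + 1" for N d i k
    using that by (induction d) (simp_all add: Xs_Suc nth del: power_Suc)
  have Xs_low: "Xs N i $$ 0 = x $ i" "Xs N i $$ 1 = b $ i" for N i
    using stable[of 0 0 N i] stable[of 1 0 N i] by (simp_all add: Xs_0)
  have Xs_x: "(\<chi> i. Xs N i $$ 0) = x" for N by (simp add: vec_eq_iff Xs_low)
  have zero: "fe.ev (Xs N) F $$ k = 0" if F: "F \<in> B" and k: "k \<le> N + 1" for N F k
    using k
  proof (induction N arbitrary: k)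
    case 0
    have "(\<chi> i. fps_const (x $ i) $$ 0) = x" by (simp add: vec_eq_iff)
    then obtain G where "fe.ev (Xs 0) F = fe.ev (\<lambda>i. fps_const (x $ i)) F
        + fps_X ^ Suc 0 * (fps_const (mpoly_differential F x b) + fps_X * G)"
      using fe_ev_taylor[of "\<lambda>i. fps_const (x $ i)" 0 b F] by (auto simp: Xs_0)
    moreover have "fe.ev (\<lambda>i. fps_const (x $ i)) F = fps_const (ce.ev (($) x) F)"
      by (induction F rule: mpoly_induct) (simp_all add: fe.ev_simps ce.ev_simps)
    ultimately have "fe.ev (Xs 0) F = fps_X * (fps_X * G)" using x[OF F] b[OF F] by simp
    moreover have "k = 0 \<or> k = 1" using 0 by auto
    ultimately show ?case by auto
  next
    case (Suc N)
    obtain G where G: "fe.ev (Xs (Suc N)) F = fe.ev (Xs N) F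
        + fps_X ^ Suc (N + 1) * (fps_const (mpoly_differential F x (w N (Xs N))) + fps_X * G)"
      using fe_ev_taylor[of "Xs N" "N + 1" "w N (Xs N)" F] unfolding Xs_Suc Xs_x by blast
    have dF: "mpoly_differential F x (w N (Xs N)) = - (fe.ev (Xs N) F $$ (N + 2))"
    proof -
      have "mpoly_differential F x (w N (Xs N))
          = (\<Sum>G\<in>B. if G = F then - (fe.ev (Xs N) F $$ (N + 2)) else 0)"
        unfolding w_def lin_sum using v F by (intro sum.cong) auto
      then show ?thesis using B(1) F by simp
    qed
    show ?case
    proof (cases "k \<le> N + 1")
      case True
      then show ?thesis using Suc.IH[OF True] by (simp add: G fps_X_power_mult_nth del: power_Suc)
    next
      case False
      then have "k = N + 2" using Suc.prems by simp
      then show ?thesis by (simp add: G dF fps_X_power_mult_nth del: power_Suc)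
    qed
  qed
  \<comment> \<open>The stages converge coefficientwise: the coefficient \<open>k\<close> no longer
    changes from stage \<open>k\<close> on.\<close>
  define X where "X i = Abs_fps (\<lambda>k. Xs k i $$ k)" for i
  have X: "X i $$ k = Xs N i $$ k" if "k \<le> N" for i k N
    using stable[of k k "N - k" i] that by (simp add: X_def)
  have "fe.ev X F = 0" if F: "F \<in> B" for F
  proof (rule fps_ext)
    show "fe.ev X F $$ N = 0 $$ N" for N
      using fe_ev_cong[of N X "Xs N" N F] X zero[OF F, of N N] by simp
  qed
  moreover have "X i $$ 0 = x $ i" "X i $$ 1 = b $ i" for i
    using X[of 0 0 i] X[of 1 1 i] Xs_low by simp_all
  ultimately show ?thesis using that by blast
qed

text \<open>The equations in \<open>B\<close> generate the ideal only after localization. The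
  denominators \<open>H\<close> do not vanish at the initial point, hence are nonzero series along
  the arc and can be cancelled.\<close>

lemma formal_arc:
  fixes x b :: "complex^'n"
  assumes smooth: "smooth_at I x"
    and x: "\<And>F. F \<in> I \<Longrightarrow> mpoly_eval (($) x) F = 0"
    and b: "\<And>F. F \<in> I \<Longrightarrow> mpoly_differential F x b = 0"
  obtains X where "\<And>i. X i $$ 0 = x $ i" "\<And>i. X i $$ 1 = b $ i" "\<And>F. F \<in> I \<Longrightarrow> fe.ev X F = 0"
proof -
  obtain B where B: "finite B" "B \<subseteq> I" "vec.dim ((\<lambda>F. mpoly_gradient F x) ` B) = card B"
    and loc: "\<And>F. F \<in> I \<Longrightarrow> \<exists>H d. homogeneous d H \<and> mpoly_eval (($) x) H \<noteq> 0 \<and> H * F \<in> ideal_generated B"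
    using smooth unfolding smooth_at_def by blast
  obtain X where X: "\<And>i. X i $$ 0 = x $ i" "\<And>i. X i $$ 1 = b $ i" "\<And>F. F \<in> B \<Longrightarrow> fe.ev X F = 0"
  proof (rule formal_arc_complete_intersection[OF B(1,3)])
    show "ce.ev (($) x) F = 0" if "F \<in> B" for F using x B(2) that by (auto simp: mpoly_eval_eq)
    show "mpoly_differential F x b = 0" if "F \<in> B" for F using b B(2) that by auto
  qed blast
  have "fe.ev X F = 0" if F: "F \<in> I" for F
  proof -
    obtain H where H: "mpoly_eval (($) x) H \<noteq> 0" "H * F \<in> ideal_generated B" using loc[OF F] by blast
    have "fe.ev X H * fe.ev X F = 0"
      using fe.ev_ideal_generated[OF H(2) X(3)] by (simp add: fe.ev_mult)
    moreover have "fe.ev X H $$ 0 \<noteq> 0" using H(1) by (simp add: fps_nth_0_fe_ev X(1) mpoly_eval_eq)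
    then have "fe.ev X H \<noteq> 0" by auto
    ultimately show ?thesis by simp
  qed
  then show ?thesis using that X by blast
qed

section \<open>Orders of forms along an arc\<close>

global_interpretation mpoly_space: vector_space "\<lambda>(c::complex) (F :: 'i mpoly). mconst c * F"
proof unfold_locales
  show "mconst a * (mconst b * F) = mconst (a * b) * F" for a b and F :: "'i mpoly"
    by (simp add: mult.assoc[symmetric] mult_single)
qed (simp_all add: distrib_left distrib_right single_add)

lemma finite_monomials: "finite {m :: 'n::finite \<Rightarrow>\<^sub>0 nat. partial_degree UNIV m = d}"
proof -
  have "Poly_Mapping.lookup m i \<le> partial_degree UNIV m" for m :: "'n \<Rightarrow>\<^sub>0 nat" and i
  proof (cases "i \<in> Poly_Mapping.keys m")
    case True
    then show ?thesis
      unfolding partial_degree_def by (intro member_le_sum) simp_all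
  qed (simp add: in_keys_iff)
  then have "Poly_Mapping.lookup ` {m :: 'n \<Rightarrow>\<^sub>0 nat. partial_degree UNIV m = d} \<subseteq> PiE UNIV (\<lambda>_. {..d})"
    by (auto simp: PiE_UNIV_domain)
  then have "finite (Poly_Mapping.lookup ` {m :: 'n \<Rightarrow>\<^sub>0 nat. partial_degree UNIV m = d})"
    by (rule finite_subset) (simp add: finite_PiE)
  then show ?thesis
    by (rule finite_imageD) (simp add: inj_on_def poly_mapping_eqI)
qed

text \<open>Forms with distinct orders are independent along the arc, so the size of this set is a
  lower bound for the Hilbert function of any scheme containing the arc.\<close>

definition arc_orders :: "('i \<Rightarrow> complex fps) \<Rightarrow> nat \<Rightarrow> nat set"
  where "arc_orders X m = {subdegree (fe.ev X G) | G. homogeneous m G \<and> fe.ev X G \<noteq> 0}"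

lemma arc_orders_0: "0 \<in> arc_orders X 0"
proof -
  have "fe.ev X (mconst 1) = 1" by (simp only: fe.ev_const) simp
  then show ?thesis
    unfolding arc_orders_def homogeneous_eq
    by (intro CollectI exI[of _ "mconst 1"]) (simp add: graded_const del: single_one)
qed

lemma arc_orders_add: "a \<in> arc_orders X m \<Longrightarrow> b \<in> arc_orders X k \<Longrightarrow> a + b \<in> arc_orders X (m + k)"
proof -
  assume "a \<in> arc_orders X m" "b \<in> arc_orders X k"
  then obtain F G where "homogeneous m F" "fe.ev X F \<noteq> 0" "a = subdegree (fe.ev X F)"
    "homogeneous k G" "fe.ev X G \<noteq> 0" "b = subdegree (fe.ev X G)"
    unfolding arc_orders_def by blast
  then show ?thesis
    unfolding arc_orders_def homogeneous_eq
    by (intro CollectI exI[of _ "F * G"]) (simp add: graded_mult fe.ev_mult)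
qed

text \<open>Elements of \<open>I\<close> vanish on the arc, so forms with distinct finite orders
  extend a basis of the degree \<open>m\<close> part of \<open>I\<close> to a larger independent
  set.\<close>

lemma card_arc_orders_dim:
  fixes X :: "'n::finite \<Rightarrow> complex fps"
  assumes I: "\<And>F. F \<in> I \<Longrightarrow> fe.ev X F = 0" and K: "finite K" "K \<subseteq> arc_orders X m"
  shows "mpoly_dim {F \<in> I. homogeneous m F} + card K \<le> mpoly_dim {F :: 'n mpoly. homogeneous m F}"
proof -
  define S where "S = {F :: 'n mpoly. homogeneous m F}"
  define M where "M = (\<lambda>k. Poly_Mapping.single k (1::complex)) ` {k :: 'n \<Rightarrow>\<^sub>0 nat. partial_degree UNIV k = m}"
  have M: "finite M" unfolding M_def using finite_monomials by (rule finite_imageI)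
  have span: "F \<in> mpoly_space.span M" if "F \<in> S" for F
  proof -
    have "mconst (Poly_Mapping.lookup F k) * Poly_Mapping.single k 1 \<in> mpoly_space.span M"
      if "k \<in> Poly_Mapping.keys F" for k
      using that \<open>F \<in> S\<close> unfolding S_def M_def homogeneous_def
      by (intro mpoly_space.span_scale mpoly_space.span_base) blast
    then have "(\<Sum>k\<in>Poly_Mapping.keys F. mconst (Poly_Mapping.lookup F k) * Poly_Mapping.single k 1)
        \<in> mpoly_space.span M"
      by (rule mpoly_space.span_sum)
    then show ?thesis by (simp add: mult_single sum_singles)
  qed
  obtain B where B: "B \<subseteq> {F \<in> I. homogeneous m F}" "mpoly_space.independent B"
    "{F \<in> I. homogeneous m F} \<subseteq> mpoly_space.span B"
    "card B = mpoly_space.dim {F \<in> I. homogeneous m F}"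
    using mpoly_space.basis_exists by blast
  obtain C where C: "C \<subseteq> S" "mpoly_space.independent C" "S \<subseteq> mpoly_space.span C"
    "card C = mpoly_space.dim S"
    using mpoly_space.basis_exists by blast
  have C_fin: "finite C"
    using mpoly_space.independent_span_bound[OF M C(2)] C(1) span by blast
  have "\<forall>k\<in>K. \<exists>G. homogeneous m G \<and> fe.ev X G \<noteq> 0 \<and> subdegree (fe.ev X G) = k"
    using K(2) unfolding arc_orders_def by blast
  then obtain G where G: "\<And>k. k \<in> K \<Longrightarrow> homogeneous m (G k)" "\<And>k. k \<in> K \<Longrightarrow> fe.ev X (G k) \<noteq> 0"
    "\<And>k. k \<in> K \<Longrightarrow> subdegree (fe.ev X (G k)) = k"
    by (metis (no_types) bchoice)
  have B_fin: "finite B"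
    using mpoly_space.independent_span_bound[OF M B(2)] B(1) span unfolding S_def by blast
  have "mpoly_space.independent (B \<union> G ` L) \<and> card (B \<union> G ` L) = card B + card L" if "finite L" "L \<subseteq> K" for L
    using that
  proof (induction L rule: finite_linorder_min_induct)
    case (insert l L)
    have l: "l \<in> K" and L: "L \<subseteq> K" using insert.prems by auto
    \<comment> \<open>Orders are added from the largest downwards. All earlier forms have
      coefficient 0 at the new smallest order \<open>l\<close>, hence so does their span, but
      \<open>G l\<close> does not.\<close>
    have "mpoly_space.subspace {F. fe.ev X F $$ l = 0}"
      by (rule mpoly_space.subspaceI) (simp_all add: fe.ev_simps)
    moreover have "B \<union> G ` L \<subseteq> {F. fe.ev X F $$ l = 0}"
    proof -
      have "fe.ev X F $$ l = 0" if "F \<in> B" for F using that B(1) I by auto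
      moreover have "fe.ev X (G k) $$ l = 0" if "k \<in> L" for k
      proof -
        have "l < subdegree (fe.ev X (G k))" using insert.hyps(2) that G(3) L by auto
        then show ?thesis by (rule nth_less_subdegree_zero)
      qed
      ultimately show ?thesis by blast
    qed
    ultimately have "mpoly_space.span (B \<union> G ` L) \<subseteq> {F. fe.ev X F $$ l = 0}"
      by (intro mpoly_space.span_minimal)
    moreover have "fe.ev X (G l) $$ l \<noteq> 0"
      using nth_subdegree_nonzero[OF G(2)[OF l]] G(3)[OF l] by simp
    ultimately have nin: "G l \<notin> mpoly_space.span (B \<union> G ` L)" by blast
    then have nin': "G l \<notin> B \<union> G ` L" by (rule contrapos_nn) (rule mpoly_space.span_base)
    have "mpoly_space.independent (insert (G l) (B \<union> G ` L))"
      using nin insert.IH[OF L] by (intro mpoly_space.independent_insertI) simp_all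
    moreover have "card (insert (G l) (B \<union> G ` L)) = Suc (card (B \<union> G ` L))"
      using nin' B_fin insert.hyps(1) by (intro card_insert_disjoint) simp_all
    moreover have "l \<notin> L" using insert.hyps(2) by auto
    ultimately show ?case using insert.IH[OF L] insert.hyps(1) by simp
  qed (simp add: B(2))
  from this[OF K(1) order_refl] have ind: "mpoly_space.independent (B \<union> G ` K)"
    and card: "card (B \<union> G ` K) = card B + card K" by simp_all
  have "B \<union> G ` K \<subseteq> S" using B(1) G(1) unfolding S_def by blast
  then have "card (B \<union> G ` K) \<le> card C"
    using mpoly_space.independent_span_bound[OF C_fin ind] C(3) by blast
  then show ?thesis
    unfolding mpoly_dim_def using card B(4) C(4) by (simp add: S_def)
qed

text \<open>The translates \<open>A + Min B\<close> and \<open>Max A + B\<close> lie in the sumset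
  and can share only the element \<open>Max A + Min B\<close>.\<close>

lemma card_sumset_ge:
  fixes A B :: "nat set"
  assumes "finite A" "finite B" "A \<noteq> {}" "B \<noteq> {}"
  shows "card A + card B \<le> Suc (card ((\<lambda>(a, b). a + b) ` (A \<times> B)))"
proof -
  define P where "P = (\<lambda>a. a + Min B) ` A"
  define Q where "Q = (\<lambda>b. Max A + b) ` B"
  have "P \<inter> Q \<subseteq> {Max A + Min B}"
  proof
    fix c assume "c \<in> P \<inter> Q"
    then obtain a b where "a \<in> A" "b \<in> B" "c = a + Min B" "c = Max A + b" unfolding P_def Q_def by blast
    moreover have "a \<le> Max A" "Min B \<le> b" using assms calculation(1,2) by simp_all
    ultimately show "c \<in> {Max A + Min B}" by simp
  qed
  then have "card (P \<inter> Q) \<le> 1" using card_mono[of "{Max A + Min B}" "P \<inter> Q"] by simp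
  moreover have "card P = card A" "card Q = card B"
    unfolding P_def Q_def by (rule card_image, simp add: inj_on_def)+
  moreover have "card P + card Q = card (P \<union> Q) + card (P \<inter> Q)"
    using assms by (intro card_Un_Int) (simp_all add: P_def Q_def)
  moreover have "card (P \<union> Q) \<le> card ((\<lambda>(a, b). a + b) ` (A \<times> B))"
  proof (rule card_mono)
    show "finite ((\<lambda>(a, b). a + b) ` (A \<times> B))" using assms by simp
    have "a + Min B \<in> (\<lambda>(a, b). a + b) ` (A \<times> B)" if "a \<in> A" for a
      using that Min_in[OF assms(2,4)] by (intro image_eqI[of _ _ "(a, Min B)"]) simp_all
    moreover have "Max A + b \<in> (\<lambda>(a, b). a + b) ` (A \<times> B)" if "b \<in> B" for b
      using that Max_in[OF assms(1,3)] by (intro image_eqI[of _ _ "(Max A, b)"]) simp_all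
    ultimately show "P \<union> Q \<subseteq> (\<lambda>(a, b). a + b) ` (A \<times> B)" unfolding P_def Q_def by blast
  qed
  ultimately show ?thesis by linarith
qed

text \<open>The Hilbert polynomial gives the bound only for large degrees; a set of orders in degree \<open>d\<close> that
  violates it would do so in all degrees \<open>j * d\<close> because of the growth of sumsets.\<close>

lemma card_arc_orders_le:
  fixes X :: "'n::finite \<Rightarrow> complex fps"
  assumes I: "\<And>F. F \<in> I \<Longrightarrow> fe.ev X F = 0" and hilb: "has_hilbert_polynomial I [:1, 2:]"
    and d: "d > 0" and K: "finite K" "K \<subseteq> arc_orders X d"
  shows "card K \<le> 2 * d + 1"
proof (rule ccontr)
  assume "\<not> card K \<le> 2 * d + 1"
  then have cK: "card K \<ge> 2 * d + 2" by simp
  then have K_ne: "K \<noteq> {}" by auto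
  \<comment> \<open>Each sumset with \<open>K\<close> gains at least \<open>2 d + 1\<close>
    elements, so in degree \<open>j d\<close> the count exceeds the Hilbert polynomial by
    \<open>j\<close>.\<close>
  have multiple: "\<exists>L. finite L \<and> L \<noteq> {} \<and> L \<subseteq> arc_orders X (j * d) \<and> j * (2 * d + 1) + 1 \<le> card L" for j
  proof (induction j)
    case 0
    show ?case by (intro exI[of _ "{0}"]) (simp add: arc_orders_0)
  next
    case (Suc j)
    then obtain L where L: "finite L" "L \<noteq> {}" "L \<subseteq> arc_orders X (j * d)" "j * (2 * d + 1) + 1 \<le> card L" by blast
    define T where "T = (\<lambda>(a, b). a + b) ` (L \<times> K)"
    have "finite T" "T \<noteq> {}" using L(1,2) K(1) K_ne by (simp_all add: T_def)
    moreover have "T \<subseteq> arc_orders X (Suc j * d)"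
      unfolding T_def using L(3) K(2) arc_orders_add[of _ X "j * d" _ d] by (auto simp: add.commute)
    moreover have "card L + card K \<le> Suc (card T)"
      unfolding T_def using L(1,2) K(1) K_ne by (intro card_sumset_ge)
    then have "Suc j * (2 * d + 1) + 1 \<le> card T" using L(4) cK by simp
    ultimately show ?case by blast
  qed
  obtain N where N: "\<And>m. m \<ge> N \<Longrightarrow>
    of_nat (mpoly_dim {F :: 'n mpoly. homogeneous m F}) - of_nat (mpoly_dim {F \<in> I. homogeneous m F})
         = poly [:1, 2 :: rat:] (of_nat m)"
    using hilb unfolding has_hilbert_polynomial_def eventually_sequentially by blast
  define j where "j = Suc N"
  obtain L where L: "finite L" "L \<subseteq> arc_orders X (j * d)" "j * (2 * d + 1) + 1 \<le> card L" using multiple by blast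
  have jN: "j * d \<ge> N" using d by (cases d) (simp_all add: j_def)
  have "of_nat (mpoly_dim {F :: 'n mpoly. homogeneous (j * d) F})
      = (of_nat (mpoly_dim {F \<in> I. homogeneous (j * d) F} + (2 * (j * d) + 1)) :: rat)"
    using N[OF jN] by (simp add: algebra_simps)
  then have "mpoly_dim {F :: 'n mpoly. homogeneous (j * d) F}
      = mpoly_dim {F \<in> I. homogeneous (j * d) F} + (2 * (j * d) + 1)"
    by (simp only: of_nat_eq_iff)
  then have "card L \<le> 2 * (j * d) + 1" using card_arc_orders_dim[of I X, OF I L(1,2)] by linarith
  moreover have "j * (2 * d + 1) + 1 = 2 * (j * d) + 1 + j" by (simp add: algebra_simps)
  ultimately show False using L(3) by (simp add: j_def)
qed

section \<open>Parametrization of conics\<close>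

definition linear_form :: "complex^'n \<Rightarrow> 'n mpoly"
  where "linear_form u = (\<Sum>i\<in>UNIV. mconst (u $ i) * mvar i)"

lemma homogeneous_linear_form: "homogeneous 1 (linear_form u)"
  unfolding homogeneous_eq linear_form_def using graded_var[where A = UNIV]
  by (intro graded_sum graded_const_mult) simp

lemma fe_ev_linear_form: "fe.ev X (linear_form u) = (\<Sum>i\<in>UNIV. fps_const (u $ i) * X i)"
  unfolding linear_form_def by (simp only: fe.ev_simps)

lemma fe_ev_compose:
  assumes "s $$ 0 = 0"
  shows "fe.ev (\<lambda>i. fps_of_poly (p i) oo s) F = fps_of_poly (pe.ev p F) oo s"
  using assms
  by (induction F rule: mpoly_induct)
    (simp_all add: fe.ev_simps pe.ev_simps fps_of_poly_const fps_of_poly_add fps_of_poly_mult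
      fps_compose_add_distrib fps_compose_mult_distrib)

lemma arc_vanishing_criterion:
  assumes G: "homogeneous d G" "\<And>k. k < M \<Longrightarrow> fe.ev X G $$ k = 0"
    and M: "\<And>k. k \<in> arc_orders X d \<Longrightarrow> k < M"
  shows "fe.ev X G = 0"
proof (rule ccontr)
  assume ne: "fe.ev X G \<noteq> 0"
  then have "subdegree (fe.ev X G) \<in> arc_orders X d" using G(1) unfolding arc_orders_def by blast
  then have "fe.ev X G $$ subdegree (fe.ev X G) = 0" using G(2) M by blast
  then show False using ne by simp
qed

text \<open>If linear forms have the orders \<open>0\<close>, \<open>1\<close> and \<open>k > 1\<close> on the arc, then quadratic forms have the orders
  \<open>0, 1, 2, k, k + 1, 2 k\<close>, of which at most five are distinct, so \<open>k = 2\<close>. For forms \<open>\<alpha>\<close>, \<open>\<beta>\<close>, \<open>\<gamma>\<close> of the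
  orders \<open>0\<close>, \<open>1\<close>, \<open>2\<close>, the same bound gives a relation \<open>\<beta>\<^sup>2 = \<alpha>' \<gamma>\<close>, and \<open>s = \<beta> / \<alpha>'\<close> is the parameter.\<close>

lemma arc_in_conic:
  fixes x b :: "complex^'n" and X :: "'n \<Rightarrow> complex fps"
  assumes I: "\<And>F. F \<in> I \<Longrightarrow> fe.ev X F = 0" and hilb: "has_hilbert_polynomial I [:1, 2:]"
    and X: "\<And>i. X i $$ 0 = x $ i" "\<And>i. X i $$ 1 = b $ i"
    and x: "x \<noteq> 0" and b: "b \<notin> vec.span {x}"
  obtains \<alpha> s :: "complex fps" and \<kappa> \<tau> :: complex and c :: "complex^'n"
  where "\<kappa> \<noteq> 0" "\<alpha> \<noteq> 0" "s \<noteq> 0" "s $$ 0 = 0"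
    "\<And>i. X i = \<alpha> * (fps_const (\<kappa> * x $ i) + fps_const (b $ i + \<tau> * x $ i) * s + fps_const (c $ i) * s\<^sup>2)"
proof -
  note One_nat_def [simp del]
  have bound: "card K \<le> 2 * d + 1" if "d > 0" "finite K" "K \<subseteq> arc_orders X d" for d K
    using card_arc_orders_le[of I X, OF I hilb that] .
  define dot where "dot u v = (\<Sum>i\<in>UNIV. u $ i * v $ i)" for u v :: "complex^'n"
  define L where "L u = fe.ev X (linear_form u)" for u
  have L: "L u = (\<Sum>i\<in>UNIV. fps_const (u $ i) * X i)" for u
    by (simp add: L_def fe_ev_linear_form)
  have L0: "L u $$ 0 = dot u x" and L1: "L u $$ 1 = dot u b" for u
    by (simp_all add: L dot_def fps_sum_nth X)
  have L_add: "L (u + v) = L u + L v" and L_scale: "L (k *s u) = fps_const k * L u" for u v k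
    by (simp_all add: L fps_const_add[symmetric] fps_const_mult[symmetric] distrib_right sum.distrib
        sum_distrib_left mult.assoc del: fps_const_add fps_const_mult)
  have L_axis: "L (axis i 1) = X i" for i
  proof -
    have "L (axis i 1) = (\<Sum>j\<in>UNIV. if j = i then X j else 0)"
      unfolding L by (intro sum.cong) (simp_all add: axis_def)
    then show ?thesis by simp
  qed
  have dot_axis: "dot (axis i 1) v = v $ i" for i v
  proof -
    have "dot (axis i 1) v = (\<Sum>j\<in>UNIV. if j = i then v $ j else 0)"
      unfolding dot_def by (intro sum.cong) (simp_all add: axis_def)
    then show ?thesis by simp
  qed
  have dot_lin: "dot (u + v) w = dot u w + dot v w" "dot (k *s u) w = k * dot u w" for u v w k
    by (simp_all add: dot_def distrib_right sum.distrib sum_distrib_left mult.assoc)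
  \<comment> \<open>Linear forms dual to \<open>x\<close> and \<open>b\<close>: on the arc the form
    \<open>u x\<close> has order 0 and \<open>u b\<close> has order 1, both with leading coefficient
    1.\<close>
  have "\<exists>u. \<forall>v\<in>{x, b}. u v \<in> UNIV \<and> (\<forall>w\<in>{x, b}. dot (u v) w = (if v = w then 1 else 0))"
  proof (rule dual_vectors[where \<phi> = "\<lambda>w u. dot u w"])
    show "finite {x, b}" "vec.subspace UNIV" by (simp_all add: vec.subspace_UNIV)
    show "dot (u + v) w = dot u w + dot v w" "dot (k *s u) w = k * dot u w" for u v w k by (rule dot_lin)+
    fix k v assume k: "\<forall>u\<in>UNIV. (\<Sum>w\<in>{x, b}. k w * dot u w) = 0" and v: "v \<in> {x, b}"
    have xb: "x \<noteq> b" using b vec.span_base[of x "{x}"] by auto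
    have "k x * x $ i + k b * b $ i = 0" for i
      using bspec[OF k UNIV_I, of "axis i 1"] xb by (simp add: dot_axis)
    then have eq: "k x *s x + k b *s b = 0" by (simp add: vec_eq_iff)
    have "k b = 0"
    proof (rule ccontr)
      assume kb: "k b \<noteq> 0"
      have "b = (- k x / k b) *s x"
      proof (rule vec_eq_iff[THEN iffD2], rule allI)
        fix i
        have "k x * x $ i + k b * b $ i = 0" using eq by (simp add: vec_eq_iff)
        then have "k b * b $ i = - k x * x $ i" by (simp add: eq_neg_iff_add_eq_0 add.commute)
        then show "b $ i = ((- k x / k b) *s x) $ i" using kb by (simp add: field_simps)
      qed
      then have "b \<in> vec.span {x}" by (metis vec.span_base vec.span_scale singletonI)
      then show False using b by simp
    qed
    moreover from this have "k x = 0" using eq x by (simp add: vec.scale_eq_0_iff)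
    ultimately show "k v = 0" using v by auto
  qed
  then obtain u where u: "\<And>v w. v \<in> {x, b} \<Longrightarrow> w \<in> {x, b} \<Longrightarrow> dot (u v) w = (if v = w then 1 else 0)" by blast
  have xb: "x \<noteq> b" using b vec.span_base[of x "{x}"] by auto
  define \<alpha> where "\<alpha> = L (u x)"
  define \<beta> where "\<beta> = L (u b)"
  have \<alpha>: "\<alpha> $$ 0 = 1" "\<alpha> $$ 1 = 0" and \<beta>: "\<beta> $$ 0 = 0" "\<beta> $$ 1 = 1"
    using xb by (simp_all add: \<alpha>_def \<beta>_def L0 L1 u)
  have \<alpha>0: "\<alpha> \<noteq> 0" and \<beta>0: "\<beta> \<noteq> 0" using \<alpha> \<beta> by auto
  have sub\<alpha>: "subdegree \<alpha> = 0" using \<alpha>(1) by (intro subdegreeI) simp_all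
  have sub\<beta>: "subdegree \<beta> = 1" using \<beta> by (intro subdegreeI) simp_all
  have A1: "subdegree (L v) \<in> arc_orders X 1" if "L v \<noteq> 0" for v
    using that homogeneous_linear_form unfolding arc_orders_def L_def by blast
  have A1_01: "0 \<in> arc_orders X 1" "1 \<in> arc_orders X 1"
    using A1[of "u x"] A1[of "u b"] \<alpha>0 \<beta>0 sub\<alpha> sub\<beta> by (simp_all add: \<alpha>_def \<beta>_def)
  \<comment> \<open>The coordinate \<open>i\<close> minus its multiples of the two dual forms; what
    remains has order at least 2 on the arc.\<close>
  define r where "r i = axis i 1 + (- (x $ i)) *s u x + (- (b $ i)) *s u b" for i
  have Lr: "X i = fps_const (x $ i) * \<alpha> + fps_const (b $ i) * \<beta> + L (r i)" for i
    unfolding r_def L_add L_scale L_axis \<alpha>_def \<beta>_def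
    by (simp add: fps_const_neg[symmetric] del: fps_const_neg)
  have r: "L (r i) $$ 0 = 0" "L (r i) $$ 1 = 0" for i
    unfolding L0 L1 r_def dot_lin dot_axis using xb by (simp_all add: u)
  show ?thesis
  \<comment> \<open>If no third order occurs, the arc lies on the line through \<open>[x]\<close>
    and \<open>[b]\<close>, and the quadratic term is zero.\<close>
  proof (cases "\<forall>v. dot v x = 0 \<and> dot v b = 0 \<longrightarrow> L v = 0")
    case True
    have "L (r i) = 0" for i using True r[of i] unfolding L0 L1 by blast
    then have X_eq: "X i = fps_const (x $ i) * \<alpha> + fps_const (b $ i) * \<beta>" for i using Lr[of i] by simp
    define s where "s = \<beta> * inverse \<alpha>"
    have \<alpha>s: "\<alpha> * s = \<beta>"
      using inverse_mult_eq_1'[of \<alpha>] \<alpha>(1) by (simp add: s_def mult.left_commute)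
    show ?thesis
    proof (rule that[of 1 \<alpha> s 0 0])
      show "s \<noteq> 0" using \<alpha>s \<beta>0 by auto
      show "s $$ 0 = 0" using \<beta>(1) by (simp add: s_def)
      fix i
      have "X i = fps_const (x $ i) * \<alpha> + fps_const (b $ i) * (\<alpha> * s)" by (simp only: X_eq \<alpha>s)
      then show "X i = \<alpha> * (fps_const (1 * x $ i) + fps_const (b $ i + 0 * x $ i) * s + fps_const (0 $ i) * s\<^sup>2)"
        by (simp add: algebra_simps)
    qed (use \<alpha>0 in simp_all)
  next
    case False
    then obtain v where v: "dot v x = 0" "dot v b = 0" "L v \<noteq> 0" by blast
    define \<gamma> where "\<gamma> = L v"
    define k where "k = subdegree \<gamma>"
    have k_A1: "k \<in> arc_orders X 1" using A1 v(3) by (simp add: k_def \<gamma>_def)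
    have \<gamma>01: "\<gamma> $$ 0 = 0" "\<gamma> $$ 1 = 0" using v by (simp_all add: \<gamma>_def L0 L1)
    have "\<gamma> $$ i = 0" if "i < 2" for i using that \<gamma>01 by (auto simp: less_2_cases_iff One_nat_def)
    then have k2: "k \<ge> 2" using v(3) unfolding k_def by (intro subdegree_geI) (simp_all add: \<gamma>_def)
    have A2: "i + j \<in> arc_orders X 2" if "i \<in> arc_orders X 1" "j \<in> arc_orders X 1" for i j
      using arc_orders_add[OF that] by (simp add: numeral_2_eq_2)
    have "k = 2"
    proof (rule ccontr)
      assume "k \<noteq> 2"
      then have "k > 2" using k2 by simp
      then have "card {0, 1, 2, k, k + 1, k + k} = 6" by simp
      moreover have "{0, 1, 2, k, k + 1, k + k} \<subseteq> arc_orders X 2"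
        using A2[OF A1_01(1) A1_01(1)] A2[OF A1_01(1) A1_01(2)] A2[OF A1_01(2) A1_01(2)]
          A2[OF k_A1 A1_01(1)] A2[OF k_A1 A1_01(2)] A2[OF k_A1 k_A1] by (simp add: numeral_2_eq_2)
      ultimately show False using bound[of 2 "{0, 1, 2, k, k + 1, k + k}"] by simp
    qed
    have g2: "\<gamma> $$ 2 \<noteq> 0"
      using nth_subdegree_nonzero[OF v(3)] \<open>k = 2\<close> by (simp only: k_def \<gamma>_def) simp
    \<comment> \<open>The orders 0 to 2 in degree 1 and 0 to 4 in degree 2 already exhaust the
      bounds 3 and 5. A form vanishing to higher order therefore vanishes on the arc.\<close>
    have A1_bound: "j < 3" if "j \<in> arc_orders X 1" for j
    proof (rule ccontr)
      assume "\<not> j < 3"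
      then have "card {0, 1, 2, j} = 4" by simp
      moreover have "{0, 1, 2, j} \<subseteq> arc_orders X 1" using A1_01 k_A1 that \<open>k = 2\<close> by simp
      ultimately show False using bound[of 1 "{0, 1, 2, j}"] by simp
    qed
    have A2_bound: "j < 5" if "j \<in> arc_orders X 2" for j
    proof (rule ccontr)
      assume "\<not> j < 5"
      then have "card {0, 1, 2, 3, 4, j} = 6" by simp
      moreover have "{0, 1, 2, 3, 4, j} \<subseteq> arc_orders X 2"
        using A2[OF A1_01(1) A1_01(1)] A2[OF A1_01(1) A1_01(2)] A2[OF A1_01(2) A1_01(2)]
          A2[OF k_A1 A1_01(2)] A2[OF k_A1 k_A1] that by (simp add: \<open>k = 2\<close>)
      ultimately show False using bound[of 2 "{0, 1, 2, 3, 4, j}"] by simp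
    qed
    \<comment> \<open>The multiple of \<open>\<gamma>\<close> that cancels the coefficient of order
      2, leaving a linear form of order at least 3, which is zero on the arc.\<close>
    define c where "c = (\<chi> i. L (r i) $$ 2 / \<gamma> $$ 2)"
    have "L (r i) = fps_const (c $ i) * \<gamma>" for i
    proof -
      have "L (r i + (- c $ i) *s v) $$ j = 0" if "j < 3" for j
      proof -
        have "j = 0 \<or> j = 1 \<or> j = 2" using that by auto
        then show ?thesis unfolding L_add L_scale \<gamma>_def[symmetric] using r[of i] \<gamma>01 g2
          by (auto simp: c_def)
      qed
      note zero = this
      have "L (r i + (- c $ i) *s v) = 0"
        unfolding L_def
      proof (rule arc_vanishing_criterion[OF homogeneous_linear_form])
        show "fe.ev X (linear_form (r i + (- c $ i) *s v)) $$ j = 0" if "j < 3" for j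
          using zero[OF that] unfolding L_def .
      qed (rule A1_bound)
      then show ?thesis unfolding L_add L_scale \<gamma>_def[symmetric]
        by (simp add: fps_const_neg[symmetric] del: fps_const_neg)
    qed
    then have X_eq: "X i = fps_const (x $ i) * \<alpha> + fps_const (b $ i) * \<beta> + fps_const (c $ i) * \<gamma>" for i
      using Lr[of i] by simp
    define \<beta>' where "\<beta>' = fps_shift 1 \<beta>"
    define \<gamma>' where "\<gamma>' = fps_shift 2 \<gamma>"
    have \<beta>': "\<beta> = fps_X ^ 1 * \<beta>'" and \<beta>'0: "\<beta>' $$ 0 = 1"
      using \<beta> by (simp_all add: fps_eq_iff \<beta>'_def fps_X_mult_nth)
    have \<gamma>'0: "\<gamma>' $$ 0 = \<gamma> $$ 2"
      by (simp add: \<gamma>'_def numeral_2_eq_2)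
    have \<gamma>': "\<gamma> = fps_X ^ 2 * \<gamma>'"
    proof (rule fps_ext)
      fix j :: nat
      have "j = 0 \<or> j = 1 \<or> j \<ge> 2" by linarith
      then show "\<gamma> $$ j = (fps_X ^ 2 * \<gamma>') $$ j"
        using \<gamma>01 by (auto simp: \<gamma>'_def fps_X_power_mult_nth simp del: add_2_eq_Suc add_2_eq_Suc')
    qed
    have X_mult: "(fps_X ^ i * f) * (fps_X ^ j * g) = fps_X ^ (i + j) * (f * g)" for i j and f g :: "complex fps"
      by (simp add: power_add mult_ac)
    have products: "\<beta> * \<beta> = fps_X ^ 2 * (\<beta>' * \<beta>')"
      "\<beta> * \<gamma> = fps_X ^ 3 * (\<beta>' * \<gamma>')" "\<gamma> * \<gamma> = fps_X ^ 4 * (\<gamma>' * \<gamma>')"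
      using X_mult[of 1 \<beta>' 1 \<beta>'] X_mult[of 1 \<beta>' 2 \<gamma>'] X_mult[of 2 \<gamma>' 2 \<gamma>']
      unfolding \<beta>'[symmetric] \<gamma>'[symmetric] by simp_all
    have \<alpha>\<gamma>: "\<alpha> * \<gamma> = fps_X ^ 2 * (\<alpha> * \<gamma>')"
      by (subst \<gamma>') (rule mult.left_commute)
    \<comment> \<open>The products \<open>\<alpha> \<gamma>\<close>,
      \<open>\<beta> \<gamma>\<close>, \<open>\<gamma> \<gamma>\<close> have orders 2, 3, 4. The
      constants \<open>l\<close>, \<open>m\<close>, \<open>n\<close> use them in turn to cancel
      these coefficients of \<open>\<beta>^2\<close>, and the resulting quadric contains the
      arc.\<close>
    define l where "l = 1 / \<gamma> $$ 2"
    define Q where "Q = \<beta> * \<beta> - fps_const l * \<alpha> * \<gamma>"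
    define m where "m = Q $$ 3 / \<gamma> $$ 2"
    define n where "n = (Q - fps_const m * \<beta> * \<gamma>) $$ 4 / (\<gamma> $$ 2 * \<gamma> $$ 2)"
    define G where "G = linear_form (u b) * linear_form (u b) + mconst (- l) * (linear_form (u x) * linear_form v)
      + mconst (- m) * (linear_form (u b) * linear_form v) + mconst (- n) * (linear_form v * linear_form v)"
    have hom_mult: "graded UNIV 2 (linear_form w * linear_form w')" for w w' :: "complex^'n"
      using graded_mult[OF homogeneous_linear_form[unfolded homogeneous_eq] homogeneous_linear_form[unfolded homogeneous_eq], of w w']
      by simp
    have G: "homogeneous 2 G"
      unfolding G_def homogeneous_eq by (intro graded_add graded_const_mult hom_mult)
    have evG: "fe.ev X G = \<beta> * \<beta> - fps_const l * \<alpha> * \<gamma> - fps_const m * \<beta> * \<gamma> - fps_const n * \<gamma> * \<gamma>"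
      unfolding G_def fe.ev_simps L_def[symmetric] \<alpha>_def[symmetric] \<beta>_def[symmetric] \<gamma>_def[symmetric]
      by (simp add: fps_const_neg[symmetric] mult.assoc del: fps_const_neg)
    have "fe.ev X G = 0"
    proof (rule arc_vanishing_criterion[OF G])
      fix j :: nat assume "j < 5"
      then have "j = 0 \<or> j = 1 \<or> j = 2 \<or> j = 3 \<or> j = 4" by auto
      moreover have "fe.ev X G $$ 0 = 0" "fe.ev X G $$ 1 = 0" "fe.ev X G $$ 2 = 0"
        "fe.ev X G $$ 3 = 0" "fe.ev X G $$ 4 = 0"
        unfolding evG m_def n_def Q_def l_def mult.assoc products \<alpha>\<gamma>
        using g2 \<alpha>(1) \<beta>'0 \<gamma>'0 by (simp_all add: fps_X_power_mult_nth)
      ultimately show "fe.ev X G $$ j = 0" by blast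
    qed (rule A2_bound)
    then have quad: "\<beta> * \<beta> = \<gamma> * (fps_const l * \<alpha> + fps_const m * \<beta> + fps_const n * \<gamma>)"
      unfolding evG by (simp add: algebra_simps)
    have l0: "l \<noteq> 0" using g2 by (simp add: l_def)
    define \<alpha>' where "\<alpha>' = fps_const l * \<alpha> + fps_const m * \<beta> + fps_const n * \<gamma>"
    have \<alpha>'0: "\<alpha>' $$ 0 = l" using \<alpha>(1) \<beta>(1) \<gamma>01(1) by (simp add: \<alpha>'_def)
    then have \<alpha>'_nz: "\<alpha>' \<noteq> 0" using l0 by auto
    define s where "s = \<beta> * inverse \<alpha>'"
    have inv: "\<alpha>' * inverse \<alpha>' = 1" using \<alpha>'0 l0 by (intro inverse_mult_eq_1') simp
    have s1: "\<alpha>' * s = \<beta>" by (simp add: s_def mult.left_commute inv)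
    have "\<alpha>' * (\<alpha>' * s\<^sup>2) = \<beta> * \<beta>" by (simp only: s1[symmetric] power2_eq_square mult_ac)
    also have "\<dots> = \<alpha>' * \<gamma>" unfolding quad \<alpha>'_def by (rule mult.commute)
    finally have s2: "\<alpha>' * s\<^sup>2 = \<gamma>" using \<alpha>'_nz by simp
    \<comment> \<open>The common factor must be \<open>\<alpha>'\<close>. Eliminating
      \<open>\<alpha>\<close> creates multiples of \<open>x\<close> in front of \<open>s\<close> and
      \<open>s^2\<close>: this is the origin of \<open>\<kappa> = 1 / l\<close>, of
      \<open>\<tau> = - m / l\<close> and of the correction to \<open>c\<close>.\<close>
    have \<alpha>_eq: "\<alpha> = fps_const (1 / l) * \<alpha>' + fps_const (- m / l) * \<beta> + fps_const (- n / l) * \<gamma>"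
    proof -
      have "fps_const l * \<alpha> = fps_const l * (fps_const (1 / l) * \<alpha>' + fps_const (- m / l) * \<beta> + fps_const (- n / l) * \<gamma>)"
        using l0 by (simp add: \<alpha>'_def distrib_left mult.assoc[symmetric] fps_const_neg[symmetric] del: fps_const_neg)
      then show ?thesis using l0 by simp
    qed
    show ?thesis
    proof (rule that[of "1 / l" \<alpha>' s "- m / l" "c + (- n / l) *s x"])
      show "1 / l \<noteq> 0" "\<alpha>' \<noteq> 0" using l0 \<alpha>'_nz by simp_all
      show "s \<noteq> 0" using s1 \<beta>0 by auto
      show "s $$ 0 = 0" using \<beta>(1) by (simp add: s_def)
      fix i
      have "X i = fps_const (x $ i) * (fps_const (1 / l) * \<alpha>' + fps_const (- m / l) * (\<alpha>' * s) + fps_const (- n / l) * (\<alpha>' * s\<^sup>2))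
          + fps_const (b $ i) * (\<alpha>' * s) + fps_const (c $ i) * (\<alpha>' * s\<^sup>2)"
        by (simp only: X_eq s1 s2 \<alpha>_eq[symmetric])
      also have "\<dots> = \<alpha>' * (fps_const (1 / l) * fps_const (x $ i) + (fps_const (b $ i) + fps_const (- m / l) * fps_const (x $ i)) * s
          + (fps_const (c $ i) + fps_const (- n / l) * fps_const (x $ i)) * s\<^sup>2)"
        by (simp only: distrib_left distrib_right mult_ac add_ac)
      also have "\<dots> = \<alpha>' * (fps_const (1 / l * x $ i) + fps_const (b $ i + - m / l * x $ i) * s
          + fps_const ((c + (- n / l) *s x) $ i) * s\<^sup>2)"
        by simp
      finally show "X i = \<alpha>' * (fps_const (1 / l * x $ i) + fps_const (b $ i + - m / l * x $ i) * s
          + fps_const ((c + (- n / l) *s x) $ i) * s\<^sup>2)" .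
    qed
  qed
qed

text \<open>Passage from the formal arc to an actual curve: composition with a nonzero series
  \<open>s\<close> without constant term is injective on polynomials. A form that vanishes along the
  arc thus vanishes for every value \<open>z\<close> of the parameter.\<close>

lemma conic_parametrization:
  fixes x b :: "complex^'n"
  assumes hilb: "has_hilbert_polynomial I [:1, 2:]" and smooth: "smooth_at I x" and x: "x \<noteq> 0"
    and zero: "\<And>F. F \<in> I \<Longrightarrow> mpoly_eval (($) x) F = 0"
    and tangent: "\<And>F. F \<in> I \<Longrightarrow> mpoly_differential F x b = 0" and b: "b \<notin> vec.span {x}"
  obtains \<kappa> \<tau> c where "\<kappa> \<noteq> 0"
    "\<And>F d z. F \<in> I \<Longrightarrow> homogeneous d F \<Longrightarrow>
      mpoly_eval (($) (\<kappa> *s x + z *s (b + \<tau> *s x) + z\<^sup>2 *s c)) F = 0"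
proof -
  have "\<exists>X. (\<forall>i. X i $$ 0 = x $ i \<and> X i $$ 1 = b $ i) \<and> (\<forall>F\<in>I. fe.ev X F = 0)"
  proof (rule formal_arc[OF smooth zero tangent])
    fix X :: "'n \<Rightarrow> complex fps"
    assume "\<And>i. X i $$ 0 = x $ i" "\<And>i. X i $$ 1 = b $ i" "\<And>F. F \<in> I \<Longrightarrow> fe.ev X F = 0"
    then show ?thesis by (intro exI[of _ X]) simp
  qed
  then obtain X where X': "\<forall>i. X i $$ 0 = x $ i \<and> X i $$ 1 = b $ i" and I': "\<forall>F\<in>I. fe.ev X F = 0"
    by blast
  have X: "X i $$ 0 = x $ i" "X i $$ 1 = b $ i" for i using X' by blast+
  have I: "fe.ev X F = 0" if "F \<in> I" for F using I' that by blast
  have "\<exists>\<alpha> s \<kappa> \<tau> c. \<kappa> \<noteq> 0 \<and> \<alpha> \<noteq> 0 \<and> s \<noteq> 0 \<and> s $$ 0 = 0 \<and> (\<forall>i. X i = \<alpha> *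
      (fps_const (\<kappa> * x $ i) + fps_const (b $ i + \<tau> * x $ i) * s + fps_const (c $ i) * s\<^sup>2))"
  proof (rule arc_in_conic[OF I hilb X x b])
    fix \<alpha> s :: "complex fps" and \<kappa> \<tau> c
    assume "\<kappa> \<noteq> 0" "\<alpha> \<noteq> 0" "s \<noteq> 0" "s $$ 0 = 0"
      "\<And>i. X i = \<alpha> * (fps_const (\<kappa> * x $ i) + fps_const (b $ i + \<tau> * x $ i) * s + fps_const (c $ i) * s\<^sup>2)"
    then show ?thesis by blast
  qed
  then obtain \<alpha> s \<kappa> \<tau> c where nz: "\<kappa> \<noteq> 0" "\<alpha> \<noteq> 0" "s \<noteq> 0" "s $$ 0 = 0" and
    X_eq: "\<And>i. X i = \<alpha> * (fps_const (\<kappa> * x $ i) + fps_const (b $ i + \<tau> * x $ i) * s + fps_const (c $ i) * s\<^sup>2)"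
    by (elim exE conjE) blast
  define p where "p i = [:\<kappa> * x $ i, b $ i + \<tau> * x $ i, c $ i:]" for i
  have p: "fps_of_poly (p i) oo s = fps_const (\<kappa> * x $ i) + fps_const (b $ i + \<tau> * x $ i) * s + fps_const (c $ i) * s\<^sup>2" for i
    using nz(4) unfolding p_def fps_of_poly_pCons fps_of_poly_0
    by (simp add: fps_compose_add_distrib fps_compose_mult_distrib algebra_simps power2_eq_square
        fps_const_add[symmetric] fps_const_mult[symmetric] del: fps_const_add fps_const_mult)
  have "mpoly_eval (($) (\<kappa> *s x + z *s (b + \<tau> *s x) + z\<^sup>2 *s c)) F = 0"
    if F: "F \<in> I" "homogeneous d F" for F d z
  proof -
    \<comment> \<open>Homogeneity turns the unknown common factor \<open>\<alpha>\<close> into a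
      nonzero factor \<open>\<alpha> ^ d\<close>.\<close>
    have "X = (\<lambda>i. \<alpha> * (fps_of_poly (p i) oo s))" unfolding p using X_eq by (rule ext)
    then have "\<alpha> ^ d * fe.ev (\<lambda>i. fps_of_poly (p i) oo s) F = 0"
      using I[OF F(1)] fe.ev_scale[OF F(2)] by metis
    then have "fps_of_poly (pe.ev p F) oo s = 0" using nz(2) by (simp add: fe_ev_compose[OF nz(4)])
    then have "pe.ev p F = 0" using nz(3,4) by (simp add: fps_compose_eq_0_iff)
    then have "ce.ev (\<lambda>i. poly (p i) z) F = 0" using poly_pe_ev[of p F z] by simp
    moreover have "(\<lambda>i. poly (p i) z) = ($) (\<kappa> *s x + z *s (b + \<tau> *s x) + z\<^sup>2 *s c)"
      by (rule ext) (simp add: p_def power2_eq_square algebra_simps)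
    ultimately show ?thesis by (simp add: mpoly_eval_eq)
  qed
  then show ?thesis using that nz(1) by blast
qed

section \<open>Equations of the adjoint variety and of nilpotent directions\<close>

text \<open>The bracket with its structure constants, extended to vectors of polynomials. The
  variables are left arbitrary, since both point coordinates and flag coordinates are used.\<close>

definition mpoly_br ::
  "(complex^'n \<Rightarrow> complex^'n \<Rightarrow> complex^'n) \<Rightarrow> ('n \<Rightarrow> 'i mpoly) \<Rightarrow> ('n \<Rightarrow> 'i mpoly) \<Rightarrow> 'n \<Rightarrow> 'i mpoly"
  where "mpoly_br br P Q j =
    (\<Sum>p\<in>UNIV. \<Sum>q\<in>UNIV. mconst (br (axis p 1) (axis q 1) $ j) * (P p * Q q))"

lemma graded_mpoly_br:
  assumes "\<And>p. graded A d (P p)" "\<And>q. graded A e (Q q)"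
  shows "graded A (d + e) (mpoly_br br P Q j)"
  unfolding mpoly_br_def using assms by (intro graded_sum graded_const_mult graded_mult)

definition ev_vec :: "('i \<Rightarrow> complex) \<Rightarrow> ('n \<Rightarrow> 'i mpoly) \<Rightarrow> complex^'n"
  where "ev_vec X P = (\<chi> i. ce.ev X (P i))"

text \<open>The factor \<open>l\<close> does not depend on \<open>v\<close>. The condition is
  therefore a system of quadratic equations, stable under scaling and automorphisms.\<close>

definition extremal :: "(complex^'n \<Rightarrow> complex^'n \<Rightarrow> complex^'n) \<Rightarrow> complex \<Rightarrow> complex^'n \<Rightarrow> bool"
  where "extremal br l v \<longleftrightarrow> (\<forall>y. br v (br v y) = (l * killing_form br v y) *s v)"

definition extremal_equation ::
  "(complex^'n \<Rightarrow> complex^'n \<Rightarrow> complex^'n) \<Rightarrow> complex \<Rightarrow> complex^'n \<Rightarrow> 'n \<Rightarrow> 'n mpoly"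
  where "extremal_equation br l y j = mpoly_br br mvar (mpoly_br br mvar (\<lambda>i. mconst (y $ i))) j
    + mconst (- l) * (linear_form (\<chi> i. killing_form br (axis i 1) y) * mvar j)"

text \<open>For fixed \<open>i\<close>, the flag coordinates \<open>(i, l)\<close> of \<open>x\<close> and \<open>w\<close> are the components of the vector
  \<open>v = x\<^sub>i w - w\<^sub>i x\<close> of the plane; the quartic is a coordinate of \<open>(ad v)\<^sup>4 y\<close>.\<close>

definition ad_quartic ::
  "(complex^'n \<Rightarrow> complex^'n \<Rightarrow> complex^'n) \<Rightarrow> 'n \<Rightarrow> complex^'n \<Rightarrow> 'n \<Rightarrow> ('n + 'n \<times> 'n) mpoly"
  where "ad_quartic br i y = (let W = \<lambda>l. mvar (Inr (i, l)) in
    mpoly_br br W (mpoly_br br W (mpoly_br br W (mpoly_br br W (\<lambda>l. mconst (y $ l))))))"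

lemma homogeneous_extremal_equation:
  fixes br :: "complex^'n \<Rightarrow> complex^'n \<Rightarrow> complex^'n"
  shows "homogeneous 2 (extremal_equation br l y j)"
proof -
  have var: "graded UNIV 1 (mvar p)" for p :: 'n
    using graded_var[of UNIV p] by simp
  have "graded UNIV (1 + (1 + 0)) (mpoly_br br mvar (mpoly_br br mvar (\<lambda>i. mconst (y $ i))) j)"
    by (intro graded_mpoly_br var graded_const)
  moreover have "graded UNIV (1 + 1) (mconst (- l) * (linear_form (\<chi> i. killing_form br (axis i 1) y) * mvar j))"
    by (intro graded_const_mult graded_mult var homogeneous_linear_form[unfolded homogeneous_eq])
  ultimately show ?thesis
    unfolding homogeneous_eq extremal_equation_def by (intro graded_add) (simp_all add: numeral_2_eq_2)
qed

lemma bihomogeneous_ad_quartic: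
  fixes br :: "complex^'n \<Rightarrow> complex^'n \<Rightarrow> complex^'n"
  shows "bihomogeneous 0 4 (ad_quartic br i y j)"
proof -
  have "(Inr (i, l) :: 'n + 'n \<times> 'n) \<notin> range Inl" for l by blast
  then have "graded (range Inl) 0 (mvar (Inr (i, l) :: 'n + 'n \<times> 'n))"
    "graded (range Inr) 1 (mvar (Inr (i, l) :: 'n + 'n \<times> 'n))" for l
    using graded_var[of "range Inl" "Inr (i, l) :: 'n + 'n \<times> 'n"]
      graded_var[of "range Inr" "Inr (i, l) :: 'n + 'n \<times> 'n"] by simp_all
  then have "graded (range Inl) (0 + (0 + (0 + (0 + 0)))) (ad_quartic br i y j)"
    "graded (range Inr) (1 + (1 + (1 + (1 + 0)))) (ad_quartic br i y j)"
    unfolding ad_quartic_def Let_def by (intro graded_mpoly_br graded_const; simp)+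
  then show ?thesis by (simp add: bihomogeneous_eq eval_nat_numeral)
qed

context complex_lie_algebra
begin

lemma ev_vec_mpoly_br: "ev_vec X (mpoly_br br P Q) = br (ev_vec X P) (ev_vec X Q)"
  by (rule vec_eq_iff[THEN iffD2], rule allI, subst br_component)
    (simp only: ev_vec_def mpoly_br_def ce.ev_sum ce.ev_mult ce.ev_const vec_lambda_beta)

lemma ev_vec_const: "ev_vec X (\<lambda>i. mconst (y $ i)) = y"
  by (simp add: ev_vec_def ce.ev_simps vec_eq_iff)

lemma eval_extremal_equation:
  "mpoly_eval (($) x) (extremal_equation br l y j) = (br x (br x y) - (l * killing_form br x y) *s x) $ j"
proof -
  have var: "ev_vec (($) x) mvar = x"
    by (simp add: ev_vec_def ce.ev_var vec_eq_iff del: One_nat_def)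
  have "ce.ev (($) x) (linear_form (\<chi> i. killing_form br (axis i 1) y)) = killing_form br x y"
  proof -
    have "killing_form br x y = killing_form br (\<Sum>i\<in>UNIV. x $ i *s axis i 1) y"
      by (simp add: basis_expansion)
    also have "\<dots> = (\<Sum>i\<in>UNIV. killing_form br (x $ i *s axis i 1) y)"
      by (rule killing_form_sum)
    finally show ?thesis
      by (simp add: linear_form_def ce.ev_simps killing_form_simps mult.commute)
  qed
  moreover have "ce.ev (($) x) (mpoly_br br mvar (mpoly_br br mvar (\<lambda>i. mconst (y $ i))) j)
      = ev_vec (($) x) (mpoly_br br mvar (mpoly_br br mvar (\<lambda>i. mconst (y $ i)))) $ j"
    by (simp add: ev_vec_def)
  ultimately show ?thesis
    unfolding mpoly_eval_eq extremal_equation_def ce.ev_add ce.ev_mult ce.ev_const ce.ev_var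
    by (simp add: ev_vec_mpoly_br ev_vec_const var)
qed

lemma eval_ad_quartic:
  assumes "w' = x $ i *s w + (- (w $ i)) *s x"
  shows "mpoly_eval (flag_coordinates x w) (ad_quartic br i y j) = br w' (br w' (br w' (br w' y))) $ j"
proof -
  have "ev_vec (flag_coordinates x w) (\<lambda>l. mvar (Inr (i, l))) = w'"
    by (simp add: ev_vec_def ce.ev_var vec_eq_iff assms flag_coordinates_def mult.commute)
  moreover have "mpoly_eval (flag_coordinates x w) (ad_quartic br i y j)
      = ev_vec (flag_coordinates x w) (ad_quartic br i y) $ j"
    by (simp add: ev_vec_def mpoly_eval_eq)
  ultimately show ?thesis
    by (simp add: ad_quartic_def Let_def ev_vec_mpoly_br ev_vec_const)
qed

lemma extremal_scale: "extremal br l v \<Longrightarrow> extremal br l (k *s v)"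
  unfolding extremal_def by (simp add: br_simps killing_form_simps mult_ac)

lemma extremal_automorphism:
  assumes "lie_automorphism br g"
  shows "extremal br l (g v) \<longleftrightarrow> extremal br l v"
proof -
  have lin: "clinear g" and bij: "bij g" and hom: "\<And>x y. g (br x y) = br (g x) (g y)"
    using assms by (auto simp: lie_automorphism_def)
  have iff: "br (g v) (br (g v) (g y)) = (l * killing_form br (g v) (g y)) *s g v
      \<longleftrightarrow> br v (br v y) = (l * killing_form br v y) *s v" for y
    using bij by (simp add: hom[symmetric] killing_form_automorphism[OF assms]
        vec.linear_scale[OF lin, symmetric] bij_def inj_eq)
  have surj: "\<exists>y. z = g y" for z using bij_is_surj[OF bij] by (rule surjD)
  show ?thesis
    unfolding extremal_def using iff surj by (intro iffI allI) metis+
qed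

end

section \<open>Tangent directions of conics\<close>

context based_simple_lie_algebra
begin

text \<open>Translating by a group element brings the flag to the fibre at \<open>[E]\<close>, where
  contact directions commute with \<open>E\<close>. The quadratic equations of \<open>Z\<close>
  belong to the ideal of the conic and can be evaluated along its parametrization.\<close>

lemma conic_direction_ad_nilpotent:
  assumes E: "E \<in> R \<theta>" "E \<noteq> 0" and Z: "adjoint_variety br Z"
    and C: "conic_in Z C" "smooth_subscheme C" and p: "p \<in> proj_zeros C"
    and flag: "(p, tangent_cone_space C p) \<in> proj_bundle (contact_distribution br h \<rho> E)"
    and w: "w \<in> tangent_cone_space C p"
  shows "br w (br w (br w (br w y))) = 0"
proof -
  define L where "L = tangent_cone_space C p"
  obtain l where l: "extremal br l E"
    using ad_highest_root_vector[OF E] unfolding extremal_def by blast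
  obtain p0 where Z_orbit: "Z = {g ` p0 | g. g \<in> adjoint_group br}"
    using Z unfolding adjoint_variety_def by blast
  obtain S where S: "Z = proj_zeros S"
    using Z unfolding adjoint_variety_def zariski_closed_def by blast
  have vanishing: "vanishing_ideal Z \<subseteq> C" and hilb: "has_hilbert_polynomial C [:1, 2:]"
    using C(1) by (simp_all add: conic_in_def closed_subscheme_def)
  have "S \<subseteq> vanishing_ideal Z" unfolding S vanishing_ideal_def proj_zeros_def by blast
  then have pZ: "p \<in> Z" using p vanishing unfolding S proj_zeros_def by blast
  obtain W where W: "(p, W) \<in> contact_distribution br h \<rho> E"
    and L: "vec.subspace L" "vec.dim L = 2" "p \<subseteq> L" "L \<subseteq> W"
    using flag unfolding proj_bundle_def L_def by blast
  obtain g where g: "g \<in> adjoint_group br" "p = g ` vec.span {E}" "W = g ` contact_fibre br h \<rho> E"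
    using W unfolding contact_distribution_def by blast
  have aut: "lie_automorphism br g" using g(1) by (rule adjoint_group_automorphism)
  then have lin: "clinear g" and bij: "bij g" and hom: "\<And>x y. g (br x y) = br (g x) (g y)"
    by (auto simp: lie_automorphism_def)
  define x where "x = g E"
  have p_span: "p = vec.span {x}"
    using vec.linear_span_image[OF lin, of "{E}"] by (simp add: g(2) x_def)
  have x0: "x \<noteq> 0"
    using E(2) bij vec.linear_0[OF lin] unfolding x_def bij_def inj_def by metis
  have xp: "x \<in> p" unfolding p_span by (rule vec.span_base) simp
  obtain g1 where g1: "g1 \<in> adjoint_group br" "p = g1 ` p0"
    using pZ unfolding Z_orbit by blast
  \<comment> \<open>The point \<open>p\<close> is a translate both of \<open>[E]\<close> and of the
    unknown base point \<open>p0\<close> of \<open>Z\<close>. Extremality thus passes from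
    \<open>E\<close> to \<open>p\<close>, back to \<open>p0\<close> and on to every point of
    \<open>Z\<close>.\<close>
  have ext: "extremal br l v" if q: "q \<in> Z" and v: "v \<in> q" for q v
  proof -
    obtain g2 where g2: "g2 \<in> adjoint_group br" "q = g2 ` p0" using q unfolding Z_orbit by blast
    obtain u where u: "u \<in> p0" "v = g2 u" using v g2(2) by blast
    have "g1 u \<in> p" using u(1) g1(2) by blast
    then obtain k where "g1 u = k *s x" unfolding p_span vec.span_singleton by blast
    moreover have "extremal br l x" unfolding x_def using extremal_automorphism[OF aut] l by blast
    ultimately have "extremal br l (g1 u)" using extremal_scale by metis
    then show ?thesis
      unfolding u(2) using extremal_automorphism[OF adjoint_group_automorphism[OF g1(1)]]
        extremal_automorphism[OF adjoint_group_automorphism[OF g2(1)]] by blast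
  qed
  have equations: "extremal_equation br l y j \<in> C" for y j
  proof -
    have "extremal_equation br l y j \<in> vanishing_ideal Z"
      unfolding vanishing_ideal_def
    proof (intro CollectI ballI)
      fix q v assume "q \<in> Z" "v \<in> q"
      then have "extremal br l v" by (rule ext)
      then show "mpoly_eval (($) v) (extremal_equation br l y j) = 0"
        unfolding eval_extremal_equation extremal_def by simp
    qed
    then show ?thesis using vanishing by blast
  qed
  have "\<not> L \<subseteq> vec.span {x}"
  proof
    assume "L \<subseteq> vec.span {x}"
    then have "vec.dim L \<le> card {x}" by (rule vec.dim_le_card) simp
    then show False using L(2) by simp
  qed
  then obtain b where b: "b \<in> L" "b \<notin> vec.span {x}" by blast
  have smooth: "smooth_at C x" using C(2) p xp x0 unfolding smooth_subscheme_def by blast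
  have zero: "mpoly_eval (($) x) F = 0" if "F \<in> C" for F using p that xp unfolding proj_zeros_def by blast
  have tangent: "mpoly_differential F x b = 0" if "F \<in> C" for F
    using b(1) that xp x0 unfolding L_def tangent_cone_space_def by blast
  have "\<exists>\<kappa> \<tau> c. \<kappa> \<noteq> 0 \<and> (\<forall>F d z. F \<in> C \<longrightarrow> homogeneous d F \<longrightarrow>
      mpoly_eval (($) (\<kappa> *s x + z *s (b + \<tau> *s x) + z\<^sup>2 *s c)) F = 0)"
  proof (rule conic_parametrization[OF hilb smooth x0 zero tangent b(2)])
    fix \<kappa> \<tau> c
    assume "\<kappa> \<noteq> 0" "\<And>F d z. F \<in> C \<Longrightarrow> homogeneous d F \<Longrightarrow>
      mpoly_eval (($) (\<kappa> *s x + z *s (b + \<tau> *s x) + z\<^sup>2 *s c)) F = 0"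
    then show ?thesis by blast
  qed
  then obtain \<kappa> \<tau> c where \<kappa>: "\<kappa> \<noteq> 0" and conic: "\<forall>F d z. F \<in> C \<longrightarrow> homogeneous d F \<longrightarrow>
      mpoly_eval (($) (\<kappa> *s x + z *s (b + \<tau> *s x) + z\<^sup>2 *s c)) F = 0" by blast
  have sq: "br u (br u y) = (l * killing_form br u y) *s u"
    if "u = \<kappa> *s x + z *s (b + \<tau> *s x) + z\<^sup>2 *s c" for u y z
  proof -
    have "(br u (br u y) - (l * killing_form br u y) *s u) $ j = 0" for j
      unfolding eval_extremal_equation[symmetric] that
      using conic equations homogeneous_extremal_equation by blast
    then show ?thesis by (simp add: vec_eq_iff)
  qed
  obtain b0 where b0: "b0 \<in> contact_fibre br h \<rho> E" "b = g b0" using b(1) L(4) g(3) by blast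
  have "br x b = 0"
    using br_contact_fibre[OF E b0(1)] vec.linear_0[OF lin] by (simp add: x_def b0(2) hom[symmetric])
  then have xb: "br (\<kappa> *s x) (b + \<tau> *s x) = 0" using alternating[of x] by (simp add: br_simps)
  have indep: "r = 0 \<and> t = 0" if eq: "r *s (\<kappa> *s x) + t *s (b + \<tau> *s x) = 0" for r t
  proof -
    have t: "t = 0"
    proof (rule ccontr)
      assume t: "t \<noteq> 0"
      have "b = (- (r * \<kappa> + t * \<tau>) / t) *s x"
      proof (rule vec_eq_iff[THEN iffD2], rule allI)
        fix i
        have "r * (\<kappa> * x $ i) + t * (b $ i + \<tau> * x $ i) = 0" using arg_cong[OF eq, of "\<lambda>v. v $ i"] by (simp add: algebra_simps)
        then have "t * b $ i = - (r * \<kappa> + t * \<tau>) * x $ i" by (simp add: algebra_simps eq_neg_iff_add_eq_0)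
        then show "b $ i = ((- (r * \<kappa> + t * \<tau>) / t) *s x) $ i" using t by (simp add: field_simps)
      qed
      then show False using b(2) by (metis vec.span_base vec.span_scale singletonI)
    qed
    then have "(r * \<kappa>) *s x = 0" using eq by simp
    then show ?thesis using t \<kappa> x0 by (simp add: vec.scale_eq_0_iff)
  qed
  have "vec.independent {b, x}"
    using b(2) x0 by (simp add: vec.independent_insert)
  moreover have "card {b, x} = 2" using b(2) vec.span_base[of x "{x}"] by (cases "b = x") simp_all
  moreover have "{b, x} \<subseteq> L" using b(1) L(3) xp by blast
  ultimately have "L \<subseteq> vec.span {b, x}" using L(2) by (intro vec.card_ge_dim_independent) simp_all
  then have "w \<in> vec.span {b, x}" using w by (auto simp: L_def)
  then obtain t where "w - t *s b \<in> vec.span {x}" unfolding vec.span_insert by blast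
  then obtain r where "w - t *s b = r *s x" unfolding vec.span_singleton by blast
  then have "w = r *s x + t *s b" by (simp add: diff_eq_eq)
  \<comment> \<open>The coefficients of the parametrization are \<open>\<kappa> x\<close> and
    \<open>b + \<tau> x\<close>, not \<open>x\<close> and \<open>b\<close>; they span the same
    plane, in which \<open>w\<close> is rewritten.\<close>
  then have "w = ((r - t * \<tau>) / \<kappa>) *s (\<kappa> *s x) + t *s (b + \<tau> *s x)"
    using \<kappa> by (simp add: vec_eq_iff field_simps)
  then show ?thesis
    using conic_tangent_ad_nilpotent[of "\<kappa> *s x" "b + \<tau> *s x" c l, OF sq[OF refl] indep xb] by metis
qed

end

text \<open>One nonzero quartic suffices for a flag to belong to \<open>U\<close>. Hence all
  quartics have to vanish on tangent flags of smooth conics, whereas for nonemptiness one nonzero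
  value at a flag over \<open>[E]\<close> is enough.\<close>

theorem corollary7p2:
  fixes br :: "complex^'n \<Rightarrow> complex^'n \<Rightarrow> complex^'n"
    and h :: "(complex^'n) set" and \<Delta> :: "'n weight set" and \<rho> :: "'n weight"
    and E :: "complex^'n" and Z :: "(complex^'n) set set"
  assumes "simple_lie_algebra br"
    and "\<not> lie_type_A br" and "\<not> lie_type_C br"
    and "cartan_subalgebra br h" and "simple_roots br h \<Delta>" and "highest_root br h \<Delta> \<rho>"
    and "E \<in> root_space br h \<rho>" and "E \<noteq> 0"
    and "adjoint_variety br Z"
  shows "\<exists>U. U \<noteq> {} \<and> zariski_open_in (proj_bundle (contact_distribution br h \<rho> E)) U \<and>
    (\<forall>C. conic_in Z C \<and> smooth_subscheme C \<longrightarrow>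
       (\<forall>p\<in>proj_zeros C. (p, tangent_cone_space C p) \<notin> U))"
proof -
  interpret based_simple_lie_algebra br h \<Delta> \<rho>
    by (intro based_simple_lie_algebra.intro based_simple_lie_algebra_axioms.intro assms)
  have E: "E \<in> R \<theta>" "E \<noteq> 0" using assms(7,8) \<theta>(3) by simp_all
  let ?P = "proj_bundle (contact_distribution br h \<rho> E)"
  define S where "S = {ad_quartic br i y j | i y j. True}"
  define U where "U = {(p, L) \<in> ?P. \<exists>F\<in>S. \<exists>x w. p = vec.span {x} \<and> L = vec.span {x, w} \<and>
    mpoly_eval (flag_coordinates x w) F \<noteq> 0}"
  have "\<forall>F\<in>S. \<exists>d e. bihomogeneous d e F"
    using bihomogeneous_ad_quartic unfolding S_def by blast
  then have "zariski_open_in ?P U"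
    unfolding zariski_open_in_def using U_def by blast
  moreover have "U \<noteq> {}"
  proof -
    obtain x where x: "x \<in> \<Phi>" "cn x \<theta> = 1" "cn \<theta> x = 1"
      using adjacent_long_root_exists[OF assms(3)] by blast
    obtain b F where b: "b \<in> contact_fibre br h \<rho> E" "b \<notin> vec.span {E}"
      and quartic: "\<And>r t w. w = t *s b + r *s E \<Longrightarrow> t \<noteq> 0 \<Longrightarrow> br w (br w (br w (br w F))) \<noteq> 0"
      using generic_contact_vector[OF E x] by metis
    \<comment> \<open>The coefficient of \<open>b\<close> in the vector \<open>w\<close> tested by
      the quartic is \<open>E $ i\<close>, which has to be nonzero for \<open>quartic\<close> to
      apply.\<close>
    obtain i where i: "E $ i \<noteq> 0" using E(2) by (auto simp: vec_eq_iff)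
    define w where "w = E $ i *s b + (- (b $ i)) *s E"
    have "br w (br w (br w (br w F))) \<noteq> 0" using quartic[OF w_def i] .
    then obtain j where "br w (br w (br w (br w F))) $ j \<noteq> 0" by (auto simp: vec_eq_iff)
    then have "mpoly_eval (flag_coordinates E b) (ad_quartic br i F j) \<noteq> 0"
      by (simp add: eval_ad_quartic[OF w_def])
    moreover have "(vec.span {E}, vec.span {E, b}) \<in> ?P"
    proof -
      have "(vec.span {E}, contact_fibre br h \<rho> E) \<in> contact_distribution br h \<rho> E"
        unfolding contact_distribution_def
        by (intro CollectI exI[of _ id] conjI adjoint_group.id) (simp only: image_id id_apply)
      moreover have "vec.dim (vec.span {E, b}) = 2"
      proof -
        have "vec.independent {b, E}" using b(2) E(2) by (simp add: vec.independent_insert)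
        moreover have "card {b, E} = 2" using b(2) vec.span_base[of E "{E}"] by (cases "b = E") simp_all
        ultimately show ?thesis using vec.dim_eq_card_independent[of "{b, E}"] by (simp add: vec.dim_span insert_commute)
      qed
      moreover have "vec.span {E} \<subseteq> vec.span {E, b}" by (intro vec.span_mono) simp
      moreover have "vec.span {E, b} \<subseteq> contact_fibre br h \<rho> E"
      proof (rule vec.span_minimal)
        have "E \<in> contact_fibre br h \<rho> E" unfolding contact_fibre_def by (rule vec.span_base) simp
        then show "{E, b} \<subseteq> contact_fibre br h \<rho> E" using b(1) by simp
        show "vec.subspace (contact_fibre br h \<rho> E)" unfolding contact_fibre_def by (rule vec.subspace_span)
      qed
      ultimately show ?thesis unfolding proj_bundle_def using vec.subspace_span by blast
    qed
    ultimately show ?thesis unfolding U_def S_def by blast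
  qed
  moreover have "(p, tangent_cone_space C p) \<notin> U"
    if C: "conic_in Z C" "smooth_subscheme C" and p: "p \<in> proj_zeros C" for C p
  proof
    assume U: "(p, tangent_cone_space C p) \<in> U"
    then obtain i y j x w where flag: "(p, tangent_cone_space C p) \<in> ?P"
      and span: "tangent_cone_space C p = vec.span {x, w}"
      and quartic: "mpoly_eval (flag_coordinates x w) (ad_quartic br i y j) \<noteq> 0"
      unfolding U_def S_def by blast
    define w' where "w' = x $ i *s w + (- (w $ i)) *s x"
    have "w' \<in> tangent_cone_space C p"
      unfolding span w'_def by (intro vec.span_add vec.span_scale vec.span_base) simp_all
    then have "br w' (br w' (br w' (br w' y))) = 0"
      by (rule conic_direction_ad_nilpotent[OF E assms(9) C p flag])
    then show False using quartic by (simp add: eval_ad_quartic[OF w'_def])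
  qed
  ultimately show ?thesis by blast
qed

end
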